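(* For the two-layer nonlinear network with activation $\varphi$, orthogonal first layer and ridge-trained second layer, for every fixed $\lambda>0$, as $d\to\infty$, \begin{align*} \lim_{d\to\infty}\mathrm{MSE}(\lambda)&=\alpha^2\pi\Big[\tfrac1\pi-1+\delta(1-\pi)\theta_1+\tfrac{\lambda}{v}\Big(\tfrac{\lambda\mu^2}{v^2}-\delta(1-\pi)\Big)\theta_2+(v-\mu^2)\Big(\tfrac{\gamma}{v}\theta_1+\tfrac1v-\tfrac{\lambda\gamma}{v^2}\theta_2\Big)\Big]\\&\quad+\sigma^2\gamma\Big(\theta_1-\tfrac{\lambda}{v}\theta_2\Big)+\sigma^2,\\ \lim_{d\to\infty}\mathrm{Bias}^2(\lambda)&=\alpha^2\Big[\pi\tfrac{\mu^2}{v}\Big(1-\tfrac{\lambda}{v}\theta_1\Big)-1\Big]^2,\\ \lim_{d\to\infty}\mathrm{Var}(\lambda)&=\alpha^2\pi\Big[\tfrac{2\mu^2}{v}-1+\Big(-\tfrac{2\lambda\mu^2}{v^2}+\delta(1-\pi)\Big)\theta_1+\tfrac{\lambda}{v}\Big(\tfrac{\lambda\mu^2}{v^2}-\delta(1-\pi)\Big)\theta_2\\&\quad-\tfrac{\pi\mu^4}{v^2}\Big(1-\tfrac{\lambda}{v}\theta_1\Big)^2+(v-\mu^2)\Big(\tfrac{\gamma}{v}\theta_1+\tfrac1v-\tfrac{\lambda\gamma}{v^2}\theta_2\Big)\Big]+\sigma^2\gamma\Big(\theta_1-\tfrac{\lambda}{v}\theta_2\Big), \end{align*} where $\theta_i=\theta_i(\gamma,\lambda/v)$,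 $i=1,2$, and $\gamma=\pi\delta$. Moreover, if $\mu\neq0$ and the following number is positive, the limiting MSE as a function of $\lambda>0$ has a unique minimum at $$\lambda^*=\frac{v^2}{\mu^2}\left[\delta\left(1-\pi+\frac{\sigma^2}{\alpha^2}\right)+\frac{(v-\mu^2)\gamma}{v}\right].$$
   Context: Setting. $\alpha>0$, $\sigma\ge 0$ fixed. For each $d$, $p=p_d\le d$, $n=n_d$, with $p/d\to\pi\in(0,1]$, $d/n\to\delta\in(0,\infty)$. $X\in\mathbb{R}^{n\times d}$ and the test point $x\in\mathbb{R}^d$ have i.i.d. $N(0,1)$ entries; $\theta\sim N(0,\alpha^2I_d/d)$; $\mathcal{E}\sim N(0,\sigma^2I_n)$; $Y=X\theta+\mathcal{E}$; $W$ is a $p\times d$ random matrix uniformly distributed on $\{W:WW^\top=I_p\}$; all independent. Activation. $\varphi:\mathbb{R}\to\mathbb{R}$ (applied entrywise) is locally absolutely continuous, with $|\varphi(t)|,|\varphi'(t)|\le c_1e^{c_2|t|}$ for some constants $c_1,c_2>0$ (for a.e. $t$ in the case of $\varphi'$), and $\mathbb{E}\varphi(Z)=0$ for $Z\sim N(0,1)$. Put $\mu=\mathbb{E}Z\varphi(Z)$ and $v=\mathbb{E}\varphi(Z)^2$, with $v>0$. Predictor. $\hat f(x)=\varphi(x^\top W^\top)\left(\tfrac1n\varphi(WX^\top)\varphi(XW^\top)+\lambda I_p\right)^{-1}\tfrac1n\varphi(WX^\top)Y$. Quantities. $\mathrm{MSE}(\lambda)=\mathbb{E}_{\theta,x,W,X,\mathcal{E}}(\hat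 f(x)-x^\top\theta)^2+\sigma^2$; $\mathrm{Bias}^2(\lambda)=\mathbb{E}_{\theta,x}(\mathbb{E}_{W,X,\mathcal{E}}\hat f(x)-x^\top\theta)^2$; $\mathrm{Var}(\lambda)=\mathbb{E}_{\theta,x,W,X,\mathcal{E}}(\hat f(x)-\mathbb{E}_{X,W,\mathcal{E}}\hat f(x))^2$. Resolvent moments. $F_\gamma$ is the Marchenko–Pastur distribution with parameter $\gamma$ (limiting eigenvalue distribution of $n^{-1}Z^\top Z$ for $Z\in\mathbb{R}^{n\times p}$ with i.i.d. mean $0$, variance $1$ entries, $p/n\to\gamma$); $\theta_1(\gamma,\lambda)=\int (x+\lambda)^{-1}dF_\gamma(x)$, $\theta_2(\gamma,\lambda)=\int (x+\lambda)^{-2}dF_\gamma(x)$. (The symbol $\theta$ without subscript is the true parameter vector.) *)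

theory Defs
  imports "HOL-Probability.Probability" "Jordan_Normal_Form.Gauss_Jordan_Elimination"
begin

definition absolutely_continuous_on_interval :: "real \<Rightarrow> real \<Rightarrow> (real \<Rightarrow> real) \<Rightarrow> bool" where
  "absolutely_continuous_on_interval a b f \<longleftrightarrow>
     (\<forall>\<epsilon>>0. \<exists>\<eta>>0. \<forall>(N::nat) (s::nat \<Rightarrow> real) (t::nat \<Rightarrow> real).
        (\<forall>k<N. a \<le> s k \<and> s k \<le> t k \<and> t k \<le> b) \<longrightarrow>
        disjoint_family_on (\<lambda>k. {s k<..<t k}) {..<N} \<longrightarrow>
        (\<Sum>k<N. t k - s k) < \<eta> \<longrightarrow>
        (\<Sum>k<N. \<bar>f (t k) - f (s k)\<bar>) < \<epsilon>)"

definition locally_absolutely_continuous :: "(real \<Rightarrow> real) \<Rightarrow> bool" where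
  "locally_absolutely_continuous f \<longleftrightarrow> (\<forall>a b. absolutely_continuous_on_interval a b f)"

text \<open>
  A random \<open>n \<times> d\<close> matrix is a random point of \<^term>\<open>PiM ({..<n} \<times> {..<d}) (\<lambda>_. borel)\<close>, turned into a
  matrix by \<^const>\<open>mat\<close>; a random vector of length \<open>n\<close> is a random point of
  \<^term>\<open>PiM {..<n} (\<lambda>_. borel)\<close>, turned into a vector by \<^const>\<open>vec\<close>.
\<close>

text \<open>
  The normal law with mean \<open>0\<close> and standard deviation \<open>s \<ge> 0\<close>.  It is defined by scaling, not by
  \<^const>\<open>normal_density\<close>, so that \<open>s = 0\<close> gives the point mass at \<open>0\<close> and not the null measure.
\<close>

definition centered_normal :: "real \<Rightarrow> real measure" where
  "centered_normal s = distr std_normal_distribution borel (\<lambda>z. s * z)"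

definition gaussian_vec :: "nat \<Rightarrow> real \<Rightarrow> (nat \<Rightarrow> real) measure" where
  "gaussian_vec n s = PiM {..<n} (\<lambda>_. centered_normal s)"

definition gaussian_mat :: "nat \<Rightarrow> nat \<Rightarrow> (nat \<times> nat \<Rightarrow> real) measure" where
  "gaussian_mat n d = PiM ({..<n} \<times> {..<d}) (\<lambda>_. centered_normal 1)"

text \<open>
  The uniform distribution on the Stiefel manifold of \<open>p \<times> d\<close> matrices with orthonormal rows is the
  unique probability measure that it carries which is invariant under the (transitive) action
  \<open>W \<mapsto> W Q\<close> of the orthogonal \<open>d \<times> d\<close> matrices \<open>Q\<close>.
\<close>

definition uniform_stiefel :: "nat \<Rightarrow> nat \<Rightarrow> (nat \<times> nat \<Rightarrow> real) measure \<Rightarrow> bool" where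
  "uniform_stiefel p d H \<longleftrightarrow>
     prob_space H \<and>
     sets H = sets (PiM ({..<p} \<times> {..<d}) (\<lambda>_. borel :: real measure)) \<and>
     (AE W in H. mat p d W * transpose_mat (mat p d W) = 1\<^sub>m p) \<and>
     (\<forall>Q \<in> carrier_mat d d. Q * transpose_mat Q = 1\<^sub>m d \<longrightarrow>
        distr H H (\<lambda>W. \<lambda>ij \<in> {..<p} \<times> {..<d}. (mat p d W * Q) $$ ij) = H)"

text \<open>Here \<open>p\<close> is the number of rows of \<open>W\<close> and \<open>n\<close> the number of rows of \<open>X\<close>.\<close>

definition predictor ::
  "(real \<Rightarrow> real) \<Rightarrow> real \<Rightarrow> real mat \<Rightarrow> real mat \<Rightarrow> real vec \<Rightarrow> real vec \<Rightarrow> real" where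
  "predictor \<phi> lam W X Y x =
     (let c = 1 / real (dim_row X);
          A = map_mat \<phi> (W * transpose_mat X);
          B = map_mat \<phi> (X * transpose_mat W)
      in map_vec \<phi> (W *\<^sub>v x) \<bullet>
           (the (mat_inverse (c \<cdot>\<^sub>m (A * B) + lam \<cdot>\<^sub>m 1\<^sub>m (dim_row W))) *\<^sub>v (c \<cdot>\<^sub>v (A *\<^sub>v Y))))"

text \<open>
  The signal and test point \<open>(\<theta>, x)\<close> and the remaining randomness \<open>(W, X, E)\<close>.  Independence is
  expressed by taking product measures; \<open>H\<close> is the law of the first layer \<open>W\<close>.
\<close>

type_synonym test_sample = "(nat \<Rightarrow> real) \<times> (nat \<Rightarrow> real)"
type_synonym train_sample = "(nat \<times> nat \<Rightarrow> real) \<times> (nat \<times> nat \<Rightarrow> real) \<times> (nat \<Rightarrow> real)"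

definition test_law :: "real \<Rightarrow> nat \<Rightarrow> test_sample measure" where
  "test_law \<alpha> d = gaussian_vec d (\<alpha> / sqrt (real d)) \<Otimes>\<^sub>M gaussian_vec d 1"

definition train_law ::
  "real \<Rightarrow> nat \<Rightarrow> nat \<Rightarrow> (nat \<times> nat \<Rightarrow> real) measure \<Rightarrow> train_sample measure" where
  "train_law \<sigma> n d H = H \<Otimes>\<^sub>M (gaussian_mat n d \<Otimes>\<^sub>M gaussian_vec n \<sigma>)"

definition truth :: "nat \<Rightarrow> test_sample \<Rightarrow> real" where
  "truth d = (\<lambda>(\<theta>, x). vec d x \<bullet> vec d \<theta>)"

definition prediction ::
  "(real \<Rightarrow> real) \<Rightarrow> nat \<Rightarrow> nat \<Rightarrow> nat \<Rightarrow> real \<Rightarrow> test_sample \<Rightarrow> train_sample \<Rightarrow> real" where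
  "prediction \<phi> p n d lam = (\<lambda>(\<theta>, x) (W, X, E).
     predictor \<phi> lam (mat p d W) (mat n d X) (mat n d X *\<^sub>v vec d \<theta> + vec n E) (vec d x))"

definition mean_prediction ::
  "(real \<Rightarrow> real) \<Rightarrow> real \<Rightarrow> nat \<Rightarrow> nat \<Rightarrow> nat \<Rightarrow> (nat \<times> nat \<Rightarrow> real) measure \<Rightarrow> real \<Rightarrow>
    test_sample \<Rightarrow> real" where
  "mean_prediction \<phi> \<sigma> p n d H lam t = (\<integral>s. prediction \<phi> p n d lam t s \<partial>train_law \<sigma> n d H)"

definition MSE ::
  "(real \<Rightarrow> real) \<Rightarrow> real \<Rightarrow> real \<Rightarrow> nat \<Rightarrow> nat \<Rightarrow> nat \<Rightarrow> (nat \<times> nat \<Rightarrow> real) measure \<Rightarrow> real \<Rightarrow> real" where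
  "MSE \<phi> \<alpha> \<sigma> p n d H lam =
     (\<integral>(t, s). (prediction \<phi> p n d lam t s - truth d t)\<^sup>2 \<partial>(test_law \<alpha> d \<Otimes>\<^sub>M train_law \<sigma> n d H)) + \<sigma>\<^sup>2"

definition Bias2 ::
  "(real \<Rightarrow> real) \<Rightarrow> real \<Rightarrow> real \<Rightarrow> nat \<Rightarrow> nat \<Rightarrow> nat \<Rightarrow> (nat \<times> nat \<Rightarrow> real) measure \<Rightarrow> real \<Rightarrow> real" where
  "Bias2 \<phi> \<alpha> \<sigma> p n d H lam =
     (\<integral>t. (mean_prediction \<phi> \<sigma> p n d H lam t - truth d t)\<^sup>2 \<partial>test_law \<alpha> d)"

definition Var ::
  "(real \<Rightarrow> real) \<Rightarrow> real \<Rightarrow> real \<Rightarrow> nat \<Rightarrow> nat \<Rightarrow> nat \<Rightarrow> (nat \<times> nat \<Rightarrow> real) measure \<Rightarrow> real \<Rightarrow> real" where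
  "Var \<phi> \<alpha> \<sigma> p n d H lam =
     (\<integral>(t, s). (prediction \<phi> p n d lam t s - mean_prediction \<phi> \<sigma> p n d H lam t)\<^sup>2
        \<partial>(test_law \<alpha> d \<Otimes>\<^sub>M train_law \<sigma> n d H))"

text \<open>
  The limiting eigenvalue distribution of the \<open>p \<times> p\<close> matrices \<open>Z\<^sup>T Z / n\<close> as \<open>p / n \<longlonglongrightarrow> \<gamma>\<close>: for
  \<open>\<gamma> > 1\<close> these are singular, which gives the atom at \<open>0\<close>.
\<close>

definition marchenko_pastur_density :: "real \<Rightarrow> real \<Rightarrow> real" where
  "marchenko_pastur_density \<gamma> x =
     (let a = (1 - sqrt \<gamma>)\<^sup>2; b = (1 + sqrt \<gamma>)\<^sup>2
      in indicator {a..b} x * sqrt ((b - x) * (x - a)) / (2 * pi * \<gamma> * x))"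

definition marchenko_pastur :: "real \<Rightarrow> real measure" where
  "marchenko_pastur \<gamma> =
     measure_of UNIV (sets borel)
       (\<lambda>A. ennreal (max 0 (1 - 1 / \<gamma>)) * indicator A 0 +
            emeasure (density lborel (\<lambda>x. ennreal (marchenko_pastur_density \<gamma> x))) A)"

lemma sets_marchenko_pastur [simp, measurable_cong]: "sets (marchenko_pastur \<gamma>) = sets borel"
  using sets.sigma_sets_eq[of "borel :: real measure"] by (simp add: marchenko_pastur_def)

lemma emeasure_marchenko_pastur:
  assumes "A \<in> sets borel"
  shows "emeasure (marchenko_pastur \<gamma>) A =
    ennreal (max 0 (1 - 1 / \<gamma>)) * indicator A 0 +
    emeasure (density lborel (\<lambda>x. ennreal (marchenko_pastur_density \<gamma> x))) A"
proof (rule emeasure_measure_of[OF marchenko_pastur_def])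
  let ?D = "density lborel (\<lambda>x. ennreal (marchenko_pastur_density \<gamma> x))"
  let ?m = "\<lambda>A. ennreal (max 0 (1 - 1 / \<gamma>)) * indicator A 0 + emeasure ?D A"
  show "positive (sets (marchenko_pastur \<gamma>)) ?m"
    by (simp add: positive_def)
  show "countably_additive (sets (marchenko_pastur \<gamma>)) ?m"
  proof (rule countably_additiveI)
    fix A :: "nat \<Rightarrow> real set"
    assume A: "range A \<subseteq> sets (marchenko_pastur \<gamma>)" "disjoint_family A"
    have "(\<Sum>i. emeasure ?D (A i)) = emeasure ?D (\<Union>i. A i)"
      using A by (intro suminf_emeasure) auto
    moreover have "(\<Sum>i. indicator (A i) 0 :: ennreal) = indicator (\<Union>i. A i) 0"
      using A(2) by (rule suminf_indicator)
    ultimately show "(\<Sum>i. ?m (A i)) = ?m (\<Union>i. A i)"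
      by (simp add: suminf_add[symmetric])
  qed
qed (use assms in auto)

definition resolvent_moment :: "nat \<Rightarrow> real \<Rightarrow> real \<Rightarrow> real" where
  "resolvent_moment k \<gamma> lam = (\<integral>x. 1 / (x + lam) ^ k \<partial>marchenko_pastur \<gamma>)"

end

theory Submission
  imports Defs "Jordan_Normal_Form.Determinant"
begin

text \<open>
  Conditionally on \<open>X\<close> and \<open>W\<close> the prediction error is linear in \<open>\<theta>\<close> and in the noise. Completing \<open>W\<close> to an orthogonal
  matrix and rotating \<open>X\<close> and \<open>x\<close> reduces the risk to \<open>W = (I 0)\<close>, where the columns of \<open>F = \<phi>(X W\<^sup>T)\<close> are independent,
  with i.i.d. entries. After the push-through identity everything is expressed by the resolvent \<open>G\<close> of \<open>F F\<^sup>T / n\<close>.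
  Removing one column from \<open>G\<close> (Sherman--Morrison) and concentration of quadratic forms give a fixed-point equation
  for \<open>tr G / n\<close>, whose solution is an explicit function of \<open>\<theta>\<^sub>1\<close>, and the limits of the forms \<open>z\<^sub>k \<cdot> G z\<^sub>k\<close> and
  \<open>f\<^sub>k \<cdot> G z\<^sub>k\<close>. Forms in \<open>G\<^sup>2\<close> are minus the derivatives in \<open>\<lambda>\<close> of convex functions, so their limits follow.

  The mean prediction is \<open>g(x) \<cdot> \<theta>\<close> with \<open>g\<close> equivariant under rotations, hence parallel to \<open>x\<close>; concentration of
  quadratic forms in \<open>x\<close> shows \<open>g(x) \<approx> \<kappa> x\<close>, which gives the bias. The variance is the remainder.
\<close>

text \<open>Orthonormal rows of \<open>W\<close> make the preactivations exactly i.i.d. Gaussian, so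
  in the limit the features and the raw data interact only through \<mu> = E Z \<phi>(Z), and only
  in the columns k < p; the remaining rotated columns are independent of all features. The
  concentration bounds are explicit, of order 1/n in mean square and uniform in the column, because
  they are averaged over d columns. The obstacle is the bias: there the mean over \<open>W\<close>
  is taken inside the square, so a rotation that depends on \<open>W\<close> cannot be applied to
  it. Parallelism to x reduces the deviation of g(x) from \<kappa> x to a scalar, Jensen's
  inequality moves the mean over \<open>W\<close> outside the square, and only then is each
  \<open>W\<close> rotated away. The factor \<kappa> = \<mu> tr(C) / d is the ratio of E \<phi>(x)
  \<cdot> C x = \<mu> tr C to E |x|^2 = d, with C the matrix of expected coefficients. The passage
  to derivatives uses limits at neighbouring parameters, so the first-order limits are established
  for every lam > 0.\<close>

no_notation inner (infix "\<bullet>" 70)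
no_notation Finite_Cartesian_Product.vec_nth (infixl "$" 90)
hide_const (open) Determinants.det

subsection \<open>Resolvents of ridge Gram matrices\<close>

definition col_vec :: "nat \<Rightarrow> (nat \<times> nat \<Rightarrow> real) \<Rightarrow> nat \<Rightarrow> real vec" where
  "col_vec n F j = vec n (\<lambda>i. F (i, j))"

definition ridge_gram :: "nat \<Rightarrow> (nat \<times> nat \<Rightarrow> real) \<Rightarrow> nat set \<Rightarrow> real \<Rightarrow> real mat" where
  "ridge_gram n F K lam =
     mat n n (\<lambda>(i, k). (\<Sum>j\<in>K. F (i, j) * F (k, j)) / real n + (if i = k then lam else 0))"

text \<open>The cofactor form makes every entry a quotient of polynomials in the entries of
  \<open>F\<close>, so measurability is immediate in \<open>borel_measurable_resolvent\<close>. It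
  is the inverse of \<open>ridge_gram\<close> once lam > 0; the set \<open>K\<close> of columns is a
  parameter so that a single column can be left out.\<close>

definition resolvent :: "nat \<Rightarrow> (nat \<times> nat \<Rightarrow> real) \<Rightarrow> nat set \<Rightarrow> real \<Rightarrow> real mat" where
  "resolvent n F K lam =
     (1 / det (ridge_gram n F K lam)) \<cdot>\<^sub>m adj_mat (ridge_gram n F K lam)"

lemma col_vec_carrier [simp]: "col_vec n F j \<in> carrier_vec n"
  by (simp add: col_vec_def)

lemma ridge_gram_carrier [simp]: "ridge_gram n F K lam \<in> carrier_mat n n"
  by (simp add: ridge_gram_def)

lemma resolvent_carrier [simp]: "resolvent n F K lam \<in> carrier_mat n n"
  using adj_mat(1)[OF ridge_gram_carrier] by (simp add: resolvent_def)

lemma resolvent_vec_carrier [simp]: "resolvent n F K lam *\<^sub>v u \<in> carrier_vec n"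
  by (intro carrier_vecI, subst dim_mult_mat_vec) (rule carrier_matD(1)[OF resolvent_carrier])

definition mat_tr :: "real mat \<Rightarrow> real" where
  "mat_tr A = (\<Sum>i<dim_row A. A $$ (i, i))"

lemma sq_norm_real_nonneg: "(u :: real vec) \<bullet> u \<ge> 0"
  by (simp add: scalar_prod_def sum_nonneg)

lemma ridge_gram_mult:
  assumes "u \<in> carrier_vec n" "i < n"
  shows "(ridge_gram n F K lam *\<^sub>v u) $ i =
    lam * u $ i + (\<Sum>j\<in>K. F (i, j) * (col_vec n F j \<bullet> u)) / real n"
proof -
  have "(ridge_gram n F K lam *\<^sub>v u) $ i =
      (\<Sum>k<n. ((\<Sum>j\<in>K. F (i, j) * F (k, j)) / real n + (if i = k then lam else 0)) * u $ k)"
    using assms by (simp add: ridge_gram_def scalar_prod_def atLeast0LessThan)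
  also have "\<dots> = (\<Sum>k<n. (\<Sum>j\<in>K. F (i, j) * F (k, j) * u $ k)) / real n + (\<Sum>k<n. (if i = k then lam * u $ k else 0))"
    unfolding sum_divide_distrib sum.distrib[symmetric]
    by (intro sum.cong refl) (simp add: distrib_right sum_divide_distrib sum_distrib_right)
  also have "(\<Sum>k<n. (\<Sum>j\<in>K. F (i, j) * F (k, j) * u $ k)) = (\<Sum>j\<in>K. F (i, j) * (col_vec n F j \<bullet> u))"
    using assms by (subst sum.swap) (simp add: scalar_prod_def atLeast0LessThan col_vec_def sum_distrib_left mult_ac)
  finally show ?thesis using assms by simp
qed

lemma ridge_gram_form:
  assumes "u \<in> carrier_vec n" "w \<in> carrier_vec n"
  shows "w \<bullet> (ridge_gram n F K lam *\<^sub>v u) =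
    lam * (w \<bullet> u) + (\<Sum>j\<in>K. (col_vec n F j \<bullet> w) * (col_vec n F j \<bullet> u)) / real n"
proof -
  have "w \<bullet> (ridge_gram n F K lam *\<^sub>v u) =
      (\<Sum>i<n. w $ i * (lam * u $ i + (\<Sum>j\<in>K. F (i, j) * (col_vec n F j \<bullet> u)) / real n))"
    using assms ridge_gram_mult[OF assms(1)]
    by (simp add: scalar_prod_def atLeast0LessThan ridge_gram_def del: index_mult_mat_vec)
  also have "\<dots> = lam * (\<Sum>i<n. w $ i * u $ i) + (\<Sum>i<n. \<Sum>j\<in>K. F (i, j) * w $ i * (col_vec n F j \<bullet> u)) / real n"
    by (simp add: sum.distrib[symmetric] sum_divide_distrib sum_distrib_right sum_distrib_left algebra_simps)
  also have "(\<Sum>i<n. \<Sum>j\<in>K. F (i, j) * w $ i * (col_vec n F j \<bullet> u)) = (\<Sum>j\<in>K. (col_vec n F j \<bullet> w) * (col_vec n F j \<bullet> u))"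
    using assms by (subst sum.swap) (simp add: scalar_prod_def[of _ w] atLeast0LessThan col_vec_def sum_distrib_right)
  finally show ?thesis using assms by (simp add: scalar_prod_def atLeast0LessThan)
qed

text \<open>Positive definiteness: a kernel vector u would give lam |u|^2 plus a sum of squares
  equal to 0.\<close>

lemma det_ridge_gram_nonzero:
  assumes "lam > 0"
  shows "det (ridge_gram n F K lam) \<noteq> 0"
proof
  assume "det (ridge_gram n F K lam) = 0"
  then obtain u where u: "u \<in> carrier_vec n" "u \<noteq> 0\<^sub>v n" "ridge_gram n F K lam *\<^sub>v u = 0\<^sub>v n"
    using det_0_iff_vec_prod_zero[OF ridge_gram_carrier] by blast
  have "0 = lam * (u \<bullet> u) + (\<Sum>j\<in>K. (col_vec n F j \<bullet> u) * (col_vec n F j \<bullet> u)) / real n"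
    using ridge_gram_form[OF u(1) u(1), of F K lam] u by simp
  moreover have "(\<Sum>j\<in>K. (col_vec n F j \<bullet> u) * (col_vec n F j \<bullet> u)) / real n \<ge> 0"
    by (simp add: sum_nonneg)
  moreover have "lam * (u \<bullet> u) \<ge> 0" using assms sq_norm_real_nonneg by simp
  ultimately have "u \<bullet> u = 0" using assms by (smt (verit) mult_eq_0_iff)
  then have "\<forall>i<n. u $ i = 0"
    using u(1) by (simp add: scalar_prod_def sum_nonneg_eq_0_iff)
  then show False using u by (metis carrier_vecD eq_vecI index_zero_vec)
qed

context
  fixes n :: nat and lam :: real and F :: "nat \<times> nat \<Rightarrow> real"
  assumes lam: "lam > 0"
begin

lemma resolvent_inverse:
  "ridge_gram n F K lam * resolvent n F K lam = 1\<^sub>m n"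
  "resolvent n F K lam * ridge_gram n F K lam = 1\<^sub>m n"
proof -
  have one: "(1 / c) \<cdot>\<^sub>m (c \<cdot>\<^sub>m 1\<^sub>m n) = 1\<^sub>m n" if "c \<noteq> 0" for c :: real
    using that by (intro eq_matI) auto
  note adj = adj_mat[OF ridge_gram_carrier[of n F K lam]]
  show "ridge_gram n F K lam * resolvent n F K lam = 1\<^sub>m n"
    unfolding resolvent_def
    by (subst mult_smult_distrib[OF ridge_gram_carrier adj(1)], subst adj(2), rule one)
       (rule det_ridge_gram_nonzero[OF lam])
  show "resolvent n F K lam * ridge_gram n F K lam = 1\<^sub>m n"
    unfolding resolvent_def
    by (subst mult_smult_assoc_mat[OF adj(1) ridge_gram_carrier], subst adj(3), rule one)
       (rule det_ridge_gram_nonzero[OF lam])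
qed

lemma ridge_gram_resolvent_vec:
  assumes "u \<in> carrier_vec n"
  shows "ridge_gram n F K lam *\<^sub>v (resolvent n F K lam *\<^sub>v u) = u"
    "resolvent n F K lam *\<^sub>v (ridge_gram n F K lam *\<^sub>v u) = u"
  using assms resolvent_inverse
  by (simp_all flip: assoc_mult_mat_vec[OF ridge_gram_carrier resolvent_carrier]
        assoc_mult_mat_vec[OF resolvent_carrier ridge_gram_carrier])

lemma resolvent_eqI:
  assumes "w \<in> carrier_vec n" "ridge_gram n F K lam *\<^sub>v w = u"
  shows "resolvent n F K lam *\<^sub>v u = w"
  using ridge_gram_resolvent_vec(2)[OF assms(1), of K] unfolding assms(2) .

text \<open>One factor u is replaced by \<open>ridge_gram\<close> applied to G u, which splits the
  form of G into lam times the form of G^2 and products along the columns of \<open>F\<close>.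
  Positivity, the norm bounds and the later sums of squared prediction coefficients all come from
  this identity.\<close>

lemma resolvent_form:
  assumes "u \<in> carrier_vec n" "w \<in> carrier_vec n"
  shows "u \<bullet> (resolvent n F K lam *\<^sub>v w) =
    lam * ((resolvent n F K lam *\<^sub>v u) \<bullet> (resolvent n F K lam *\<^sub>v w)) +
    (\<Sum>j\<in>K. (col_vec n F j \<bullet> (resolvent n F K lam *\<^sub>v u)) * (col_vec n F j \<bullet> (resolvent n F K lam *\<^sub>v w))) / real n"
proof -
  have "u \<bullet> (resolvent n F K lam *\<^sub>v w) =
     (resolvent n F K lam *\<^sub>v w) \<bullet> (ridge_gram n F K lam *\<^sub>v (resolvent n F K lam *\<^sub>v u))"
    by (subst ridge_gram_resolvent_vec(1)[OF assms(1)])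
       (rule comm_scalar_prod[of _ n], use assms in auto)
  then show ?thesis
    using comm_scalar_prod[OF resolvent_vec_carrier resolvent_vec_carrier]
    by (subst (asm) ridge_gram_form) (auto simp: mult.commute)
qed

lemma resolvent_sym:
  assumes "u \<in> carrier_vec n" "w \<in> carrier_vec n"
  shows "u \<bullet> (resolvent n F K lam *\<^sub>v w) = w \<bullet> (resolvent n F K lam *\<^sub>v u)"
  unfolding resolvent_form[OF assms] resolvent_form[OF assms(2,1)]
  by (simp add: mult.commute comm_scalar_prod[of _ n])

lemma resolvent_form_ge:
  assumes "u \<in> carrier_vec n"
  shows "lam * ((resolvent n F K lam *\<^sub>v u) \<bullet> (resolvent n F K lam *\<^sub>v u)) \<le> u \<bullet> (resolvent n F K lam *\<^sub>v u)"
  unfolding resolvent_form[OF assms assms] by (simp add: sum_nonneg)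

lemma resolvent_form_nonneg:
  assumes "u \<in> carrier_vec n"
  shows "0 \<le> u \<bullet> (resolvent n F K lam *\<^sub>v u)"
  using resolvent_form_ge[OF assms] lam sq_norm_real_nonneg
  by (meson less_eq_real_def mult_nonneg_nonneg order_trans)

lemma real_vec_Cauchy_Schwarz:
  assumes "u \<in> carrier_vec n" "w \<in> carrier_vec n"
  shows "(u \<bullet> w)\<^sup>2 \<le> (u \<bullet> u) * ((w :: real vec) \<bullet> w)"
  using assms Cauchy_Schwarz_ineq_sum[of "\<lambda>i. u $ i" "\<lambda>i. w $ i" "{0..<n}"]
  by (simp add: scalar_prod_def power2_eq_square)

text \<open>The bound 1 / lam on the operator norm of G: Cauchy--Schwarz turns lam |Gu|^2 \<le> u
  \<bullet> Gu into an inequality from which one factor |Gu|^2 cancels.\<close>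

lemma resolvent_norm_le:
  assumes "u \<in> carrier_vec n"
  shows "lam\<^sup>2 * ((resolvent n F K lam *\<^sub>v u) \<bullet> (resolvent n F K lam *\<^sub>v u)) \<le> u \<bullet> u"
proof -
  let ?g = "resolvent n F K lam *\<^sub>v u"
  have "(lam * (?g \<bullet> ?g))\<^sup>2 \<le> (u \<bullet> ?g)\<^sup>2"
    using resolvent_form_ge[OF assms] lam sq_norm_real_nonneg by (intro power_mono) auto
  also have "\<dots> \<le> (u \<bullet> u) * (?g \<bullet> ?g)"
    by (rule real_vec_Cauchy_Schwarz) (use assms in auto)
  finally have "(lam\<^sup>2 * (?g \<bullet> ?g)) * (?g \<bullet> ?g) \<le> (u \<bullet> u) * (?g \<bullet> ?g)"
    by (simp add: power2_eq_square mult_ac)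
  then show ?thesis
    using sq_norm_real_nonneg[of ?g] sq_norm_real_nonneg[of u]
    by (cases "?g \<bullet> ?g = 0") (auto simp: mult_le_cancel_right)
qed

lemma resolvent_form_le:
  assumes "u \<in> carrier_vec n"
  shows "lam * (u \<bullet> (resolvent n F K lam *\<^sub>v u)) \<le> u \<bullet> u"
proof -
  let ?g = "resolvent n F K lam *\<^sub>v u"
  have "(u \<bullet> ?g)\<^sup>2 \<le> (u \<bullet> u) * (?g \<bullet> ?g)"
    by (rule real_vec_Cauchy_Schwarz) (use assms in auto)
  from mult_left_mono[OF this zero_le_power2[of lam]]
  have "(lam * (u \<bullet> ?g))\<^sup>2 \<le> (u \<bullet> u) * (lam\<^sup>2 * (?g \<bullet> ?g))"
    by (simp add: power_mult_distrib mult.left_commute)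
  also have "\<dots> \<le> (u \<bullet> u) * (u \<bullet> u)"
    by (intro mult_left_mono resolvent_norm_le assms sq_norm_real_nonneg)
  finally have "(lam * (u \<bullet> ?g))\<^sup>2 \<le> (u \<bullet> u)\<^sup>2"
    by (simp add: power2_eq_square)
  then show ?thesis
    by (rule power2_le_imp_le[OF _ sq_norm_real_nonneg])
qed

text \<open>Sherman--Morrison: adding one column is a rank-one update.\<close>

lemma resolvent_insert:
  assumes "finite K" "j \<notin> K" "n > 0" and u: "u \<in> carrier_vec n"
  defines "f \<equiv> col_vec n F j" and "G \<equiv> resolvent n F K lam"
  shows "resolvent n F (insert j K) lam *\<^sub>v u =
    G *\<^sub>v u - ((f \<bullet> (G *\<^sub>v u)) / (real n + f \<bullet> (G *\<^sub>v f))) \<cdot>\<^sub>v (G *\<^sub>v f)"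
proof (rule resolvent_eqI)
  define c where "c = (f \<bullet> (G *\<^sub>v u)) / (real n + f \<bullet> (G *\<^sub>v f))"
  have fc: "f \<in> carrier_vec n" and Gc: "\<And>u. G *\<^sub>v u \<in> carrier_vec n"
    by (simp_all add: f_def G_def)
  define w where "w = G *\<^sub>v u - c \<cdot>\<^sub>v (G *\<^sub>v f)"
  show wc: "G *\<^sub>v u - c \<cdot>\<^sub>v (G *\<^sub>v f) \<in> carrier_vec n" using Gc by simp
  have pos: "real n + f \<bullet> (G *\<^sub>v f) > 0"
    using resolvent_form_nonneg[OF fc, of K] assms(3) unfolding G_def by linarith
  have fw: "f \<bullet> w = f \<bullet> (G *\<^sub>v u) - c * (f \<bullet> (G *\<^sub>v f))"
    unfolding w_def by (subst scalar_prod_minus_distrib[of _ n]) (use fc Gc in auto)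
  \<comment> \<open>The choice of c makes f \<bullet> w equal to n c, so the new rank-one term
    returns exactly the c f that is missing in \<open>lin\<close>.\<close>
  have cw: "f \<bullet> w = real n * c" using pos unfolding fw c_def by (simp add: field_simps)
  have ins: "(ridge_gram n F (insert j K) lam *\<^sub>v x) $ i = (ridge_gram n F K lam *\<^sub>v x) $ i + F (i, j) * (f \<bullet> x) / real n"
    if "x \<in> carrier_vec n" "i < n" for x i
    using that assms(1,2) unfolding ridge_gram_mult[OF that] f_def by (simp add: add_divide_distrib)
  have lin: "ridge_gram n F K lam *\<^sub>v w = u - c \<cdot>\<^sub>v f"
  proof -
    have "ridge_gram n F K lam *\<^sub>v w = ridge_gram n F K lam *\<^sub>v (G *\<^sub>v u) - ridge_gram n F K lam *\<^sub>v (c \<cdot>\<^sub>v (G *\<^sub>v f))"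
      unfolding w_def by (rule mult_minus_distrib_mat_vec[of _ n n]) (use Gc in auto)
    also have "ridge_gram n F K lam *\<^sub>v (c \<cdot>\<^sub>v (G *\<^sub>v f)) = c \<cdot>\<^sub>v (ridge_gram n F K lam *\<^sub>v (G *\<^sub>v f))"
      by (rule mult_mat_vec[of _ n n]) (use Gc in auto)
    finally show ?thesis
      unfolding G_def using ridge_gram_resolvent_vec(1) u fc by simp
  qed
  show "ridge_gram n F (insert j K) lam *\<^sub>v (G *\<^sub>v u - c \<cdot>\<^sub>v (G *\<^sub>v f)) = u"
  proof (intro eq_vecI)
    fix i assume "i < dim_vec u"
    then have i: "i < n" using u by simp
    have fi: "f $ i = F (i, j)" using i by (simp add: f_def col_vec_def)
    show "(ridge_gram n F (insert j K) lam *\<^sub>v (G *\<^sub>v u - c \<cdot>\<^sub>v (G *\<^sub>v f))) $ i = u $ i"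
      using ins[OF wc i] lin cw i u fc assms(3) fi unfolding w_def[symmetric] by simp
  qed (use u carrier_matD(1)[OF ridge_gram_carrier] in simp)
qed

lemma resolvent_insert_form:
  assumes "finite K" "j \<notin> K" "n > 0" and u: "u \<in> carrier_vec n" "w \<in> carrier_vec n"
  defines "f \<equiv> col_vec n F j" and "G \<equiv> resolvent n F K lam"
  shows "w \<bullet> (resolvent n F (insert j K) lam *\<^sub>v u) =
    w \<bullet> (G *\<^sub>v u) - (f \<bullet> (G *\<^sub>v u)) * (w \<bullet> (G *\<^sub>v f)) / (real n + f \<bullet> (G *\<^sub>v f))"
  unfolding f_def G_def resolvent_insert[OF assms(1-4)]
  by (subst scalar_prod_minus_distrib[of _ n]) (use u in auto)

text \<open>When the vector on the right is f itself, the Sherman--Morrison correction collapses to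
  a division by 1 + f \<bullet> Gf / n, with G free of column j. A form that contains its own column
  thus becomes a function of leave-one-out forms.\<close>

lemma resolvent_insert_col:
  assumes "finite K" "j \<notin> K" "n > 0" and w: "w \<in> carrier_vec n"
  defines "f \<equiv> col_vec n F j" and "G \<equiv> resolvent n F K lam"
  shows "w \<bullet> (resolvent n F (insert j K) lam *\<^sub>v f) / real n =
    (w \<bullet> (G *\<^sub>v f) / real n) / (1 + f \<bullet> (G *\<^sub>v f) / real n)"
proof -
  have pos: "real n + f \<bullet> (G *\<^sub>v f) > 0"
    using resolvent_form_nonneg[of f K] assms(3) unfolding G_def f_def by (simp add: add_pos_nonneg)
  have "w \<bullet> (resolvent n F (insert j K) lam *\<^sub>v f) = w \<bullet> (G *\<^sub>v f) -
      (f \<bullet> (G *\<^sub>v f)) * (w \<bullet> (G *\<^sub>v f)) / (real n + f \<bullet> (G *\<^sub>v f))"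
    unfolding f_def G_def by (rule resolvent_insert_form) (use assms in auto)
  also have "\<dots> = real n * (w \<bullet> (G *\<^sub>v f)) / (real n + f \<bullet> (G *\<^sub>v f))"
    using pos by (simp add: field_simps)
  finally have eq: "w \<bullet> (resolvent n F (insert j K) lam *\<^sub>v f) =
      real n * (w \<bullet> (G *\<^sub>v f)) / (real n + f \<bullet> (G *\<^sub>v f))" .
  have "1 + f \<bullet> (G *\<^sub>v f) / real n = (real n + f \<bullet> (G *\<^sub>v f)) / real n"
    using assms(3) by (simp add: add_divide_distrib)
  then show ?thesis using assms(3) unfolding eq by simp
qed

lemma resolvent_entry:
  assumes "i < n" "k < n"
  shows "(resolvent n F K lam *\<^sub>v unit_vec n k) $ i = resolvent n F K lam $$ (i, k)"
  using assms by (simp add: scalar_prod_right_unit carrier_matD[OF resolvent_carrier])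

lemma resolvent_unit_form:
  assumes "i < n" "u \<in> carrier_vec n"
  shows "u \<bullet> (resolvent n F K lam *\<^sub>v unit_vec n i) = (resolvent n F K lam *\<^sub>v u) $ i"
  by (subst resolvent_sym)
     (use assms carrier_vecD[OF resolvent_vec_carrier] in \<open>auto simp: scalar_prod_left_unit\<close>)

lemma mat_tr_resolvent_alt:
  "mat_tr (resolvent n F K lam) = (\<Sum>i<n. unit_vec n i \<bullet> (resolvent n F K lam *\<^sub>v unit_vec n i))"
  unfolding mat_tr_def using carrier_matD(1)[OF resolvent_carrier] 
  by (auto intro!: sum.cong simp: resolvent_unit_form resolvent_entry simp del: index_mult_mat_vec)

lemma mat_tr_resolvent_nonneg: "0 \<le> mat_tr (resolvent n F K lam)"
  unfolding mat_tr_resolvent_alt by (intro sum_nonneg resolvent_form_nonneg) simp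

lemma mat_tr_resolvent_le: "mat_tr (resolvent n F K lam) \<le> real n / lam"
proof -
  have "unit_vec n i \<bullet> (resolvent n F K lam *\<^sub>v unit_vec n i) \<le> 1 / lam" if "i < n" for i
    using resolvent_form_le[of "unit_vec n i" K] lam that by (simp add: field_simps)
  then have "mat_tr (resolvent n F K lam) \<le> (\<Sum>i<n. 1 / lam)"
    unfolding mat_tr_resolvent_alt by (intro sum_mono) auto
  then show ?thesis by simp
qed

lemma resolvent_frobenius_alt:
  "(\<Sum>i<n. (resolvent n F K lam *\<^sub>v unit_vec n i) \<bullet> (resolvent n F K lam *\<^sub>v unit_vec n i)) =
   (\<Sum>i<n. \<Sum>k<n. (resolvent n F K lam $$ (i, k))\<^sup>2)"
  by (subst sum.swap)
     (auto intro!: sum.cong simp: scalar_prod_def[of _ "_ *\<^sub>v _"] atLeast0LessThan power2_eq_square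
        resolvent_entry carrier_matD[OF resolvent_carrier] simp del: index_mult_mat_vec)

text \<open>Each G e_i has squared norm at most 1 / lam^2. The variance of a normalised quadratic
  form is governed by this squared Frobenius norm divided by n^2, hence is O(1/n).\<close>

lemma resolvent_frobenius_le:
  "(\<Sum>i<n. \<Sum>k<n. (resolvent n F K lam $$ (i, k))\<^sup>2) \<le> real n / lam\<^sup>2"
proof -
  have "(resolvent n F K lam *\<^sub>v unit_vec n i) \<bullet> (resolvent n F K lam *\<^sub>v unit_vec n i) \<le> 1 / lam\<^sup>2" if "i < n" for i
    using resolvent_norm_le[of "unit_vec n i" K] lam that by (simp add: field_simps)
  then have "(\<Sum>i<n. (resolvent n F K lam *\<^sub>v unit_vec n i) \<bullet> (resolvent n F K lam *\<^sub>v unit_vec n i)) \<le> (\<Sum>i<n. 1 / lam\<^sup>2)"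
    by (intro sum_mono) auto
  then show ?thesis by (simp add: resolvent_frobenius_alt)
qed

text \<open>The trace drops by |Gf|^2 / (n + f \<bullet> Gf), and lam |Gf|^2 \<le> f \<bullet> Gf
  bounds this by 1 / lam whatever the size of the column. This bounded influence of one column feeds
  the variance bound for the trace.\<close>

lemma mat_tr_resolvent_insert:
  assumes "finite K" "j \<notin> K" "n > 0"
  shows "mat_tr (resolvent n F (insert j K) lam) \<le> mat_tr (resolvent n F K lam)"
    "mat_tr (resolvent n F K lam) - mat_tr (resolvent n F (insert j K) lam) \<le> 1 / lam"
proof -
  let ?f = "col_vec n F j" and ?G = "resolvent n F K lam"
  let ?q = "?f \<bullet> (?G *\<^sub>v ?f)" and ?s = "(?G *\<^sub>v ?f) \<bullet> (?G *\<^sub>v ?f)"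
  have pos: "real n + ?q > 0"
    using resolvent_form_nonneg[of ?f K] assms(3) by (simp add: add_pos_nonneg)
  have "mat_tr (resolvent n F (insert j K) lam) =
      (\<Sum>i<n. unit_vec n i \<bullet> (?G *\<^sub>v unit_vec n i) - ((?G *\<^sub>v ?f) $ i * (?G *\<^sub>v ?f) $ i) / (real n + ?q))"
    unfolding mat_tr_resolvent_alt
    by (intro sum.cong refl, subst resolvent_insert_form)
       (use assms in \<open>auto simp: resolvent_unit_form scalar_prod_left_unit carrier_matD[OF resolvent_carrier] simp del: index_mult_mat_vec\<close>)
  also have "\<dots> = mat_tr ?G - ?s / (real n + ?q)"
    unfolding mat_tr_resolvent_alt sum_subtractf sum_divide_distrib[symmetric]
    by (simp add: scalar_prod_def[of _ "_ *\<^sub>v col_vec _ _ _"] atLeast0LessThan carrier_matD[OF resolvent_carrier] del: index_mult_mat_vec)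
  finally have eq: "mat_tr (resolvent n F (insert j K) lam) = mat_tr ?G - ?s / (real n + ?q)" .
  show "mat_tr (resolvent n F (insert j K) lam) \<le> mat_tr ?G"
    unfolding eq using pos sq_norm_real_nonneg[of "?G *\<^sub>v ?f"] by simp
  have "lam * ?s \<le> real n + ?q" using resolvent_form_ge[of ?f K] by simp
  then have "?s / (real n + ?q) \<le> 1 / lam" using pos lam by (simp add: field_simps)
  then show "mat_tr ?G - mat_tr (resolvent n F (insert j K) lam) \<le> 1 / lam" unfolding eq by simp
qed

text \<open>The trace of \<open>ridge_gram\<close> times its inverse is n; the Gram part contributes
  the column forms and the ridge part lam tr G. Averaged over the data this becomes the fixed-point
  equation.\<close>

lemma mat_tr_resolvent_eq:
  "(\<Sum>j\<in>K. col_vec n F j \<bullet> (resolvent n F K lam *\<^sub>v col_vec n F j) / real n) =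
    real n - lam * mat_tr (resolvent n F K lam)"
proof -
  let ?G = "resolvent n F K lam"
  have "real n = (\<Sum>i<n. (ridge_gram n F K lam *\<^sub>v (?G *\<^sub>v unit_vec n i)) $ i)"
    by (subst ridge_gram_resolvent_vec) auto
  also have "\<dots> = (\<Sum>i<n. lam * ?G $$ (i, i) + (\<Sum>j\<in>K. F (i, j) * (?G *\<^sub>v col_vec n F j) $ i) / real n)"
    by (intro sum.cong refl, subst ridge_gram_mult)
       (auto simp: resolvent_unit_form resolvent_entry simp del: index_mult_mat_vec)
  also have "\<dots> = lam * mat_tr ?G + (\<Sum>j\<in>K. \<Sum>i<n. F (i, j) * (?G *\<^sub>v col_vec n F j) $ i) / real n"
    unfolding sum.distrib sum_divide_distrib[symmetric]
    by (subst sum.swap) (simp add: mat_tr_def sum_distrib_left carrier_matD[OF resolvent_carrier] del: index_mult_mat_vec)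
  also have "(\<Sum>j\<in>K. \<Sum>i<n. F (i, j) * (?G *\<^sub>v col_vec n F j) $ i) = (\<Sum>j\<in>K. col_vec n F j \<bullet> (?G *\<^sub>v col_vec n F j))"
    by (intro sum.cong refl)
       (simp add: scalar_prod_def[of _ "_ *\<^sub>v _"] col_vec_def[of _ _ j for j] atLeast0LessThan carrier_matD[OF resolvent_carrier] del: index_mult_mat_vec)
  finally show ?thesis by (simp add: sum_divide_distrib)
qed

end

text \<open>The function lam \<mapsto> u \<bullet> Gu is convex with derivative -|Gu|^2; these are
  its two tangent inequalities. By the resolvent identity the difference equals (lam' - lam) times
  the mixed product of G'u and Gu, and positivity of G and G' compares that product with |G'u|^2 and
  |Gu|^2.\<close>

lemma resolvent_secant:
  fixes n F K
  assumes "0 < lam" "lam < lam'" and u: "u \<in> carrier_vec n"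
  defines "R \<equiv> resolvent n F K lam" and "R' \<equiv> resolvent n F K lam'"
  shows "(lam' - lam) * ((R' *\<^sub>v u) \<bullet> (R' *\<^sub>v u)) \<le> u \<bullet> (R *\<^sub>v u) - u \<bullet> (R' *\<^sub>v u)" (is ?A)
    and "u \<bullet> (R *\<^sub>v u) - u \<bullet> (R' *\<^sub>v u) \<le> (lam' - lam) * ((R *\<^sub>v u) \<bullet> (R *\<^sub>v u))" (is ?B)
proof -
  define h where "h = lam' - lam"
  have h: "h > 0" and l': "lam' > 0" using assms by (auto simp: h_def)
  have Rc: "R *\<^sub>v x \<in> carrier_vec n" "R' *\<^sub>v x \<in> carrier_vec n" for x
    by (simp_all add: R_def R'_def)
  have shift: "ridge_gram n F K lam' *\<^sub>v x = ridge_gram n F K lam *\<^sub>v x + h \<cdot>\<^sub>v x"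
    if "x \<in> carrier_vec n" for x
  proof (rule eq_vecI)
    fix i assume "i < dim_vec (ridge_gram n F K lam *\<^sub>v x + h \<cdot>\<^sub>v x)"
    then have i: "i < n" using that by simp
    then show "(ridge_gram n F K lam' *\<^sub>v x) $ i = (ridge_gram n F K lam *\<^sub>v x + h \<cdot>\<^sub>v x) $ i"
      using that ridge_gram_mult[OF that i, of F K] carrier_matD(1)[OF ridge_gram_carrier]
      by (simp add: h_def algebra_simps del: index_mult_mat_vec)
  qed (use that carrier_matD(1)[OF ridge_gram_carrier] in simp)
  \<comment> \<open>The resolvent identity in its two orders: \<open>1\<close> bounds the mixed
    product from above, \<open>2\<close> from below, and \<open>1\<close> also gives the exact
    difference in \<open>mid\<close>.\<close>
  have 1: "R *\<^sub>v u = R' *\<^sub>v u + h \<cdot>\<^sub>v (R' *\<^sub>v (R *\<^sub>v u))"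
  proof -
    have "R' *\<^sub>v (u + h \<cdot>\<^sub>v (R *\<^sub>v u)) = R *\<^sub>v u"
      unfolding R'_def
      by (rule resolvent_eqI[OF l' Rc(1)], subst shift[OF Rc(1)])
         (simp add: R_def ridge_gram_resolvent_vec[OF assms(1) u])
    moreover have "R' *\<^sub>v (u + h \<cdot>\<^sub>v (R *\<^sub>v u)) = R' *\<^sub>v u + h \<cdot>\<^sub>v (R' *\<^sub>v (R *\<^sub>v u))"
      unfolding R'_def
      by (subst mult_add_distrib_mat_vec[OF resolvent_carrier u], simp add: Rc)
         (simp add: mult_mat_vec[OF resolvent_carrier Rc(1)])
    ultimately show ?thesis by simp
  qed
  have 2: "R *\<^sub>v u = R' *\<^sub>v u + h \<cdot>\<^sub>v (R *\<^sub>v (R' *\<^sub>v u))"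
  proof -
    have "ridge_gram n F K lam *\<^sub>v (R' *\<^sub>v u) + h \<cdot>\<^sub>v (R' *\<^sub>v u) = u"
      unfolding shift[OF Rc(2), symmetric] unfolding R'_def by (rule ridge_gram_resolvent_vec[OF l' u])
    then have "R *\<^sub>v u = R *\<^sub>v (ridge_gram n F K lam *\<^sub>v (R' *\<^sub>v u) + h \<cdot>\<^sub>v (R' *\<^sub>v u))" by simp
    also have "\<dots> = R *\<^sub>v (ridge_gram n F K lam *\<^sub>v (R' *\<^sub>v u)) + R *\<^sub>v (h \<cdot>\<^sub>v (R' *\<^sub>v u))"
      unfolding R_def by (rule mult_add_distrib_mat_vec[OF resolvent_carrier])
        (use Rc mult_mat_vec_carrier[OF ridge_gram_carrier Rc(2)] in auto)
    also have "R *\<^sub>v (ridge_gram n F K lam *\<^sub>v (R' *\<^sub>v u)) = R' *\<^sub>v u"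
      unfolding R_def by (rule ridge_gram_resolvent_vec(2)[OF assms(1) Rc(2)])
    also have "R *\<^sub>v (h \<cdot>\<^sub>v (R' *\<^sub>v u)) = h \<cdot>\<^sub>v (R *\<^sub>v (R' *\<^sub>v u))"
      unfolding R_def by (rule mult_mat_vec[OF resolvent_carrier Rc(2)])
    finally show ?thesis .
  qed
  have mid: "u \<bullet> (R *\<^sub>v u) - u \<bullet> (R' *\<^sub>v u) = h * ((R' *\<^sub>v u) \<bullet> (R *\<^sub>v u))"
  proof -
    have "u \<bullet> (R *\<^sub>v u) = u \<bullet> (R' *\<^sub>v u) + h * (u \<bullet> (R' *\<^sub>v (R *\<^sub>v u)))"
      by (subst 1, subst scalar_prod_add_distrib[OF u Rc(2)]) (use Rc u in auto)
    also have "u \<bullet> (R' *\<^sub>v (R *\<^sub>v u)) = (R *\<^sub>v u) \<bullet> (R' *\<^sub>v u)"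
      unfolding R'_def by (rule resolvent_sym[OF l' u Rc(1)])
    also have "\<dots> = (R' *\<^sub>v u) \<bullet> (R *\<^sub>v u)" by (rule comm_scalar_prod[OF Rc])
    finally show ?thesis by simp
  qed
  have "(R *\<^sub>v u) \<bullet> (R *\<^sub>v u) = (R *\<^sub>v u) \<bullet> (R' *\<^sub>v u) + h * ((R *\<^sub>v u) \<bullet> (R' *\<^sub>v (R *\<^sub>v u)))"
    by (subst (2) 1, subst scalar_prod_add_distrib[OF Rc])
       (simp_all add: Rc scalar_prod_smult_distrib[OF Rc(1) Rc(2)])
  moreover have "(R *\<^sub>v u) \<bullet> (R' *\<^sub>v (R *\<^sub>v u)) \<ge> 0"
    unfolding R'_def by (rule resolvent_form_nonneg[OF l' Rc(1)])
  ultimately have b: "(R' *\<^sub>v u) \<bullet> (R *\<^sub>v u) \<le> (R *\<^sub>v u) \<bullet> (R *\<^sub>v u)"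
    using h comm_scalar_prod[OF Rc, of u u] by (simp add: mult_nonneg_nonneg)
  have "(R' *\<^sub>v u) \<bullet> (R *\<^sub>v u) = (R' *\<^sub>v u) \<bullet> (R' *\<^sub>v u) + h * ((R' *\<^sub>v u) \<bullet> (R *\<^sub>v (R' *\<^sub>v u)))"
    by (subst 2, subst scalar_prod_add_distrib[OF Rc(2) Rc(2)])
       (simp_all add: Rc scalar_prod_smult_distrib[OF Rc(2) Rc(1)])
  moreover have "(R' *\<^sub>v u) \<bullet> (R *\<^sub>v (R' *\<^sub>v u)) \<ge> 0"
    unfolding R_def by (rule resolvent_form_nonneg[OF assms(1) Rc(2)])
  ultimately have a: "(R' *\<^sub>v u) \<bullet> (R' *\<^sub>v u) \<le> (R' *\<^sub>v u) \<bullet> (R *\<^sub>v u)"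
    using h by (simp add: mult_nonneg_nonneg)
  show ?A ?B unfolding mid using a b h by (simp_all add: h_def)
qed

section \<open>Measurability of the resolvent and the push-through form of the predictor\<close>

lemma borel_measurable_det [measurable (raw)]:
  assumes "\<And>x. A x \<in> carrier_mat m m"
    and "\<And>i k. i < m \<Longrightarrow> k < m \<Longrightarrow> (\<lambda>x. A x $$ (i, k)) \<in> borel_measurable M"
  shows "(\<lambda>x. Determinant.det (A x) :: real) \<in> borel_measurable M"
proof -
  have eq: "Determinant.det (A x) = (\<Sum>p \<in> {p. p permutes {0..<m}}. signof p * (\<Prod>i=0..<m. A x $$ (i, p i)))" for x
    by (rule det_def'[OF assms(1)])
  show ?thesis unfolding eq
    by (intro borel_measurable_sum borel_measurable_times borel_measurable_prod borel_measurable_const assms(2))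
       (auto simp: permutes_in_image)
qed

lemma borel_measurable_resolvent:
  assumes "\<And>i j. i < n \<Longrightarrow> j \<in> K \<Longrightarrow> (\<lambda>x. F x (i, j)) \<in> borel_measurable M" and "i < n" "k < n"
  shows "(\<lambda>x. resolvent n (F x) K lam $$ (i, k)) \<in> borel_measurable M"
proof -
  have S: "(\<lambda>x. ridge_gram n (F x) K lam $$ (i, k)) \<in> borel_measurable M" if "i < n" "k < n" for i k
    using that assms(1) by (auto simp: ridge_gram_def intro!: borel_measurable_sum borel_measurable_times borel_measurable_add borel_measurable_divide)
  have D: "(\<lambda>x. Determinant.det (mat_delete (ridge_gram n (F x) K lam) k i)) \<in> borel_measurable M"
    by (rule borel_measurable_det[of _ "n - 1"])
       (use assms(2,3) S in \<open>auto simp: mat_delete_def carrier_matD[OF ridge_gram_carrier]\<close>)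
  have "resolvent n (F x) K lam $$ (i, k) =
      1 / Determinant.det (ridge_gram n (F x) K lam) * ((-1) ^ (k + i) * Determinant.det (mat_delete (ridge_gram n (F x) K lam) k i))" for x
    unfolding resolvent_def using assms(2,3) carrier_matD[OF adj_mat(1)[OF ridge_gram_carrier]]
    by (subst index_smult_mat) (auto simp: adj_mat_def cofactor_def carrier_matD[OF ridge_gram_carrier])
  moreover have "(\<lambda>x. Determinant.det (ridge_gram n (F x) K lam)) \<in> borel_measurable M"
    by (rule borel_measurable_det[of _ n, OF ridge_gram_carrier]) (use S in auto)
  ultimately show ?thesis using D by simp
qed

lemma form_sum:
  fixes A :: "real mat"
  assumes "A \<in> carrier_mat n n" "u \<in> carrier_vec n" "w \<in> carrier_vec n"
  shows "u \<bullet> (A *\<^sub>v w) = (\<Sum>i<n. \<Sum>k<n. A $$ (i, k) * u $ i * w $ k)"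
  using assms by (simp add: scalar_prod_def atLeast0LessThan sum_distrib_left mult_ac)

text \<open>Uniqueness of the inverse identifies the output of Gauss--Jordan elimination with the
  cofactor inverse used everywhere else.\<close>

lemma mat_inverse_eqI:
  fixes A :: "real mat"
  assumes A: "A \<in> carrier_mat n n" and B: "B \<in> carrier_mat n n" and AB: "A * B = 1\<^sub>m n" "B * A = 1\<^sub>m n"
  shows "mat_inverse A = Some B"
proof -
  have "A \<in> Units (ring_mat TYPE(real) n ())"
    using A B AB by (auto simp: Units_def ring_mat_simps)
  then have "mat_inverse A \<noteq> None"
    using mat_inverse(1)[OF A, of "()"] by blast
  then obtain C where C: "mat_inverse A = Some C" by blast
  from mat_inverse(2)[OF A C] have C': "C * A = 1\<^sub>m n" "C \<in> carrier_mat n n" by auto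
  have "C = C * (A * B)" using C' AB by simp
  also have "\<dots> = (C * A) * B" using A B C' by (intro assoc_mult_mat[symmetric])
  finally show ?thesis using C C' B by simp
qed

text \<open>The push-through identity \<open>(F\<^sup>T F / n + \<lambda>)\<inverse> F\<^sup>T = F\<^sup>T (F F\<^sup>T / n + \<lambda>)\<inverse>\<close> moves the inverse of the
  predictor to the side of the observations.\<close>

lemma predictor_eq:
  fixes \<phi> :: "real \<Rightarrow> real"
  assumes W: "W \<in> carrier_mat p d" and X: "X \<in> carrier_mat n d" and Y: "Y \<in> carrier_vec n"
    and x: "x \<in> carrier_vec d" and lam: "lam > 0" and n: "n > 0" and p: "p > 0"
  defines "F \<equiv> \<lambda>(i, j). \<phi> ((X * transpose_mat W) $$ (i, j))"
  shows "predictor \<phi> lam W X Y x =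
    (\<Sum>j<p. \<phi> ((W *\<^sub>v x) $ j) * (col_vec n F j \<bullet> (resolvent n F {..<p} lam *\<^sub>v Y) / real n))"
proof -
  define A where "A = map_mat \<phi> (W * transpose_mat X)"
  define B where "B = map_mat \<phi> (X * transpose_mat W)"
  have A: "A \<in> carrier_mat p n" "\<And>i j. i < n \<Longrightarrow> j < p \<Longrightarrow> A $$ (j, i) = F (i, j)"
    using W X by (auto simp: A_def F_def intro!: arg_cong[where f = \<phi>] comm_scalar_prod[of _ d])
  have B: "B \<in> carrier_mat n p" "\<And>i j. i < n \<Longrightarrow> j < p \<Longrightarrow> B $$ (i, j) = F (i, j)"
    using W X by (auto simp: B_def F_def)
  \<comment> \<open>The transposed feature matrix, rescaled because \<open>ridge_gram p\<close>
    divides by p whereas the predictor divides by n. This makes \<open>M\<close> itself a ridge Gram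
    matrix, hence invertible.\<close>
  define F' where "F' = (\<lambda>(j, i). F (i, j) * sqrt (real p / real n))"
  define M where "M = (1 / real n) \<cdot>\<^sub>m (A * B) + lam \<cdot>\<^sub>m 1\<^sub>m p"
  have sq: "sqrt (real p / real n) * sqrt (real p / real n) = real p / real n" by simp
  have FF: "F' (j, i) * F' (k, i) = F (i, j) * F (i, k) * (real p / real n)" for i j k
  proof -
    have "F' (j, i) * F' (k, i) = F (i, j) * F (i, k) * (sqrt (real p / real n) * sqrt (real p / real n))"
      unfolding F'_def split by (simp only: mult_ac)
    then show ?thesis unfolding sq .
  qed
  have M: "M = ridge_gram p F' {..<n} lam"
  proof (rule eq_matI)
    fix j k assume "j < dim_row (ridge_gram p F' {..<n} lam)" "k < dim_col (ridge_gram p F' {..<n} lam)"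
    then have jk: "j < p" "k < p" by (simp_all add: ridge_gram_def)
    have "(A * B) $$ (j, k) = (\<Sum>i<n. F (i, j) * F (i, k))"
      using A B jk by (simp add: scalar_prod_def atLeast0LessThan)
    moreover have "(\<Sum>i<n. F' (j, i) * F' (k, i)) / real p = (\<Sum>i<n. F (i, j) * F (i, k)) / real n"
      unfolding FF sum_distrib_right[symmetric] using p by simp
    ultimately show "M $$ (j, k) = ridge_gram p F' {..<n} lam $$ (j, k)"
      using jk A B unfolding M_def by (simp add: ridge_gram_def)
  qed (use A B in \<open>auto simp: M_def ridge_gram_def\<close>)
  have inv: "the (mat_inverse M) = resolvent p F' {..<n} lam"
    unfolding M by (subst mat_inverse_eqI[OF _ _ resolvent_inverse]) (use lam in auto)
  define g where "g = resolvent n F {..<p} lam *\<^sub>v Y"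
  have g: "g \<in> carrier_vec n" by (simp add: g_def)
  define w where "w = vec p (\<lambda>j. col_vec n F j \<bullet> g / real n)"
  have w: "w \<in> carrier_vec p" by (simp add: w_def)
  \<comment> \<open>The candidate w = F^T g / n is checked in the p-dimensional system: multiplying
    the n-dimensional equation for g by F^T gives the right-hand side.\<close>
  have "ridge_gram p F' {..<n} lam *\<^sub>v w = (1 / real n) \<cdot>\<^sub>v (A *\<^sub>v Y)"
  proof (rule eq_vecI)
    fix j assume "j < dim_vec ((1 / real n) \<cdot>\<^sub>v (A *\<^sub>v Y))"
    then have j: "j < p" using A by simp
    have gY: "Y $ i = lam * g $ i + (\<Sum>k<p. F (i, k) * (col_vec n F k \<bullet> g)) / real n" if "i < n" for i
      using ridge_gram_mult[OF g that, of F "{..<p}" lam] ridge_gram_resolvent_vec(1)[OF lam Y, of F "{..<p}"]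
      unfolding g_def by simp
    have "(A *\<^sub>v Y) $ j = (\<Sum>i<n. F (i, j) * Y $ i)"
      using A Y j by (simp add: scalar_prod_def atLeast0LessThan)
    also have "\<dots> = (\<Sum>i<n. F (i, j) * (lam * g $ i + (\<Sum>k<p. F (i, k) * (col_vec n F k \<bullet> g)) / real n))"
      using gY by simp
    also have "\<dots> = lam * (\<Sum>i<n. F (i, j) * g $ i) + (\<Sum>i<n. F (i, j) * (\<Sum>k<p. F (i, k) * (col_vec n F k \<bullet> g)) / real n)"
      by (simp add: distrib_left sum.distrib sum_distrib_left mult_ac)
    also have "(\<Sum>i<n. F (i, j) * g $ i) = real n * w $ j"
      using j g n by (simp add: w_def scalar_prod_def atLeast0LessThan col_vec_def)
    also have "(\<Sum>i<n. F (i, j) * (\<Sum>k<p. F (i, k) * (col_vec n F k \<bullet> g)) / real n) =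
        real n * ((\<Sum>i<n. F' (j, i) * (col_vec p F' i \<bullet> w)) / real p)"
    proof -
      have "F' (j, i) * (col_vec p F' i \<bullet> w) = F (i, j) * (\<Sum>k<p. F (i, k) * (col_vec n F k \<bullet> g)) / real n * (real p / real n)" for i
      proof -
        have "F' (j, i) * (col_vec p F' i \<bullet> w) = (\<Sum>k<p. F' (j, i) * F' (k, i) * (col_vec n F k \<bullet> g / real n))"
          unfolding scalar_prod_def[of _ w]
            by (simp add: w_def col_vec_def[of p] atLeast0LessThan sum_distrib_left mult.assoc)
        also have "\<dots> = F (i, j) * (\<Sum>k<p. F (i, k) * (col_vec n F k \<bullet> g)) / real n * (real p / real n)"
          unfolding FF by (simp add: sum_distrib_left sum_distrib_right sum_divide_distrib mult_ac)
        finally show ?thesis .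
      qed
      then show ?thesis using n p by (simp add: sum_distrib_right[symmetric] sum_divide_distrib[symmetric])
    qed
    finally have "(A *\<^sub>v Y) $ j = lam * (real n * w $ j) + real n * ((\<Sum>i<n. F' (j, i) * (col_vec p F' i \<bullet> w)) / real p)" .
    then have "(A *\<^sub>v Y) $ j / real n = lam * w $ j + (\<Sum>i<n. F' (j, i) * (col_vec p F' i \<bullet> w)) / real p"
      using n by (simp add: field_simps)
    then show "(ridge_gram p F' {..<n} lam *\<^sub>v w) $ j = ((1 / real n) \<cdot>\<^sub>v (A *\<^sub>v Y)) $ j"
      unfolding ridge_gram_mult[OF w j] using j A(1) by simp
  qed (use A carrier_matD[OF ridge_gram_carrier] in simp)
  then have res: "resolvent p F' {..<n} lam *\<^sub>v ((1 / real n) \<cdot>\<^sub>v (A *\<^sub>v Y)) = w"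
    by (rule resolvent_eqI[OF lam w])
  have "predictor \<phi> lam W X Y x = map_vec \<phi> (W *\<^sub>v x) \<bullet> w"
    unfolding predictor_def Let_def A_def[symmetric] B_def[symmetric]
    using W X inv res unfolding M_def by simp
  also have "\<dots> = (\<Sum>j<p. \<phi> ((W *\<^sub>v x) $ j) * (col_vec n F j \<bullet> g / real n))"
    using W unfolding scalar_prod_def[of _ w] by (simp add: w_def atLeast0LessThan del: index_mult_mat_vec)
  finally show ?thesis by (simp add: g_def)
qed

subsection \<open>Rotation invariance of Gaussian vectors\<close>

abbreviation "N01 \<equiv> std_normal_distribution"

lemma centered_normal_1: "centered_normal 1 = std_normal_distribution"
proof -
  have "(\<lambda>z :: real. 1 * z) = (\<lambda>z. z)" by simp
  then show ?thesis unfolding centered_normal_def by (simp only:) (rule distr_id2, simp)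
qed

text \<open>Translation invariance in one coordinate, with the other frozen, shows that shears
  preserve planar Lebesgue measure. Three of them make a rotation, so rotation invariance follows
  from one-dimensional facts and Fubini.\<close>

lemma shear_nn_integral:
  fixes h :: "real \<times> real \<Rightarrow> ennreal"
  assumes [measurable]: "h \<in> borel_measurable borel"
  shows "(\<integral>\<^sup>+ y. \<integral>\<^sup>+ x. h (x + c * y, y) \<partial>lborel \<partial>lborel) = (\<integral>\<^sup>+ y. \<integral>\<^sup>+ x. h (x, y) \<partial>lborel \<partial>lborel)"
    "(\<integral>\<^sup>+ y. \<integral>\<^sup>+ x. h (x, y + c * x) \<partial>lborel \<partial>lborel) = (\<integral>\<^sup>+ y. \<integral>\<^sup>+ x. h (x, y) \<partial>lborel \<partial>lborel)"
proof -
  have tr: "(\<integral>\<^sup>+ x. k (x + a) \<partial>lborel) = (\<integral>\<^sup>+ x. k x \<partial>lborel)"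
    if [measurable]: "k \<in> borel_measurable borel" for a :: real and k :: "real \<Rightarrow> ennreal"
  proof -
    have "(\<integral>\<^sup>+ x. k x \<partial>lborel) = (\<integral>\<^sup>+ x. k x \<partial>distr lborel borel ((+) a))"
      by (simp add: lborel_distr_plus)
    also have "\<dots> = (\<integral>\<^sup>+ x. k (x + a) \<partial>lborel)"
      by (subst nn_integral_distr) (auto simp: add.commute)
    finally show ?thesis ..
  qed
  show "(\<integral>\<^sup>+ y. \<integral>\<^sup>+ x. h (x + c * y, y) \<partial>lborel \<partial>lborel) = (\<integral>\<^sup>+ y. \<integral>\<^sup>+ x. h (x, y) \<partial>lborel \<partial>lborel)"
    by (intro nn_integral_cong tr) measurable
  have "(\<integral>\<^sup>+ y. \<integral>\<^sup>+ x. h (x, y + c * x) \<partial>lborel \<partial>lborel) = (\<integral>\<^sup>+ x. \<integral>\<^sup>+ y. h (x, y + c * x) \<partial>lborel \<partial>lborel)"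
    by (rule lborel_pair.Fubini'[of "\<lambda>x y. h (x, y + c * x)"]) measurable
  also have "\<dots> = (\<integral>\<^sup>+ x. \<integral>\<^sup>+ y. h (x, y) \<partial>lborel \<partial>lborel)"
    by (intro nn_integral_cong tr) measurable
  also have "\<dots> = (\<integral>\<^sup>+ y. \<integral>\<^sup>+ x. h (x, y) \<partial>lborel \<partial>lborel)"
    by (rule lborel_pair.Fubini'[of "\<lambda>x y. h (x, y)", symmetric]) measurable
  finally show "(\<integral>\<^sup>+ y. \<integral>\<^sup>+ x. h (x, y + c * x) \<partial>lborel \<partial>lborel) = (\<integral>\<^sup>+ y. \<integral>\<^sup>+ x. h (x, y) \<partial>lborel \<partial>lborel)" .
qed


text \<open>The density depends on x^2 + y^2 only, and the rotation is the composition of a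
  horizontal, a vertical and a horizontal shear, each of which preserves the iterated Lebesgue
  integral.\<close>

lemma std_normal_rotation:
  fixes h :: "real \<times> real \<Rightarrow> ennreal"
  assumes [measurable]: "h \<in> borel_measurable borel" and cs: "c\<^sup>2 + s\<^sup>2 = 1" "s \<noteq> 0"
  shows "(\<integral>\<^sup>+ y. \<integral>\<^sup>+ x. h (c * x + s * y, - s * x + c * y) \<partial>N01 \<partial>N01) =
    (\<integral>\<^sup>+ y. \<integral>\<^sup>+ x. h (x, y) \<partial>N01 \<partial>N01)"
proof -
  define g where "g = (\<lambda>(x, y). ennreal (exp (- (x\<^sup>2 + y\<^sup>2) / 2) / (2 * pi)))"
  have [measurable]: "g \<in> borel_measurable borel"
    unfolding g_def by (simp add: borel_prod[symmetric])
  have dens: "(\<integral>\<^sup>+ y. \<integral>\<^sup>+ x. k (x, y) \<partial>N01 \<partial>N01) = (\<integral>\<^sup>+ y. \<integral>\<^sup>+ x. g (x, y) * k (x, y) \<partial>lborel \<partial>lborel)"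
    if [measurable]: "k \<in> borel_measurable borel" for k :: "real \<times> real \<Rightarrow> ennreal"
  proof -
    have gg: "g (x, y) = ennreal (normal_density 0 1 y) * ennreal (normal_density 0 1 x)" for x y
    proof -
      have "exp (- (x\<^sup>2 + y\<^sup>2) / 2) = exp (- (y\<^sup>2 / 2)) * exp (- (x\<^sup>2 / 2))"
        by (simp add: exp_add[symmetric] field_simps)
      moreover have "2 * pi = sqrt (2 * pi) * sqrt (2 * pi)" by simp
      ultimately have "exp (- (x\<^sup>2 + y\<^sup>2) / 2) / (2 * pi) = normal_density 0 1 y * normal_density 0 1 x"
        by (simp add: normal_density_def del: real_sqrt_mult)
      then show ?thesis unfolding g_def by (simp add: ennreal_mult)
    qed
    have "(\<integral>\<^sup>+ y. \<integral>\<^sup>+ x. k (x, y) \<partial>N01 \<partial>N01) =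
        (\<integral>\<^sup>+ y. ennreal (normal_density 0 1 y) * (\<integral>\<^sup>+ x. ennreal (normal_density 0 1 x) * k (x, y) \<partial>lborel) \<partial>lborel)"
      by (simp add: nn_integral_density)
    also have "\<dots> = (\<integral>\<^sup>+ y. \<integral>\<^sup>+ x. g (x, y) * k (x, y) \<partial>lborel \<partial>lborel)"
      by (intro nn_integral_cong) (simp add: gg nn_integral_cmult[symmetric] mult.assoc)
    finally show ?thesis .
  qed
  \<comment> \<open>The tangent of half the rotation angle is the coefficient of the two outer
    shears; the middle shear has coefficient -s.\<close>
  define a where "a = (1 - c) / s"
  define k where "k = (\<lambda>z. g z * h z)"
  define k1 where "k1 = (\<lambda>(x, y). k (x + a * y, y))"
  define k2 where "k2 = (\<lambda>(x, y). k1 (x, y + (- s) * x))"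
  have [measurable]: "k \<in> borel_measurable borel" by (simp add: k_def)
  have [measurable]: "k1 \<in> borel_measurable borel"
    unfolding k1_def by (simp add: borel_prod[symmetric])
  have [measurable]: "k2 \<in> borel_measurable borel"
    unfolding k2_def by (simp add: borel_prod[symmetric])
  have as: "a * s = 1 - c" using cs(2) by (simp add: a_def)
  have ac: "a * (1 + c) = s"
    using cs unfolding a_def by (simp add: field_simps power2_eq_square)
  have rot: "k2 (x + a * y, y) = k (c * x + s * y, - s * x + c * y)" for x y
  proof -
    have 1: "y + - s * (x + a * y) = - s * x + c * y"
      using as by (simp add: algebra_simps) (metis add.commute diff_add_cancel mult.assoc mult.commute mult.right_neutral ring_class.ring_distribs(1))
    have "x + a * y + a * (- s * x + c * y) = (1 - a * s) * x + (a * (1 + c)) * y"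
      by (simp add: algebra_simps)
    then have 2: "x + a * y + a * (- s * x + c * y) = c * x + s * y" using as ac by simp
    show ?thesis unfolding k2_def k1_def split 1 2 ..
  qed
  have grot: "g (c * x + s * y, - s * x + c * y) = g (x, y)" for x y
  proof -
    have "(c * x + s * y)\<^sup>2 + (- s * x + c * y)\<^sup>2 = (c\<^sup>2 + s\<^sup>2) * (x\<^sup>2 + y\<^sup>2)"
      by (simp add: power2_eq_square algebra_simps)
    then show ?thesis unfolding g_def split using cs by simp
  qed
  have "(\<integral>\<^sup>+ y. \<integral>\<^sup>+ x. h (x, y) \<partial>N01 \<partial>N01) = (\<integral>\<^sup>+ y. \<integral>\<^sup>+ x. k (x, y) \<partial>lborel \<partial>lborel)"
    unfolding k_def by (rule dens) measurable
  also have "\<dots> = (\<integral>\<^sup>+ y. \<integral>\<^sup>+ x. k1 (x, y) \<partial>lborel \<partial>lborel)"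
    unfolding k1_def split by (rule shear_nn_integral(1)[symmetric]) measurable
  also have "\<dots> = (\<integral>\<^sup>+ y. \<integral>\<^sup>+ x. k2 (x, y) \<partial>lborel \<partial>lborel)"
    unfolding k2_def split by (rule shear_nn_integral(2)[symmetric]) measurable
  also have "\<dots> = (\<integral>\<^sup>+ y. \<integral>\<^sup>+ x. k2 (x + a * y, y) \<partial>lborel \<partial>lborel)"
    by (rule shear_nn_integral(1)[symmetric]) measurable
  also have "\<dots> = (\<integral>\<^sup>+ y. \<integral>\<^sup>+ x. g (x, y) * h (c * x + s * y, - s * x + c * y) \<partial>lborel \<partial>lborel)"
    unfolding rot k_def grot ..
  also have "\<dots> = (\<integral>\<^sup>+ y. \<integral>\<^sup>+ x. h (c * x + s * y, - s * x + c * y) \<partial>N01 \<partial>N01)"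
  proof -
    have "(\<lambda>z. h (c * fst z + s * snd z, - s * fst z + c * snd z)) \<in> borel_measurable borel"
      unfolding borel_prod[symmetric] by measurable
    from dens[OF this] show ?thesis by simp
  qed
  finally show ?thesis ..
qed

lemma std_normal_sign:
  assumes [measurable]: "h \<in> borel_measurable borel" and "e\<^sup>2 = 1"
  shows "(\<integral>\<^sup>+ x. h (e * x) \<partial>N01) = (\<integral>\<^sup>+ x. h x \<partial>N01)"
proof -
  consider "e = 1" | "e = - 1" using assms(2) by (auto simp: power2_eq_1_iff)
  then show ?thesis
  proof cases
    case 2
    have "(\<integral>\<^sup>+ x. h x \<partial>N01) = (\<integral>\<^sup>+ x. ennreal (normal_density 0 1 x) * h x \<partial>lborel)"
      by (simp add: nn_integral_density)
    also have "\<dots> = (\<integral>\<^sup>+ x. ennreal (normal_density 0 1 x) * h x \<partial>distr lborel borel uminus)"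
      by (simp add: lborel_distr_uminus)
    also have "\<dots> = (\<integral>\<^sup>+ x. ennreal (normal_density 0 1 x) * h (- x) \<partial>lborel)"
      by (subst nn_integral_distr) (auto simp: normal_density_def)
    also have "\<dots> = (\<integral>\<^sup>+ x. h (- x) \<partial>N01)"
      by (simp add: nn_integral_density)
    finally show ?thesis using 2 by simp
  qed simp
qed

lemma prob_space_N01: "prob_space N01"
  by (rule prob_space_normal_density) simp

interpretation N01: product_prob_space "\<lambda>_. N01" UNIV
  using prob_space_N01 by (auto simp: product_prob_space_def product_prob_space_axioms_def product_sigma_finite_def prob_space_imp_sigma_finite)

lemma sets_PiM_N01 [measurable_cong]: "sets (PiM I (\<lambda>_. N01)) = sets (PiM I (\<lambda>_. borel))"
  by (rule sets_PiM_cong) auto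

text \<open>Outer induction on the set of rows. For a new row \<open>j0\<close>, plane rotations of
  the Gaussian coordinates remove its nonzero entries one at a time without changing the integral.
  Once a single entry is left it is 1 or -1, orthogonality clears that column in all other rows, and
  the coordinate splits off as an independent Gaussian.\<close>

lemma orthonormal_gaussian_aux:
  fixes w :: "'j \<Rightarrow> 'i \<Rightarrow> real"
  assumes "finite J" "finite I"
    and "\<And>j k. j \<in> J \<Longrightarrow> k \<in> J \<Longrightarrow> (\<Sum>i\<in>I. w j i * w k i) = (if j = k then 1 else 0)"
    and "h \<in> borel_measurable (PiM J (\<lambda>_. borel))"
  shows "(\<integral>\<^sup>+ x. h (\<lambda>j\<in>J. \<Sum>i\<in>I. w j i * x i) \<partial>PiM I (\<lambda>_. N01)) = (\<integral>\<^sup>+ y. h y \<partial>PiM J (\<lambda>_. N01))"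
  using assms
proof (induction J arbitrary: I w h rule: finite_induct)
  case empty
  interpret I: prob_space "PiM I (\<lambda>_. N01)" by (rule prob_space_PiM) (rule prob_space_N01)
  show ?case using I.emeasure_space_1
    by (simp add: PiM_empty nn_integral_count_space_finite)
next
  case (insert j0 J)
  note h = insert.prems(3)
  have main: "(\<integral>\<^sup>+ x. h (\<lambda>j\<in>insert j0 J. \<Sum>i\<in>I. w j i * x i) \<partial>PiM I (\<lambda>_. N01)) = (\<integral>\<^sup>+ y. h y \<partial>PiM (insert j0 J) (\<lambda>_. N01))"
    if "\<And>j k. j \<in> insert j0 J \<Longrightarrow> k \<in> insert j0 J \<Longrightarrow> (\<Sum>i\<in>I. w j i * w k i) = (if j = k then 1 else 0)"
    for w
    using that
  proof (induction "card {i\<in>I. w j0 i \<noteq> 0}" arbitrary: w rule: less_induct)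
    case less
    note orth = less.prems
    define A where "A = {i\<in>I. w j0 i \<noteq> 0}"
    have finA: "finite A" using insert.prems(1) by (simp add: A_def)
    have sq: "(\<Sum>i\<in>I. w j0 i * w j0 i) = 1" using orth[of j0 j0] by simp
    have "A \<noteq> {}"
    proof
      assume "A = {}"
      then have "\<And>i. i \<in> I \<Longrightarrow> w j0 i = 0" by (auto simp: A_def)
      then show False using sq by simp
    qed
    then obtain a where a: "a \<in> A" by blast
    then have aI: "a \<in> I" "w j0 a \<noteq> 0" by (auto simp: A_def)
    show ?case
    proof (cases "A = {a}")
      case True
      define I' where "I' = I - {a}"
      have I: "I = insert a I'" "a \<notin> I'" "finite I'" using aI insert.prems(1) by (auto simp: I'_def)
      have z: "w j0 i = 0" if "i \<in> I'" for i using True that by (auto simp: A_def I'_def)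
      have e: "(w j0 a)\<^sup>2 = 1" using sq I z by (simp add: power2_eq_square)
      have z2: "w j a = 0" if "j \<in> J" for j
      proof -
        have "j \<noteq> j0" using that insert.hyps by auto
        then have "(\<Sum>i\<in>I. w j i * w j0 i) = 0" using orth[of j j0] that by simp
        then show ?thesis using I z aI(2) by simp
      qed
      have orth': "(\<Sum>i\<in>I'. w j i * w k i) = (if j = k then 1 else 0)" if "j \<in> J" "k \<in> J" for j k
        using orth[of j k] that I z2 by simp
      have rew: "(\<lambda>j\<in>insert j0 J. \<Sum>i\<in>I. w j i * (x(a := y)) i) = (\<lambda>j\<in>J. \<Sum>i\<in>I'. w j i * x i)(j0 := w j0 a * y)" for x y
      proof
        fix j
        have "(\<Sum>i\<in>I'. w j i * (x(a := y)) i) = (\<Sum>i\<in>I'. w j i * x i)" for j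
          using I(2) by (intro sum.cong) auto
        then show "(\<lambda>j\<in>insert j0 J. \<Sum>i\<in>I. w j i * (x(a := y)) i) j = ((\<lambda>j\<in>J. \<Sum>i\<in>I'. w j i * x i)(j0 := w j0 a * y)) j"
          using I z z2 insert.hyps by (auto simp: restrict_def)
      qed
      have m1: "(\<lambda>x. h (\<lambda>j\<in>insert j0 J. \<Sum>i\<in>I. w j i * x i)) \<in> borel_measurable (PiM (insert a I') (\<lambda>_. N01))"
        unfolding I(1)[symmetric]
        by (rule measurable_compose[OF _ h], rule measurable_restrict) 
           (auto intro!: borel_measurable_sum borel_measurable_times measurable_compose[OF measurable_component_singleton])
      have m2: "(\<lambda>y. h (z(j0 := y))) \<in> borel_measurable borel" if "z \<in> space (PiM J (\<lambda>_. borel))" for z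
        by (rule measurable_compose[OF measurable_component_update h]) (use that insert.hyps in auto)
      have m3: "(\<lambda>z. \<integral>\<^sup>+ y. h (z(j0 := y)) \<partial>N01) \<in> borel_measurable (PiM J (\<lambda>_. borel))"
      proof -
        have "(\<lambda>(z, y). h (z(j0 := y))) \<in> borel_measurable (PiM J (\<lambda>_. borel) \<Otimes>\<^sub>M N01)"
          using measurable_compose[OF measurable_add_dim h]
          by (simp add: case_prod_beta' fun_upd_def cong: measurable_cong_sets)
        then show ?thesis by (rule sigma_finite_measure.borel_measurable_nn_integral[OF prob_space_imp_sigma_finite[OF prob_space_N01]])
      qed
      have "(\<integral>\<^sup>+ x. h (\<lambda>j\<in>insert j0 J. \<Sum>i\<in>I. w j i * x i) \<partial>PiM I (\<lambda>_. N01)) =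
         (\<integral>\<^sup>+ x. \<integral>\<^sup>+ y. h ((\<lambda>j\<in>J. \<Sum>i\<in>I'. w j i * x i)(j0 := w j0 a * y)) \<partial>N01 \<partial>PiM I' (\<lambda>_. N01))"
        unfolding rew[symmetric] using m1 unfolding I(1)
        by (subst N01.product_nn_integral_insert) (use I in auto)
      also have "\<dots> = (\<integral>\<^sup>+ x. \<integral>\<^sup>+ y. h ((\<lambda>j\<in>J. \<Sum>i\<in>I'. w j i * x i)(j0 := y)) \<partial>N01 \<partial>PiM I' (\<lambda>_. N01))"
        by (intro nn_integral_cong std_normal_sign[OF m2 e]) (auto simp: space_PiM)
      also have "\<dots> = (\<integral>\<^sup>+ z. \<integral>\<^sup>+ y. h (z(j0 := y)) \<partial>N01 \<partial>PiM J (\<lambda>_. N01))"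
        by (rule insert.IH[OF I(3) orth' m3])
      also have "\<dots> = (\<integral>\<^sup>+ y. h y \<partial>PiM (insert j0 J) (\<lambda>_. N01))"
        by (rule N01.product_nn_integral_insert[symmetric])
           (use insert.hyps h in \<open>auto cong: measurable_cong_sets simp: sets_PiM_N01\<close>)
      finally show ?thesis .
    next
      case False
      then obtain b where b: "b \<in> A" "b \<noteq> a" using a by blast
      then have bI: "b \<in> I" "w j0 b \<noteq> 0" by (auto simp: A_def)
      define I' where "I' = I - {a, b}"
      have I: "I = insert b (insert a I')" "a \<notin> I'" "b \<notin> insert a I'" "finite I'"
        using aI bI b insert.prems(1) by (auto simp: I'_def)
      define r where "r = sqrt ((w j0 a)\<^sup>2 + (w j0 b)\<^sup>2)"
      have r: "r > 0" using aI(2) by (simp add: r_def sum_power2_gt_zero_iff)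
      have r2: "r\<^sup>2 = (w j0 a)\<^sup>2 + (w j0 b)\<^sup>2" by (simp add: r_def)
      \<comment> \<open>The rotation in the plane of a and b that sends the two entries of row
        \<open>j0\<close> to (r, 0), so that its support loses b.\<close>
      define c s where "c = w j0 a / r" and "s = w j0 b / r"
      have cs: "c\<^sup>2 + (- s)\<^sup>2 = 1" "- s \<noteq> 0"
        using r r2 bI by (auto simp: c_def s_def power_divide add_divide_distrib[symmetric])
      define w' where "w' = (\<lambda>j. (w j)(a := c * w j a + s * w j b, b := - s * w j a + c * w j b))"
      have w'I: "w' j i = w j i" if "i \<in> I'" for i j using that I by (auto simp: w'_def)
      have w'ab: "w' j a = c * w j a + s * w j b" "w' j b = - s * w j a + c * w j b" for j
        using b by (auto simp: w'_def)
      have sumI: "(\<Sum>i\<in>I. f i) = f b + (f a + (\<Sum>i\<in>I'. f i))" for f :: "'i \<Rightarrow> real"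
        using I by simp
      have orth': "(\<Sum>i\<in>I. w' j i * w' k i) = (if j = k then 1 else 0)"
        if "j \<in> insert j0 J" "k \<in> insert j0 J" for j k
      proof -
        have "w' j b * w' k b + w' j a * w' k a = (c\<^sup>2 + (- s)\<^sup>2) * (w j b * w k b + w j a * w k a)"
          unfolding w'ab by (simp add: power2_eq_square algebra_simps)
        then have "(\<Sum>i\<in>I. w' j i * w' k i) = (\<Sum>i\<in>I. w j i * w k i)"
          unfolding sumI using w'I cs by simp
        then show ?thesis using orth that by simp
      qed
      have "w' j0 b = 0" unfolding w'ab c_def s_def by simp
      then have "{i\<in>I. w' j0 i \<noteq> 0} \<subseteq> A - {b}"
        using w'I aI bI unfolding A_def by (subst (1) I(1)) (auto simp: I(1))
      then have "card {i\<in>I. w' j0 i \<noteq> 0} < card {i\<in>I. w j0 i \<noteq> 0}"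
        unfolding A_def[symmetric] using b(1) finA
        by (meson Diff_subset card_Diff1_less card_mono finite_Diff le_less_trans)
      from less.hyps[OF this orth']
      have IH: "(\<integral>\<^sup>+ x. h (\<lambda>j\<in>insert j0 J. \<Sum>i\<in>I. w' j i * x i) \<partial>PiM I (\<lambda>_. N01)) = (\<integral>\<^sup>+ y. h y \<partial>PiM (insert j0 J) (\<lambda>_. N01))" .
      have m0: "(\<lambda>x. h (\<lambda>j\<in>insert j0 J. \<Sum>i\<in>I. w j i * x i)) \<in> borel_measurable (PiM I (\<lambda>_. N01))" for w
        by (rule measurable_compose[OF _ h], rule measurable_restrict)
           (auto intro!: borel_measurable_sum borel_measurable_times measurable_compose[OF measurable_component_singleton])
      \<comment> \<open>Coordinates b and a are integrated innermost, so that
        \<open>std_normal_rotation\<close> applies to this pair with all other coordinates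
        fixed.\<close>
      have two: "(\<integral>\<^sup>+ x. h (\<lambda>j\<in>insert j0 J. \<Sum>i\<in>I. w j i * x i) \<partial>PiM I (\<lambda>_. N01)) =
          (\<integral>\<^sup>+ x. \<integral>\<^sup>+ y. \<integral>\<^sup>+ z. h (\<lambda>j\<in>insert j0 J. w j b * z + (w j a * y + (\<Sum>i\<in>I'. w j i * x i))) \<partial>N01 \<partial>N01 \<partial>PiM I' (\<lambda>_. N01))" for w
      proof -
        have m1: "(\<lambda>x. h (\<lambda>j\<in>insert j0 J. \<Sum>i\<in>I. w j i * x i)) \<in> borel_measurable (PiM (insert b (insert a I')) (\<lambda>_. N01))"
          using m0 I(1) by simp
        have m2: "(\<lambda>x. \<integral>\<^sup>+ y. h (\<lambda>j\<in>insert j0 J. \<Sum>i\<in>I. w j i * (x(b := y)) i) \<partial>N01) \<in> borel_measurable (PiM (insert a I') (\<lambda>_. N01))"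
        proof -
            have "(\<lambda>(z, y). h (\<lambda>j\<in>insert j0 J. \<Sum>i\<in>I. w j i * (z(b := y)) i)) \<in> borel_measurable (PiM (insert a I') (\<lambda>_. N01) \<Otimes>\<^sub>M N01)"
            using measurable_compose[OF measurable_add_dim m1]
            by (simp add: case_prod_beta' cong: measurable_cong_sets)
          then show ?thesis by (rule sigma_finite_measure.borel_measurable_nn_integral[OF prob_space_imp_sigma_finite[OF prob_space_N01]])
        qed
        have sI: "(\<Sum>i\<in>I. w j i * ((x(a := y))(b := z)) i) = w j b * z + (w j a * y + (\<Sum>i\<in>I'. w j i * x i))" for j x y z
        proof -
          have "(\<Sum>i\<in>I'. w j i * ((x(a := y))(b := z)) i) = (\<Sum>i\<in>I'. w j i * x i)"
            using I by (intro sum.cong) auto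
          then show ?thesis unfolding sumI using b by auto
        qed
        have "(\<integral>\<^sup>+ x. h (\<lambda>j\<in>insert j0 J. \<Sum>i\<in>I. w j i * x i) \<partial>PiM I (\<lambda>_. N01)) =
          (\<integral>\<^sup>+ x. \<integral>\<^sup>+ z. h (\<lambda>j\<in>insert j0 J. \<Sum>i\<in>I. w j i * (x(b := z)) i) \<partial>N01 \<partial>PiM (insert a I') (\<lambda>_. N01))"
          using N01.product_nn_integral_insert[OF _ I(3) m1] I by simp
        also have "\<dots> = (\<integral>\<^sup>+ x. \<integral>\<^sup>+ y. \<integral>\<^sup>+ z. h (\<lambda>j\<in>insert j0 J. \<Sum>i\<in>I. w j i * ((x(a := y))(b := z)) i) \<partial>N01 \<partial>N01 \<partial>PiM I' (\<lambda>_. N01))"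
          by (rule N01.product_nn_integral_insert[OF I(4) I(2) m2])
        finally show ?thesis unfolding sI .
      qed
      have "(\<integral>\<^sup>+ y. \<integral>\<^sup>+ z. h (\<lambda>j\<in>insert j0 J. w' j b * z + (w' j a * y + C j)) \<partial>N01 \<partial>N01) =
            (\<integral>\<^sup>+ y. \<integral>\<^sup>+ z. h (\<lambda>j\<in>insert j0 J. w j b * z + (w j a * y + C j)) \<partial>N01 \<partial>N01)" for C
      proof -
        define H where "H = (\<lambda>(z, y). h (\<lambda>j\<in>insert j0 J. w j b * z + (w j a * y + C j)))"
        have H: "H \<in> borel_measurable borel"
          unfolding H_def split_def borel_prod[symmetric]
          by (rule measurable_compose[OF _ h], rule measurable_restrict) measurable
        have "h (\<lambda>j\<in>insert j0 J. w' j b * z + (w' j a * y + C j)) = H (c * z + s * y, - s * z + c * y)" for y z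
          unfolding H_def split w'ab by (simp add: algebra_simps)
        then show ?thesis
          using std_normal_rotation[OF H, of c s] cs unfolding H_def by simp
      qed
      then show ?thesis unfolding IH[symmetric] two using w'I by (simp cong: sum.cong)
    qed
  qed
  show ?case by (rule main[OF insert.prems(2)])
qed

lemma orthonormal_gaussian:
  fixes w :: "'j \<Rightarrow> 'i \<Rightarrow> real"
  assumes "finite J" "finite I"
    and "\<And>j k. j \<in> J \<Longrightarrow> k \<in> J \<Longrightarrow> (\<Sum>i\<in>I. w j i * w k i) = (if j = k then 1 else 0)"
  shows "distr (PiM I (\<lambda>_. N01)) (PiM J (\<lambda>_. N01)) (\<lambda>x. \<lambda>j\<in>J. \<Sum>i\<in>I. w j i * x i) = PiM J (\<lambda>_. N01)"
proof (rule measure_eqI)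
  have m: "(\<lambda>x. \<lambda>j\<in>J. \<Sum>i\<in>I. w j i * x i) \<in> measurable (PiM I (\<lambda>_. N01)) (PiM J (\<lambda>_. N01))"
    by (rule measurable_restrict)
       (auto intro!: borel_measurable_sum borel_measurable_times measurable_compose[OF measurable_component_singleton])
  fix A assume "A \<in> sets (distr (PiM I (\<lambda>_. N01)) (PiM J (\<lambda>_. N01)) (\<lambda>x. \<lambda>j\<in>J. \<Sum>i\<in>I. w j i * x i))"
  then have A: "A \<in> sets (PiM J (\<lambda>_. N01))" by simp
  then have ind: "indicator A \<in> borel_measurable (PiM J (\<lambda>_. borel))"
    using sets_PiM_N01 by (metis borel_measurable_indicator)
  have "emeasure (distr (PiM I (\<lambda>_. N01)) (PiM J (\<lambda>_. N01)) (\<lambda>x. \<lambda>j\<in>J. \<Sum>i\<in>I. w j i * x i)) A =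
    (\<integral>\<^sup>+ x. indicator A (\<lambda>j\<in>J. \<Sum>i\<in>I. w j i * x i) \<partial>PiM I (\<lambda>_. N01))"
  proof (subst nn_integral_distr[OF m, symmetric])
    show "indicator A \<in> borel_measurable (distr (PiM I (\<lambda>_. N01)) (PiM J (\<lambda>_. N01)) (\<lambda>x. \<lambda>j\<in>J. \<Sum>i\<in>I. w j i * x i))"
      using A by simp
  qed (use A in simp)
  also have "\<dots> = emeasure (PiM J (\<lambda>_. N01)) A"
    using A by (subst orthonormal_gaussian_aux[OF assms ind]) auto
  finally show "emeasure (distr (PiM I (\<lambda>_. N01)) (PiM J (\<lambda>_. N01)) (\<lambda>x. \<lambda>j\<in>J. \<Sum>i\<in>I. w j i * x i)) A =
    emeasure (PiM J (\<lambda>_. N01)) A" .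
qed simp

subsection \<open>Linear and quadratic forms in independent coordinates\<close>

definition sq_integrable :: "'a measure \<Rightarrow> ('a \<Rightarrow> real) \<Rightarrow> bool" where
  "sq_integrable M f \<longleftrightarrow> f \<in> borel_measurable M \<and> integrable M (\<lambda>x. (f x)\<^sup>2)"

lemma sq_integrable_measurable [measurable_dest]: "sq_integrable M f \<Longrightarrow> f \<in> borel_measurable M"
  by (simp add: sq_integrable_def)

lemma sq_integrable_mult:
  assumes "sq_integrable M f" "sq_integrable M g"
  shows "integrable M (\<lambda>x. f x * g x)"
proof (rule Bochner_Integration.integrable_bound)
  show "integrable M (\<lambda>x. (f x)\<^sup>2 + (g x)\<^sup>2)" using assms by (simp add: sq_integrable_def)
  have "\<bar>a * b\<bar> \<le> a\<^sup>2 + b\<^sup>2" for a b :: real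
  proof -
    have "2 * (\<bar>a\<bar> * \<bar>b\<bar>) \<le> a\<^sup>2 + b\<^sup>2"
      using sum_squares_bound[of "\<bar>a\<bar>" "\<bar>b\<bar>"] by (simp add: mult.assoc)
    moreover have "0 \<le> \<bar>a\<bar> * \<bar>b\<bar>" by simp
    ultimately show ?thesis by (simp only: abs_mult)
  qed
  then show "AE x in M. norm (f x * g x) \<le> norm ((f x)\<^sup>2 + (g x)\<^sup>2)"
    by (intro always_eventually) (auto simp: abs_mult)
qed (use assms in \<open>auto simp: sq_integrable_def\<close>)

lemma sq_integrable_add:
  assumes "sq_integrable M f" "sq_integrable M g"
  shows "sq_integrable M (\<lambda>x. f x + g x)"
  using assms sq_integrable_mult[OF assms] by (auto simp: sq_integrable_def power2_sum mult.assoc)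

lemma sq_integrable_cmult:
  assumes "sq_integrable M f"
  shows "sq_integrable M (\<lambda>x. c * f x)"
  using assms by (auto simp: sq_integrable_def power_mult_distrib)

lemma sq_integrable_diff:
  assumes "sq_integrable M f" "sq_integrable M g"
  shows "sq_integrable M (\<lambda>x. f x - g x)"
  using sq_integrable_add[OF assms(1) sq_integrable_cmult[OF assms(2), of "- 1"]] by simp

lemma sq_integrable_sum:
  assumes "\<And>i. i \<in> I \<Longrightarrow> sq_integrable M (f i)"
  shows "sq_integrable M (\<lambda>x. \<Sum>i\<in>I. f i x)"
  using assms
proof (induction I rule: infinite_finite_induct)
  case (insert i I)
  then show ?case using sq_integrable_add[of M "f i" "\<lambda>x. \<Sum>i\<in>I. f i x"] by simp
qed (auto simp: sq_integrable_def)

lemma (in prob_space) sq_integrable_const [simp]: "sq_integrable M (\<lambda>_. c)"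
  by (simp add: sq_integrable_def)

lemma (in prob_space) sq_integrable_integrable:
  assumes "sq_integrable M f"
  shows "integrable M f"
  using sq_integrable_mult[OF assms sq_integrable_const[of 1]] by simp

lemma (in prob_space) integral_sq_le:
  assumes "sq_integrable M f"
  shows "(expectation f)\<^sup>2 \<le> expectation (\<lambda>x. (f x)\<^sup>2)"
proof -
  have "0 \<le> expectation (\<lambda>x. (f x - expectation f)\<^sup>2)" by simp
  also have "\<dots> = expectation (\<lambda>x. (f x)\<^sup>2) - (expectation f)\<^sup>2"
    using variance_eq[OF sq_integrable_integrable[OF assms]] assms by (simp add: sq_integrable_def)
  finally show ?thesis by simp
qed

lemma (in prob_space) abs_integral_le_of_sq:
  assumes "sq_integrable M f" "expectation (\<lambda>x. (f x)\<^sup>2) \<le> c"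
  shows "expectation (\<lambda>x. \<bar>f x\<bar>) \<le> sqrt c"
proof -
  have "sq_integrable M (\<lambda>x. \<bar>f x\<bar>)" using assms(1) by (auto simp: sq_integrable_def)
  from integral_sq_le[OF this] assms(2) have "(expectation (\<lambda>x. \<bar>f x\<bar>))\<^sup>2 \<le> c" by simp
  then show ?thesis by (rule real_le_rsqrt)
qed

lemma integral_PiM_component:
  fixes g :: "'a \<Rightarrow> real"
  assumes N: "prob_space N" and i: "i \<in> I" and g: "g \<in> borel_measurable N"
  shows "(\<integral>x. g (x i) \<partial>PiM I (\<lambda>_. N)) = integral\<^sup>L N g"
    "integrable (PiM I (\<lambda>_. N)) (\<lambda>x. g (x i)) \<longleftrightarrow> integrable N g"
proof -
  have d: "distr (PiM I (\<lambda>_. N)) N (\<lambda>x. x i) = N"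
    by (rule distr_PiM_component) (use N i in auto)
  have m: "(\<lambda>x. x i) \<in> measurable (PiM I (\<lambda>_. N)) N" using i by simp
  show "(\<integral>x. g (x i) \<partial>PiM I (\<lambda>_. N)) = integral\<^sup>L N g"
    using integral_distr[OF m g] unfolding d ..
  show "integrable (PiM I (\<lambda>_. N)) (\<lambda>x. g (x i)) \<longleftrightarrow> integrable N g"
    using integrable_distr_eq[OF m g] unfolding d by simp
qed

lemma sq_integrable_component:
  assumes "prob_space N" "i \<in> I" "sq_integrable N g"
  shows "sq_integrable (PiM I (\<lambda>_. N)) (\<lambda>x. g (x i))"
proof -
  have g: "g \<in> borel_measurable N" "(\<lambda>x. (g x)\<^sup>2) \<in> borel_measurable N"
    using assms(3) by (auto simp: sq_integrable_def)
  have "(\<lambda>x. g (x i)) \<in> borel_measurable (PiM I (\<lambda>_. N))"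
    by (rule measurable_compose[OF measurable_component_singleton[OF assms(2)] g(1)])
  then show ?thesis
    using assms(3) integral_PiM_component(2)[OF assms(1,2) g(2)] by (simp add: sq_integrable_def)
qed

lemma integral_PiM_pair:
  fixes u w :: "'a \<Rightarrow> real"
  assumes N: "prob_space N" and I: "finite I" "i \<in> I" "k \<in> I" and uw: "sq_integrable N u" "sq_integrable N w"
  shows "(\<integral>x. u (x i) * w (x k) \<partial>PiM I (\<lambda>_. N)) =
    (if i = k then (\<integral>z. u z * w z \<partial>N) else integral\<^sup>L N u * integral\<^sup>L N w)"
proof (cases "i = k")
  case True
  then show ?thesis
    using integral_PiM_component(1)[OF N I(2), of "\<lambda>z. u z * w z"] uw by (simp add: sq_integrable_def)
next
  case False
  interpret product_sigma_finite "\<lambda>_. N" 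
    using N by (simp add: product_sigma_finite_def prob_space_imp_sigma_finite)
  interpret N: prob_space N by (rule N)
  define f where "f = (\<lambda>l. if l = i then u else if l = k then w else (\<lambda>_. 1))"
  have int: "integrable N (f l)" for l
    using uw N.sq_integrable_integrable by (auto simp: f_def)
  have split: "(\<Prod>l\<in>I. g l) = g i * g k" if "\<And>l. l \<in> I - {i, k} \<Longrightarrow> g l = 1" for g :: "_ \<Rightarrow> real"
  proof -
    have "(\<Prod>l\<in>I. g l) = (\<Prod>l\<in>{i,k}. g l)"
      by (rule prod.mono_neutral_right) (use I that in auto)
    then show ?thesis using False by simp
  qed
  have "(\<integral>x. u (x i) * w (x k) \<partial>PiM I (\<lambda>_. N)) = (\<integral>x. (\<Prod>l\<in>I. f l (x l)) \<partial>PiM I (\<lambda>_. N))"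
    using False by (subst split) (auto simp: f_def)
  also have "\<dots> = (\<Prod>l\<in>I. integral\<^sup>L N (f l))"
    by (rule product_integral_prod[OF I(1) int])
  also have "\<dots> = integral\<^sup>L N u * integral\<^sup>L N w"
    using False by (subst split) (auto simp: f_def N.prob_space)
  finally show ?thesis using False by simp
qed

text \<open>Off the diagonal the expectation factors and one of the two means vanishes, so only
  equal indices contribute.\<close>

lemma integral_linear_forms:
  fixes u w :: "'a \<Rightarrow> real"
  assumes N: "prob_space N" and I: "finite I" and uw: "sq_integrable N u" "sq_integrable N w"
    and z: "integral\<^sup>L N u = 0 \<or> integral\<^sup>L N w = 0"
  shows "(\<integral>x. (\<Sum>i\<in>I. a i * u (x i)) * (\<Sum>i\<in>I. b i * w (x i)) \<partial>PiM I (\<lambda>_. N)) =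
     (\<integral>z. u z * w z \<partial>N) * (\<Sum>i\<in>I. a i * b i)"
proof -
  note c = sq_integrable_component[OF N]
  have "(\<integral>x. (\<Sum>i\<in>I. a i * u (x i)) * (\<Sum>i\<in>I. b i * w (x i)) \<partial>PiM I (\<lambda>_. N)) =
    (\<integral>x. (\<Sum>i\<in>I. \<Sum>k\<in>I. (a i * b k) * (u (x i) * w (x k))) \<partial>PiM I (\<lambda>_. N))"
    by (simp add: sum_product mult_ac)
  also have "\<dots> = (\<Sum>i\<in>I. \<Sum>k\<in>I. (a i * b k) * (\<integral>x. u (x i) * w (x k) \<partial>PiM I (\<lambda>_. N)))"
  proof -
    have int: "integrable (PiM I (\<lambda>_. N)) (\<lambda>x. (a i * b k) * (u (x i) * w (x k)))" if "i \<in> I" "k \<in> I" for i k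
      by (intro Bochner_Integration.integrable_mult_right sq_integrable_mult c uw that)
    have "(\<integral>x. (\<Sum>i\<in>I. \<Sum>k\<in>I. (a i * b k) * (u (x i) * w (x k))) \<partial>PiM I (\<lambda>_. N)) =
        (\<Sum>i\<in>I. \<integral>x. (\<Sum>k\<in>I. (a i * b k) * (u (x i) * w (x k))) \<partial>PiM I (\<lambda>_. N))"
      by (intro Bochner_Integration.integral_sum Bochner_Integration.integrable_sum int)
    also have "\<dots> = (\<Sum>i\<in>I. \<Sum>k\<in>I. \<integral>x. (a i * b k) * (u (x i) * w (x k)) \<partial>PiM I (\<lambda>_. N))"
      by (intro sum.cong refl Bochner_Integration.integral_sum int)
    finally show ?thesis by simp
  qed
  also have "\<dots> = (\<Sum>i\<in>I. \<Sum>k\<in>I. (a i * b k) * (if i = k then (\<integral>z. u z * w z \<partial>N) else 0))"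
    using z by (intro sum.cong refl) (auto simp: integral_PiM_pair[OF N I _ _ uw])
  also have "\<dots> = (\<integral>z. u z * w z \<partial>N) * (\<Sum>i\<in>I. a i * b i)"
    using I by (simp add: if_distrib sum.delta sum_distrib_left mult_ac cong: if_cong)
  finally show ?thesis .
qed

lemma sq_integrable_linear_form:
  assumes "prob_space N" "sq_integrable N u"
  shows "sq_integrable (PiM I (\<lambda>_. N)) (\<lambda>x. \<Sum>i\<in>I. a i * u (x i))"
  by (intro sq_integrable_sum sq_integrable_cmult sq_integrable_component assms)

text \<open>Variance bound of a quadratic form per unit of squared Frobenius norm. The two terms
  belong to the off-diagonal and the diagonal part; the factor 3 comes from (a + b + c)^2 \<le> 3
  (a^2 + b^2 + c^2).\<close>

definition form_const :: "'a measure \<Rightarrow> ('a \<Rightarrow> real) \<Rightarrow> ('a \<Rightarrow> real) \<Rightarrow> real" where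
  "form_const N u w = 3 * ((\<integral>z. (u z)\<^sup>2 \<partial>N) * (\<integral>z. (w z)\<^sup>2 \<partial>N) +
     (\<integral>z. (u z * w z - (\<integral>z. u z * w z \<partial>N))\<^sup>2 \<partial>N))"

lemma form_const_nonneg: "form_const N u w \<ge> 0"
  by (simp add: form_const_def)

lemma sq_integrable_prod_of_fourth:
  fixes f g :: "'a \<Rightarrow> real"
  assumes [measurable]: "f \<in> borel_measurable M" "g \<in> borel_measurable M"
    and "integrable M (\<lambda>x. f x ^ 4)" "integrable M (\<lambda>x. g x ^ 4)"
  shows "sq_integrable M (\<lambda>x. f x * g x)"
proof -
  have "sq_integrable M (\<lambda>x. (f x)\<^sup>2)" "sq_integrable M (\<lambda>x. (g x)\<^sup>2)"
    using assms by (simp_all add: sq_integrable_def flip: power_mult)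
  from sq_integrable_mult[OF this] show ?thesis by (simp add: sq_integrable_def power_mult_distrib)
qed

lemma (in prob_space) sq_integrable_of_fourth:
  fixes f :: "'a \<Rightarrow> real"
  assumes "f \<in> borel_measurable M" "integrable M (\<lambda>x. f x ^ 4)"
  shows "sq_integrable M f"
  using sq_integrable_prod_of_fourth[of f M "\<lambda>_. 1"] assms by simp

text \<open>Adding the coordinates one at a time makes the centred form a martingale: the increment
  has mean zero given the earlier coordinates, so second moments add. The increment consists of two
  linear forms times the new variable and a centred diagonal term, whose second moments involve
  exactly the new column, the new row and the new diagonal entry of A.\<close>

lemma quadratic_form_second_moment:
  fixes u w :: "'a \<Rightarrow> real" and A :: "'i \<Rightarrow> 'i \<Rightarrow> real"
  assumes N: "prob_space N" and I: "finite I"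
    and [measurable]: "u \<in> borel_measurable N" "w \<in> borel_measurable N"
    and int4: "integrable N (\<lambda>z. u z ^ 4)" "integrable N (\<lambda>z. w z ^ 4)"
    and zero: "integral\<^sup>L N u = 0" "integral\<^sup>L N w = 0"
  defines "m \<equiv> \<integral>z. u z * w z \<partial>N"
  defines "Q \<equiv> \<lambda>I x. (\<Sum>i\<in>I. \<Sum>k\<in>I. A i k * (u (x i) * w (x k))) - m * (\<Sum>i\<in>I. A i i)"
  shows "sq_integrable (PiM I (\<lambda>_. N)) (Q I)"
    and "(\<integral>x. (Q I x)\<^sup>2 \<partial>PiM I (\<lambda>_. N)) \<le> form_const N u w * (\<Sum>i\<in>I. \<Sum>k\<in>I. (A i k)\<^sup>2)"
proof -
  interpret N: prob_space N by (rule N)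
  interpret product_sigma_finite "\<lambda>_. N" 
    using N by (simp add: product_sigma_finite_def prob_space_imp_sigma_finite)
  have su: "sq_integrable N u" and sw: "sq_integrable N w"
    using int4 by (auto intro!: N.sq_integrable_of_fourth)
  have suw: "sq_integrable N (\<lambda>z. u z * w z)"
    using int4 by (intro sq_integrable_prod_of_fourth) auto
  have sqQ: "sq_integrable (PiM I (\<lambda>_. N)) (Q I)" for I
  proof -
    interpret P: prob_space "PiM I (\<lambda>_. N)" by (rule prob_space_PiM) (rule N)
    have pm: "(\<lambda>x. u (x i)) \<in> borel_measurable (PiM I (\<lambda>_. N))" "(\<lambda>x. w (x i)) \<in> borel_measurable (PiM I (\<lambda>_. N))" if "i \<in> I" for i
      using that by (auto intro: measurable_compose[OF measurable_component_singleton])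
    show ?thesis unfolding Q_def
      by (intro sq_integrable_diff sq_integrable_sum sq_integrable_cmult P.sq_integrable_const sq_integrable_prod_of_fourth pm)
         (use int4 in \<open>simp_all add: integral_PiM_component(2)[OF N, of _ _ "\<lambda>z. _ z ^ 4"]\<close>)
  qed
  show "sq_integrable (PiM I (\<lambda>_. N)) (Q I)" by (rule sqQ)
  define su2 where "su2 = (\<integral>z. (u z)\<^sup>2 \<partial>N)"
  define sw2 where "sw2 = (\<integral>z. (w z)\<^sup>2 \<partial>N)"
  define V where "V = (\<integral>z. (u z * w z - m)\<^sup>2 \<partial>N)"
  have nn: "su2 \<ge> 0" "sw2 \<ge> 0" "V \<ge> 0" by (auto simp: su2_def sw2_def V_def)
  define K where "K = form_const N u w"
  have K: "3 * (su2 * sw2) \<le> K" "3 * V \<le> K" "0 \<le> K"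
    using nn unfolding K_def form_const_def su2_def[symmetric] sw2_def[symmetric] m_def[symmetric] V_def[symmetric]
    by auto
  show "(\<integral>x. (Q I x)\<^sup>2 \<partial>PiM I (\<lambda>_. N)) \<le> form_const N u w * (\<Sum>i\<in>I. \<Sum>k\<in>I. (A i k)\<^sup>2)"
    unfolding K_def[symmetric] using I
  proof (induction I rule: finite_induct)
    case empty
    then show ?case by (simp add: Q_def)
  next
    case (insert j I)
    interpret P: prob_space "PiM I (\<lambda>_. N)" by (rule prob_space_PiM) (rule N)
    define L where "L = (\<lambda>x. \<Sum>i\<in>I. A i j * u (x i))"
    define L' where "L' = (\<lambda>x. \<Sum>i\<in>I. A j i * w (x i))"
    define T where "T = (\<lambda>x y. (L x * w y + L' x * u y) + A j j * (u y * w y - m))"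
    have Qi: "Q (insert j I) (x(j := y)) = Q I x + T x y" for x y
    proof -
      define x' where "x' = x(j := y)"
      have e: "x' j = y" "\<And>i. i \<in> I \<Longrightarrow> x' i = x i" using insert.hyps by (auto simp: x'_def)
      show ?thesis
        unfolding Q_def T_def L_def L'_def x'_def[symmetric] using insert.hyps
        by (simp add: e sum.distrib sum_distrib_left sum_distrib_right algebra_simps cong: sum.cong)
    qed
    have sT: "sq_integrable N (T x)" for x
      unfolding T_def by (intro sq_integrable_add sq_integrable_diff sq_integrable_cmult su sw suw N.sq_integrable_const)
    have T0: "integral\<^sup>L N (T x) = 0" for x
      unfolding T_def using N.sq_integrable_integrable[OF su] N.sq_integrable_integrable[OF sw] N.sq_integrable_integrable[OF suw]
      by (simp add: zero m_def N.prob_space)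
    have sL: "sq_integrable (PiM I (\<lambda>_. N)) L" "sq_integrable (PiM I (\<lambda>_. N)) L'"
      unfolding L_def L'_def by (intro sq_integrable_linear_form N su sw)+
    have inner: "(\<integral>y. (Q (insert j I) (x(j := y)))\<^sup>2 \<partial>N) \<le>
        (Q I x)\<^sup>2 + 3 * (sw2 * (L x)\<^sup>2 + su2 * (L' x)\<^sup>2 + V * (A j j)\<^sup>2)" for x
    proof -
      have "(\<integral>y. (Q (insert j I) (x(j := y)))\<^sup>2 \<partial>N) = (\<integral>y. (Q I x)\<^sup>2 + 2 * Q I x * T x y + (T x y)\<^sup>2 \<partial>N)"
        unfolding Qi by (simp add: power2_sum algebra_simps)
      also have "\<dots> = (Q I x)\<^sup>2 + (\<integral>y. (T x y)\<^sup>2 \<partial>N)"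
        using sT[of x] N.sq_integrable_integrable[OF sT[of x]] T0[of x]
        by (simp add: sq_integrable_def N.prob_space)
      finally have eq1: "(\<integral>y. (Q (insert j I) (x(j := y)))\<^sup>2 \<partial>N) = (Q I x)\<^sup>2 + (\<integral>y. (T x y)\<^sup>2 \<partial>N)" .
      have "(\<integral>y. (T x y)\<^sup>2 \<partial>N) \<le> (\<integral>y. 3 * ((L x)\<^sup>2 * (w y)\<^sup>2 + (L' x)\<^sup>2 * (u y)\<^sup>2 + (A j j)\<^sup>2 * (u y * w y - m)\<^sup>2) \<partial>N)"
      proof (rule integral_mono)
        show "integrable N (\<lambda>y. (T x y)\<^sup>2)" using sT by (simp add: sq_integrable_def)
        show "integrable N (\<lambda>y. 3 * ((L x)\<^sup>2 * (w y)\<^sup>2 + (L' x)\<^sup>2 * (u y)\<^sup>2 + (A j j)\<^sup>2 * (u y * w y - m)\<^sup>2))"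
          using su sw sq_integrable_diff[OF suw N.sq_integrable_const[of m]] by (simp add: sq_integrable_def)
        fix y
        have "((a + b) + c)\<^sup>2 \<le> 3 * (a\<^sup>2 + b\<^sup>2 + c\<^sup>2)" for a b c :: real
        proof -
          have "3 * (a\<^sup>2 + b\<^sup>2 + c\<^sup>2) - ((a + b) + c)\<^sup>2 = (a - b)\<^sup>2 + (b - c)\<^sup>2 + (a - c)\<^sup>2"
            by (simp add: power2_eq_square algebra_simps)
          then show ?thesis by (smt (verit) zero_le_power2)
        qed
        from this[of "L x * w y" "L' x * u y" "A j j * (u y * w y - m)"]
        show "(T x y)\<^sup>2 \<le> 3 * ((L x)\<^sup>2 * (w y)\<^sup>2 + (L' x)\<^sup>2 * (u y)\<^sup>2 + (A j j)\<^sup>2 * (u y * w y - m)\<^sup>2)"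
          unfolding T_def by (simp add: power_mult_distrib)
      qed
      also have "\<dots> = 3 * (sw2 * (L x)\<^sup>2 + su2 * (L' x)\<^sup>2 + V * (A j j)\<^sup>2)"
        using su sw sq_integrable_diff[OF suw N.sq_integrable_const[of m]]
        by (simp add: sq_integrable_def su2_def sw2_def V_def mult_ac)
      finally show ?thesis unfolding eq1 by (rule add_left_mono)
    qed
    have int: "integrable (PiM (insert j I) (\<lambda>_. N)) (\<lambda>x. (Q (insert j I) x)\<^sup>2)"
      using sqQ by (simp add: sq_integrable_def)
    have "(\<integral>x. (Q (insert j I) x)\<^sup>2 \<partial>PiM (insert j I) (\<lambda>_. N)) =
       (\<integral>x. (\<integral>y. (Q (insert j I) (x(j := y)))\<^sup>2 \<partial>N) \<partial>PiM I (\<lambda>_. N))"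
      by (rule product_integral_insert[OF insert.hyps int])
    also have "\<dots> \<le> (\<integral>x. (Q I x)\<^sup>2 + 3 * (sw2 * (L x)\<^sup>2 + su2 * (L' x)\<^sup>2 + V * (A j j)\<^sup>2) \<partial>PiM I (\<lambda>_. N))"
    proof (rule integral_mono')
      show "integrable (PiM I (\<lambda>_. N)) (\<lambda>x. (Q I x)\<^sup>2 + 3 * (sw2 * (L x)\<^sup>2 + su2 * (L' x)\<^sup>2 + V * (A j j)\<^sup>2))"
        using sqQ[of I] sL by (simp add: sq_integrable_def)
      show "(\<integral>y. (Q (insert j I) (x(j := y)))\<^sup>2 \<partial>N) \<le>
        (Q I x)\<^sup>2 + 3 * (sw2 * (L x)\<^sup>2 + su2 * (L' x)\<^sup>2 + V * (A j j)\<^sup>2)" for x by (rule inner)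
    qed (use nn in simp)
    also have "\<dots> = (\<integral>x. (Q I x)\<^sup>2 \<partial>PiM I (\<lambda>_. N)) + 3 * (sw2 * (\<integral>x. (L x)\<^sup>2 \<partial>PiM I (\<lambda>_. N)) + su2 * (\<integral>x. (L' x)\<^sup>2 \<partial>PiM I (\<lambda>_. N)) + V * (A j j)\<^sup>2)"
      using sqQ[of I] sL by (simp add: sq_integrable_def P.prob_space)
    also have "(\<integral>x. (L x)\<^sup>2 \<partial>PiM I (\<lambda>_. N)) = su2 * (\<Sum>i\<in>I. (A i j)\<^sup>2)"
      using integral_linear_forms[OF N insert.hyps(1) su su, of "\<lambda>i. A i j" "\<lambda>i. A i j"] zero
      unfolding L_def su2_def by (simp add: power2_eq_square)
    also have "(\<integral>x. (L' x)\<^sup>2 \<partial>PiM I (\<lambda>_. N)) = sw2 * (\<Sum>i\<in>I. (A j i)\<^sup>2)"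
      using integral_linear_forms[OF N insert.hyps(1) sw sw, of "\<lambda>i. A j i" "\<lambda>i. A j i"] zero
      unfolding L'_def sw2_def by (simp add: power2_eq_square)
    also have "(\<integral>x. (Q I x)\<^sup>2 \<partial>PiM I (\<lambda>_. N)) + 3 * (sw2 * (su2 * (\<Sum>i\<in>I. (A i j)\<^sup>2)) + su2 * (sw2 * (\<Sum>i\<in>I. (A j i)\<^sup>2)) + V * (A j j)\<^sup>2)
       = (\<integral>x. (Q I x)\<^sup>2 \<partial>PiM I (\<lambda>_. N)) + (3 * (su2 * sw2)) * (\<Sum>i\<in>I. (A i j)\<^sup>2) + (3 * (su2 * sw2)) * (\<Sum>i\<in>I. (A j i)\<^sup>2) + (3 * V) * (A j j)\<^sup>2"
      by (simp add: algebra_simps)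
    also have "\<dots> \<le> K * (\<Sum>i\<in>I. \<Sum>k\<in>I. (A i k)\<^sup>2) + K * (\<Sum>i\<in>I. (A i j)\<^sup>2) + K * (\<Sum>i\<in>I. (A j i)\<^sup>2) + K * (A j j)\<^sup>2"
      by (intro add_mono mult_right_mono insert.IH K sum_nonneg) auto
    also have "\<dots> = K * (\<Sum>i\<in>insert j I. \<Sum>k\<in>insert j I. (A i k)\<^sup>2)"
      using insert.hyps by (simp add: sum.distrib algebra_simps)
    finally show ?case .
  qed
qed

text \<open>The Efron--Stein inequality.\<close>

lemma block_variance_le:
  fixes f :: "('i \<Rightarrow> 'a) \<Rightarrow> real"
  assumes N: "prob_space N" and J: "finite J" and B: "\<And>j. j \<in> J \<Longrightarrow> finite (B j)" "disjoint_family_on B J"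
    and f: "f \<in> borel_measurable (PiM (\<Union>j\<in>J. B j) (\<lambda>_. N))"
    and b: "\<And>x. x \<in> space (PiM (\<Union>j\<in>J. B j) (\<lambda>_. N)) \<Longrightarrow> \<bar>f x\<bar> \<le> b"
    and osc: "\<And>x x' j. x \<in> space (PiM (\<Union>j\<in>J. B j) (\<lambda>_. N)) \<Longrightarrow> x' \<in> space (PiM (\<Union>j\<in>J. B j) (\<lambda>_. N)) \<Longrightarrow>
        j \<in> J \<Longrightarrow> (\<And>i. i \<in> (\<Union>j\<in>J. B j) - B j \<Longrightarrow> x i = x' i) \<Longrightarrow> \<bar>f x - f x'\<bar> \<le> c"
  shows "(\<integral>x. (f x - integral\<^sup>L (PiM (\<Union>j\<in>J. B j) (\<lambda>_. N)) f)\<^sup>2 \<partial>PiM (\<Union>j\<in>J. B j) (\<lambda>_. N)) \<le> real (card J) * c\<^sup>2"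
  using J B f b osc
proof (induction J arbitrary: f rule: finite_induct)
  case empty
  interpret P: prob_space "PiM {} (\<lambda>_. N) :: ('i \<Rightarrow> 'a) measure" by (rule prob_space_PiM) (rule N)
  have "integral\<^sup>L (PiM {} (\<lambda>_. N)) f = (\<integral>x. f (\<lambda>_. undefined) \<partial>(PiM {} (\<lambda>_. N) :: ('i \<Rightarrow> 'a) measure))"
    by (rule Bochner_Integration.integral_cong[OF refl]) (auto simp: space_PiM)
  then have m: "integral\<^sup>L (PiM {} (\<lambda>_. N)) f = f (\<lambda>_. undefined)" by (simp add: P.prob_space)
  have "(\<integral>x. (f x - f (\<lambda>_. undefined))\<^sup>2 \<partial>PiM {} (\<lambda>_. N)) = (\<integral>x. 0 \<partial>(PiM {} (\<lambda>_. N) :: ('i \<Rightarrow> 'a) measure))"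
    by (intro Bochner_Integration.integral_cong) (auto simp: space_PiM)
  then show ?case using m by simp
next
  case (insert j J)
  define U where "U = (\<Union>j\<in>J. B j)"
  have finU: "finite U" "finite (B j)" using insert.hyps insert.prems(1) by (auto simp: U_def)
  have disj: "U \<inter> B j = {}" using insert.prems(2) insert.hyps(2) by (fastforce simp: disjoint_family_on_def U_def)
  have UJ: "(\<Union>j\<in>insert j J. B j) = U \<union> B j" by (auto simp: U_def)
  interpret P: prob_space "PiM U (\<lambda>_. N)" by (rule prob_space_PiM) (rule N)
  interpret R: prob_space "PiM (B j) (\<lambda>_. N)" by (rule prob_space_PiM) (rule N)
  interpret S: prob_space "PiM (U \<union> B j) (\<lambda>_. N)" by (rule prob_space_PiM) (rule N)
  interpret product_sigma_finite "\<lambda>_. N" 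
    using N by (simp add: product_sigma_finite_def prob_space_imp_sigma_finite)
  have f[measurable]: "f \<in> borel_measurable (PiM (U \<union> B j) (\<lambda>_. N))"
    and b: "\<And>x. x \<in> space (PiM (U \<union> B j) (\<lambda>_. N)) \<Longrightarrow> \<bar>f x\<bar> \<le> b"
    using insert.prems(3,4) unfolding UJ by auto
  have osc: "\<And>x x' k. x \<in> space (PiM (U \<union> B j) (\<lambda>_. N)) \<Longrightarrow> x' \<in> space (PiM (U \<union> B j) (\<lambda>_. N)) \<Longrightarrow>
        k \<in> insert j J \<Longrightarrow> (\<And>i. i \<in> (U \<union> B j) - B k \<Longrightarrow> x i = x' i) \<Longrightarrow> \<bar>f x - f x'\<bar> \<le> c"
    using insert.prems(5) unfolding UJ by auto
  define h where "h = (\<lambda>x y. f (merge U (B j) (x, y)))"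
  \<comment> \<open>\<open>g\<close> averages over the last block. It inherits the oscillation bound
    for the other blocks, so the induction hypothesis applies to it, and f differs from it by at
    most c.\<close>
  define g where "g = (\<lambda>x. \<integral>y. h x y \<partial>PiM (B j) (\<lambda>_. N))"
  define m where "m = integral\<^sup>L (PiM (U \<union> B j) (\<lambda>_. N)) f"
  have mh: "case_prod h \<in> borel_measurable (PiM U (\<lambda>_. N) \<Otimes>\<^sub>M PiM (B j) (\<lambda>_. N))"
    unfolding h_def using measurable_compose[OF measurable_merge f] by (simp add: case_prod_beta')
  have hx: "h x \<in> borel_measurable (PiM (B j) (\<lambda>_. N))" if "x \<in> space (PiM U (\<lambda>_. N))" for x
    using measurable_Pair2[OF mh that] by simp
  have sp: "merge U (B j) (x, y) \<in> space (PiM (U \<union> B j) (\<lambda>_. N))"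
    if "x \<in> space (PiM U (\<lambda>_. N))" "y \<in> space (PiM (B j) (\<lambda>_. N))" for x y
    using measurable_space[OF measurable_merge, of "(x, y)" U "\<lambda>_. N" "B j"] that
    by (simp add: space_pair_measure)
  have hb: "\<bar>h x y\<bar> \<le> b" if "x \<in> space (PiM U (\<lambda>_. N))" "y \<in> space (PiM (B j) (\<lambda>_. N))" for x y
    unfolding h_def by (rule b[OF sp[OF that]])
  have inth: "integrable (PiM (B j) (\<lambda>_. N)) (h x)" if "x \<in> space (PiM U (\<lambda>_. N))" for x
    by (rule R.integrable_const_bound[of _ b]) (use hx hb that in auto)
  have gm[measurable]: "g \<in> borel_measurable (PiM U (\<lambda>_. N))"
    unfolding g_def by (rule R.borel_measurable_lebesgue_integral[OF mh])
  have gb: "\<bar>g x\<bar> \<le> b" if "x \<in> space (PiM U (\<lambda>_. N))" for x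
  proof -
    have "\<bar>g x\<bar> \<le> (\<integral>y. \<bar>h x y\<bar> \<partial>PiM (B j) (\<lambda>_. N))" unfolding g_def by (rule integral_abs_bound)
    also have "\<dots> \<le> (\<integral>y. b \<partial>PiM (B j) (\<lambda>_. N))"
      using inth[OF that] hb[OF that] by (intro integral_mono) auto
    finally show ?thesis by (simp add: R.prob_space)
  qed
  have sf: "integrable (PiM (U \<union> B j) (\<lambda>_. N)) f"
    by (rule S.integrable_const_bound[of _ b]) (use b in auto)
  have mg: "m = integral\<^sup>L (PiM U (\<lambda>_. N)) g"
    unfolding m_def g_def h_def by (rule product_integral_fold[OF disj finU sf])
  have c0: "h x y - g x \<le> c" "g x - h x y \<le> c" if x: "x \<in> space (PiM U (\<lambda>_. N))" and y: "y \<in> space (PiM (B j) (\<lambda>_. N))" for x y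
  proof -
    have o: "\<bar>h x y - h x y'\<bar> \<le> c" if "y' \<in> space (PiM (B j) (\<lambda>_. N))" for y'
      unfolding h_def
      by (rule osc[of _ _ j]) (use sp x y that disj in \<open>auto simp: merge_def\<close>)
    have "(\<integral>y'. h x y - c \<partial>PiM (B j) (\<lambda>_. N)) \<le> g x" "g x \<le> (\<integral>y'. h x y + c \<partial>PiM (B j) (\<lambda>_. N))"
      unfolding g_def using o by (intro integral_mono inth x; fastforce simp: abs_le_iff)+
    then show "h x y - g x \<le> c" "g x - h x y \<le> c" by (simp_all add: R.prob_space)
  qed
  have cg: "\<bar>g x - g x'\<bar> \<le> c" if x: "x \<in> space (PiM U (\<lambda>_. N))" and x': "x' \<in> space (PiM U (\<lambda>_. N))"
    and k: "k \<in> J" and eq: "\<And>i. i \<in> U - B k \<Longrightarrow> x i = x' i" for x x' k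
  proof -
    have kj: "B k \<inter> B j = {}" using insert.prems(2) insert.hyps(2) k unfolding disjoint_family_on_def by auto
    have "\<bar>g x - g x'\<bar> = \<bar>\<integral>y. h x y - h x' y \<partial>PiM (B j) (\<lambda>_. N)\<bar>"
      unfolding g_def using inth x x' by simp
    also have "\<dots> \<le> (\<integral>y. \<bar>h x y - h x' y\<bar> \<partial>PiM (B j) (\<lambda>_. N))" by (rule integral_abs_bound)
    also have "\<dots> \<le> (\<integral>y. c \<partial>PiM (B j) (\<lambda>_. N))"
    proof (rule integral_mono)
      fix y assume y: "y \<in> space (PiM (B j) (\<lambda>_. N))"
      show "\<bar>h x y - h x' y\<bar> \<le> c" unfolding h_def
        by (rule osc[of _ _ k]) (use sp x x' y k eq kj in \<open>auto simp: merge_def\<close>)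
    qed (use inth x x' in auto)
    finally show ?thesis by (simp add: R.prob_space)
  qed
  have IH: "(\<integral>x. (g x - m)\<^sup>2 \<partial>PiM U (\<lambda>_. N)) \<le> real (card J) * c\<^sup>2"
    unfolding mg U_def
    by (rule insert.IH)
       (use insert.prems gm gb cg in \<open>auto simp: U_def disjoint_family_on_def\<close>)
  have sf2: "integrable (PiM (U \<union> B j) (\<lambda>_. N)) (\<lambda>x. (f x - m)\<^sup>2)"
  proof (rule S.integrable_const_bound[of _ "(b + \<bar>m\<bar>)\<^sup>2"])
    show "AE x in PiM (U \<union> B j) (\<lambda>_. N). norm ((f x - m)\<^sup>2) \<le> (b + \<bar>m\<bar>)\<^sup>2"
    proof (rule AE_I2)
      fix x assume "x \<in> space (PiM (U \<union> B j) (\<lambda>_. N))"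
      from b[OF this] have "\<bar>f x - m\<bar> \<le> \<bar>b + \<bar>m\<bar>\<bar>" by linarith
      then show "norm ((f x - m)\<^sup>2) \<le> (b + \<bar>m\<bar>)\<^sup>2" by (simp add: abs_le_square_iff)
    qed
  qed simp
  have sg2: "integrable (PiM U (\<lambda>_. N)) (\<lambda>x. (g x - m)\<^sup>2)"
  proof (rule P.integrable_const_bound[of _ "(b + \<bar>m\<bar>)\<^sup>2"])
    show "AE x in PiM U (\<lambda>_. N). norm ((g x - m)\<^sup>2) \<le> (b + \<bar>m\<bar>)\<^sup>2"
    proof (rule AE_I2)
      fix x assume "x \<in> space (PiM U (\<lambda>_. N))"
      from gb[OF this] have "\<bar>g x - m\<bar> \<le> \<bar>b + \<bar>m\<bar>\<bar>" by linarith
      then show "norm ((g x - m)\<^sup>2) \<le> (b + \<bar>m\<bar>)\<^sup>2" by (simp add: abs_le_square_iff)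
    qed
  qed simp
  have inner: "(\<integral>y. (h x y - m)\<^sup>2 \<partial>PiM (B j) (\<lambda>_. N)) \<le> c\<^sup>2 + (g x - m)\<^sup>2"
    if x: "x \<in> space (PiM U (\<lambda>_. N))" for x
  proof -
    \<comment> \<open>The cross term is linear in h - g and integrates to 0 over the block, so the
      inner integral is at most c^2 + (g - m)^2.\<close>
    have sq: "(h x y - m)\<^sup>2 \<le> c\<^sup>2 + 2 * (g x - m) * (h x y - g x) + (g x - m)\<^sup>2"
      if "y \<in> space (PiM (B j) (\<lambda>_. N))" for y
    proof -
      have "(h x y - g x)\<^sup>2 \<le> c\<^sup>2" using c0[OF x that] by (intro abs_le_square_iff[THEN iffD1]) linarith
      moreover have "(h x y - m)\<^sup>2 = (h x y - g x)\<^sup>2 + 2 * (g x - m) * (h x y - g x) + (g x - m)\<^sup>2"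
        by (simp add: power2_eq_square algebra_simps)
      ultimately show ?thesis by simp
    qed
    have i: "integrable (PiM (B j) (\<lambda>_. N)) (\<lambda>y. c\<^sup>2 + 2 * (g x - m) * (h x y - g x) + (g x - m)\<^sup>2)"
      using inth[OF x] by simp
    have "(\<integral>y. (h x y - m)\<^sup>2 \<partial>PiM (B j) (\<lambda>_. N)) \<le> (\<integral>y. c\<^sup>2 + 2 * (g x - m) * (h x y - g x) + (g x - m)\<^sup>2 \<partial>PiM (B j) (\<lambda>_. N))"
    proof (rule integral_mono'[OF i sq])
      fix y assume "y \<in> space (PiM (B j) (\<lambda>_. N))"
      from sq[OF this] show "0 \<le> c\<^sup>2 + 2 * (g x - m) * (h x y - g x) + (g x - m)\<^sup>2"
        by (rule order_trans[OF zero_le_power2])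
    qed
    also have "\<dots> = c\<^sup>2 + (g x - m)\<^sup>2"
      using inth[OF x] by (simp add: R.prob_space g_def)
    finally show ?thesis .
  qed
  have "(\<integral>x. (f x - m)\<^sup>2 \<partial>PiM (U \<union> B j) (\<lambda>_. N)) = (\<integral>x. (\<integral>y. (h x y - m)\<^sup>2 \<partial>PiM (B j) (\<lambda>_. N)) \<partial>PiM U (\<lambda>_. N))"
    unfolding h_def by (rule product_integral_fold[OF disj finU sf2])
  also have "\<dots> \<le> (\<integral>x. c\<^sup>2 + (g x - m)\<^sup>2 \<partial>PiM U (\<lambda>_. N))"
    using sg2 inner by (intro integral_mono') auto
  also have "\<dots> \<le> c\<^sup>2 + real (card J) * c\<^sup>2"
    using sg2 IH by (simp add: P.prob_space)
  finally show ?case unfolding UJ m_def using insert.hyps by (simp add: algebra_simps)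
qed

section \<open>Moments of the standard normal law and functions of exponential growth\<close>

lemma integrable_N01_iff:
  assumes "f \<in> borel_measurable borel"
  shows "integrable N01 f \<longleftrightarrow> integrable lborel (\<lambda>x. std_normal_density x * f x)"
  by (subst integrable_density) (use assms in auto)

lemma integral_N01:
  assumes "f \<in> borel_measurable borel"
  shows "integral\<^sup>L N01 f = (\<integral>x. std_normal_density x * f x \<partial>lborel)"
  by (subst integral_density) (use assms in auto)

lemma integrable_N01_power: "integrable N01 (\<lambda>z. z ^ k)"
  using integrable_normal_moment[of 1 0 k] by (simp add: integrable_N01_iff)

lemma N01_mean: "(\<integral>z. z \<partial>N01) = 0"
  using integral_normal_moment_nz_1[of 1 0] by (simp add: integral_N01)

lemma N01_second_moment: "(\<integral>z. z\<^sup>2 \<partial>N01) = 1"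
  using integral_std_normal_moment_even[of 1] by (simp add: integral_N01)

lemma integrable_N01_exp_abs: "integrable N01 (\<lambda>z. exp (a * \<bar>z\<bar>))"
proof (rule Bochner_Integration.integrable_bound)
  have e: "integrable N01 (\<lambda>z. exp (b * z))" for b
  proof -
    \<comment> \<open>Completing the square: the exponential tilt shifts the mean to b.\<close>
    have "std_normal_density x * exp (b * x) = exp (b\<^sup>2 / 2) * normal_density b 1 x" for x
      unfolding normal_density_def
      by (simp add: exp_add[symmetric] power2_eq_square field_simps)
    then show ?thesis by (simp add: integrable_N01_iff)
  qed
  show "integrable N01 (\<lambda>z. exp (a * z) + exp (- a * z))"
    by (intro Bochner_Integration.integrable_add e)
  show "AE z in N01. norm (exp (a * \<bar>z\<bar>)) \<le> norm (exp (a * z) + exp (- a * z))"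
  proof (rule AE_I2)
    fix z :: real
    have "exp (a * \<bar>z\<bar>) \<le> exp (a * z) + exp (- a * z)" by (cases "z \<ge> 0") auto
    then show "norm (exp (a * \<bar>z\<bar>)) \<le> norm (exp (a * z) + exp (- a * z))" by simp
  qed
qed simp

lemma continuous_of_locally_absolutely_continuous:
  assumes "locally_absolutely_continuous f"
  shows "continuous_on UNIV f"
proof (rule continuous_at_imp_continuous_on, intro ballI)
  fix x :: real
  have ac: "absolutely_continuous_on_interval (x - 1) (x + 1) f"
    using assms by (simp add: locally_absolutely_continuous_def)
  show "isCont f x"
    unfolding continuous_at_eps_delta
  proof (intro allI impI)
    fix e :: real assume e: "e > 0"
    obtain h where h: "h > 0" and H: "\<And>(N::nat) s t. (\<forall>k<N. x - 1 \<le> s k \<and> s k \<le> t k \<and> t k \<le> x + 1) \<Longrightarrow>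
        disjoint_family_on (\<lambda>k. {s k<..<t k}) {..<N} \<Longrightarrow> (\<Sum>k<N. t k - s k) < h \<Longrightarrow>
        (\<Sum>k<N. \<bar>f (t k) - f (s k)\<bar>) < e"
      using ac[unfolded absolutely_continuous_on_interval_def, rule_format, OF e] by blast
    have "dist (f y) (f x) < e" if y: "dist y x < min h 1" for y
    proof -
      \<comment> \<open>A single interval, with end points ordered by \<open>min\<close> and
        \<open>max\<close>, turns absolute continuity into continuity.\<close>
      have "(\<Sum>k<(1::nat). \<bar>f (max x y) - f (min x y)\<bar>) < e"
        by (rule H) (use y in \<open>auto simp: disjoint_family_on_def dist_real_def\<close>)
      then show ?thesis by (auto simp: dist_real_def max_def min_def split: if_splits)
    qed
    then show "\<exists>d>0. \<forall>y. dist y x < d \<longrightarrow> dist (f y) (f x) < e"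
      using h by (intro exI[of _ "min h 1"]) auto
  qed
qed

lemma integrable_N01_exp_growth:
  assumes "f \<in> borel_measurable borel" "\<And>t. \<bar>f t\<bar> \<le> c\<^sub>1 * exp (c\<^sub>2 * \<bar>t\<bar>)"
  shows "integrable N01 (\<lambda>z. f z ^ k)"
proof (rule Bochner_Integration.integrable_bound)
  show "integrable N01 (\<lambda>z. c\<^sub>1 ^ k * exp (real k * c\<^sub>2 * \<bar>z\<bar>))"
    by (intro Bochner_Integration.integrable_mult_right integrable_N01_exp_abs)
  have "\<bar>f z ^ k\<bar> \<le> \<bar>c\<^sub>1 ^ k * exp (real k * c\<^sub>2 * \<bar>z\<bar>)\<bar>" for z
  proof -
    have "\<bar>f z\<bar> ^ k \<le> (c\<^sub>1 * exp (c\<^sub>2 * \<bar>z\<bar>)) ^ k"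
      by (intro power_mono assms) auto
    also have "\<dots> = c\<^sub>1 ^ k * exp (real k * c\<^sub>2 * \<bar>z\<bar>)"
      by (simp add: power_mult_distrib exp_of_nat_mult[symmetric] mult.assoc)
    finally show ?thesis by (simp add: power_abs)
  qed
  then show "AE z in N01. norm (f z ^ k) \<le> norm (c\<^sub>1 ^ k * exp (real k * c\<^sub>2 * \<bar>z\<bar>))"
    by (intro AE_I2) simp
qed (use assms in simp)

subsection \<open>Concentration of the resolvent averages\<close>

lemma resolvent_cong:
  assumes "\<And>i j. i < n \<Longrightarrow> j \<in> K \<Longrightarrow> F (i, j) = F' (i, j)"
  shows "resolvent n F K lam = resolvent n F' K lam"
proof -
  have "ridge_gram n F K lam = ridge_gram n F' K lam"
    using assms unfolding ridge_gram_def by (intro cong_mat) (auto intro!: sum.cong)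
  then show ?thesis by (simp add: resolvent_def)
qed

definition apply_entries :: "(real \<Rightarrow> real) \<Rightarrow> (nat \<times> nat \<Rightarrow> real) \<Rightarrow> nat \<times> nat \<Rightarrow> real" where
  "apply_entries u X = (\<lambda>ij. u (X ij))"

abbreviation gram_law :: "nat \<Rightarrow> nat \<Rightarrow> (nat \<times> nat \<Rightarrow> real) measure" where
  "gram_law n d \<equiv> PiM ({..<n} \<times> {..<d}) (\<lambda>_. N01)"

text \<open>What the random matrix analysis uses of the activation: centring, the first Hermite
  coefficient \<mu>, the second moment v, and a fourth moment, which gives quadratic forms a finite
  variance.\<close>

locale activation =
  fixes \<phi> :: "real \<Rightarrow> real" and \<mu> v :: real
  assumes meas: "\<phi> \<in> borel_measurable borel"
    and fourth: "integrable N01 (\<lambda>z. \<phi> z ^ 4)"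
    and mean: "(\<integral>z. \<phi> z \<partial>N01) = 0"
    and mu: "\<mu> = (\<integral>z. z * \<phi> z \<partial>N01)"
    and v: "v = (\<integral>z. (\<phi> z)\<^sup>2 \<partial>N01)" and vpos: "v > 0"
begin

definition G :: "nat \<Rightarrow> nat set \<Rightarrow> real \<Rightarrow> (nat \<times> nat \<Rightarrow> real) \<Rightarrow> real mat" where
  "G n K lam X = resolvent n (apply_entries \<phi> X) K lam"

text \<open>With u and w among the identity and \<phi> these are the three forms z_k \<bullet> G
  z_k, z_k \<bullet> G f_k and f_k \<bullet> G f_k, where z_k is a data column and f_k its feature
  column. The set \<open>K\<close> decides whether column k itself enters G.\<close>

definition form :: "nat \<Rightarrow> nat set \<Rightarrow> real \<Rightarrow> (real \<Rightarrow> real) \<Rightarrow> (real \<Rightarrow> real) \<Rightarrow> nat \<Rightarrow> (nat \<times> nat \<Rightarrow> real) \<Rightarrow> real" where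
  "form n K lam u w k X =
    col_vec n (apply_entries u X) k \<bullet> (G n K lam X *\<^sub>v col_vec n (apply_entries w X) k) / real n"

definition trn :: "nat \<Rightarrow> nat set \<Rightarrow> real \<Rightarrow> (nat \<times> nat \<Rightarrow> real) \<Rightarrow> real" where
  "trn n K lam X = mat_tr (G n K lam X) / real n"

definition \<tau> :: "nat \<Rightarrow> nat \<Rightarrow> nat \<Rightarrow> real \<Rightarrow> real" where
  "\<tau> n d p lam = (\<integral>X. trn n {..<p} lam X \<partial>gram_law n d)"

definition admissible :: "(real \<Rightarrow> real) \<Rightarrow> bool" where
  "admissible u \<longleftrightarrow> u \<in> borel_measurable borel \<and> integrable N01 (\<lambda>z. u z ^ 4) \<and> (\<integral>z. u z \<partial>N01) = 0"

lemma admissible_phi: "admissible \<phi>"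
  using meas fourth mean by (simp add: admissible_def)

lemma admissible_id: "admissible (\<lambda>z. z)"
  using N01_mean integrable_N01_power by (simp add: admissible_def)

lemma gram_prob: "prob_space (gram_law n d)"
  by (rule prob_space_PiM) (rule prob_space_N01)

lemma measurable_entry:
  assumes "u \<in> borel_measurable borel" "ij \<in> A"
  shows "(\<lambda>X. u (X ij)) \<in> borel_measurable (PiM A (\<lambda>_. N01))"
  by (rule measurable_compose[OF measurable_component_singleton[OF assms(2)]]) (use assms(1) in simp)

lemma measurable_G:
  assumes "i < n" "k < n" "{..<n} \<times> K \<subseteq> A"
  shows "(\<lambda>X. G n K lam X $$ (i, k)) \<in> borel_measurable (PiM A (\<lambda>_. N01))"
  unfolding G_def apply_entries_def
  by (rule borel_measurable_resolvent[OF measurable_entry[OF meas]]) (use assms in auto)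

lemma G_carrier [simp]: "G n K lam X \<in> carrier_mat n n"
  by (simp add: G_def)

lemma form_alt:
  "form n K lam u w k X = (\<Sum>i<n. \<Sum>l<n. (G n K lam X $$ (i, l) / real n) * (u (X (i, k)) * w (X (l, k))))"
  unfolding form_def
  by (subst form_sum[of _ n])
     (auto simp: col_vec_def apply_entries_def sum_divide_distrib mult_ac intro!: sum.cong)

lemma measurable_form:
  assumes "u \<in> borel_measurable borel" "w \<in> borel_measurable borel" "{..<n} \<times> insert k K \<subseteq> A"
  shows "form n K lam u w k \<in> borel_measurable (PiM A (\<lambda>_. N01))"
  unfolding form_alt[abs_def]
  by (intro borel_measurable_sum borel_measurable_times borel_measurable_divide borel_measurable_const measurable_G measurable_entry)
     (use assms in auto)

lemma measurable_trn:
  assumes "{..<n} \<times> K \<subseteq> A"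
  shows "trn n K lam \<in> borel_measurable (PiM A (\<lambda>_. N01))"
proof -
  have "trn n K lam = (\<lambda>X. (\<Sum>i<n. G n K lam X $$ (i, i)) / real n)"
    unfolding trn_def mat_tr_def using carrier_matD(1)[OF G_carrier] by simp
  then show ?thesis
    using assms by (auto intro!: borel_measurable_divide borel_measurable_sum measurable_G)
qed

lemma trn_bounds:
  assumes "lam > 0" "n > 0"
  shows "0 \<le> trn n K lam X" "trn n K lam X \<le> 1 / lam"
proof -
  show "0 \<le> trn n K lam X"
    unfolding trn_def G_def using mat_tr_resolvent_nonneg[OF assms(1)] by simp
  have "mat_tr (G n K lam X) \<le> real n / lam"
    unfolding G_def by (rule mat_tr_resolvent_le[OF assms(1)])
  then have "trn n K lam X \<le> (real n / lam) / real n"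
    unfolding trn_def by (rule divide_right_mono) simp
  then show "trn n K lam X \<le> 1 / lam" using assms by simp
qed

lemma trn_insert:
  assumes "lam > 0" "n > 0" "finite K" "j \<notin> K"
  shows "\<bar>trn n K lam X - trn n (insert j K) lam X\<bar> \<le> 1 / (real n * lam)"
proof -
  have "0 \<le> mat_tr (G n K lam X) - mat_tr (G n (insert j K) lam X)"
    "mat_tr (G n K lam X) - mat_tr (G n (insert j K) lam X) \<le> 1 / lam"
    unfolding G_def using mat_tr_resolvent_insert[OF assms(1,3,4,2), of "apply_entries \<phi> X"] by auto
  from divide_right_mono[OF this(1), of "real n"] divide_right_mono[OF this(2), of "real n"]
  show ?thesis unfolding trn_def diff_divide_distrib[symmetric]
    by (simp add: mult.commute)
qed

text \<open>A column that does not enter the resolvent is independent of it.\<close>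

lemma form_concentration:
  assumes lam: "lam > 0" and n: "n > 0" and K: "K \<subseteq> {..<d}" "k < d" "k \<notin> K"
    and u: "admissible u" and w: "admissible w"
  defines "m \<equiv> \<integral>z. u z * w z \<partial>N01"
  shows "sq_integrable (gram_law n d) (\<lambda>X. form n K lam u w k X - m * trn n K lam X)" (is ?A)
    and "(\<integral>X. (form n K lam u w k X - m * trn n K lam X)\<^sup>2 \<partial>gram_law n d) \<le> form_const N01 u w / (real n * lam\<^sup>2)" (is ?B)
proof -
  let ?D = "\<lambda>X. form n K lam u w k X - m * trn n K lam X"
  define A where "A = {..<n} \<times> {k}"
  define R where "R = {..<n} \<times> ({..<d} - {k})"
  have AR: "R \<union> A = {..<n} \<times> {..<d}" "R \<inter> A = {}" "finite A" "finite R" using K by (auto simp: A_def R_def)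
  have u': "u \<in> borel_measurable borel" "w \<in> borel_measurable borel" using u w by (auto simp: admissible_def)
  have sub: "{..<n} \<times> insert k K \<subseteq> {..<n} \<times> {..<d}" "{..<n} \<times> K \<subseteq> {..<n} \<times> {..<d}" using K by auto
  have mD: "?D \<in> borel_measurable (gram_law n d)"
    using measurable_form[OF u' sub(1)] measurable_trn[OF sub(2)] by simp
  define c where "c = form_const N01 u w / (real n * lam\<^sup>2)"
  \<comment> \<open>Given the other columns the resolvent is a constant matrix, and the deviation is
    a centred quadratic form in column k with coefficient matrix G / n.\<close>
  have inner: "(\<integral>\<^sup>+ y. ennreal ((?D (merge R A (x, y)))\<^sup>2) \<partial>PiM A (\<lambda>_. N01)) \<le> ennreal c" for x
  proof -
    have Gx: "G n K lam (merge R A (x, y)) = G n K lam x" for y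
      unfolding G_def apply_entries_def
      by (rule resolvent_cong) (use K in \<open>auto simp: merge_def R_def A_def\<close>)
    define B where "B = (\<lambda>(i::nat \<times> nat) (l::nat \<times> nat). G n K lam x $$ (fst i, fst l) / real n :: real)"
    have sA: "(\<Sum>i\<in>A. f i) = (\<Sum>i<n. f (i, k))" for f :: "nat \<times> nat \<Rightarrow> real"
    proof -
      have "A = (\<lambda>i. (i, k)) ` {..<n}" by (auto simp: A_def)
      then show ?thesis by (simp add: sum.reindex inj_on_def)
    qed
    have D: "?D (merge R A (x, y)) = (\<Sum>i\<in>A. \<Sum>l\<in>A. B i l * (u (y i) * w (y l))) - m * (\<Sum>i\<in>A. B i i)" for y
    proof -
      have mk: "merge R A (x, y) (i, k) = y (i, k)" if "i < n" for i
        using that by (auto simp: merge_def R_def A_def)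
      show ?thesis
        unfolding form_alt trn_def Gx mat_tr_def sA B_def
        using carrier_matD(1)[OF G_carrier] by (simp add: mk sum_divide_distrib)
    qed
    note q = quadratic_form_second_moment[OF prob_space_N01 AR(3), of u w B, folded m_def]
    have q1: "sq_integrable (PiM A (\<lambda>_. N01)) (\<lambda>y. (\<Sum>i\<in>A. \<Sum>l\<in>A. B i l * (u (y i) * w (y l))) - m * (\<Sum>i\<in>A. B i i))"
      and q2: "(\<integral>y. ((\<Sum>i\<in>A. \<Sum>l\<in>A. B i l * (u (y i) * w (y l))) - m * (\<Sum>i\<in>A. B i i))\<^sup>2 \<partial>PiM A (\<lambda>_. N01)) \<le>
        form_const N01 u w * (\<Sum>i\<in>A. \<Sum>l\<in>A. (B i l)\<^sup>2)"
      using q u w by (auto simp: admissible_def)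
    have "(\<Sum>i\<in>A. \<Sum>l\<in>A. (B i l)\<^sup>2) = (\<Sum>i<n. \<Sum>l<n. (G n K lam x $$ (i, l))\<^sup>2) / (real n)\<^sup>2"
      unfolding sA B_def by (simp add: power_divide sum_divide_distrib)
    also have "\<dots> \<le> (real n / lam\<^sup>2) / (real n)\<^sup>2"
      unfolding G_def by (intro divide_right_mono resolvent_frobenius_le lam) simp
    also have "\<dots> = 1 / (real n * lam\<^sup>2)" using n by (simp add: power2_eq_square)
    finally have "form_const N01 u w * (\<Sum>i\<in>A. \<Sum>l\<in>A. (B i l)\<^sup>2) \<le> form_const N01 u w * (1 / (real n * lam\<^sup>2))"
      by (rule mult_left_mono) (rule form_const_nonneg)
    then have "(\<integral>y. (?D (merge R A (x, y)))\<^sup>2 \<partial>PiM A (\<lambda>_. N01)) \<le> c"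
      unfolding D c_def using q2 by simp
    moreover have "integrable (PiM A (\<lambda>_. N01)) (\<lambda>y. (?D (merge R A (x, y)))\<^sup>2)"
      unfolding D using q1 by (simp add: sq_integrable_def)
    ultimately show ?thesis by (subst nn_integral_eq_integral) (auto intro: ennreal_leI)
  qed
  interpret P: prob_space "PiM R (\<lambda>_. N01)" by (rule prob_space_PiM) (rule prob_space_N01)
  \<comment> \<open>Nonnegative integrals allow Fubini before integrability is known; integrability
    of the square is then read off from the bound.\<close>
  have "(\<integral>\<^sup>+ X. ennreal ((?D X)\<^sup>2) \<partial>gram_law n d) =
      (\<integral>\<^sup>+ x. \<integral>\<^sup>+ y. ennreal ((?D (merge R A (x, y)))\<^sup>2) \<partial>PiM A (\<lambda>_. N01) \<partial>PiM R (\<lambda>_. N01))"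
    unfolding AR(1)[symmetric]
    by (rule N01.product_nn_integral_fold[OF AR(2,4,3)]) (use mD in \<open>simp add: AR(1)\<close>)
  also have "\<dots> \<le> (\<integral>\<^sup>+ x. ennreal c \<partial>PiM R (\<lambda>_. N01))"
    by (intro nn_integral_mono inner)
  also have "\<dots> = ennreal c" by (simp add: P.emeasure_space_1)
  finally have le: "(\<integral>\<^sup>+ X. ennreal ((?D X)\<^sup>2) \<partial>gram_law n d) \<le> ennreal c" .
  have int: "integrable (gram_law n d) (\<lambda>X. (?D X)\<^sup>2)"
    by (rule integrableI_bounded) (use mD le in \<open>auto simp: less_top[symmetric] top_unique intro: le_less_trans\<close>)
  show ?A using mD int by (simp add: sq_integrable_def)
  have "c \<ge> 0" unfolding c_def by (intro divide_nonneg_nonneg form_const_nonneg mult_nonneg_nonneg) auto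
  then have "(\<integral>X. (?D X)\<^sup>2 \<partial>gram_law n d) \<le> c"
    using le int by (subst (asm) nn_integral_eq_integral) auto
  then show ?B unfolding c_def .
qed

text \<open>Efron--Stein with the columns of the data as blocks. Changing a column amounts to
  removing it and inserting another, which moves the normalised trace by at most 2 / (n lam); the
  squares are summed over d columns.\<close>

lemma trn_variance:
  assumes lam: "lam > 0" and n: "n > 0" and p: "p \<le> d"
  shows "(\<integral>X. (trn n {..<p} lam X - \<tau> n d p lam)\<^sup>2 \<partial>gram_law n d) \<le> 4 * real d / (real n * lam)\<^sup>2"
proof -
  define B where "B = (\<lambda>j::nat. {..<n} \<times> {j})"
  have U: "{..<n} \<times> {..<d} = (\<Union>j\<in>{..<d}. B j)" by (auto simp: B_def)
  have osc1: "\<bar>trn n {..<p} lam X - trn n {..<p} lam X'\<bar> \<le> 2 / (real n * lam)"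
    if "j < d" and eq: "\<And>i. i \<in> (\<Union>j\<in>{..<d}. B j) - B j \<Longrightarrow> X i = X' i" for X X' j
  proof -
    have G: "trn n ({..<p} - {j}) lam X = trn n ({..<p} - {j}) lam X'"
      unfolding trn_def G_def
      by (subst resolvent_cong[of n _ _ "apply_entries \<phi> X'"]) (use eq p in \<open>auto simp: apply_entries_def B_def\<close>)
    show ?thesis
    proof (cases "j < p")
      case True
      then have i: "insert j ({..<p} - {j}) = {..<p}" by auto
      define e where "e = 1 / (real n * lam)"
      have "\<bar>trn n ({..<p} - {j}) lam Y - trn n {..<p} lam Y\<bar> \<le> e" for Y
        using trn_insert[OF lam n, of "{..<p} - {j}" j Y] unfolding i e_def by simp
      from this[of X] this[of X'] G have "\<bar>trn n {..<p} lam X - trn n {..<p} lam X'\<bar> \<le> 2 * e" by linarith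
      then show ?thesis by (simp add: e_def)
    next
      case False
      then have "{..<p} - {j} = {..<p}" by auto
      with G show ?thesis using lam by simp
    qed
  qed
  have "(\<integral>X. (trn n {..<p} lam X - \<tau> n d p lam)\<^sup>2 \<partial>gram_law n d) \<le> real (card {..<d}) * (2 / (real n * lam))\<^sup>2"
    unfolding \<tau>_def U
  proof (rule block_variance_le[OF prob_space_N01, where b = "1 / lam"])
    show "trn n {..<p} lam \<in> borel_measurable (PiM (\<Union>j\<in>{..<d}. B j) (\<lambda>_. N01))"
      by (rule measurable_trn) (use p in \<open>auto simp: B_def\<close>)
    show "\<bar>trn n {..<p} lam X\<bar> \<le> 1 / lam" for X using trn_bounds[OF lam n, of "{..<p}" X] by simp
  qed (use osc1 in \<open>auto simp: B_def disjoint_family_on_def\<close>)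
  then show ?thesis by (simp add: power_divide mult.commute)
qed

lemma tau_bounds:
  assumes "lam > 0" "n > 0" "p \<le> d"
  shows "0 \<le> \<tau> n d p lam" "\<tau> n d p lam \<le> 1 / lam" "integrable (gram_law n d) (trn n {..<p} lam)"
proof -
  interpret P: prob_space "gram_law n d" by (rule gram_prob)
  have m: "trn n {..<p} lam \<in> borel_measurable (gram_law n d)"
    by (rule measurable_trn) (use assms in auto)
  show i: "integrable (gram_law n d) (trn n {..<p} lam)"
    by (rule P.integrable_const_bound[of _ "1 / lam"]) (use trn_bounds[OF assms(1,2)] m in auto)
  show "0 \<le> \<tau> n d p lam" unfolding \<tau>_def using trn_bounds[OF assms(1,2)] by simp
  have "\<tau> n d p lam \<le> (\<integral>X. 1 / lam \<partial>gram_law n d)"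
    unfolding \<tau>_def using trn_bounds[OF assms(1,2)] i by (intro integral_mono) auto
  then show "\<tau> n d p lam \<le> 1 / lam" by (simp add: P.prob_space)
qed

text \<open>The three sources of error in \<open>form_loo\<close>: concentration of a form given the
  other columns, removal of one column from the trace, and fluctuation of the trace. Sums and maxima
  make one bound serve all three pairs of functions; it is O(1/n) while d / n stays bounded.\<close>

definition err :: "real \<Rightarrow> nat \<Rightarrow> nat \<Rightarrow> real" where
  "err lam n d = 3 * ((form_const N01 \<phi> \<phi> + form_const N01 (\<lambda>z. z) \<phi> + form_const N01 (\<lambda>z. z) (\<lambda>z. z)) / (real n * lam\<^sup>2)
     + (max 1 (max v \<bar>\<mu>\<bar>))\<^sup>2 * (1 / (real n * lam)\<^sup>2 + 4 * real d / (real n * lam)\<^sup>2))"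

lemma err_nonneg: "err lam n d \<ge> 0"
  unfolding err_def by (intro mult_nonneg_nonneg add_nonneg_nonneg divide_nonneg_nonneg form_const_nonneg) auto

text \<open>The deviation is telescoped through the leave-one-out trace and the full trace to the
  mean trace. The three cases share one bound so that later estimates can combine them.\<close>

lemma form_loo:
  assumes lam: "lam > 0" and n: "n > 0" and p: "p \<le> d" and k: "k < d"
    and u: "(u = \<phi> \<and> w = \<phi> \<and> m = v) \<or> (u = (\<lambda>z. z) \<and> w = \<phi> \<and> m = \<mu>) \<or> (u = (\<lambda>z. z) \<and> w = (\<lambda>z. z) \<and> m = 1)"
  shows "sq_integrable (gram_law n d) (\<lambda>X. form n ({..<p} - {k}) lam u w k X - m * \<tau> n d p lam)"
    and "(\<integral>X. (form n ({..<p} - {k}) lam u w k X - m * \<tau> n d p lam)\<^sup>2 \<partial>gram_law n d) \<le> err lam n d"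
proof -
  interpret P: prob_space "gram_law n d" by (rule gram_prob)
  let ?K = "{..<p} - {k}" and ?M = "max 1 (max v \<bar>\<mu>\<bar>)"
  have adm: "admissible u" "admissible w" using u admissible_phi admissible_id by auto
  have m: "(\<integral>z. u z * w z \<partial>N01) = m"
    using u v mu N01_second_moment by (auto simp: power2_eq_square)
  have mb: "m\<^sup>2 \<le> ?M\<^sup>2"
    by (rule abs_le_square_iff[THEN iffD1]) (use u vpos in auto)
  have fc: "form_const N01 u w \<le> form_const N01 \<phi> \<phi> + form_const N01 (\<lambda>z. z) \<phi> + form_const N01 (\<lambda>z. z) (\<lambda>z. z)"
    using u form_const_nonneg[of N01 \<phi> \<phi>] form_const_nonneg[of N01 "\<lambda>z. z" \<phi>] form_const_nonneg[of N01 "\<lambda>z. z" "\<lambda>z. z"] by auto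
  define a where "a = (\<lambda>X. form n ?K lam u w k X - m * trn n ?K lam X)"
  define b where "b = (\<lambda>X. m * (trn n ?K lam X - trn n {..<p} lam X))"
  define c where "c = (\<lambda>X. m * (trn n {..<p} lam X - \<tau> n d p lam))"
  note conc = form_concentration[OF lam n _ k _ adm, of ?K, unfolded m]
  have sub: "?K \<subseteq> {..<d}" "k \<notin> ?K" using p by auto
  have sa: "sq_integrable (gram_law n d) a" "(\<integral>X. (a X)\<^sup>2 \<partial>gram_law n d) \<le> form_const N01 u w / (real n * lam\<^sup>2)"
    unfolding a_def using conc[OF sub] by auto
  have mt: "trn n ?K lam \<in> borel_measurable (gram_law n d)" "trn n {..<p} lam \<in> borel_measurable (gram_law n d)"
    by (rule measurable_trn; use p in auto)+
  have dif: "\<bar>trn n ?K lam X - trn n {..<p} lam X\<bar> \<le> 1 / (real n * lam)" for X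
  proof (cases "k < p")
    case True
    then have i: "insert k ?K = {..<p}" by auto
    show ?thesis using trn_insert[OF lam n, of ?K k X] unfolding i by simp
  next
    case False
    then have "?K = {..<p}" by auto
    then show ?thesis using lam by simp
  qed
  have bb: "(b X)\<^sup>2 \<le> ?M\<^sup>2 * (1 / (real n * lam)\<^sup>2)" for X
  proof -
    have "(trn n ?K lam X - trn n {..<p} lam X)\<^sup>2 \<le> (1 / (real n * lam))\<^sup>2"
      using dif[of X] lam by (intro abs_le_square_iff[THEN iffD1]) simp
    then show ?thesis unfolding b_def power_mult_distrib
      using mb by (intro mult_mono) (auto simp: power_divide power_mult_distrib)
  qed
  have sb: "integrable (gram_law n d) (\<lambda>X. (b X)\<^sup>2)"
    by (rule P.integrable_const_bound[of _ "?M\<^sup>2 * (1 / (real n * lam)\<^sup>2)"]) (use bb mt in \<open>auto simp: b_def\<close>)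
  have sc: "integrable (gram_law n d) (\<lambda>X. (c X)\<^sup>2)"
  proof (rule P.integrable_const_bound[of _ "(\<bar>m\<bar> * (2 / lam))\<^sup>2"])
    show "AE X in gram_law n d. norm ((c X)\<^sup>2) \<le> (\<bar>m\<bar> * (2 / lam))\<^sup>2"
    proof (rule AE_I2)
      fix X
      have "\<bar>trn n {..<p} lam X - \<tau> n d p lam\<bar> \<le> 2 / lam"
        using trn_bounds[OF lam n, of "{..<p}" X] tau_bounds[OF lam n p] by (auto simp: abs_le_iff)
      then have "\<bar>c X\<bar> \<le> \<bar>\<bar>m\<bar> * (2 / lam)\<bar>"
        unfolding c_def abs_mult by (intro mult_mono) (use lam in auto)
      then have "(c X)\<^sup>2 \<le> (\<bar>m\<bar> * (2 / lam))\<^sup>2" by (rule abs_le_square_iff[THEN iffD1])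
      then show "norm ((c X)\<^sup>2) \<le> (\<bar>m\<bar> * (2 / lam))\<^sup>2" by simp
    qed
  qed (use mt in \<open>auto simp: c_def\<close>)
  have ssb: "sq_integrable (gram_law n d) b" "sq_integrable (gram_law n d) c"
    using sb sc mt by (auto simp: sq_integrable_def b_def c_def)
  have split: "form n ?K lam u w k X - m * \<tau> n d p lam = a X + b X + c X" for X
    by (simp add: a_def b_def c_def algebra_simps)
  show s: "sq_integrable (gram_law n d) (\<lambda>X. form n ?K lam u w k X - m * \<tau> n d p lam)"
    unfolding split by (intro sq_integrable_add sa ssb)
  have three: "(a + b + c)\<^sup>2 \<le> 3 * (a\<^sup>2 + b\<^sup>2 + c\<^sup>2)" for a b c :: real
  proof -
    have "3 * (a\<^sup>2 + b\<^sup>2 + c\<^sup>2) - (a + b + c)\<^sup>2 = (a - b)\<^sup>2 + (b - c)\<^sup>2 + (a - c)\<^sup>2"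
      by (simp add: power2_eq_square algebra_simps)
    then show ?thesis by (smt (verit) zero_le_power2)
  qed
  have ia: "integrable (gram_law n d) (\<lambda>X. (a X)\<^sup>2)" using sa by (simp add: sq_integrable_def)
  have ib: "(\<integral>X. (b X)\<^sup>2 \<partial>gram_law n d) \<le> ?M\<^sup>2 * (1 / (real n * lam)\<^sup>2)"
  proof -
    have "(\<integral>X. (b X)\<^sup>2 \<partial>gram_law n d) \<le> (\<integral>X. ?M\<^sup>2 * (1 / (real n * lam)\<^sup>2) \<partial>gram_law n d)"
      using sb bb by (intro integral_mono) auto
    then show ?thesis by (simp add: P.prob_space)
  qed
  have ic: "(\<integral>X. (c X)\<^sup>2 \<partial>gram_law n d) \<le> ?M\<^sup>2 * (4 * real d / (real n * lam)\<^sup>2)"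
  proof -
    have "(\<integral>X. (c X)\<^sup>2 \<partial>gram_law n d) = m\<^sup>2 * (\<integral>X. (trn n {..<p} lam X - \<tau> n d p lam)\<^sup>2 \<partial>gram_law n d)"
      unfolding c_def power_mult_distrib by simp
    also have "\<dots> \<le> ?M\<^sup>2 * (4 * real d / (real n * lam)\<^sup>2)"
      by (intro mult_mono mb trn_variance lam n p) auto
    finally show ?thesis .
  qed
  have "(\<integral>X. (form n ?K lam u w k X - m * \<tau> n d p lam)\<^sup>2 \<partial>gram_law n d) \<le>
      (\<integral>X. 3 * ((a X)\<^sup>2 + (b X)\<^sup>2 + (c X)\<^sup>2) \<partial>gram_law n d)"
    unfolding split using three ia sb sc by (intro integral_mono') auto
  also have "\<dots> = 3 * ((\<integral>X. (a X)\<^sup>2 \<partial>gram_law n d) + (\<integral>X. (b X)\<^sup>2 \<partial>gram_law n d) + (\<integral>X. (c X)\<^sup>2 \<partial>gram_law n d))"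
    using ia sb sc by simp
  also have "\<dots> \<le> err lam n d"
  proof -
    have "form_const N01 u w / (real n * lam\<^sup>2) \<le> (form_const N01 \<phi> \<phi> + form_const N01 (\<lambda>z. z) \<phi> + form_const N01 (\<lambda>z. z) (\<lambda>z. z)) / (real n * lam\<^sup>2)"
      by (intro divide_right_mono fc) simp
    note fin = add_mono[OF order.trans[OF sa(2) this] add_mono[OF ib ic], unfolded add.assoc]
    show ?thesis unfolding err_def distrib_left[of "?M\<^sup>2"] add.assoc
      by (rule mult_left_mono[OF fin]) simp
  qed
  finally show "(\<integral>X. (form n ?K lam u w k X - m * \<tau> n d p lam)\<^sup>2 \<partial>gram_law n d) \<le> err lam n d" .
qed

end

lemma (in prob_space) abs_expectation_diff_le:
  fixes f g :: "'a \<Rightarrow> real"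
  assumes "integrable M f" "integrable M g" "\<And>x. x \<in> space M \<Longrightarrow> \<bar>f x - c\<bar> \<le> g x"
  shows "\<bar>expectation f - c\<bar> \<le> expectation g"
proof -
  have "\<bar>expectation f - c\<bar> = \<bar>expectation (\<lambda>x. f x - c)\<bar>"
    using assms(1) by (simp add: prob_space)
  also have "\<dots> \<le> expectation (\<lambda>x. \<bar>f x - c\<bar>)" by (rule integral_abs_bound)
  also have "\<dots> \<le> expectation g" using assms by (intro integral_mono) auto
  finally show ?thesis .
qed

context activation
begin

lemma form_nonneg: "lam > 0 \<Longrightarrow> 0 \<le> form n K lam u u k X"
  unfolding form_def G_def by (intro divide_nonneg_nonneg resolvent_form_nonneg) auto

text \<open>Concentration is available only for forms whose column is absent from G;
  Sherman--Morrison expresses the forms with the column present as rational functions of these, with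
  a denominator at least 1.\<close>

lemma form_insert:
  assumes "lam > 0" "n > 0" "finite K" "k \<notin> K"
  shows "form n (insert k K) lam u \<phi> k X = form n K lam u \<phi> k X / (1 + form n K lam \<phi> \<phi> k X)"
    and "form n (insert k K) lam u u k X =
      form n K lam u u k X - (form n K lam u \<phi> k X)\<^sup>2 / (1 + form n K lam \<phi> \<phi> k X)"
proof -
  show "form n (insert k K) lam u \<phi> k X = form n K lam u \<phi> k X / (1 + form n K lam \<phi> \<phi> k X)"
    unfolding form_def G_def by (rule resolvent_insert_col) (use assms in auto)
  let ?f = "col_vec n (apply_entries \<phi> X) k" and ?z = "col_vec n (apply_entries u X) k"
  have s: "?f \<bullet> (G n K lam X *\<^sub>v ?z) = ?z \<bullet> (G n K lam X *\<^sub>v ?f)"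
    unfolding G_def by (rule resolvent_sym[OF assms(1)]) auto
  have q: "0 \<le> ?f \<bullet> (G n K lam X *\<^sub>v ?f)"
    unfolding G_def by (rule resolvent_form_nonneg[OF assms(1)]) auto
  have "?z \<bullet> (G n (insert k K) lam X *\<^sub>v ?z) = ?z \<bullet> (G n K lam X *\<^sub>v ?z) -
     (?f \<bullet> (G n K lam X *\<^sub>v ?z)) * (?z \<bullet> (G n K lam X *\<^sub>v ?f)) / (real n + ?f \<bullet> (G n K lam X *\<^sub>v ?f))"
    unfolding G_def by (rule resolvent_insert_form) (use assms in auto)
  then have e: "form n (insert k K) lam u u k X = form n K lam u u k X -
     (?z \<bullet> (G n K lam X *\<^sub>v ?f))\<^sup>2 / (real n + ?f \<bullet> (G n K lam X *\<^sub>v ?f)) / real n"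
    unfolding form_def s by (simp add: diff_divide_distrib power2_eq_square)
  have "x\<^sup>2 / (real n + y) / real n = (x / real n)\<^sup>2 / (1 + y / real n)" if "y \<ge> 0" for x y :: real
  proof -
    have "1 + y / real n = (real n + y) / real n" using assms(2) by (simp add: add_divide_distrib)
    then show ?thesis using assms(2) by (simp add: power2_eq_square)
  qed
  then show "form n (insert k K) lam u u k X =
      form n K lam u u k X - (form n K lam u \<phi> k X)\<^sup>2 / (1 + form n K lam \<phi> \<phi> k X)"
    unfolding e unfolding form_def using q by simp
qed

context
  fixes n d p :: nat and lam :: real
  assumes lam: "lam > 0" and n: "n > 0" and p: "p \<le> d"
begin

interpretation P: prob_space "gram_law n d" by (rule gram_prob)

lemma form_loo_abs:
  assumes k: "k < d"
    and u: "(u = \<phi> \<and> w = \<phi> \<and> m = v) \<or> (u = (\<lambda>z. z) \<and> w = \<phi> \<and> m = \<mu>) \<or> (u = (\<lambda>z. z) \<and> w = (\<lambda>z. z) \<and> m = 1)"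
  shows "sq_integrable (gram_law n d) (form n ({..<p} - {k}) lam u w k)"
    "(\<integral>X. \<bar>form n ({..<p} - {k}) lam u w k X - m * \<tau> n d p lam\<bar> \<partial>gram_law n d) \<le> sqrt (err lam n d)"
    "integrable (gram_law n d) (\<lambda>X. \<bar>form n ({..<p} - {k}) lam u w k X - m * \<tau> n d p lam\<bar>)"
proof -
  note s = form_loo[OF lam n p k u]
  show "(\<integral>X. \<bar>form n ({..<p} - {k}) lam u w k X - m * \<tau> n d p lam\<bar> \<partial>gram_law n d) \<le> sqrt (err lam n d)"
    by (rule P.abs_integral_le_of_sq[OF s])
  show "sq_integrable (gram_law n d) (form n ({..<p} - {k}) lam u w k)"
    using sq_integrable_add[OF s(1) P.sq_integrable_const[of "m * \<tau> n d p lam"]] by simp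
  show "integrable (gram_law n d) (\<lambda>X. \<bar>form n ({..<p} - {k}) lam u w k X - m * \<tau> n d p lam\<bar>)"
    using P.sq_integrable_integrable[OF s(1)] by simp
qed

lemma insert_col: "k < p \<Longrightarrow> insert k ({..<p} - {k}) = {..<p}"
  by auto

lemma diff_col: "\<not> k < p \<Longrightarrow> {..<p} - {k} = {..<p}"
  by auto

text \<open>The function x / (1 + x) is 1-Lipschitz on x \<ge> 0, so the L^1 error of the
  leave-one-out form passes to the full form.\<close>

lemma form_phi_phi_limit:
  assumes k: "k < p"
  shows "integrable (gram_law n d) (form n {..<p} lam \<phi> \<phi> k)"
    "\<bar>(\<integral>X. form n {..<p} lam \<phi> \<phi> k X \<partial>gram_law n d) - v * \<tau> n d p lam / (1 + v * \<tau> n d p lam)\<bar> \<le> sqrt (err lam n d)"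
proof -
  let ?q = "form n ({..<p} - {k}) lam \<phi> \<phi> k" and ?a = "v * \<tau> n d p lam"
  have kd: "k < d" using k p by simp
  note l = form_loo_abs[OF kd, of \<phi> \<phi> v, simplified]
  have f: "form n {..<p} lam \<phi> \<phi> k X = ?q X / (1 + ?q X)" for X
    using form_insert(1)[OF lam n, of "{..<p} - {k}" k] unfolding insert_col[OF k] by simp
  have q: "0 \<le> ?q X" for X by (rule form_nonneg[OF lam])
  have a: "0 \<le> ?a" using tau_bounds[OF lam n p] vpos by simp
  show i: "integrable (gram_law n d) (form n {..<p} lam \<phi> \<phi> k)"
  proof (rule Bochner_Integration.integrable_bound)
    show "integrable (gram_law n d) ?q" by (rule P.sq_integrable_integrable[OF l(1)])
    show "form n {..<p} lam \<phi> \<phi> k \<in> borel_measurable (gram_law n d)"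
      by (rule measurable_form[OF meas meas]) (use k p in auto)
    have "?q X / (1 + ?q X) \<le> ?q X" for X using q[of X] by (simp add: field_simps)
    then show "AE X in gram_law n d. norm (form n {..<p} lam \<phi> \<phi> k X) \<le> norm (?q X)"
      unfolding f using q by (intro AE_I2) (simp add: abs_of_nonneg)
  qed
  have lip: "\<bar>x / (1 + x) - y / (1 + y)\<bar> \<le> \<bar>x - y\<bar>" if "x \<ge> 0" "y \<ge> 0" for x y :: real
  proof -
    have "x / (1 + x) - y / (1 + y) = (x - y) / ((1 + x) * (1 + y))"
      using that by (simp add: field_simps)
    then have "\<bar>x / (1 + x) - y / (1 + y)\<bar> = \<bar>x - y\<bar> / ((1 + x) * (1 + y))"
      using that by (simp add: abs_mult)
    also have "\<dots> \<le> \<bar>x - y\<bar> / 1"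
      using that by (intro divide_left_mono) (auto intro: mult_ge1_I add_pos_nonneg simp: algebra_simps)
    finally show ?thesis by simp
  qed
  have "\<bar>(\<integral>X. form n {..<p} lam \<phi> \<phi> k X \<partial>gram_law n d) - ?a / (1 + ?a)\<bar> \<le> (\<integral>X. \<bar>?q X - ?a\<bar> \<partial>gram_law n d)"
    by (rule P.abs_expectation_diff_le[OF i]) (use l(3) lip q a in \<open>auto simp: f\<close>)
  then show "\<bar>(\<integral>X. form n {..<p} lam \<phi> \<phi> k X \<partial>gram_law n d) - ?a / (1 + ?a)\<bar> \<le> sqrt (err lam n d)"
    using l(2) by simp
qed

lemma ratio_diff_le:
  fixes x y r s :: real
  assumes "x \<ge> 0" "y \<ge> 0"
  shows "\<bar>r / (1 + x) - s / (1 + y)\<bar> \<le> \<bar>r - s\<bar> + \<bar>s\<bar> * \<bar>x - y\<bar>"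
proof -
  have "r / (1 + x) - s / (1 + y) = (r - s) / (1 + x) + s * ((y - x) / ((1 + x) * (1 + y)))"
  proof -
    have "1 / (1 + x) - 1 / (1 + y) = (y - x) / ((1 + x) * (1 + y))"
      using assms by (simp add: field_simps)
    moreover have "r / (1 + x) - s / (1 + y) = (r - s) / (1 + x) + s * (1 / (1 + x) - 1 / (1 + y))"
      by (simp add: diff_divide_distrib algebra_simps)
    ultimately show ?thesis by simp
  qed
  moreover have "\<bar>(r - s) / (1 + x)\<bar> \<le> \<bar>r - s\<bar>"
    using assms by (simp add: abs_divide divide_le_eq mult_le_cancel_left1 ring_distribs)
  moreover have "\<bar>s * ((y - x) / ((1 + x) * (1 + y)))\<bar> \<le> \<bar>s\<bar> * \<bar>x - y\<bar>"
  proof -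
    have "(1 + x) * (1 + y) \<ge> 1" using assms by (simp add: algebra_simps)
    then have "\<bar>(y - x) / ((1 + x) * (1 + y))\<bar> \<le> \<bar>y - x\<bar> / 1"
      unfolding abs_divide by (intro divide_left_mono) auto
    then show ?thesis unfolding abs_mult by (intro mult_left_mono) (auto simp: abs_minus_commute)
  qed
  ultimately show ?thesis by linarith
qed

text \<open>A ratio with denominator at least 1 depends in a Lipschitz way on numerator and
  denominator (\<open>ratio_diff_le\<close>); the constant uses |\<mu> \<tau>| \<le> |\<mu>| /
  lam.\<close>

lemma form_id_phi_limit:
  assumes k: "k < p"
  shows "integrable (gram_law n d) (form n {..<p} lam (\<lambda>z. z) \<phi> k)"
    "\<bar>(\<integral>X. form n {..<p} lam (\<lambda>z. z) \<phi> k X \<partial>gram_law n d) - \<mu> * \<tau> n d p lam / (1 + v * \<tau> n d p lam)\<bar> \<le>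
       (1 + \<bar>\<mu>\<bar> / lam) * sqrt (err lam n d)"
proof -
  let ?q = "form n ({..<p} - {k}) lam \<phi> \<phi> k" and ?a = "v * \<tau> n d p lam"
  let ?r = "form n ({..<p} - {k}) lam (\<lambda>z. z) \<phi> k" and ?b = "\<mu> * \<tau> n d p lam"
  have kd: "k < d" using k p by simp
  note l = form_loo_abs[OF kd, of \<phi> \<phi> v, simplified]
  note lr = form_loo_abs[OF kd, of "\<lambda>z. z" \<phi> \<mu>, simplified]
  have f: "form n {..<p} lam (\<lambda>z. z) \<phi> k X = ?r X / (1 + ?q X)" for X
    using form_insert(1)[OF lam n, of "{..<p} - {k}" k] unfolding insert_col[OF k] by simp
  have q: "0 \<le> ?q X" for X by (rule form_nonneg[OF lam])
  have a: "0 \<le> ?a" using tau_bounds[OF lam n p] vpos by simp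
  have b: "\<bar>?b\<bar> \<le> \<bar>\<mu>\<bar> / lam"
    using tau_bounds[OF lam n p] mult_left_mono[of "\<tau> n d p lam" "1 / lam" "\<bar>\<mu>\<bar>"] by (simp add: abs_mult)
  show i: "integrable (gram_law n d) (form n {..<p} lam (\<lambda>z. z) \<phi> k)"
  proof (rule Bochner_Integration.integrable_bound)
    show "integrable (gram_law n d) ?r" by (rule P.sq_integrable_integrable[OF lr(1)])
    show "form n {..<p} lam (\<lambda>z. z) \<phi> k \<in> borel_measurable (gram_law n d)"
      by (rule measurable_form[OF _ meas]) (use k p in auto)
    have "\<bar>?r X\<bar> / (1 + ?q X) \<le> \<bar>?r X\<bar>" for X using q[of X]
      by (simp add: divide_le_eq mult_le_cancel_left1 ring_distribs)
    then show "AE X in gram_law n d. norm (form n {..<p} lam (\<lambda>z. z) \<phi> k X) \<le> norm (?r X)"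
      unfolding f using q by (intro AE_I2) (simp add: abs_of_nonneg abs_divide)
  qed
  have "\<bar>(\<integral>X. form n {..<p} lam (\<lambda>z. z) \<phi> k X \<partial>gram_law n d) - ?b / (1 + ?a)\<bar> \<le>
      (\<integral>X. \<bar>?r X - ?b\<bar> + \<bar>?b\<bar> * \<bar>?q X - ?a\<bar> \<partial>gram_law n d)"
    by (rule P.abs_expectation_diff_le[OF i]) (use l(3) lr(3) ratio_diff_le q a in \<open>auto simp: f\<close>)
  also have "\<dots> = (\<integral>X. \<bar>?r X - ?b\<bar> \<partial>gram_law n d) + \<bar>?b\<bar> * (\<integral>X. \<bar>?q X - ?a\<bar> \<partial>gram_law n d)"
    using l(3) lr(3) by simp
  also have "\<dots> \<le> sqrt (err lam n d) + (\<bar>\<mu>\<bar> / lam) * sqrt (err lam n d)"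
    by (intro add_mono mult_mono b l lr) (use lam in auto)
  finally show "\<bar>(\<integral>X. form n {..<p} lam (\<lambda>z. z) \<phi> k X \<partial>gram_law n d) - ?b / (1 + ?a)\<bar> \<le> (1 + \<bar>\<mu>\<bar> / lam) * sqrt (err lam n d)"
    by (simp add: algebra_simps)
qed

text \<open>A column k \<ge> p does not enter the resolvent, so its form concentrates as it stands.
  For k < p the Sherman--Morrison correction contains the square of a cross form; expanding it
  around its limit costs E^2 + 2 |b| E, which is why mean-square bounds are kept besides the L^1
  bounds.\<close>

lemma form_id_id_limit:
  assumes k: "k < d"
  defines "E \<equiv> sqrt (err lam n d)"
  shows "integrable (gram_law n d) (form n {..<p} lam (\<lambda>z. z) (\<lambda>z. z) k)"
    "\<bar>(\<integral>X. form n {..<p} lam (\<lambda>z. z) (\<lambda>z. z) k X \<partial>gram_law n d) -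
      (\<tau> n d p lam - (if k < p then (\<mu> * \<tau> n d p lam)\<^sup>2 / (1 + v * \<tau> n d p lam) else 0))\<bar> \<le>
       E + (E\<^sup>2 + 2 * (\<bar>\<mu>\<bar> / lam) * E) + (\<bar>\<mu>\<bar> / lam)\<^sup>2 * E"
proof -
  let ?q = "form n ({..<p} - {k}) lam \<phi> \<phi> k" and ?a = "v * \<tau> n d p lam"
  let ?r = "form n ({..<p} - {k}) lam (\<lambda>z. z) \<phi> k" and ?b = "\<mu> * \<tau> n d p lam"
  let ?s = "form n ({..<p} - {k}) lam (\<lambda>z. z) (\<lambda>z. z) k" and ?t = "\<tau> n d p lam"
  note l = form_loo_abs[OF k, of \<phi> \<phi> v, simplified]
  note lr = form_loo_abs[OF k, of "\<lambda>z. z" \<phi> \<mu>, simplified]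
  note ls = form_loo_abs[OF k, of "\<lambda>z. z" "\<lambda>z. z" 1, simplified]
  note lr2 = form_loo[OF lam n p k, of "\<lambda>z. z" \<phi> \<mu>, simplified]
  have q: "0 \<le> ?q X" for X by (rule form_nonneg[OF lam])
  have a: "0 \<le> ?a" using tau_bounds[OF lam n p] vpos by simp
  have b: "\<bar>?b\<bar> \<le> \<bar>\<mu>\<bar> / lam"
    using tau_bounds[OF lam n p] mult_left_mono[of "\<tau> n d p lam" "1 / lam" "\<bar>\<mu>\<bar>"] by (simp add: abs_mult)
  have E: "E \<ge> 0" "E\<^sup>2 = err lam n d" using err_nonneg by (auto simp: E_def)
  have isx: "integrable (gram_law n d) ?s" by (rule P.sq_integrable_integrable[OF ls(1)])
  have Epos: "0 \<le> E\<^sup>2 + 2 * (\<bar>\<mu>\<bar> / lam) * E" "0 \<le> (\<bar>\<mu>\<bar> / lam)\<^sup>2 * E"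
    using E(1) lam by (auto intro!: add_nonneg_nonneg)
  have "integrable (gram_law n d) (form n {..<p} lam (\<lambda>z. z) (\<lambda>z. z) k) \<and>
    \<bar>(\<integral>X. form n {..<p} lam (\<lambda>z. z) (\<lambda>z. z) k X \<partial>gram_law n d) - (?t - (if k < p then ?b\<^sup>2 / (1 + ?a) else 0))\<bar> \<le>
       E + (E\<^sup>2 + 2 * (\<bar>\<mu>\<bar> / lam) * E) + (\<bar>\<mu>\<bar> / lam)\<^sup>2 * E"
  proof (cases "k < p")
    case False
    have "\<bar>(\<integral>X. ?s X \<partial>gram_law n d) - ?t\<bar> \<le> (\<integral>X. \<bar>?s X - ?t\<bar> \<partial>gram_law n d)"
      by (rule P.abs_expectation_diff_le[OF isx ls(3)]) auto
    then have "\<bar>(\<integral>X. ?s X \<partial>gram_law n d) - ?t\<bar> \<le> E" using ls(2) by (simp add: E_def)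
    then have "\<bar>(\<integral>X. ?s X \<partial>gram_law n d) - ?t\<bar> \<le> E + (E\<^sup>2 + 2 * (\<bar>\<mu>\<bar> / lam) * E) + (\<bar>\<mu>\<bar> / lam)\<^sup>2 * E"
      using Epos by linarith
    then show ?thesis using False isx unfolding diff_col[OF False] by simp
  next
    case True
    have f: "form n {..<p} lam (\<lambda>z. z) (\<lambda>z. z) k X = ?s X - (?r X)\<^sup>2 / (1 + ?q X)" for X
      using form_insert(2)[OF lam n, of "{..<p} - {k}" k "\<lambda>z. z"] unfolding insert_col[OF True] by simp
    have ir: "integrable (gram_law n d) (\<lambda>X. (?r X)\<^sup>2)" using lr(1) by (simp add: sq_integrable_def)
    have irq: "integrable (gram_law n d) (\<lambda>X. (?r X)\<^sup>2 / (1 + ?q X))"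
    proof (rule Bochner_Integration.integrable_bound[OF ir])
      show "(\<lambda>X. (?r X)\<^sup>2 / (1 + ?q X)) \<in> borel_measurable (gram_law n d)"
        using lr(1) l(1) by (auto simp: sq_integrable_def)
      have "(?r X)\<^sup>2 / (1 + ?q X) \<le> (?r X)\<^sup>2" for X using q[of X]
        by (simp add: divide_le_eq mult_le_cancel_left1 ring_distribs)
      then show "AE X in gram_law n d. norm ((?r X)\<^sup>2 / (1 + ?q X)) \<le> norm ((?r X)\<^sup>2)"
        using q by (intro AE_I2) (simp add: abs_of_nonneg)
    qed
    have i: "integrable (gram_law n d) (form n {..<p} lam (\<lambda>z. z) (\<lambda>z. z) k)"
      unfolding f[abs_def] using isx irq by simp
    have ir2: "integrable (gram_law n d) (\<lambda>X. (?r X - ?b)\<^sup>2)" using lr2 by (simp add: sq_integrable_def)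
    have bound: "\<bar>form n {..<p} lam (\<lambda>z. z) (\<lambda>z. z) k X - (?t - ?b\<^sup>2 / (1 + ?a))\<bar> \<le>
        \<bar>?s X - ?t\<bar> + ((?r X - ?b)\<^sup>2 + 2 * \<bar>?b\<bar> * \<bar>?r X - ?b\<bar>) + ?b\<^sup>2 * \<bar>?q X - ?a\<bar>" for X
    proof -
      have "(?r X)\<^sup>2 - ?b\<^sup>2 = (?r X - ?b)\<^sup>2 + 2 * ?b * (?r X - ?b)"
        by (simp add: power2_eq_square algebra_simps)
      then have "\<bar>(?r X)\<^sup>2 - ?b\<^sup>2\<bar> \<le> (?r X - ?b)\<^sup>2 + 2 * \<bar>?b\<bar> * \<bar>?r X - ?b\<bar>"
        using abs_triangle_ineq[of "(?r X - ?b)\<^sup>2" "2 * ?b * (?r X - ?b)"] by (simp add: abs_mult)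
      moreover have "\<bar>(?r X)\<^sup>2 / (1 + ?q X) - ?b\<^sup>2 / (1 + ?a)\<bar> \<le> \<bar>(?r X)\<^sup>2 - ?b\<^sup>2\<bar> + ?b\<^sup>2 * \<bar>?q X - ?a\<bar>"
        using ratio_diff_le[OF q[of X] a, of "(?r X)\<^sup>2" "?b\<^sup>2"] by simp
      moreover have "\<bar>(s - x) - (t - y)\<bar> \<le> \<bar>s - t\<bar> + (a + b) + c"
        if "\<bar>d\<bar> \<le> a + b" "\<bar>x - y\<bar> \<le> \<bar>d\<bar> + c" for s x t y a b c d :: real
        using that by linarith
      ultimately show ?thesis unfolding f by blast
    qed
    have "\<bar>(\<integral>X. form n {..<p} lam (\<lambda>z. z) (\<lambda>z. z) k X \<partial>gram_law n d) - (?t - ?b\<^sup>2 / (1 + ?a))\<bar> \<le>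
       (\<integral>X. \<bar>?s X - ?t\<bar> + ((?r X - ?b)\<^sup>2 + 2 * \<bar>?b\<bar> * \<bar>?r X - ?b\<bar>) + ?b\<^sup>2 * \<bar>?q X - ?a\<bar> \<partial>gram_law n d)"
      by (rule P.abs_expectation_diff_le[OF i _ bound]) (use ls(3) lr(3) l(3) ir2 in simp)
    also have "\<dots> = (\<integral>X. \<bar>?s X - ?t\<bar> \<partial>gram_law n d) + ((\<integral>X. (?r X - ?b)\<^sup>2 \<partial>gram_law n d) + 2 * \<bar>?b\<bar> * (\<integral>X. \<bar>?r X - ?b\<bar> \<partial>gram_law n d))
       + \<bar>?b\<bar>\<^sup>2 * (\<integral>X. \<bar>?q X - ?a\<bar> \<partial>gram_law n d)"
      using ls(3) lr(3) l(3) ir2 by simp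
    also have "\<dots> \<le> E + (E\<^sup>2 + 2 * (\<bar>\<mu>\<bar> / lam) * E) + (\<bar>\<mu>\<bar> / lam)\<^sup>2 * E"
      unfolding E(2) unfolding E_def
      by (intro add_mono mult_mono power_mono ls lr l lr2 b order_refl) (use lam in auto)
    finally show ?thesis using i True by simp
  qed
  then show "integrable (gram_law n d) (form n {..<p} lam (\<lambda>z. z) (\<lambda>z. z) k)"
    "\<bar>(\<integral>X. form n {..<p} lam (\<lambda>z. z) (\<lambda>z. z) k X \<partial>gram_law n d) -
      (\<tau> n d p lam - (if k < p then (\<mu> * \<tau> n d p lam)\<^sup>2 / (1 + v * \<tau> n d p lam) else 0))\<bar> \<le>
       E + (E\<^sup>2 + 2 * (\<bar>\<mu>\<bar> / lam) * E) + (\<bar>\<mu>\<bar> / lam)\<^sup>2 * E" by auto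
qed

text \<open>This is \<open>mat_tr_resolvent_eq\<close> in expectation: each of the p column forms is
  within the square root of \<open>err\<close> of the same function of \<tau>, so \<tau> solves a
  scalar equation up to a vanishing error.\<close>

lemma tau_fixed_point:
  "\<bar>(1 - lam * \<tau> n d p lam) - real p / real n * (v * \<tau> n d p lam / (1 + v * \<tau> n d p lam))\<bar> \<le> real p / real n * sqrt (err lam n d)"
proof -
  let ?t = "\<tau> n d p lam"
  let ?g = "v * ?t / (1 + v * ?t)"
  have "(\<Sum>j<p. form n {..<p} lam \<phi> \<phi> j X) = real n - lam * (real n * trn n {..<p} lam X)" for X
    unfolding form_def trn_def G_def using mat_tr_resolvent_eq[OF lam, of n "apply_entries \<phi> X" "{..<p}"] n by simp
  then have "(\<integral>X. (\<Sum>j<p. form n {..<p} lam \<phi> \<phi> j X) \<partial>gram_law n d) = real n - lam * (real n * ?t)"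
    unfolding \<tau>_def using tau_bounds(3)[OF lam n p] by (simp add: P.prob_space)
  then have eq: "(\<Sum>j<p. \<integral>X. form n {..<p} lam \<phi> \<phi> j X \<partial>gram_law n d) = real n * (1 - lam * ?t)"
    using form_phi_phi_limit(1) by (subst (asm) Bochner_Integration.integral_sum) (auto simp: algebra_simps)
  have "real n * (1 - lam * ?t) - real p * ?g = (\<Sum>j<p. (\<integral>X. form n {..<p} lam \<phi> \<phi> j X \<partial>gram_law n d) - ?g)"
    unfolding sum_subtractf eq by simp
  then have "\<bar>real n * (1 - lam * ?t) - real p * ?g\<bar> \<le> (\<Sum>j<p. \<bar>(\<integral>X. form n {..<p} lam \<phi> \<phi> j X \<partial>gram_law n d) - ?g\<bar>)"
    by (simp only: sum_abs)
  also have "\<dots> \<le> (\<Sum>j<p. sqrt (err lam n d))"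
    by (intro sum_mono form_phi_phi_limit(2)) auto
  finally have le: "\<bar>real n * (1 - lam * ?t) - real p * ?g\<bar> \<le> real p * sqrt (err lam n d)" by simp
  have "(1 - lam * ?t) - real p / real n * ?g = (real n * (1 - lam * ?t) - real p * ?g) / real n"
    using n by (simp add: diff_divide_distrib)
  then show ?thesis using divide_right_mono[OF le, of "real n"] n by (simp add: abs_divide)
qed

end

end

subsection \<open>Resolvent moments of the Marchenko--Pastur law\<close>

text \<open>An antiderivative of \<open>sqrt ((b - x) (x - a)) / (x + c)\<close> on \<open>(a, b)\<close>.\<close>

definition mp_aux :: "real \<Rightarrow> real \<Rightarrow> real \<Rightarrow> real \<Rightarrow> real" where
  "mp_aux a b c x = sqrt ((b - x) * (x - a)) + ((a + b) / 2 + c) * arcsin ((2 * x - a - b) / (b - a))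
    - (if a + c = 0 then 0 else sqrt ((a + c) * (b + c)) *
        arcsin (((a + b + 2 * c) * (x + c) - 2 * (a + c) * (b + c)) / ((x + c) * (b - a))))"

text \<open>Denominator minus numerator and denominator plus numerator factor as 2 (a + c) (b - x)
  and 2 (b + c) (x - a), both nonnegative on the interval. The bound makes the arcsine continuous up
  to the edges.\<close>

lemma arcsin_arg_bound:
  fixes a b c x :: real
  assumes "a < b" "a + c > 0" "a \<le> x" "x \<le> b"
  shows "\<bar>((a + b + 2 * c) * (x + c) - 2 * (a + c) * (b + c)) / ((x + c) * (b - a))\<bar> \<le> 1"
proof -
  have p: "(x + c) * (b - a) > 0" using assms by simp
  define P where "P = (x + c) * (b - a)"
  define M where "M = (a + b + 2 * c) * (x + c) - 2 * (a + c) * (b + c)"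
  have "P - M = 2 * (a + c) * (b - x)" "P + M = 2 * (b + c) * (x - a)"
    by (simp_all add: P_def M_def algebra_simps)
  moreover have "2 * (a + c) * (b - x) \<ge> 0" "2 * (b + c) * (x - a) \<ge> 0" using assms by auto
  ultimately have "P - M \<ge> 0" "P + M \<ge> 0" by simp_all
  then have "\<bar>M\<bar> \<le> P" by linarith
  then show ?thesis using p unfolding P_def[symmetric] M_def[symmetric] by (simp add: abs_divide)
qed

text \<open>Between the edges each arcsine runs from -pi / 2 to pi / 2 and the square root vanishes
  at both ends, which leaves pi times a difference of coefficients. The fundamental theorem is
  applied with interior derivatives, since the square root and the arcsines are singular at the
  edges. The degenerate case a + c = 0 occurs later for \<gamma> = 1 and c = 0.\<close>

lemma mp_integral:
  fixes a b c :: real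
  assumes ab: "0 \<le> a" "a < b" and c: "c \<ge> 0"
  shows "((\<lambda>x. sqrt ((b - x) * (x - a)) / (x + c)) has_integral
     pi * ((a + b) / 2 + c - sqrt ((a + c) * (b + c)))) {a..b}"
proof -
  have ac: "a + c \<ge> 0" using ab c by simp
  have d1: "((\<lambda>x. arcsin ((2 * x - a - b) / (b - a))) has_real_derivative 1 / sqrt ((b - x) * (x - a))) (at x)"
    if x: "a < x" "x < b" for x
  proof -
    define u where "u = (2 * x - a - b) / (b - a)"
    have u1: "-1 < u" "u < 1" using x ab by (auto simp: u_def field_simps)
    have "1 - u\<^sup>2 = ((b - a)\<^sup>2 - (2 * x - a - b)\<^sup>2) / (b - a)\<^sup>2"
      unfolding u_def power_divide using ab by (simp add: diff_divide_distrib[of "(b - a)\<^sup>2"])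
    also have "(b - a)\<^sup>2 - (2 * x - a - b)\<^sup>2 = 4 * ((b - x) * (x - a))"
      by (simp add: power2_eq_square algebra_simps)
    finally have e: "sqrt (1 - u\<^sup>2) = 2 * sqrt ((b - x) * (x - a)) / (b - a)"
      using ab by (simp add: real_sqrt_divide real_sqrt_mult)
    have pos: "sqrt ((b - x) * (x - a)) > 0" using x by simp
    have "((\<lambda>x. arcsin ((2 * x - a - b) / (b - a))) has_real_derivative inverse (sqrt (1 - u\<^sup>2)) * (2 / (b - a))) (at x)"
    proof (rule DERIV_chain2[where g = "\<lambda>x. (2 * x - a - b) / (b - a)"])
      show "(arcsin has_real_derivative inverse (sqrt (1 - u\<^sup>2))) (at ((2 * x - a - b) / (b - a)))"
        using DERIV_arcsin[OF u1] unfolding u_def .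
      show "((\<lambda>x. (2 * x - a - b) / (b - a)) has_real_derivative 2 / (b - a)) (at x)"
        by (rule DERIV_cdivide) (auto intro!: derivative_eq_intros)
    qed
    also have "inverse (sqrt (1 - u\<^sup>2)) * (2 / (b - a)) = 1 / sqrt ((b - x) * (x - a))"
      unfolding e using ab pos by (simp add: field_simps)
    finally show ?thesis .
  qed
  have d2: "((\<lambda>x. arcsin (((a + b + 2 * c) * (x + c) - 2 * (a + c) * (b + c)) / ((x + c) * (b - a)))) has_real_derivative
      sqrt ((a + c) * (b + c)) / ((x + c) * sqrt ((b - x) * (x - a)))) (at x)"
    if x: "a < x" "x < b" and ac: "a + c > 0" for x
  proof -
    define u where "u = (\<lambda>x. ((a + b + 2 * c) * (x + c) - 2 * (a + c) * (b + c)) / ((x + c) * (b - a)))"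
    have xc: "x + c > 0" "b - a > 0" "b + c > 0" using x ac ab by auto
    have e1: "1 - (u x)\<^sup>2 = (1 - u x) * (1 + u x)" by (simp add: power2_eq_square algebra_simps)
    \<comment> \<open>1 - u and 1 + u factor through b - x and x - a, which makes 1 - u^2 a perfect
      square in terms of S and Q.\<close>
    have e2: "1 - u x = 2 * (a + c) * (b - x) / ((x + c) * (b - a))"
    proof -
      have "1 - u x = ((x + c) * (b - a) - ((a + b + 2 * c) * (x + c) - 2 * (a + c) * (b + c))) / ((x + c) * (b - a))"
        unfolding u_def diff_divide_distrib[of "(x + c) * (b - a)"] using xc by simp
      also have "(x + c) * (b - a) - ((a + b + 2 * c) * (x + c) - 2 * (a + c) * (b + c)) = 2 * (a + c) * (b - x)"
        by (simp add: algebra_simps)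
      finally show ?thesis .
    qed
    have e3: "1 + u x = 2 * (b + c) * (x - a) / ((x + c) * (b - a))"
    proof -
      have "1 + u x = ((x + c) * (b - a) + ((a + b + 2 * c) * (x + c) - 2 * (a + c) * (b + c))) / ((x + c) * (b - a))"
        unfolding u_def add_divide_distrib[of "(x + c) * (b - a)"] using xc by simp
      also have "(x + c) * (b - a) + ((a + b + 2 * c) * (x + c) - 2 * (a + c) * (b + c)) = 2 * (b + c) * (x - a)"
        by (simp add: algebra_simps)
      finally show ?thesis .
    qed
    have "1 - u x > 0" "1 + u x > 0" unfolding e2 e3 using xc x ac by auto
    then have u1: "-1 < u x" "u x < 1" by auto
    define S where "S = sqrt ((a + c) * (b + c))"
    define Q where "Q = sqrt ((b - x) * (x - a))"
    have SQ: "S > 0" "Q > 0" using xc x ac by (auto simp: S_def Q_def)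
    have SS: "S * S = (a + c) * (b + c)" using ac xc by (simp add: S_def)
    have "1 - (u x)\<^sup>2 = (2 * S * Q / ((x + c) * (b - a)))\<^sup>2"
    proof -
      have "S\<^sup>2 = (a + c) * (b + c)" "Q\<^sup>2 = (b - x) * (x - a)" using xc x ac by (auto simp: S_def Q_def)
      then have "(2 * S * Q / ((x + c) * (b - a)))\<^sup>2 = 4 * ((a + c) * (b + c)) * ((b - x) * (x - a)) / ((x + c) * (b - a))\<^sup>2"
        by (simp add: power_divide power_mult_distrib)
      also have "\<dots> = (2 * (a + c) * (b - x)) * (2 * (b + c) * (x - a)) / (((x + c) * (b - a)) * ((x + c) * (b - a)))"
      proof -
        have "4 * ((a + c) * (b + c)) * ((b - x) * (x - a)) = (2 * (a + c) * (b - x)) * (2 * (b + c) * (x - a))"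
        proof -
          have "4 * (A * B) * (C * D) = (2 * A * C) * (2 * B * D)" for A B C D :: real by (simp add: mult_ac)
          then show ?thesis .
        qed
        then show ?thesis by (simp only: power2_eq_square)
      qed
      also have "\<dots> = 1 - (u x)\<^sup>2"
        unfolding e1 e2 e3 by simp
      finally show ?thesis ..
    qed
    then have e: "sqrt (1 - (u x)\<^sup>2) = 2 * S * Q / ((x + c) * (b - a))"
      using SQ xc by simp
    have du: "(u has_real_derivative 2 * (S * S) / ((x + c)\<^sup>2 * (b - a))) (at x)"
    proof -
      have "u y = (a + b + 2 * c) / (b - a) - 2 * (a + c) * (b + c) / (b - a) * inverse (y + c)" if "y + c \<noteq> 0" for y
      proof -
        have "(m * Y - k) / (Y * w) = m / w - k / w * inverse Y" if "Y \<noteq> 0" "w \<noteq> 0" for m Y k w :: real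
          using that by (simp add: field_simps)
        from this[OF that] xc show ?thesis unfolding u_def by simp
      qed
      then have ev: "eventually (\<lambda>y. u y = (a + b + 2 * c) / (b - a) - 2 * (a + c) * (b + c) / (b - a) * inverse (y + c)) (nhds x)"
        using xc by (intro eventually_nhds_in_open[of "{- c<..}", THEN eventually_mono]) auto
      have dv: "((\<lambda>y. (a + b + 2 * c) / (b - a) - 2 * (a + c) * (b + c) / (b - a) * inverse (y + c)) has_real_derivative
          2 * (S * S) / ((x + c)\<^sup>2 * (b - a))) (at x)"
      proof -
        have "((\<lambda>y. A - k * inverse (y + c)) has_real_derivative k * (inverse (x + c) * inverse (x + c))) (at x)" for A k
          using xc by (auto intro!: derivative_eq_intros simp: power2_eq_square)
        moreover have "2 * (a + c) * (b + c) / (b - a) * (inverse (x + c) * inverse (x + c)) = 2 * (S * S) / ((x + c)\<^sup>2 * (b - a))"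
        proof -
          have "2 * (a + c) * (b + c) = 2 * (S * S)" unfolding SS by (rule mult.assoc)
          then show ?thesis by (simp only: divide_inverse power2_eq_square inverse_mult_distrib mult_ac)
        qed
        ultimately show ?thesis by metis
      qed
      show ?thesis by (rule DERIV_cong_ev[OF refl ev refl, THEN iffD2, OF dv])
    qed
    have "((\<lambda>x. arcsin (u x)) has_real_derivative inverse (sqrt (1 - (u x)\<^sup>2)) * (2 * (S * S) / ((x + c)\<^sup>2 * (b - a)))) (at x)"
      by (rule DERIV_chain2[OF DERIV_arcsin du]) (use u1 in auto)
    also have "inverse (sqrt (1 - (u x)\<^sup>2)) * (2 * (S * S) / ((x + c)\<^sup>2 * (b - a))) = S / ((x + c) * Q)"
      unfolding e using SQ xc by (simp add: power2_eq_square)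
    finally show ?thesis unfolding u_def S_def Q_def .
  qed
  have "((\<lambda>x. sqrt ((b - x) * (x - a)) / (x + c)) has_integral mp_aux a b c b - mp_aux a b c a) {a..b}"
  proof (rule fundamental_theorem_of_calculus_interior)
    show "a \<le> b" using ab by simp
    have c1: "continuous_on {a..b} (\<lambda>x. arcsin ((2 * x - a - b) / (b - a)))"
      by (intro continuous_intros) (use ab in \<open>auto simp: field_simps\<close>)
    have c2: "continuous_on {a..b} (\<lambda>x. arcsin (((a + b + 2 * c) * (x + c) - 2 * (a + c) * (b + c)) / ((x + c) * (b - a))))"
      if "a + c > 0"
    proof (intro continuous_intros ballI)
      fix x assume "x \<in> {a..b}"
      then have "a \<le> x" "x \<le> b" by auto
      have unit: "- 1 \<le> y \<and> y \<le> 1" if "\<bar>y\<bar> \<le> 1" for y :: real using that by auto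
      show "- 1 \<le> ((a + b + 2 * c) * (x + c) - 2 * (a + c) * (b + c)) / ((x + c) * (b - a)) \<and>
          ((a + b + 2 * c) * (x + c) - 2 * (a + c) * (b + c)) / ((x + c) * (b - a)) \<le> 1"
        by (rule unit[OF arcsin_arg_bound[OF ab(2) that \<open>a \<le> x\<close> \<open>x \<le> b\<close>]])
      show "(x + c) * (b - a) \<noteq> 0" using \<open>a \<le> x\<close> that ab by auto
    qed
    show "continuous_on {a..b} (mp_aux a b c)"
      unfolding mp_aux_def using c1 c2 ac
      by (cases "a + c = 0") (auto intro!: continuous_intros)
    fix x assume "x \<in> {a<..<b}"
    then have x: "a < x" "x < b" by auto
    define Q where "Q = sqrt ((b - x) * (x - a))"
    have Q: "Q > 0" "Q * Q = (b - x) * (x - a)" using x by (auto simp: Q_def)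
    have xc: "x + c > 0" using x ab c by simp
    have dQ: "((\<lambda>x. sqrt ((b - x) * (x - a))) has_real_derivative (a + b - 2 * x) / (2 * Q)) (at x)"
    proof -
      have "((\<lambda>x. (b - x) * (x - a)) has_real_derivative (a + b - 2 * x)) (at x)"
        by (auto intro!: derivative_eq_intros)
      from DERIV_chain2[OF DERIV_real_sqrt this]
      have "((\<lambda>x. sqrt ((b - x) * (x - a))) has_real_derivative inverse (sqrt ((b - x) * (x - a))) / 2 * (a + b - 2 * x)) (at x)"
        using x by simp
      moreover have "inverse (sqrt ((b - x) * (x - a))) / 2 * (a + b - 2 * x) = (a + b - 2 * x) / (2 * Q)"
        unfolding Q_def[symmetric] by (simp only: divide_inverse inverse_mult_distrib mult_ac)
      ultimately show ?thesis by metis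
    qed
    \<comment> \<open>Over the common denominator (x + c) Q the numerators of the three derivatives
      collapse to (b - x) (x - a) = Q^2.\<close>
    have alg: "(a + b - 2 * x) / (2 * Q) + ((a + b) / 2 + c) * (1 / Q) - (a + c) * (b + c) / ((x + c) * Q) = Q / (x + c)"
    proof -
      have "(a + b - 2 * x) / (2 * Q) + ((a + b) / 2 + c) * (1 / Q) - (a + c) * (b + c) / ((x + c) * Q)
         = ((a + b + c - x) * (x + c) - (a + c) * (b + c)) / ((x + c) * Q)"
      proof -
        have "(a + b - 2 * x) / (2 * Q) + ((a + b) / 2 + c) * (1 / Q) = (a + b + c - x) / Q"
          using Q(1) by (simp add: field_simps)
        moreover have "m / Q - k / (Y * Q) = (m * Y - k) / (Y * Q)" if "Y > 0" for m k Y
          using that by (simp add: diff_divide_distrib)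
        ultimately show ?thesis using xc by metis
      qed
      also have "(a + b + c - x) * (x + c) - (a + c) * (b + c) = Q * Q"
        unfolding Q by (simp add: algebra_simps)
      finally show ?thesis using Q(1) by simp
    qed
    have "(mp_aux a b c has_real_derivative Q / (x + c)) (at x)"
    proof (cases "a + c = 0")
      case True
      have "((\<lambda>x. sqrt ((b - x) * (x - a)) + ((a + b) / 2 + c) * arcsin ((2 * x - a - b) / (b - a)))
          has_real_derivative (a + b - 2 * x) / (2 * Q) + ((a + b) / 2 + c) * (1 / Q)) (at x)"
        using d1[OF x] unfolding Q_def[symmetric] by (intro DERIV_add dQ DERIV_cmult)
      then show ?thesis unfolding mp_aux_def using True alg by simp
    next
      case False
      then have ac': "a + c > 0" using ac by simp
      define S where "S = sqrt ((a + c) * (b + c))"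
      have SS: "S * (S / ((x + c) * Q)) = (a + c) * (b + c) / ((x + c) * Q)"
        using ac' ab c by (simp add: S_def)
      have "((\<lambda>x. sqrt ((b - x) * (x - a)) + ((a + b) / 2 + c) * arcsin ((2 * x - a - b) / (b - a))
          - S * arcsin (((a + b + 2 * c) * (x + c) - 2 * (a + c) * (b + c)) / ((x + c) * (b - a))))
          has_real_derivative (a + b - 2 * x) / (2 * Q) + ((a + b) / 2 + c) * (1 / Q) - S * (S / ((x + c) * Q))) (at x)"
        using d1[OF x] d2[OF x ac'] unfolding Q_def[symmetric] S_def[symmetric]
        by (intro DERIV_diff DERIV_add dQ DERIV_cmult)
      from this[unfolded SS alg] show ?thesis
        unfolding mp_aux_def[abs_def] S_def[symmetric] if_not_P[OF False] .
    qed
    then show "(mp_aux a b c has_vector_derivative sqrt ((b - x) * (x - a)) / (x + c)) (at x)"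
      unfolding Q_def by (simp add: has_real_derivative_iff_has_vector_derivative)
  qed
  moreover have "mp_aux a b c b - mp_aux a b c a = pi * ((a + b) / 2 + c - sqrt ((a + c) * (b + c)))"
  proof -
    have 1: "(2 * b - a - b) / (b - a) = 1" "(2 * a - a - b) / (b - a) = - 1" using ab by (auto simp: field_simps)
    have 2: "((a + b + 2 * c) * (b + c) - 2 * (a + c) * (b + c)) / ((b + c) * (b - a)) = 1"
      "((a + b + 2 * c) * (a + c) - 2 * (a + c) * (b + c)) / ((a + c) * (b - a)) = - 1" if "a + c > 0"
    proof -
      have nz: "(b + c) * (b - a) \<noteq> 0" "(a + c) * (b - a) \<noteq> 0" using that ab by auto
      have "(a + b + 2 * c) * (b + c) - 2 * (a + c) * (b + c) = (b + c) * (b - a)"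
        "(a + b + 2 * c) * (a + c) - 2 * (a + c) * (b + c) = - ((a + c) * (b - a))"
        by (simp_all add: algebra_simps)
      then show "((a + b + 2 * c) * (b + c) - 2 * (a + c) * (b + c)) / ((b + c) * (b - a)) = 1"
        "((a + b + 2 * c) * (a + c) - 2 * (a + c) * (b + c)) / ((a + c) * (b - a)) = - 1"
        using nz by simp_all
    qed
    show ?thesis unfolding mp_aux_def 1
      using 2 ac by (cases "a + c = 0") (auto simp: algebra_simps)
  qed
  ultimately show ?thesis by simp
qed


text \<open>A pointwise limit of decreasing convex functions has, at points of differentiability, the limit of
  the slopes as its slope.\<close>

lemma secant_limit:
  fixes f s :: "nat \<Rightarrow> real \<Rightarrow> real"
  assumes f: "\<And>x. x > 0 \<Longrightarrow> (\<lambda>n. f n x) \<longlonglongrightarrow> F x"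
    and sec: "eventually (\<lambda>n. \<forall>x y. 0 < x \<longrightarrow> x < y \<longrightarrow> (y - x) * s n y \<le> f n x - f n y \<and> f n x - f n y \<le> (y - x) * s n x) sequentially"
    and D: "(F has_real_derivative D) (at x)" and x: "x > 0"
  shows "(\<lambda>n. s n x) \<longlonglongrightarrow> - D"
proof (rule tendstoI)
  fix e :: real assume e: "e > 0"
  have "((\<lambda>y. (F y - F x) / (y - x)) \<longlongrightarrow> D) (at x)"
    using D by (simp add: has_field_derivative_iff)
  then have "eventually (\<lambda>y. dist ((F y - F x) / (y - x)) D < e / 2) (at x)"
    using e by (intro tendstoD) auto
  then obtain r where r: "r > 0" "\<And>y. y \<noteq> x \<Longrightarrow> dist y x < r \<Longrightarrow> dist ((F y - F x) / (y - x)) D < e / 2"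
    unfolding eventually_at by auto
  \<comment> \<open>Half of \<open>min r x\<close> keeps x - h positive and both difference
    quotients in the range where they approximate D.\<close>
  define h where "h = min r x / 2"
  have h: "h > 0" "h < r" "h < x" using r x by (auto simp: h_def)
  have right: "\<bar>(F (x + h) - F x) / h - D\<bar> < e / 2" using r(2)[of "x + h"] h by (simp add: dist_real_def)
  have left: "\<bar>(F x - F (x - h)) / h - D\<bar> < e / 2"
  proof -
    have "(F (x - h) - F x) / (x - h - x) = (F x - F (x - h)) / h" by (simp add: field_simps minus_divide_left)
    then show ?thesis using r(2)[of "x - h"] h by (simp add: dist_real_def)
  qed
  have l1: "(\<lambda>n. (f n x - f n (x + h)) / h) \<longlonglongrightarrow> (F x - F (x + h)) / h"
    by (intro tendsto_intros f) (use x h in auto)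
  have l2: "(\<lambda>n. (f n (x - h) - f n x) / h) \<longlonglongrightarrow> (F (x - h) - F x) / h"
    by (intro tendsto_intros f) (use x h in auto)
  have e1: "eventually (\<lambda>n. dist ((f n x - f n (x + h)) / h) ((F x - F (x + h)) / h) < e / 2) sequentially"
    using l1 e by (intro tendstoD) auto
  have e2: "eventually (\<lambda>n. dist ((f n (x - h) - f n x) / h) ((F (x - h) - F x) / h) < e / 2) sequentially"
    using l2 e by (intro tendstoD) auto
  show "eventually (\<lambda>n. dist (s n x) (- D) < e) sequentially"
    using sec e1 e2
  proof eventually_elim
    case (elim n)
    have "f n x - f n (x + h) \<le> h * s n x" "h * s n x \<le> f n (x - h) - f n x"
      using elim(1)[rule_format, of x "x + h"] elim(1)[rule_format, of "x - h" x] x h by auto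
    then have "(f n x - f n (x + h)) / h \<le> s n x" "s n x \<le> (f n (x - h) - f n x) / h"
      using h by (simp_all add: field_simps)
    moreover have "(F x - F (x + h)) / h = - ((F (x + h) - F x) / h)" "(F (x - h) - F x) / h = - ((F x - F (x - h)) / h)"
      by (simp_all add: minus_divide_left)
    ultimately show ?case
      using elim(2,3) right left unfolding dist_real_def by linarith
  qed
qed

section \<open>Integration against the Marchenko--Pastur law and its first two resolvent
  moments\<close>

lemma nn_integral_marchenko_pastur:
  assumes f: "f \<in> borel_measurable borel"
  shows "(\<integral>\<^sup>+ x. f x \<partial>marchenko_pastur \<gamma>) = ennreal (max 0 (1 - 1 / \<gamma>)) * f 0 +
     (\<integral>\<^sup>+ x. ennreal (marchenko_pastur_density \<gamma> x) * f x \<partial>lborel)"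
proof -
  have d[measurable]: "marchenko_pastur_density \<gamma> \<in> borel_measurable borel"
    unfolding marchenko_pastur_density_def Let_def by measurable
  let ?D = "density lborel (\<lambda>x. ennreal (marchenko_pastur_density \<gamma> x))"
  have "(\<integral>\<^sup>+ x. f x \<partial>marchenko_pastur \<gamma>) = ennreal (max 0 (1 - 1 / \<gamma>)) * f 0 + (\<integral>\<^sup>+ x. f x \<partial>?D)"
    using f
  proof (induction f rule: borel_measurable_induct)
    case (cong f g)
    then show ?case by (simp cong: nn_integral_cong)
  next
    case (set A)
    then show ?case
      by (simp add: nn_integral_indicator emeasure_marchenko_pastur)
  next
    case (mult u c)
    then show ?case
      by (simp add: nn_integral_cmult distrib_left mult_ac)
  next
    case (add u w)
    then show ?case
      by (simp add: nn_integral_add distrib_left add_ac)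
  next
    case (seq U)
    have mono: "incseq (\<lambda>i. \<integral>\<^sup>+ x. U i x \<partial>?D)" "incseq (\<lambda>i. ennreal (max 0 (1 - 1 / \<gamma>)) * U i 0)"
      using seq(3) by (auto simp: incseq_def le_fun_def intro!: nn_integral_mono mult_left_mono)
    have "(\<integral>\<^sup>+ x. (SUP i. U i x) \<partial>marchenko_pastur \<gamma>) = (SUP i. \<integral>\<^sup>+ x. U i x \<partial>marchenko_pastur \<gamma>)"
      using seq by (intro nn_integral_monotone_convergence_SUP) auto
    also have "\<dots> = (SUP i. ennreal (max 0 (1 - 1 / \<gamma>)) * U i 0 + (\<integral>\<^sup>+ x. U i x \<partial>?D))"
      by (intro SUP_cong refl) (use seq in auto)
    also have "\<dots> = (SUP i. ennreal (max 0 (1 - 1 / \<gamma>)) * U i 0) + (SUP i. \<integral>\<^sup>+ x. U i x \<partial>?D)"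
      by (rule ennreal_SUP_add[OF mono(2,1)])
    also have "(SUP i. \<integral>\<^sup>+ x. U i x \<partial>?D) = (\<integral>\<^sup>+ x. (SUP i. U i x) \<partial>?D)"
      using seq by (intro nn_integral_monotone_convergence_SUP[symmetric]) auto
    also have "(SUP i. ennreal (max 0 (1 - 1 / \<gamma>)) * U i 0) = ennreal (max 0 (1 - 1 / \<gamma>)) * (SUP i. U i 0)"
      by (rule SUP_mult_left_ennreal[symmetric])
    finally show ?case by (simp add: SUP_apply image_comp)
  qed
  then show ?thesis using f by (simp add: nn_integral_density)
qed

context
  fixes \<gamma> a b :: real
  assumes g: "\<gamma> > 0" and a: "a = (1 - sqrt \<gamma>)\<^sup>2" and b: "b = (1 + sqrt \<gamma>)\<^sup>2"
begin

lemma mp_edges: "0 \<le> a" "a < b" "a + b = 2 * (1 + \<gamma>)" "a * b = (1 - \<gamma>)\<^sup>2"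
proof -
  have s: "sqrt \<gamma> > 0" "sqrt \<gamma> * sqrt \<gamma> = \<gamma>" using g by auto
  show "0 \<le> a" by (simp add: a)
  show "a < b" unfolding a b using s by (simp add: power2_eq_square algebra_simps)
  show "a + b = 2 * (1 + \<gamma>)" unfolding a b using s by (simp add: power2_eq_square algebra_simps)
  have "a * b = ((1 - sqrt \<gamma>) * (1 + sqrt \<gamma>))\<^sup>2" unfolding a b by (simp add: power_mult_distrib)
  also have "(1 - sqrt \<gamma>) * (1 + sqrt \<gamma>) = 1 - \<gamma>" using s by (simp add: algebra_simps)
  finally show "a * b = (1 - \<gamma>)\<^sup>2" .
qed

lemma mp_density_eq:
  "marchenko_pastur_density \<gamma> x = (if a \<le> x \<and> x \<le> b then sqrt ((b - x) * (x - a)) / (2 * pi * \<gamma> * x) else 0)"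
  unfolding marchenko_pastur_density_def Let_def a b by (simp add: indicator_def)

lemma mp_density_nonneg: "marchenko_pastur_density \<gamma> x \<ge> 0"
  unfolding mp_density_eq using mp_edges g by auto

lemma mp_density_neg: "x < 0 \<Longrightarrow> marchenko_pastur_density \<gamma> x = 0"
  unfolding mp_density_eq using mp_edges by auto

lemma mp_density_measurable [measurable]: "marchenko_pastur_density \<gamma> \<in> borel_measurable borel"
  unfolding marchenko_pastur_density_def Let_def by measurable

lemma mp_AE_nonneg: "AE x in marchenko_pastur \<gamma>. x \<ge> 0"
proof (rule AE_I[where N = "{..<0}"])
  have "(\<integral>\<^sup>+ x. ennreal (marchenko_pastur_density \<gamma> x) * indicator {..<0} x \<partial>lborel) = (\<integral>\<^sup>+ x. 0 \<partial>(lborel :: real measure))"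
    by (intro nn_integral_cong) (auto simp: indicator_def mp_density_neg)
  then show "emeasure (marchenko_pastur \<gamma>) {..<0} = 0"
    using nn_integral_marchenko_pastur[of "indicator {..<0}" \<gamma>] by (simp add: nn_integral_indicator)
qed auto

text \<open>\<open>mp_integral\<close> with c = 0 evaluates the mass of the continuous part; its
  finiteness makes the bounded resolvent integrands integrable.\<close>

lemma finite_measure_mp: "finite_measure (marchenko_pastur \<gamma>)"
proof (rule finite_measureI)
  have "((\<lambda>x. 1 / (2 * pi * \<gamma>) * (sqrt ((b - x) * (x - a)) / (x + 0))) has_integral
     1 / (2 * pi * \<gamma>) * (pi * ((a + b) / 2 + 0 - sqrt ((a + 0) * (b + 0))))) {a..b}"
    by (intro has_integral_mult_right mp_integral) (use mp_edges in auto)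
  then have "(marchenko_pastur_density \<gamma> has_integral
     1 / (2 * pi * \<gamma>) * (pi * ((a + b) / 2 + 0 - sqrt ((a + 0) * (b + 0))))) UNIV"
    by (subst (asm) has_integral_restrict_UNIV[symmetric]) (erule has_integral_eq[rotated], simp add: mp_density_eq)
  from nn_integral_has_integral_lborel[OF mp_density_measurable mp_density_nonneg this]
  have "(\<integral>\<^sup>+ x. ennreal (marchenko_pastur_density \<gamma> x) \<partial>lborel) < \<infinity>" by simp
  then show "emeasure (marchenko_pastur \<gamma>) (space (marchenko_pastur \<gamma>)) \<noteq> \<infinity>"
    using nn_integral_marchenko_pastur[of "\<lambda>_. 1" \<gamma>] by (simp add: ennreal_mult_eq_top_iff ennreal_add_eq_top)
qed

lemma mp_integrable_bounded:
  fixes f :: "real \<Rightarrow> real"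
  assumes "f \<in> borel_measurable borel" "\<And>x. x \<ge> 0 \<Longrightarrow> \<bar>f x\<bar> \<le> B"
  shows "integrable (marchenko_pastur \<gamma>) f"
proof -
  interpret finite_measure "marchenko_pastur \<gamma>" by (rule finite_measure_mp)
  show ?thesis
    by (rule integrable_const_bound[of _ B]) (use mp_AE_nonneg assms in auto)
qed

lemma mp_integrable_resolvent:
  assumes "l > 0"
  shows "integrable (marchenko_pastur \<gamma>) (\<lambda>x. 1 / (x + l) ^ k)"
proof (rule mp_integrable_bounded)
  fix x :: real assume "x \<ge> 0"
  then have "(x + l) ^ k \<ge> l ^ k" "(x + l) ^ k > 0" using assms by (auto intro: power_mono)
  then show "\<bar>1 / (x + l) ^ k\<bar> \<le> 1 / l ^ k"
    using assms by (simp add: frac_le)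
qed simp

text \<open>Partial fractions of 1 / (x (x + l)) turn the continuous part into two values of
  \<open>mp_integral\<close>. The term |1 - \<gamma>| at c = 0 combines with the atom at 0, so one
  formula covers both \<gamma> < 1 and \<gamma> \<ge> 1.\<close>

lemma resolvent_moment_1:
  assumes l: "l > 0"
  shows "resolvent_moment 1 \<gamma> l = (\<gamma> - 1 - l + sqrt ((l + \<gamma> - 1)\<^sup>2 + 4 * l)) / (2 * \<gamma> * l)"
proof -
  \<comment> \<open>The integrand is cut off on x < 0, a null set of the law, so that it is
    nonnegative everywhere and nonnegative integration applies.\<close>
  define f where "f = (\<lambda>x. if x \<ge> 0 then 1 / (x + l) else 0)"
  have [measurable]: "f \<in> borel_measurable borel" unfolding f_def by measurable
  have f0: "f x \<ge> 0" for x using l by (simp add: f_def)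
  define D where "D = sqrt ((l + \<gamma> - 1)\<^sup>2 + 4 * l)"
  have abl: "(a + l) * (b + l) = (l + \<gamma> - 1)\<^sup>2 + 4 * l"
  proof -
    have "(a + l) * (b + l) = a * b + (a + b) * l + l\<^sup>2" by (simp add: power2_eq_square algebra_simps)
    then show ?thesis unfolding mp_edges by (simp add: power2_eq_square algebra_simps)
  qed
  define J where "J = 1 / (2 * \<gamma> * l) * (- \<bar>1 - \<gamma>\<bar> - l + D)"
  have h: "((\<lambda>x. 1 / (2 * pi * \<gamma> * l) * (sqrt ((b - x) * (x - a)) / (x + 0) - sqrt ((b - x) * (x - a)) / (x + l))) has_integral
     1 / (2 * pi * \<gamma> * l) * (pi * ((a + b) / 2 + 0 - sqrt ((a + 0) * (b + 0))) - pi * ((a + b) / 2 + l - sqrt ((a + l) * (b + l))))) {a..b}"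
    by (intro has_integral_mult_right has_integral_diff mp_integral) (use mp_edges l in auto)
  have ab0: "sqrt ((a + 0) * (b + 0)) = \<bar>1 - \<gamma>\<bar>" using mp_edges(4) by simp
  have J: "1 / (2 * pi * \<gamma> * l) * (pi * ((a + b) / 2 + 0 - sqrt ((a + 0) * (b + 0))) - pi * ((a + b) / 2 + l - sqrt ((a + l) * (b + l)))) = J"
    unfolding ab0 abl J_def D_def[symmetric] using g l by (simp add: field_simps)
  have pt: "1 / (2 * pi * \<gamma> * l) * (sqrt ((b - x) * (x - a)) / (x + 0) - sqrt ((b - x) * (x - a)) / (x + l)) =
      marchenko_pastur_density \<gamma> x * f x" if x: "x \<in> {a..b}" for x
  \<comment> \<open>The point x = 0 lies in the support only if a = 0; then the square root vanishes
    there and both sides are 0.\<close>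
  proof (cases "x = 0")
    case True
    then have "a = 0" using x mp_edges(1) by auto
    then show ?thesis using True by (simp add: mp_density_eq)
  next
    case False
    then have "x > 0" using x mp_edges(1) by auto
    have "1 / (2 * pi * \<gamma> * l) * (s / x - s / (x + l)) = s / (2 * pi * \<gamma> * x) * (1 / (x + l))" for s
    proof -
      have "s / x - s / (x + l) = s * l / (x * (x + l))" using \<open>x > 0\<close> l by (simp add: field_simps)
      then show ?thesis using l by simp
    qed
    then show ?thesis using x \<open>x > 0\<close> by (simp add: mp_density_eq f_def)
  qed
  have "((\<lambda>x. marchenko_pastur_density \<gamma> x * f x) has_integral J) {a..b}"
    by (rule has_integral_eq[OF pt h[unfolded J]])
  then have "((\<lambda>x. marchenko_pastur_density \<gamma> x * f x) has_integral J) UNIV"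
    by (subst (asm) has_integral_restrict_UNIV[symmetric])
       (erule has_integral_eq[rotated], auto simp: mp_density_eq)
  from nn_integral_has_integral_lborel[OF _ _ this]
  have nJ: "(\<integral>\<^sup>+ x. ennreal (marchenko_pastur_density \<gamma> x * f x) \<partial>lborel) = ennreal J"
    using mp_density_nonneg f0 by simp
  have J0: "J \<ge> 0"
  proof -
    have "((\<lambda>x. marchenko_pastur_density \<gamma> x * f x) has_integral J) UNIV" by fact
    then show ?thesis by (rule has_integral_nonneg) (simp add: mp_density_nonneg f0)
  qed
  have "resolvent_moment 1 \<gamma> l = integral\<^sup>L (marchenko_pastur \<gamma>) f"
    unfolding resolvent_moment_def
    by (rule integral_cong_AE) (use mp_AE_nonneg in \<open>auto simp: f_def\<close>)
  also have "\<dots> = enn2real (\<integral>\<^sup>+ x. ennreal (f x) \<partial>marchenko_pastur \<gamma>)"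
    by (rule integral_eq_nn_integral) (use f0 in auto)
  also have "(\<integral>\<^sup>+ x. ennreal (f x) \<partial>marchenko_pastur \<gamma>) = ennreal (max 0 (1 - 1 / \<gamma>)) * ennreal (f 0) + ennreal J"
    unfolding nJ[symmetric] using mp_density_nonneg f0
    by (subst nn_integral_marchenko_pastur) (auto simp: ennreal_mult)
  also have "\<dots> = ennreal (max 0 (1 - 1 / \<gamma>) * f 0 + J)"
    using f0 J0 by (simp add: ennreal_mult ennreal_plus)
  also have "enn2real \<dots> = max 0 (1 - 1 / \<gamma>) * f 0 + J"
    using f0 J0 by (intro enn2real_ennreal) simp
  also have "\<dots> = (\<gamma> - 1 - l + D) / (2 * \<gamma> * l)"
  proof (cases "\<gamma> \<ge> 1")
    case True
    then have "max 0 (1 - 1 / \<gamma>) = 1 - 1 / \<gamma>" "\<bar>1 - \<gamma>\<bar> = \<gamma> - 1" by auto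
    then show ?thesis unfolding J_def f_def using g l by (simp add: field_simps)
  next
    case False
    then have "max 0 (1 - 1 / \<gamma>) = 0" "\<bar>1 - \<gamma>\<bar> = 1 - \<gamma>" using g by auto
    then show ?thesis unfolding J_def by (simp add: algebra_simps)
  qed
  finally show ?thesis unfolding D_def .
qed

text \<open>The closed form of the first moment is differentiable, and its slope is identified by
  the tangent inequalities under the integral, through \<open>secant_limit\<close> applied to
  constant sequences.\<close>

lemma resolvent_moment_deriv:
  assumes l: "l > 0"
  shows "(resolvent_moment 1 \<gamma> has_real_derivative - resolvent_moment 2 \<gamma> l) (at l)"
proof -
  define R where "R = (\<lambda>l. (\<gamma> - 1 - l + sqrt ((l + \<gamma> - 1)\<^sup>2 + 4 * l)) / (2 * \<gamma> * l))"
  have pos: "(l + \<gamma> - 1)\<^sup>2 + 4 * l > 0" using l by (simp add: add_nonneg_pos)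
  have "R field_differentiable at l"
    unfolding R_def field_differentiable_def using l g pos
    by (intro exI) (auto intro!: derivative_eq_intros)
  then obtain D where D: "(R has_real_derivative D) (at l)" unfolding field_differentiable_def by blast
  have ev: "eventually (\<lambda>x. resolvent_moment 1 \<gamma> x = R x) (nhds l)"
    using l resolvent_moment_1 unfolding R_def
    by (intro eventually_nhds_in_open[of "{0<..}", THEN eventually_mono]) auto
  have D: "(resolvent_moment 1 \<gamma> has_real_derivative D) (at l)"
    by (rule DERIV_cong_ev[OF refl ev refl, THEN iffD2, OF D])
  have sec: "(y - x) * resolvent_moment 2 \<gamma> y \<le> resolvent_moment 1 \<gamma> x - resolvent_moment 1 \<gamma> y \<and>
      resolvent_moment 1 \<gamma> x - resolvent_moment 1 \<gamma> y \<le> (y - x) * resolvent_moment 2 \<gamma> x"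
    if xy: "0 < x" "x < y" for x y
  proof -
    have y: "0 < y" using xy by simp
    have eq: "resolvent_moment 1 \<gamma> x - resolvent_moment 1 \<gamma> y = (\<integral>t. 1 / (t + x) ^ 1 - 1 / (t + y) ^ 1 \<partial>marchenko_pastur \<gamma>)"
      unfolding resolvent_moment_def using mp_integrable_resolvent[OF xy(1), of 1] mp_integrable_resolvent[OF y, of 1] by simp
    have mul: "(y - x) * resolvent_moment 2 \<gamma> z = (\<integral>t. (y - x) * (1 / (t + z) ^ 2) \<partial>marchenko_pastur \<gamma>)" for z
      unfolding resolvent_moment_def by (rule integral_mult_right_zero[symmetric])
    have pt: "1 / (t + x) ^ 1 - 1 / (t + y) ^ 1 = (y - x) * (1 / ((t + x) * (t + y)))" if "t \<ge> 0" for t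
      using that xy by (simp add: field_simps)
    have up: "1 / ((t + x) * (t + y)) \<le> 1 / (t + x)\<^sup>2" "1 / (t + y)\<^sup>2 \<le> 1 / ((t + x) * (t + y))" if "t \<ge> 0" for t
      using that xy by (auto simp: power2_eq_square intro!: divide_left_mono mult_mono)
    show ?thesis unfolding eq mul
    proof (intro conjI integral_mono_AE)
      show "AE t in marchenko_pastur \<gamma>. (y - x) * (1 / (t + y)\<^sup>2) \<le> 1 / (t + x) ^ 1 - 1 / (t + y) ^ 1"
        using mp_AE_nonneg
      proof eventually_elim
        case (elim t)
        then show ?case unfolding pt[OF elim] using up xy by (intro mult_left_mono) auto
      qed
      show "AE t in marchenko_pastur \<gamma>. 1 / (t + x) ^ 1 - 1 / (t + y) ^ 1 \<le> (y - x) * (1 / (t + x)\<^sup>2)"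
        using mp_AE_nonneg
      proof eventually_elim
        case (elim t)
        then show ?case unfolding pt[OF elim] using up xy by (intro mult_left_mono) auto
      qed
    qed (intro Bochner_Integration.integrable_diff Bochner_Integration.integrable_mult_right
          mp_integrable_resolvent y xy(1))+
  qed
  have "(\<lambda>n::nat. resolvent_moment 2 \<gamma> l) \<longlonglongrightarrow> - D"
    by (rule secant_limit[where f = "\<lambda>_. resolvent_moment 1 \<gamma>" and s = "\<lambda>_. resolvent_moment 2 \<gamma>" and F = "resolvent_moment 1 \<gamma>"])
       (use sec D l in auto)
  then have "resolvent_moment 2 \<gamma> l = - D" by (simp add: LIMSEQ_const_iff)
  then show ?thesis using D by simp
qed

text \<open>The right-hand side is the integral of \<open>(l\<^sup>2 + c x) / (x + l)\<^sup>2\<close>, which exceeds its value at \<open>l = c\<close>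
  by the integral of \<open>x (l - c)\<^sup>2 / ((x + l)\<^sup>2 (x + c))\<close>.\<close>

lemma resolvent_moment_minimum:
  assumes l: "l > 0" and c: "c > 0" and lc: "l \<noteq> c"
  shows "c\<^sup>2 * resolvent_moment 2 \<gamma> c + c * (resolvent_moment 1 \<gamma> c - c * resolvent_moment 2 \<gamma> c) <
    l\<^sup>2 * resolvent_moment 2 \<gamma> l + c * (resolvent_moment 1 \<gamma> l - l * resolvent_moment 2 \<gamma> l)"
proof -
  interpret finite_measure "marchenko_pastur \<gamma>" by (rule finite_measure_mp)
  define h where "h = (\<lambda>l x. l\<^sup>2 * (1 / (x + l)\<^sup>2) + c * (1 / (x + l) ^ 1 - l * (1 / (x + l)\<^sup>2)))"
  have h: "integrable (marchenko_pastur \<gamma>) (h l)"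
    "integral\<^sup>L (marchenko_pastur \<gamma>) (h l) = l\<^sup>2 * resolvent_moment 2 \<gamma> l + c * (resolvent_moment 1 \<gamma> l - l * resolvent_moment 2 \<gamma> l)"
    if "l > 0" for l
    unfolding h_def resolvent_moment_def
    using mp_integrable_resolvent[OF that, of 1] mp_integrable_resolvent[OF that, of 2]
    by (simp_all del: power_one_right times_divide_eq_right)
  have diff: "h l x - h c x = x * (l - c)\<^sup>2 / ((x + l)\<^sup>2 * (x + c))" if "x \<ge> 0" for x
  proof -
    have p: "x + l > 0" "x + c > 0" using that l c by auto
    have 1: "h l x = (l\<^sup>2 + c * x) / (x + l)\<^sup>2" if "x + l > 0" for l
    proof -
      have "1 / (x + l) = (x + l) / (x + l)\<^sup>2" using that by (simp add: power2_eq_square)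
      then have "h l x = (l\<^sup>2 + c * ((x + l) - l)) / (x + l)\<^sup>2"
        unfolding h_def by (simp add: add_divide_distrib diff_divide_distrib algebra_simps)
      then show ?thesis by simp
    qed
    have 2: "h c x = c / (x + c)"
    proof -
      have "c\<^sup>2 + c * x = c * (x + c)" by (simp add: power2_eq_square algebra_simps)
      then show ?thesis unfolding 1[OF p(2)] using p by (simp add: power2_eq_square)
    qed
    have "h l x - h c x = ((l\<^sup>2 + c * x) * (x + c) - c * (x + l)\<^sup>2) / ((x + l)\<^sup>2 * (x + c))"
      unfolding 1[OF p(1)] 2 using p by (simp add: diff_frac_eq)
    also have "(l\<^sup>2 + c * x) * (x + c) - c * (x + l)\<^sup>2 = x * (l - c)\<^sup>2"
      by (simp add: power2_eq_square algebra_simps)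
    finally show ?thesis .
  qed
  \<comment> \<open>Strictness comes from the open support interval: it has positive mass and lies
    in x > 0, where the difference of the integrands is positive.\<close>
  have "integral\<^sup>L (marchenko_pastur \<gamma>) (h c) < integral\<^sup>L (marchenko_pastur \<gamma>) (h l)"
  proof (rule integral_less_AE[OF h(1)[OF c] h(1)[OF l], of "{a<..<b}"])
    have "emeasure (marchenko_pastur \<gamma>) {a<..<b} \<ge> emeasure (density lborel (\<lambda>x. ennreal (marchenko_pastur_density \<gamma> x))) {a<..<b}"
      by (subst emeasure_marchenko_pastur) auto
    moreover have "emeasure (density lborel (\<lambda>x. ennreal (marchenko_pastur_density \<gamma> x))) {a<..<b} \<noteq> 0"
    proof
      assume "emeasure (density lborel (\<lambda>x. ennreal (marchenko_pastur_density \<gamma> x))) {a<..<b} = 0"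
      then have "(\<integral>\<^sup>+ x. ennreal (marchenko_pastur_density \<gamma> x) * indicator {a<..<b} x \<partial>lborel) = 0"
        by (subst (asm) emeasure_density) auto
      then have "AE x in lborel. ennreal (marchenko_pastur_density \<gamma> x) * indicator {a<..<b} x = 0"
        by (subst (asm) nn_integral_0_iff_AE) auto
      then have "AE x in lborel. x \<notin> {a<..<b}"
      proof eventually_elim
        case (elim x)
        show ?case
        proof
          assume x: "x \<in> {a<..<b}"
          then have "marchenko_pastur_density \<gamma> x > 0"
            unfolding mp_density_eq using mp_edges(1) g by auto
          then show False using elim x by simp
        qed
      qed
      then have "emeasure lborel {a<..<b} = 0"
        by (subst (asm) AE_iff_measurable[where N = "{a<..<b}"]) auto
      then show False using mp_edges(2) by simp
    qed
    ultimately show "emeasure (marchenko_pastur \<gamma>) {a<..<b} \<noteq> 0" by (metis le_zero_eq)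
    show "AE x in marchenko_pastur \<gamma>. x \<in> {a<..<b} \<longrightarrow> h c x \<noteq> h l x"
    proof (intro AE_I2 impI)
      fix x assume "x \<in> {a<..<b}"
      then have x: "x > 0" using mp_edges(1) by auto
      have "x * (l - c)\<^sup>2 / ((x + l)\<^sup>2 * (x + c)) > 0"
        using x l c lc by simp
      then show "h c x \<noteq> h l x" using diff[of x] x by simp
    qed
    show "AE x in marchenko_pastur \<gamma>. h c x \<le> h l x"
      using mp_AE_nonneg
    proof eventually_elim
      case (elim x)
      have "x * (l - c)\<^sup>2 / ((x + l)\<^sup>2 * (x + c)) \<ge> 0" using elim l c by simp
      then show ?case using diff[OF elim] by simp
    qed
  qed simp
  then show ?thesis unfolding h(2)[OF c] h(2)[OF l] .
qed

end

section \<open>Forms in the squared resolvent as slopes of forms in the resolvent\<close>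

context activation
begin

definition form2 :: "nat \<Rightarrow> nat set \<Rightarrow> real \<Rightarrow> nat \<Rightarrow> (nat \<times> nat \<Rightarrow> real) \<Rightarrow> real" where
  "form2 n K lam k X =
    (G n K lam X *\<^sub>v col_vec n X k) \<bullet> (G n K lam X *\<^sub>v col_vec n X k) / real n"

text \<open>By symmetry of G this is tr(G^2) / n, written as squared lengths so that
  \<open>resolvent_secant\<close> applies term by term.\<close>

definition trn2 :: "nat \<Rightarrow> nat set \<Rightarrow> real \<Rightarrow> (nat \<times> nat \<Rightarrow> real) \<Rightarrow> real" where
  "trn2 n K lam X = (\<Sum>i<n. (G n K lam X *\<^sub>v unit_vec n i) \<bullet> (G n K lam X *\<^sub>v unit_vec n i)) / real n"

lemma apply_entries_id [simp]: "apply_entries (\<lambda>z. z) X = X"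
  by (simp add: apply_entries_def)

lemma form2_nonneg: "0 \<le> form2 n K lam k X"
  by (simp add: form2_def sq_norm_real_nonneg)

lemma trn2_nonneg: "0 \<le> trn2 n K lam X"
  by (simp add: trn2_def sq_norm_real_nonneg sum_nonneg)

lemma form2_le:
  assumes "lam > 0"
  shows "lam * form2 n K lam k X \<le> form n K lam (\<lambda>z. z) (\<lambda>z. z) k X"
  unfolding form2_def form_def G_def apply_entries_id times_divide_eq_right
  by (intro divide_right_mono resolvent_form_ge[OF assms]) auto

lemma trn2_le:
  assumes "lam > 0" "n > 0"
  shows "trn2 n K lam X \<le> 1 / lam\<^sup>2"
proof -
  have "trn2 n K lam X \<le> (real n / lam\<^sup>2) / real n"
    unfolding trn2_def G_def resolvent_frobenius_alt[OF assms(1)]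
    by (intro divide_right_mono resolvent_frobenius_le assms) auto
  then show ?thesis using assms by simp
qed

lemma measurable_form2:
  assumes "{..<n} \<times> insert k K \<subseteq> A"
  shows "form2 n K lam k \<in> borel_measurable (PiM A (\<lambda>_. N01))"
proof -
  have "form2 n K lam k X = (\<Sum>i<n. (\<Sum>l<n. G n K lam X $$ (i, l) * X (l, k))\<^sup>2) / real n" for X
    unfolding form2_def
    by (simp add: scalar_prod_def atLeast0LessThan col_vec_def power2_eq_square carrier_matD[OF G_carrier])
  moreover have "(\<lambda>X. X (l, k)) \<in> borel_measurable (PiM A (\<lambda>_. N01))" if "l < n" for l
    using that assms measurable_entry[of "\<lambda>z. z" "(l, k)" A] by auto
  moreover have "(\<lambda>X. G n K lam X $$ (i, l)) \<in> borel_measurable (PiM A (\<lambda>_. N01))" if "i < n" "l < n" for i l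
    using that assms by (intro measurable_G) auto
  ultimately show ?thesis
    by (subst measurable_cong) (auto intro!: borel_measurable_divide borel_measurable_sum borel_measurable_power borel_measurable_times)
qed

lemma measurable_trn2:
  assumes "{..<n} \<times> K \<subseteq> A" "lam > 0"
  shows "trn2 n K lam \<in> borel_measurable (PiM A (\<lambda>_. N01))"
proof -
  have "trn2 n K lam X = (\<Sum>i<n. \<Sum>k<n. (G n K lam X $$ (i, k))\<^sup>2) / real n" for X
    unfolding trn2_def G_def resolvent_frobenius_alt[OF assms(2)] ..
  moreover have "(\<lambda>X. G n K lam X $$ (i, l)) \<in> borel_measurable (PiM A (\<lambda>_. N01))" if "i < n" "l < n" for i l
    using that assms by (intro measurable_G) auto
  ultimately show ?thesis
    by (subst measurable_cong) (auto intro!: borel_measurable_divide borel_measurable_sum borel_measurable_power)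
qed

lemma form2_secant:
  assumes "0 < lam" "lam < lam'"
  shows "(lam' - lam) * form2 n K lam' k X \<le> form n K lam (\<lambda>z. z) (\<lambda>z. z) k X - form n K lam' (\<lambda>z. z) (\<lambda>z. z) k X"
    "form n K lam (\<lambda>z. z) (\<lambda>z. z) k X - form n K lam' (\<lambda>z. z) (\<lambda>z. z) k X \<le> (lam' - lam) * form2 n K lam k X"
  unfolding form2_def form_def G_def apply_entries_id times_divide_eq_right diff_divide_distrib[symmetric]
  using resolvent_secant[OF assms, of "col_vec n X k"] by (auto intro!: divide_right_mono)

lemma trn2_secant:
  assumes "0 < lam" "lam < lam'"
  shows "(lam' - lam) * trn2 n K lam' X \<le> trn n K lam X - trn n K lam' X"
    "trn n K lam X - trn n K lam' X \<le> (lam' - lam) * trn2 n K lam X"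
proof -
  have l': "lam' > 0" using assms by simp
  note s = resolvent_secant[OF assms, of "unit_vec n _", OF unit_vec_carrier]
  have t: "trn n K lam X = (\<Sum>i<n. unit_vec n i \<bullet> (G n K lam X *\<^sub>v unit_vec n i)) / real n" if "lam > 0" for lam
    unfolding trn_def G_def mat_tr_resolvent_alt[OF that] ..
  show "(lam' - lam) * trn2 n K lam' X \<le> trn n K lam X - trn n K lam' X"
    "trn n K lam X - trn n K lam' X \<le> (lam' - lam) * trn2 n K lam X"
    unfolding t[OF assms(1)] t[OF l'] trn2_def times_divide_eq_right diff_divide_distrib[symmetric]
      sum_distrib_left sum_subtractf[symmetric] G_def
    by (rule divide_right_mono[OF sum_mono[OF s(1)]], simp)
       (rule divide_right_mono[OF sum_mono[OF s(2)]], simp)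
qed

text \<open>There are p terms but the divisor is d: each signal coordinate has variance \<alpha>^2 /
  d, and the cross term of the risk involves the first p coordinates only.\<close>

definition avg_cross :: "nat \<Rightarrow> nat \<Rightarrow> nat \<Rightarrow> real \<Rightarrow> real" where
  "avg_cross n d p lam = (\<Sum>k<p. \<integral>X. form n {..<p} lam (\<lambda>z. z) \<phi> k X \<partial>gram_law n d) / real d"

definition avg_form :: "nat \<Rightarrow> nat \<Rightarrow> nat \<Rightarrow> real \<Rightarrow> real" where
  "avg_form n d p lam = (\<Sum>k<d. \<integral>X. form n {..<p} lam (\<lambda>z. z) (\<lambda>z. z) k X \<partial>gram_law n d) / real d"

definition avg_form2 :: "nat \<Rightarrow> nat \<Rightarrow> nat \<Rightarrow> real \<Rightarrow> real" where
  "avg_form2 n d p lam = (\<Sum>k<d. \<integral>X. form2 n {..<p} lam k X \<partial>gram_law n d) / real d"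

definition \<tau>2 :: "nat \<Rightarrow> nat \<Rightarrow> nat \<Rightarrow> real \<Rightarrow> real" where
  "\<tau>2 n d p lam = (\<integral>X. trn2 n {..<p} lam X \<partial>gram_law n d)"

lemma integrable_form2:
  assumes "lam > 0" "n > 0" "p \<le> d" "k < d"
  shows "integrable (gram_law n d) (form2 n {..<p} lam k)"
proof (rule Bochner_Integration.integrable_bound)
  show "integrable (gram_law n d) (\<lambda>X. form n {..<p} lam (\<lambda>z. z) (\<lambda>z. z) k X / lam)"
    using form_id_id_limit(1)[OF assms] by simp
  show "form2 n {..<p} lam k \<in> borel_measurable (gram_law n d)"
    by (rule measurable_form2) (use assms in auto)
  have "form2 n {..<p} lam k X \<le> form n {..<p} lam (\<lambda>z. z) (\<lambda>z. z) k X / lam" for X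
    using form2_le[OF assms(1), of n "{..<p}" k X] assms(1) by (simp add: field_simps)
  then show "AE X in gram_law n d. norm (form2 n {..<p} lam k X) \<le> norm (form n {..<p} lam (\<lambda>z. z) (\<lambda>z. z) k X / lam)"
    using form2_nonneg form_nonneg[OF assms(1)] assms(1) by (intro AE_I2) auto
qed

lemma integrable_trn2:
  assumes "lam > 0" "n > 0" "p \<le> d"
  shows "integrable (gram_law n d) (trn2 n {..<p} lam)"
proof -
  interpret P: prob_space "gram_law n d" by (rule gram_prob)
  have "trn2 n {..<p} lam \<in> borel_measurable (gram_law n d)"
    by (rule measurable_trn2) (use assms in auto)
  then show ?thesis
    by (rule P.integrable_const_bound[of _ "1 / lam\<^sup>2", rotated])
       (use trn2_nonneg trn2_le[OF assms(1,2)] in auto)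
qed

text \<open>The tangent inequalities hold for every realisation and every column, so they survive
  expectation and averaging; they are the hypothesis of \<open>secant_limit\<close>.\<close>

lemma avg_form_secant:
  assumes "0 < lam" "lam < lam'" "n > 0" "p \<le> d"
  shows "(lam' - lam) * avg_form2 n d p lam' \<le> avg_form n d p lam - avg_form n d p lam'"
    "avg_form n d p lam - avg_form n d p lam' \<le> (lam' - lam) * avg_form2 n d p lam"
proof -
  have l': "lam' > 0" using assms by simp
  note i = form_id_id_limit(1)[OF assms(1,3,4)] form_id_id_limit(1)[OF l' assms(3,4)]
    integrable_form2[OF assms(1,3,4)] integrable_form2[OF l' assms(3,4)]
  have e: "avg_form n d p lam - avg_form n d p lam' =
     (\<Sum>k<d. \<integral>X. form n {..<p} lam (\<lambda>z. z) (\<lambda>z. z) k X - form n {..<p} lam' (\<lambda>z. z) (\<lambda>z. z) k X \<partial>gram_law n d) / real d"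
    unfolding avg_form_def diff_divide_distrib[symmetric] sum_subtractf[symmetric] using i by simp
  have e2: "c * avg_form2 n d p l = (\<Sum>k<d. \<integral>X. c * form2 n {..<p} l k X \<partial>gram_law n d) / real d" for c l
    unfolding avg_form2_def by (simp add: sum_distrib_left)
  show "(lam' - lam) * avg_form2 n d p lam' \<le> avg_form n d p lam - avg_form n d p lam'"
    "avg_form n d p lam - avg_form n d p lam' \<le> (lam' - lam) * avg_form2 n d p lam"
    unfolding e e2
    by (intro divide_right_mono sum_mono integral_mono form2_secant[OF assms(1,2)];
        use i in auto)+
qed

lemma tau_secant:
  assumes "0 < lam" "lam < lam'" "n > 0" "p \<le> d"
  shows "(lam' - lam) * \<tau>2 n d p lam' \<le> \<tau> n d p lam - \<tau> n d p lam'"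
    "\<tau> n d p lam - \<tau> n d p lam' \<le> (lam' - lam) * \<tau>2 n d p lam"
proof -
  have l': "lam' > 0" using assms by simp
  note i = tau_bounds(3)[OF assms(1,3,4)] tau_bounds(3)[OF l' assms(3,4)]
    integrable_trn2[OF assms(1,3,4)] integrable_trn2[OF l' assms(3,4)]
  have e: "\<tau> n d p lam - \<tau> n d p lam' = (\<integral>X. trn n {..<p} lam X - trn n {..<p} lam' X \<partial>gram_law n d)"
    unfolding \<tau>_def using i by simp
  have e2: "c * \<tau>2 n d p l = (\<integral>X. c * trn2 n {..<p} l X \<partial>gram_law n d)" for c l
    unfolding \<tau>2_def by simp
  show "(lam' - lam) * \<tau>2 n d p lam' \<le> \<tau> n d p lam - \<tau> n d p lam'"
    "\<tau> n d p lam - \<tau> n d p lam' \<le> (lam' - lam) * \<tau>2 n d p lam"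
    unfolding e e2
    by (intro integral_mono trn2_secant[OF assms(1,2)]; use i in auto)+
qed

end

lemma abs_avg_le:
  fixes f :: "nat \<Rightarrow> real"
  assumes "\<And>k. k < m \<Longrightarrow> \<bar>f k\<bar> \<le> B"
  shows "\<bar>(\<Sum>k<m. f k) / real d\<bar> \<le> real m * B / real d"
proof -
  have "\<bar>\<Sum>k<m. f k\<bar> \<le> (\<Sum>k<m. B)"
    by (rule order_trans[OF sum_abs sum_mono]) (use assms in auto)
  then show ?thesis unfolding abs_divide by (simp add: divide_right_mono)
qed

subsection \<open>Limits of the resolvent averages\<close>

locale regime = activation +
  fixes \<pi> \<delta> \<gamma> :: real and p n :: "nat \<Rightarrow> nat"
  assumes pi: "\<pi> \<in> {0<..1}" and delta: "\<delta> > 0" and pd: "\<And>d. p d \<le> d"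
    and lim_p: "(\<lambda>d. real (p d) / real d) \<longlonglongrightarrow> \<pi>" and lim_n: "(\<lambda>d. real d / real (n d)) \<longlonglongrightarrow> \<delta>"
    and gam: "\<gamma> = \<pi> * \<delta>"
begin

lemma gamma_pos: "\<gamma> > 0"
  using pi delta gam by simp

text \<open>Division by 0 gives 0, so positive limits of the two ratios eventually force all three
  dimensions to be positive.\<close>

lemma eventually_pos: "eventually (\<lambda>d. d > 0 \<and> p d > 0 \<and> n d > 0) sequentially"
proof -
  have "eventually (\<lambda>d. real (p d) / real d > 0) sequentially"
    using order_tendstoD(1)[OF lim_p, of 0] pi by simp
  moreover have "eventually (\<lambda>d. real d / real (n d) > 0) sequentially"
    using order_tendstoD(1)[OF lim_n, of 0] delta by simp
  ultimately show ?thesis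
    by eventually_elim (auto simp: zero_less_divide_iff)
qed

lemma lim_inverse_n: "(\<lambda>d. 1 / real (n d)) \<longlonglongrightarrow> 0"
proof -
  have "(\<lambda>d. real d / real (n d) * (1 / real d)) \<longlonglongrightarrow> \<delta> * 0"
    by (intro tendsto_mult lim_n lim_1_over_n)
  moreover have "eventually (\<lambda>d. real d / real (n d) * (1 / real d) = 1 / real (n d)) sequentially"
    using eventually_pos by eventually_elim auto
  ultimately have "(\<lambda>d. 1 / real (n d)) \<longlonglongrightarrow> \<delta> * 0"
    by (rule Lim_transform_eventually)
  then show ?thesis by simp
qed

lemma lim_p_n: "(\<lambda>d. real (p d) / real (n d)) \<longlonglongrightarrow> \<gamma>"
proof -
  have "(\<lambda>d. real (p d) / real d * (real d / real (n d))) \<longlonglongrightarrow> \<gamma>"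
    unfolding gam by (intro tendsto_mult lim_n lim_p)
  moreover have "eventually (\<lambda>d. real (p d) / real d * (real d / real (n d)) = real (p d) / real (n d)) sequentially"
    using eventually_pos by eventually_elim auto
  ultimately show ?thesis by (rule Lim_transform_eventually)
qed

lemma lim_err: "(\<lambda>d. err lam (n d) d) \<longlonglongrightarrow> 0"
proof -
  define C where "C = form_const N01 \<phi> \<phi> + form_const N01 (\<lambda>z. z) \<phi> + form_const N01 (\<lambda>z. z) (\<lambda>z. z)"
  define M where "M = (max 1 (max v \<bar>\<mu>\<bar>))\<^sup>2"
  define e where "e = (\<lambda>d. 1 / real (n d))"
  define r where "r = (\<lambda>d. real d / real (n d))"
  define c where "c = 1 / lam\<^sup>2"
  have "(\<lambda>d. 3 * (C * c * e d + M * ((e d)\<^sup>2 * c + 4 * r d * e d * c)))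
     \<longlonglongrightarrow> 3 * (C * c * 0 + M * (0\<^sup>2 * c + 4 * \<delta> * 0 * c))"
    by (intro tendsto_intros lim_inverse_n[folded e_def] lim_n[folded r_def])
  moreover have "3 * (C * c * e d + M * ((e d)\<^sup>2 * c + 4 * r d * e d * c)) = err lam (n d) d" for d
    unfolding err_def C_def[symmetric] M_def[symmetric] e_def r_def c_def
    by (simp add: power_mult_distrib power_divide) (simp add: power2_eq_square mult_ac)
  ultimately show ?thesis by simp
qed

lemma lim_sqrt_err: "(\<lambda>d. sqrt (err lam (n d) d)) \<longlonglongrightarrow> 0"
  using tendsto_real_sqrt[OF lim_err] by simp

abbreviation "\<theta>1 \<equiv> resolvent_moment 1 \<gamma>"
abbreviation "\<theta>2 \<equiv> resolvent_moment 2 \<gamma>"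

text \<open>The Stieltjes transform at -l of the n \<times> n companion limit law at unit variance:
  its nonzero eigenvalues are those of the p \<times> p matrix, and the surplus n - p of zero
  eigenvalues, possibly negative, accounts for (1 - \<gamma>) / l.\<close>

definition T :: "real \<Rightarrow> real" where
  "T l = \<gamma> * \<theta>1 l + (1 - \<gamma>) / l"

text \<open>T is the positive root of l T^2 + (l + \<gamma> - 1) T = 1, which is the fixed-point
  equation after clearing the denominator; the root is read off from the closed form of
  \<open>\<theta>1\<close>.\<close>

lemma T_facts:
  assumes l: "l > 0"
  shows "T l > 0" "T l / (1 + T l) = 1 - l * \<theta>1 l" "1 - l * T l = \<gamma> * (T l / (1 + T l))"
proof -
  define s where "s = l + \<gamma> - 1"
  define D where "D = sqrt (s\<^sup>2 + 4 * l)"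
  have D2: "D\<^sup>2 = s\<^sup>2 + 4 * l" using l by (simp add: D_def)
  have Ds: "D > \<bar>s\<bar>"
  proof -
    have "sqrt (s\<^sup>2) < D" unfolding D_def using l by (intro real_sqrt_less_mono) simp
    then show ?thesis by simp
  qed
  have th: "\<theta>1 l = (\<gamma> - 1 - l + D) / (2 * \<gamma> * l)"
    using resolvent_moment_1[OF gamma_pos refl refl l] by (simp add: D_def s_def)
  have T: "T l = (D - s) / (2 * l)"
    unfolding T_def th s_def using l gamma_pos by (simp add: field_simps)
  show T0: "T l > 0" unfolding T using Ds l by auto
  have quad: "l * (T l)\<^sup>2 + s * T l = 1"
  proof -
    have "l * (T l)\<^sup>2 + s * T l = T l * (l * T l + s)" by (simp add: power2_eq_square algebra_simps)
    also have "l * T l + s = (D + s) / 2" unfolding T using l by (simp add: field_simps)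
    also have "T l * ((D + s) / 2) = (D\<^sup>2 - s\<^sup>2) / (4 * l)" unfolding T by (simp add: power2_eq_square algebra_simps)
    also have "\<dots> = 1" unfolding D2 using l by simp
    finally show ?thesis .
  qed
  have "(1 - l * T l) * (1 + T l) = \<gamma> * T l"
    using quad unfolding s_def by (simp add: power2_eq_square algebra_simps)
  then show fp: "1 - l * T l = \<gamma> * (T l / (1 + T l))"
    unfolding times_divide_eq_right using T0 by (subst nonzero_eq_divide_eq) auto
  have "1 - l * T l = \<gamma> * (1 - l * \<theta>1 l)" unfolding T_def using l by (simp add: field_simps)
  then have "\<gamma> * (T l / (1 + T l)) = \<gamma> * (1 - l * \<theta>1 l)" using fp by (rule trans[OF sym, rotated])
  then show "T l / (1 + T l) = 1 - l * \<theta>1 l"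
    by (metis gamma_pos mult_cancel_left order_less_irrefl)
qed

text \<open>Scaling the activation to unit variance replaces lam by lam / v and divides the
  resolvent by v.\<close>

definition t :: "real \<Rightarrow> real" where "t lam = T (lam / v) / v"

lemma t_facts:
  assumes "lam > 0"
  shows "t lam > 0" "v * t lam = T (lam / v)" "1 - lam * t lam = \<gamma> * (v * t lam / (1 + v * t lam))"
  using T_facts[of "lam / v"] assms vpos by (auto simp: t_def)

text \<open>The function 1 - lam x - \<gamma> g(x) decreases in x with slope at most -lam, because g
  is increasing. An approximate root therefore lies within its residual divided by lam of the exact
  root \<open>t lam\<close>; the residual includes the error of p / n against \<gamma>.\<close>

lemma tau_limit:
  assumes lam: "lam > 0"
  shows "(\<lambda>d. \<tau> (n d) d (p d) lam) \<longlonglongrightarrow> t lam"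
proof -
  define g where "g = (\<lambda>x. v * x / (1 + v * x))"
  have g1: "0 \<le> g x" "g x \<le> 1" if "x \<ge> 0" for x
  proof -
    have "1 + v * x > 0" "v * x \<ge> 0" using that vpos by (auto simp: add_pos_nonneg)
    then show "0 \<le> g x" "g x \<le> 1" by (auto simp: g_def divide_le_eq)
  qed
  have gm: "g x \<le> g y" if "0 \<le> x" "x \<le> y" for x y
  proof -
    have "g z = 1 - 1 / (1 + v * z)" if "z \<ge> 0" for z
    proof -
      have "1 + v * z > 0" using that vpos by (simp add: add_pos_nonneg)
      then show ?thesis by (simp add: g_def field_simps)
    qed
    moreover have "1 / (1 + v * y) \<le> 1 / (1 + v * x)"
      using that vpos by (intro frac_le) (auto simp: add_pos_nonneg)
    ultimately show ?thesis using that by simp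
  qed
  have bound: "\<bar>\<tau> (n d) d (p d) lam - t lam\<bar> \<le>
      (real (p d) / real (n d) * sqrt (err lam (n d) d) + \<bar>real (p d) / real (n d) - \<gamma>\<bar>) / lam"
    if "n d > 0" for d
  proof -
    let ?x = "\<tau> (n d) d (p d) lam" and ?c = "real (p d) / real (n d)"
    have x: "0 \<le> ?x" using tau_bounds[OF lam that pd] by simp
    have fp: "\<bar>(1 - lam * ?x) - ?c * g ?x\<bar> \<le> ?c * sqrt (err lam (n d) d)"
      using tau_fixed_point[OF lam that pd[of d]] by (simp add: g_def)
    have ft: "1 - lam * t lam = \<gamma> * g (t lam)" using t_facts[OF lam] by (simp add: g_def)
    have "\<bar>(?c - \<gamma>) * g ?x\<bar> \<le> \<bar>?c - \<gamma>\<bar> * 1"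
      unfolding abs_mult using g1[OF x] by (intro mult_left_mono) auto
    moreover have "lam * \<bar>?x - t lam\<bar> \<le> \<bar>(1 - lam * ?x) - \<gamma> * g ?x\<bar>"
    proof (cases "?x \<le> t lam")
      case True
      have "\<gamma> * g ?x \<le> \<gamma> * g (t lam)" using gm[OF x True] gamma_pos by simp
      then have "lam * (t lam - ?x) \<le> (1 - lam * ?x) - \<gamma> * g ?x" using ft by (simp add: algebra_simps)
      then show ?thesis using True by simp
    next
      case False
      then have "\<gamma> * g (t lam) \<le> \<gamma> * g ?x" using gm[of "t lam" ?x] t_facts[OF lam] gamma_pos by simp
      then have "lam * (?x - t lam) \<le> - ((1 - lam * ?x) - \<gamma> * g ?x)" using ft by (simp add: algebra_simps)
      then show ?thesis using False by simp
    qed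
    moreover have "(1 - lam * ?x) - \<gamma> * g ?x = ((1 - lam * ?x) - ?c * g ?x) + (?c - \<gamma>) * g ?x"
      by (simp add: algebra_simps)
    moreover have "z \<le> u + w" if "\<bar>b\<bar> \<le> w * 1" "z \<le> \<bar>a'\<bar>" "a' = a + b" "\<bar>a\<bar> \<le> u" for a a' b u w z :: real
      using that by linarith
    ultimately have "lam * \<bar>?x - t lam\<bar> \<le> ?c * sqrt (err lam (n d) d) + \<bar>?c - \<gamma>\<bar>"
      using fp by blast
    then show ?thesis using lam by (simp add: field_simps)
  qed
  define r E where "r = (\<lambda>d. real (p d) / real (n d))" and "E = (\<lambda>d. sqrt (err lam (n d) d))"
  have "(\<lambda>d. (r d * E d + \<bar>r d - \<gamma>\<bar>) / lam) \<longlonglongrightarrow> (\<gamma> * 0 + \<bar>\<gamma> - \<gamma>\<bar>) / lam"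
    using lam by (intro tendsto_intros lim_p_n[folded r_def] lim_sqrt_err[of lam, folded E_def]) auto
  then have lim0: "(\<lambda>d. (real (p d) / real (n d) * sqrt (err lam (n d) d) + \<bar>real (p d) / real (n d) - \<gamma>\<bar>) / lam) \<longlonglongrightarrow> 0"
    by (simp add: r_def E_def)
  have "(\<lambda>d. \<tau> (n d) d (p d) lam - t lam) \<longlonglongrightarrow> 0"
    by (rule Lim_null_comparison[OF _ lim0])
       (use eventually_pos bound in \<open>auto elim!: eventually_mono\<close>)
  then show ?thesis by (simp add: LIM_zero_iff)
qed

lemma avg_cross_limit:
  assumes lam: "lam > 0"
  shows "(\<lambda>d. avg_cross (n d) d (p d) lam) \<longlonglongrightarrow> \<pi> * (\<mu> * t lam / (1 + v * t lam))"
proof -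
  let ?c = "\<lambda>d. \<mu> * \<tau> (n d) d (p d) lam / (1 + v * \<tau> (n d) d (p d) lam)"
  have nz: "1 + v * t lam \<noteq> 0" using mult_pos_pos[OF vpos t_facts(1)[OF lam]] by linarith
  have main: "(\<lambda>d. real (p d) / real d * ?c d) \<longlonglongrightarrow> \<pi> * (\<mu> * t lam / (1 + v * t lam))"
    by (rule tendsto_mult[OF lim_p tendsto_divide[OF tendsto_mult[OF tendsto_const tau_limit[OF lam]]
          tendsto_add[OF tendsto_const tendsto_mult[OF tendsto_const tau_limit[OF lam]]] nz]])
  have b: "\<bar>avg_cross (n d) d (p d) lam - real (p d) / real d * ?c d\<bar> \<le>
      real (p d) / real d * ((1 + \<bar>\<mu>\<bar> / lam) * sqrt (err lam (n d) d))" if "n d > 0" "d > 0" for d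
  proof -
    have eq: "avg_cross (n d) d (p d) lam - real (p d) / real d * ?c d =
       (\<Sum>k<p d. (\<integral>X. form (n d) {..<p d} lam (\<lambda>z. z) \<phi> k X \<partial>gram_law (n d) d) - ?c d) / real d"
      unfolding avg_cross_def sum_subtractf by (simp add: diff_divide_distrib)
    have "\<bar>(\<Sum>k<p d. (\<integral>X. form (n d) {..<p d} lam (\<lambda>z. z) \<phi> k X \<partial>gram_law (n d) d) - ?c d) / real d\<bar> \<le>
        real (p d) * ((1 + \<bar>\<mu>\<bar> / lam) * sqrt (err lam (n d) d)) / real d"
      by (rule abs_avg_le) (rule form_id_phi_limit(2)[OF lam that(1) pd])
    then show ?thesis unfolding eq by (simp only: times_divide_eq_left)
  qed
  have "(\<lambda>d. real (p d) / real d * ((1 + \<bar>\<mu>\<bar> / lam) * sqrt (err lam (n d) d))) \<longlonglongrightarrow> \<pi> * ((1 + \<bar>\<mu>\<bar> / lam) * 0)"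
    by (rule tendsto_mult[OF lim_p]) (rule tendsto_mult[OF tendsto_const lim_sqrt_err])
  then have lim0: "(\<lambda>d. real (p d) / real d * ((1 + \<bar>\<mu>\<bar> / lam) * sqrt (err lam (n d) d))) \<longlonglongrightarrow> 0"
    by (simp only: mult_zero_right)
  have "(\<lambda>d. avg_cross (n d) d (p d) lam - real (p d) / real d * ?c d) \<longlonglongrightarrow> 0"
  proof (rule Lim_null_comparison[OF _ lim0])
    show "eventually (\<lambda>d. norm (avg_cross (n d) d (p d) lam - real (p d) / real d * ?c d) \<le>
        real (p d) / real d * ((1 + \<bar>\<mu>\<bar> / lam) * sqrt (err lam (n d) d))) sequentially"
      using eventually_pos unfolding real_norm_def by eventually_elim (rule b, simp_all)
  qed
  from tendsto_add[OF this main] show ?thesis by (simp only: diff_add_cancel add_0_left)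
qed

text \<open>All d columns contribute \<open>t lam\<close>; the correction occurs only in the p
  columns that enter the features and so carries the factor \<pi>.\<close>

lemma avg_form_limit:
  assumes lam: "lam > 0"
  shows "(\<lambda>d. avg_form (n d) d (p d) lam) \<longlonglongrightarrow> t lam - \<pi> * ((\<mu> * t lam)\<^sup>2 / (1 + v * t lam))"
proof -
  let ?t = "\<lambda>d. \<tau> (n d) d (p d) lam"
  let ?c = "\<lambda>d. (\<mu> * ?t d)\<^sup>2 / (1 + v * ?t d)"
  let ?E = "\<lambda>d. sqrt (err lam (n d) d)"
  let ?B = "\<lambda>d. ?E d + ((?E d)\<^sup>2 + 2 * (\<bar>\<mu>\<bar> / lam) * ?E d) + (\<bar>\<mu>\<bar> / lam)\<^sup>2 * ?E d"
  have nz: "1 + v * t lam \<noteq> 0" using mult_pos_pos[OF vpos t_facts(1)[OF lam]] by linarith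
  have main: "(\<lambda>d. ?t d - real (p d) / real d * ?c d) \<longlonglongrightarrow> t lam - \<pi> * ((\<mu> * t lam)\<^sup>2 / (1 + v * t lam))"
    by (rule tendsto_diff[OF tau_limit[OF lam] tendsto_mult[OF lim_p tendsto_divide[OF
          tendsto_power[OF tendsto_mult[OF tendsto_const tau_limit[OF lam]]]
          tendsto_add[OF tendsto_const tendsto_mult[OF tendsto_const tau_limit[OF lam]]] nz]]])
  have b: "\<bar>avg_form (n d) d (p d) lam - (?t d - real (p d) / real d * ?c d)\<bar> \<le> ?B d" if "n d > 0" "d > 0" for d
  proof -
    have "(\<Sum>k<d. if k < p d then ?c d else 0) = (\<Sum>k<p d. ?c d)"
      by (rule sum.mono_neutral_cong_right) (use pd[of d] in auto)
    then have eq: "avg_form (n d) d (p d) lam - (?t d - real (p d) / real d * ?c d) =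
       (\<Sum>k<d. (\<integral>X. form (n d) {..<p d} lam (\<lambda>z. z) (\<lambda>z. z) k X \<partial>gram_law (n d) d) - (?t d - (if k < p d then ?c d else 0))) / real d"
      unfolding avg_form_def sum_subtractf using that(2) by (simp add: diff_divide_distrib)
    have "\<bar>(\<Sum>k<d. (\<integral>X. form (n d) {..<p d} lam (\<lambda>z. z) (\<lambda>z. z) k X \<partial>gram_law (n d) d) - (?t d - (if k < p d then ?c d else 0))) / real d\<bar> \<le>
        real d * ?B d / real d"
      by (rule abs_avg_le) (rule form_id_id_limit(2)[OF lam that(1) pd])
    moreover have "real d * x / real d = x" for x using that(2) by simp
    ultimately show ?thesis unfolding eq by (simp only:)
  qed
  define E' m where "E' = ?E" and "m = \<bar>\<mu>\<bar> / lam"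
  have "(\<lambda>d. E' d + ((E' d)\<^sup>2 + 2 * m * E' d) + m\<^sup>2 * E' d) \<longlonglongrightarrow> 0 + (0\<^sup>2 + 2 * m * 0) + m\<^sup>2 * 0"
    by (intro tendsto_intros lim_sqrt_err[of lam, folded E'_def])
  then have lim0: "(\<lambda>d. ?B d) \<longlonglongrightarrow> 0"
    unfolding E'_def m_def by simp
  have "(\<lambda>d. avg_form (n d) d (p d) lam - (?t d - real (p d) / real d * ?c d)) \<longlonglongrightarrow> 0"
  proof (rule Lim_null_comparison[OF _ lim0])
    show "eventually (\<lambda>d. norm (avg_form (n d) d (p d) lam - (?t d - real (p d) / real d * ?c d)) \<le> ?B d) sequentially"
      using eventually_pos unfolding real_norm_def by eventually_elim (rule b, simp_all)
  qed
  from tendsto_add[OF this main] show ?thesis by (simp only: diff_add_cancel add_0_left)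
qed

definition T' :: "real \<Rightarrow> real" where
  "T' l = - \<gamma> * \<theta>2 l - (1 - \<gamma>) / l\<^sup>2"

lemma T_deriv:
  assumes "l > 0"
  shows "(T has_real_derivative T' l) (at l)"
  unfolding T_def[abs_def] T'_def using assms resolvent_moment_deriv[OF gamma_pos refl refl assms]
  by (auto intro!: derivative_eq_intros simp: power2_eq_square)
    (metis minus_diff_eq minus_divide_left)

text \<open>Convergence of \<tau> at every positive parameter together with
  \<open>tau_secant\<close> forces the slopes to converge to the slope of \<open>t\<close>.\<close>

lemma tau2_limit:
  assumes lam: "lam > 0"
  shows "(\<lambda>d. \<tau>2 (n d) d (p d) lam) \<longlonglongrightarrow> - (T' (lam / v) / v\<^sup>2)"
proof (rule secant_limit[where F = t, OF tau_limit _ _ lam])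
  show "eventually (\<lambda>d. \<forall>x y. 0 < x \<longrightarrow> x < y \<longrightarrow> (y - x) * \<tau>2 (n d) d (p d) y \<le> \<tau> (n d) d (p d) x - \<tau> (n d) d (p d) y \<and>
      \<tau> (n d) d (p d) x - \<tau> (n d) d (p d) y \<le> (y - x) * \<tau>2 (n d) d (p d) x) sequentially"
    using eventually_pos
  proof eventually_elim
    case (elim d)
    show ?case
    proof (intro allI impI)
      fix x y :: real assume "0 < x" "x < y"
      then show "(y - x) * \<tau>2 (n d) d (p d) y \<le> \<tau> (n d) d (p d) x - \<tau> (n d) d (p d) y \<and>
          \<tau> (n d) d (p d) x - \<tau> (n d) d (p d) y \<le> (y - x) * \<tau>2 (n d) d (p d) x"
        using tau_secant[of x y "n d" "p d" d] elim pd[of d] by simp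
    qed
  qed
  have "((\<lambda>x. T (x / v)) has_real_derivative T' (lam / v) * (1 / v)) (at lam)"
    by (rule DERIV_chain2[OF T_deriv]) (use lam vpos in \<open>auto intro!: derivative_eq_intros\<close>)
  from DERIV_cdivide[OF this, of v] show "(t has_real_derivative T' (lam / v) / v\<^sup>2) (at lam)"
    unfolding t_def[abs_def] by (simp add: power2_eq_square)
qed

text \<open>Since T^2 / (1 + T) = T - T / (1 + T) and T / (1 + T) = 1 - l \<open>\<theta>1\<close>,
  the limit becomes linear in T and l \<open>\<theta>1\<close>, which makes it easy to differentiate
  in \<open>avg_form2_limit\<close>.\<close>

lemma avg_form_limit_alt:
  assumes lam: "lam > 0"
  shows "t lam - \<pi> * ((\<mu> * t lam)\<^sup>2 / (1 + v * t lam)) =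
    (T (lam / v) - \<pi> * (\<mu>\<^sup>2 / v) * (T (lam / v) - 1 + (lam / v) * \<theta>1 (lam / v))) / v"
proof -
  define l where "l = lam / v"
  have l: "l > 0" using lam vpos by (simp add: l_def)
  note T = T_facts[OF l]
  have "(\<mu> * t lam)\<^sup>2 / (1 + v * t lam) = \<mu>\<^sup>2 / v\<^sup>2 * ((T l)\<^sup>2 / (1 + T l))"
    unfolding t_facts(2)[OF lam] l_def[symmetric] unfolding t_def l_def[symmetric]
    by (simp add: power_divide power_mult_distrib)
  also have "(T l)\<^sup>2 / (1 + T l) = T l - T l / (1 + T l)"
    using T(1) by (simp add: field_simps power2_eq_square)
  also have "\<dots> = T l - 1 + l * \<theta>1 l" unfolding T(2) by simp
  finally have e: "(\<mu> * t lam)\<^sup>2 / (1 + v * t lam) = \<mu>\<^sup>2 / v\<^sup>2 * (T l - 1 + l * \<theta>1 l)" .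
  have "T l / v - \<pi> * (\<mu>\<^sup>2 / v\<^sup>2 * y) = (T l - \<pi> * (\<mu>\<^sup>2 / v) * y) / v" for y
    by (simp add: diff_divide_distrib power2_eq_square)
  then show ?thesis unfolding e unfolding t_def l_def[symmetric] .
qed

lemma avg_form2_limit:
  assumes lam: "lam > 0"
  shows "(\<lambda>d. avg_form2 (n d) d (p d) lam) \<longlonglongrightarrow>
    - ((T' (lam / v) - \<pi> * (\<mu>\<^sup>2 / v) * (T' (lam / v) + \<theta>1 (lam / v) - (lam / v) * \<theta>2 (lam / v))) / v\<^sup>2)"
proof (rule secant_limit[where F = "\<lambda>lam. (T (lam / v) - \<pi> * (\<mu>\<^sup>2 / v) * (T (lam / v) - 1 + (lam / v) * \<theta>1 (lam / v))) / v", OF _ _ _ lam])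
  show "(\<lambda>d. avg_form (n d) d (p d) x) \<longlonglongrightarrow> (T (x / v) - \<pi> * (\<mu>\<^sup>2 / v) * (T (x / v) - 1 + (x / v) * \<theta>1 (x / v))) / v"
    if "x > 0" for x
    using avg_form_limit[OF that] unfolding avg_form_limit_alt[OF that] .
  show "eventually (\<lambda>d. \<forall>x y. 0 < x \<longrightarrow> x < y \<longrightarrow> (y - x) * avg_form2 (n d) d (p d) y \<le> avg_form (n d) d (p d) x - avg_form (n d) d (p d) y \<and>
      avg_form (n d) d (p d) x - avg_form (n d) d (p d) y \<le> (y - x) * avg_form2 (n d) d (p d) x) sequentially"
    using eventually_pos
  proof eventually_elim
    case (elim d)
    show ?case
    proof (intro allI impI)
      fix x y :: real assume "0 < x" "x < y"
      then show "(y - x) * avg_form2 (n d) d (p d) y \<le> avg_form (n d) d (p d) x - avg_form (n d) d (p d) y \<and>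
          avg_form (n d) d (p d) x - avg_form (n d) d (p d) y \<le> (y - x) * avg_form2 (n d) d (p d) x"
        using avg_form_secant[of x y "n d" "p d" d] elim pd[of d] by simp
    qed
  qed
  define l where "l = lam / v"
  have l: "l > 0" using lam vpos by (simp add: l_def)
  have "((\<lambda>l. (T l - \<pi> * (\<mu>\<^sup>2 / v) * (T l - 1 + l * \<theta>1 l)) / v) has_real_derivative
      (T' l - \<pi> * (\<mu>\<^sup>2 / v) * (T' l + (\<theta>1 l - l * \<theta>2 l))) / v) (at l)"
    using l vpos T_deriv[OF l] resolvent_moment_deriv[OF gamma_pos refl refl l]
    by (auto intro!: derivative_eq_intros)
  then have D: "((\<lambda>l. (T l - \<pi> * (\<mu>\<^sup>2 / v) * (T l - 1 + l * \<theta>1 l)) / v) has_real_derivative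
      (T' l - \<pi> * (\<mu>\<^sup>2 / v) * (T' l + (\<theta>1 l - l * \<theta>2 l))) / v) (at (lam / v))" by (simp only: l_def)
  have "((\<lambda>x. x / v) has_real_derivative 1 / v) (at lam)"
    using vpos by (auto intro!: derivative_eq_intros)
  note c = DERIV_chain2[where g = "\<lambda>x. x / v", OF D this]
  have "(T' l - \<pi> * (\<mu>\<^sup>2 / v) * (T' l + (\<theta>1 l - l * \<theta>2 l))) / v * (1 / v) =
      (T' l - \<pi> * (\<mu>\<^sup>2 / v) * (T' l + \<theta>1 l - l * \<theta>2 l)) / v\<^sup>2"
    by (simp add: power2_eq_square add_diff_eq)
  from c[unfolded this] show "((\<lambda>lam. (T (lam / v) - \<pi> * (\<mu>\<^sup>2 / v) * (T (lam / v) - 1 + (lam / v) * \<theta>1 (lam / v))) / v) has_real_derivative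
      (T' (lam / v) - \<pi> * (\<mu>\<^sup>2 / v) * (T' (lam / v) + \<theta>1 (lam / v) - (lam / v) * \<theta>2 (lam / v))) / v\<^sup>2) (at lam)"
    unfolding l_def .
qed

definition mse_limit :: "real \<Rightarrow> real \<Rightarrow> real \<Rightarrow> real" where
  "mse_limit \<alpha> \<sigma> lam = \<alpha>\<^sup>2 * \<pi> * (1 / \<pi> - 1 + \<delta> * (1 - \<pi>) * \<theta>1 (lam / v)
            + lam / v * (lam * \<mu>\<^sup>2 / v\<^sup>2 - \<delta> * (1 - \<pi>)) * \<theta>2 (lam / v)
            + (v - \<mu>\<^sup>2) * (\<gamma> / v * \<theta>1 (lam / v) + 1 / v - lam * \<gamma> / v\<^sup>2 * \<theta>2 (lam / v)))
        + \<sigma>\<^sup>2 * \<gamma> * (\<theta>1 (lam / v) - lam / v * \<theta>2 (lam / v)) + \<sigma>\<^sup>2"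

text \<open>The sequence is the exact finite-dimensional risk, as \<open>MSE_expansion\<close>
  shows. Its limit simplifies because the resolvent enters through the combination G - lam
  G^2.\<close>

lemma mse_limit:
  assumes lam: "lam > 0"
  shows "(\<lambda>d. \<alpha>\<^sup>2 * (v * (avg_form (n d) d (p d) lam - lam * avg_form2 (n d) d (p d) lam) - 2 * \<mu> * avg_cross (n d) d (p d) lam + 1)
     + v * \<sigma>\<^sup>2 * (\<tau> (n d) d (p d) lam - lam * \<tau>2 (n d) d (p d) lam) + \<sigma>\<^sup>2) \<longlonglongrightarrow> mse_limit \<alpha> \<sigma> lam"
proof -
  define l where "l = lam / v"
  have l: "l > 0" "lam = l * v" using lam vpos by (simp_all add: l_def)
  define h where "h = (T l - \<pi> * (\<mu>\<^sup>2 / v) * (T l - 1 + l * \<theta>1 l)) / v"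
  define h2 where "h2 = - ((T' l - \<pi> * (\<mu>\<^sup>2 / v) * (T' l + \<theta>1 l - l * \<theta>2 l)) / v\<^sup>2)"
  have cross: "\<mu> * t lam / (1 + v * t lam) = \<mu> / v * (1 - l * \<theta>1 l)"
    unfolding t_facts(2)[OF lam] l_def[symmetric] T_facts(2)[OF l(1), symmetric]
    unfolding t_def l_def[symmetric] by simp
  have lim: "(\<lambda>d. \<alpha>\<^sup>2 * (v * (avg_form (n d) d (p d) lam - lam * avg_form2 (n d) d (p d) lam) - 2 * \<mu> * avg_cross (n d) d (p d) lam + 1)
     + v * \<sigma>\<^sup>2 * (\<tau> (n d) d (p d) lam - lam * \<tau>2 (n d) d (p d) lam) + \<sigma>\<^sup>2) \<longlonglongrightarrow>
     \<alpha>\<^sup>2 * (v * (h - lam * h2) - 2 * \<mu> * (\<pi> * (\<mu> / v * (1 - l * \<theta>1 l))) + 1) + v * \<sigma>\<^sup>2 * (T l / v - lam * (- (T' l / v\<^sup>2))) + \<sigma>\<^sup>2"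
    using avg_form_limit[OF lam] avg_form2_limit[OF lam] avg_cross_limit[OF lam] tau_limit[OF lam] tau2_limit[OF lam]
    unfolding avg_form_limit_alt[OF lam] cross l_def[symmetric] h_def[symmetric] h2_def[symmetric]
    unfolding t_def l_def[symmetric]
    by (intro tendsto_intros)
  \<comment> \<open>In T + l T' the terms with (1 - \<gamma>) / l cancel: the zero eigenvalues of
    the companion matrix do not contribute to G - lam G^2.\<close>
  define S where "S = \<gamma> * (\<theta>1 l - l * \<theta>2 l)"
  have TT: "T l + l * T' l = S"
    unfolding T_def T'_def S_def using l by (simp add: field_simps power2_eq_square)
  have 1: "v * (T l / v - lam * (- (T' l / v\<^sup>2))) = S"
    unfolding TT[symmetric] l(2) using vpos by (simp add: field_simps power2_eq_square)
  have 2: "v * (h - lam * h2) = S - \<pi> * (\<mu>\<^sup>2 / v) * (S - 1 + 2 * l * \<theta>1 l - l\<^sup>2 * \<theta>2 l)"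
  proof -
    have A: "v * h = T l - \<pi> * (\<mu>\<^sup>2 / v) * (T l - 1 + l * \<theta>1 l)" unfolding h_def using vpos by simp
    have B: "v * (lam * h2) = - (l * (T' l - \<pi> * (\<mu>\<^sup>2 / v) * (T' l + \<theta>1 l - l * \<theta>2 l)))"
      unfolding h2_def l(2) using vpos by (simp add: power2_eq_square)
    have "(a - c * (a - 1 + l * x)) - - (l * (b - c * (b + x - l * y))) = (a + l * b) - c * ((a + l * b) - 1 + 2 * l * x - l\<^sup>2 * y)" for a b c x y
      by (simp add: algebra_simps power2_eq_square)
    then have "v * (h - lam * h2) = (T l + l * T' l) - \<pi> * (\<mu>\<^sup>2 / v) * ((T l + l * T' l) - 1 + 2 * l * \<theta>1 l - l\<^sup>2 * \<theta>2 l)"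
      unfolding right_diff_distrib[of v] A B .
    then show ?thesis unfolding TT .
  qed
  define q where "q = \<mu>\<^sup>2 / v"
  have "mse_limit \<alpha> \<sigma> lam = \<alpha>\<^sup>2 * (S - \<pi> * q * (S - 1 + 2 * l * \<theta>1 l - l\<^sup>2 * \<theta>2 l) - 2 * \<pi> * q * (1 - l * \<theta>1 l) + 1) + \<sigma>\<^sup>2 * S + \<sigma>\<^sup>2"
  proof -
    have a: "l * (lam * \<mu>\<^sup>2 / v\<^sup>2 - \<delta> * (1 - \<pi>)) = l\<^sup>2 * q - l * (\<delta> * (1 - \<pi>))"
      unfolding q_def l(2) using vpos by (simp add: power2_eq_square field_simps)
    have b: "(v - \<mu>\<^sup>2) * (\<gamma> / v * \<theta>1 l + 1 / v - lam * \<gamma> / v\<^sup>2 * \<theta>2 l) = (1 - q) * (S + 1)"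
      unfolding q_def l(2) S_def using vpos by (simp add: power2_eq_square field_simps)
    have c: "\<pi> * (1 / \<pi> - 1) = 1 - \<pi>" using pi by (simp add: algebra_simps)
    have d: "\<pi> * (1 / \<pi> - 1 + \<delta> * (1 - \<pi>) * \<theta>1 l + (l\<^sup>2 * q - l * (\<delta> * (1 - \<pi>))) * \<theta>2 l + (1 - q) * (S + 1)) =
        S - \<pi> * q * (S - 1 + 2 * l * \<theta>1 l - l\<^sup>2 * \<theta>2 l) - 2 * \<pi> * q * (1 - l * \<theta>1 l) + 1"
    proof -
      have "\<pi> * (1 / \<pi> - 1 + \<delta> * (1 - \<pi>) * \<theta>1 l + (l\<^sup>2 * q - l * (\<delta> * (1 - \<pi>))) * \<theta>2 l + (1 - q) * (S + 1)) =
        \<pi> * (1 / \<pi> - 1) + (1 - \<pi>) * (\<pi> * \<delta> * (\<theta>1 l - l * \<theta>2 l)) + \<pi> * (l\<^sup>2 * q * \<theta>2 l + (1 - q) * (S + 1))"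
        by (simp add: algebra_simps)
      also have "\<dots> = (1 - \<pi>) + (1 - \<pi>) * S + \<pi> * (l\<^sup>2 * q * \<theta>2 l + (1 - q) * (S + 1))"
        unfolding c S_def gam by simp
      finally show ?thesis by (simp add: algebra_simps)
    qed
    have "mse_limit \<alpha> \<sigma> lam = \<alpha>\<^sup>2 * (\<pi> * (1 / \<pi> - 1 + \<delta> * (1 - \<pi>) * \<theta>1 l + (l\<^sup>2 * q - l * (\<delta> * (1 - \<pi>))) * \<theta>2 l + (1 - q) * (S + 1))) + \<sigma>\<^sup>2 * S + \<sigma>\<^sup>2"
      unfolding mse_limit_def l_def[symmetric] a b S_def by (simp add: mult.assoc)
    then show ?thesis unfolding d .
  qed
  also have "\<dots> = \<alpha>\<^sup>2 * (v * (h - lam * h2) - 2 * \<mu> * (\<pi> * (\<mu> / v * (1 - l * \<theta>1 l))) + 1) + v * \<sigma>\<^sup>2 * (T l / v - lam * (- (T' l / v\<^sup>2))) + \<sigma>\<^sup>2"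
  proof -
    have "2 * \<mu> * (\<pi> * (\<mu> / v * (1 - l * \<theta>1 l))) = 2 * \<pi> * q * (1 - l * \<theta>1 l)"
      unfolding q_def by (simp add: power2_eq_square)
    moreover have "v * \<sigma>\<^sup>2 * (T l / v - lam * (- (T' l / v\<^sup>2))) = \<sigma>\<^sup>2 * S"
      unfolding 1[symmetric] by (simp only: mult_ac)
    ultimately show ?thesis unfolding 2 q_def by (simp only:)
  qed
  finally show ?thesis using lim by simp
qed

end

subsection \<open>Rotating the first layer to coordinate form\<close>

text \<open>The projections of the d unit vectors onto the span have squared norms adding up to p <
  d, so some unit vector e_m is not in the span. Its residual is orthogonal to the given rows and
  only has to be normalised.\<close>

lemma orthonormal_extend:
  fixes w :: "nat \<Rightarrow> nat \<Rightarrow> real"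
  assumes w: "\<And>j k. j < p \<Longrightarrow> k < p \<Longrightarrow> (\<Sum>i<d. w j i * w k i) = (if j = k then 1 else 0)" and p: "p < d"
  shows "\<exists>u. (\<Sum>i<d. u i * u i) = 1 \<and> (\<forall>j<p. (\<Sum>i<d. w j i * u i) = 0)"
proof -
  have "(\<Sum>i<d. \<Sum>j<p. w j i * w j i) = (\<Sum>j<p. 1)"
    by (subst sum.swap) (auto intro!: sum.cong simp: w)
  then have total: "(\<Sum>i<d. \<Sum>j<p. w j i * w j i) < (\<Sum>i<d. 1)" using p by simp
  obtain m where m: "m < d" "(\<Sum>j<p. w j m * w j m) < 1"
  proof (rule ccontr)
    assume "\<not> thesis"
    then have "\<And>i. i < d \<Longrightarrow> 1 \<le> (\<Sum>j<p. w j i * w j i)" using that by (meson not_less)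
    then have "(\<Sum>i<d. 1) \<le> (\<Sum>i<d. \<Sum>j<p. w j i * w j i)" by (intro sum_mono) auto
    with total show False by simp
  qed
  define u where "u = (\<lambda>i. (if i = m then 1 else 0) - (\<Sum>j<p. w j m * w j i))"
  have inner: "(\<Sum>i<d. w k i * u i) = 0" if k: "k < p" for k
  proof -
    have "(\<Sum>i<d. w k i * u i) = (\<Sum>i<d. if i = m then w k i else 0) - (\<Sum>i<d. \<Sum>j<p. w j m * (w k i * w j i))"
      unfolding u_def sum_subtractf[symmetric]
      by (intro sum.cong refl) (simp add: right_diff_distrib sum_distrib_left mult_ac if_distrib cong: if_cong)
    also have "(\<Sum>i<d. \<Sum>j<p. w j m * (w k i * w j i)) = (\<Sum>j<p. w j m * (if k = j then 1 else 0))"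
      by (subst sum.swap) (simp add: sum_distrib_left[symmetric] w k)
    also have "\<dots> = w k m" using k by (simp add: if_distrib cong: if_cong)
    finally show ?thesis using m(1) by simp
  qed
  \<comment> \<open>Since u is orthogonal to all rows, |u|^2 equals its coordinate at m, which is 1
    minus the squared norm of the projection of e_m.\<close>
  have "(\<Sum>i<d. u i * u i) = (\<Sum>i<d. (if i = m then u i else 0) - (\<Sum>j<p. w j m * (w j i * u i)))"
    by (intro sum.cong refl)
       (subst u_def, simp add: left_diff_distrib sum_distrib_right mult.assoc if_distrib cong: if_cong)
  also have "\<dots> = u m - (\<Sum>j<p. w j m * (\<Sum>i<d. w j i * u i))"
  proof -
    have "(\<Sum>i<d. \<Sum>j<p. w j m * (w j i * u i)) = (\<Sum>j<p. w j m * (\<Sum>i<d. w j i * u i))"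
      by (subst sum.swap) (simp add: sum_distrib_left)
    then show ?thesis unfolding sum_subtractf using m(1) by simp
  qed
  also have "\<dots> = 1 - (\<Sum>j<p. w j m * w j m)"
  proof -
    have "(\<Sum>j<p. w j m * (\<Sum>i<d. w j i * u i)) = 0" using inner by simp
    moreover have "u m = 1 - (\<Sum>j<p. w j m * w j m)" by (simp add: u_def)
    ultimately show ?thesis by simp
  qed
  finally have pos: "(\<Sum>i<d. u i * u i) > 0" using m(2) by simp
  define r where "r = sqrt (\<Sum>i<d. u i * u i)"
  have r: "r > 0" "r * r = (\<Sum>i<d. u i * u i)" using pos by (auto simp: r_def)
  have "(\<Sum>i<d. (u i / r) * (u i / r)) = 1"
    using r pos by (simp add: sum_divide_distrib[symmetric])
  moreover have "(\<Sum>i<d. w j i * (u i / r)) = 0" if "j < p" for j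
    using inner[OF that] by (simp add: sum_divide_distrib[symmetric])
  ultimately show ?thesis by (intro exI[of _ "\<lambda>i. u i / r"]) auto
qed

definition orthogonal :: "nat \<Rightarrow> (nat \<Rightarrow> nat \<Rightarrow> real) \<Rightarrow> bool" where
  "orthogonal d Q \<longleftrightarrow>
     (\<forall>j<d. \<forall>k<d. (\<Sum>i<d. Q j i * Q k i) = (if j = k then 1 else 0)) \<and>
     (\<forall>j<d. \<forall>k<d. (\<Sum>i<d. Q i j * Q i k) = (if j = k then 1 else 0))"

text \<open>For square matrices a right inverse is also a left inverse, so orthonormal rows force
  orthonormal columns.\<close>

lemma orthogonalI:
  assumes "\<And>j k. j < d \<Longrightarrow> k < d \<Longrightarrow> (\<Sum>i<d. Q j i * Q k i) = (if j = k then 1 else 0)"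
  shows "orthogonal d Q"
proof -
  define A where "A = mat d d (\<lambda>(i, j). Q i j)"
  have A: "A \<in> carrier_mat d d" "transpose_mat A \<in> carrier_mat d d" by (simp_all add: A_def)
  have "A * transpose_mat A = 1\<^sub>m d"
    by (rule eq_matI) (auto simp: A_def scalar_prod_def atLeast0LessThan assms)
  then have "transpose_mat A * A = 1\<^sub>m d"
    by (rule mat_mult_left_right_inverse[OF A])
  then have "(transpose_mat A * A) $$ (j, k) = (if j = k then 1 else 0)" if "j < d" "k < d" for j k
    using that by simp
  then have "(\<Sum>i<d. Q i j * Q i k) = (if j = k then 1 else 0)" if "j < d" "k < d" for j k
    using that by (simp add: A_def scalar_prod_def atLeast0LessThan)
  then show ?thesis using assms by (simp add: orthogonal_def)
qed

lemma orthonormal_complete: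
  fixes w :: "nat \<Rightarrow> nat \<Rightarrow> real"
  assumes w: "\<And>j k. j < p \<Longrightarrow> k < p \<Longrightarrow> (\<Sum>i<d. w j i * w k i) = (if j = k then 1 else 0)" and p: "p \<le> d"
  shows "\<exists>Q. (\<forall>j<p. Q j = w j) \<and> orthogonal d Q"
  using assms
proof (induction "d - p" arbitrary: p w)
  case 0
  then have "p = d" by simp
  then have "orthogonal d w" using 0 by (intro orthogonalI) auto
  then show ?case by blast
next
  case (Suc m)
  then have "p < d" by simp
  from orthonormal_extend[OF Suc.prems(1) this]
  obtain u where u: "(\<Sum>i<d. u i * u i) = 1" "\<And>j. j < p \<Longrightarrow> (\<Sum>i<d. w j i * u i) = 0" by blast
  define w' where "w' = w(p := u)"
  have "(\<Sum>i<d. w' j i * w' k i) = (if j = k then 1 else 0)" if "j < Suc p" "k < Suc p" for j k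
    using that u Suc.prems(1)[of j k] by (auto simp: w'_def less_Suc_eq mult.commute)
  moreover have "m = d - Suc p" "Suc p \<le> d" using Suc by auto
  ultimately obtain Q where "\<forall>j<Suc p. Q j = w' j" "orthogonal d Q" using Suc.hyps(1)[of "Suc p" w'] by blast
  then show ?case by (intro exI[of _ Q]) (auto simp: w'_def)
qed

lemma orthogonal_inner:
  assumes "orthogonal d Q"
  shows "(\<Sum>k<d. (\<Sum>l<d. Q k l * a l) * (\<Sum>l<d. Q k l * b l)) = (\<Sum>l<d. a l * (b l :: real))"
proof -
  have "(\<Sum>k<d. (\<Sum>l<d. Q k l * a l) * (\<Sum>l<d. Q k l * b l)) = (\<Sum>k<d. \<Sum>l<d. \<Sum>m<d. (a l * b m) * (Q k l * Q k m))"
    by (simp add: sum_product mult_ac)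
  also have "\<dots> = (\<Sum>l<d. \<Sum>k<d. \<Sum>m<d. (a l * b m) * (Q k l * Q k m))" by (rule sum.swap)
  also have "\<dots> = (\<Sum>l<d. \<Sum>m<d. (a l * b m) * (\<Sum>k<d. Q k l * Q k m))"
    by (rule sum.cong[OF refl], subst sum.swap, simp add: sum_distrib_left)
  also have "\<dots> = (\<Sum>l<d. \<Sum>m<d. (a l * b m) * (if l = m then 1 else 0))"
    using assms by (intro sum.cong refl) (simp add: orthogonal_def)
  finally show ?thesis by (simp add: if_distrib cong: if_cong)
qed

lemma orthogonal_norm:
  assumes "orthogonal d Q"
  shows "(\<Sum>k<d. (\<Sum>l<d. Q k l * a l)\<^sup>2) = (\<Sum>l<d. (a l :: real)\<^sup>2)"
  using orthogonal_inner[OF assms, of a a] by (simp add: power2_eq_square)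

definition rot_vec :: "nat \<Rightarrow> (nat \<Rightarrow> nat \<Rightarrow> real) \<Rightarrow> (nat \<Rightarrow> real) \<Rightarrow> nat \<Rightarrow> real" where
  "rot_vec d Q x = (\<lambda>k\<in>{..<d}. \<Sum>l<d. Q k l * x l)"

definition rot_mat :: "nat \<Rightarrow> nat \<Rightarrow> (nat \<Rightarrow> nat \<Rightarrow> real) \<Rightarrow> (nat \<times> nat \<Rightarrow> real) \<Rightarrow> nat \<times> nat \<Rightarrow> real" where
  "rot_mat n d Q X = (\<lambda>ik\<in>{..<n}\<times>{..<d}. \<Sum>l<d. Q (snd ik) l * X (fst ik, l))"

lemma nn_integral_rot_vec:
  assumes "orthogonal d Q" "h \<in> borel_measurable (PiM {..<d} (\<lambda>_. borel))"
  shows "(\<integral>\<^sup>+ x. h (rot_vec d Q x) \<partial>PiM {..<d} (\<lambda>_. N01)) = (\<integral>\<^sup>+ x. h x \<partial>PiM {..<d} (\<lambda>_. N01))"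
  unfolding rot_vec_def
  by (rule orthonormal_gaussian_aux) (use assms in \<open>auto simp: orthogonal_def\<close>)

text \<open>Rotating every row of X by Q is a single orthonormal map on the index pairs, block
  diagonal with n copies of Q.\<close>

lemma distr_rot_mat:
  assumes Q: "orthogonal d Q"
  shows "distr (gram_law n d) (gram_law n d) (rot_mat n d Q) = gram_law n d"
proof -
  define w where "w = (\<lambda>(ik :: nat \<times> nat) (jl :: nat \<times> nat). if fst ik = fst jl then Q (snd ik) (snd jl) else (0::real))"
  have sum_del: "(\<Sum>jl\<in>{..<n}\<times>{..<d}. f (if i = fst jl then g jl else 0) jl) = (\<Sum>l<d. f (g (i, l)) (i, l))"
    if "i < n" "\<And>jl. f 0 jl = 0" for i and f :: "real \<Rightarrow> nat \<times> nat \<Rightarrow> real" and g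
  proof -
    have "(\<Sum>jl\<in>{..<n}\<times>{..<d}. f (if i = fst jl then g jl else 0) jl) = (\<Sum>jl\<in>{i}\<times>{..<d}. f (g jl) jl)"
      by (rule sum.mono_neutral_cong_right) (use that in auto)
    also have "{i} \<times> {..<d} = (\<lambda>l. (i, l)) ` {..<d}" by auto
    finally show ?thesis by (simp add: sum.reindex inj_on_def)
  qed
  have rot: "rot_mat n d Q = (\<lambda>X. \<lambda>ik\<in>{..<n}\<times>{..<d}. \<Sum>jl\<in>{..<n}\<times>{..<d}. w ik jl * X jl)"
    unfolding rot_mat_def w_def using sum_del[where f = "\<lambda>a jl. a * _ jl"]
    by (intro ext restrict_ext) auto
  show ?thesis unfolding rot
  proof (rule orthonormal_gaussian)
    fix a b assume a: "a \<in> {..<n}\<times>{..<d}" and b: "b \<in> {..<n}\<times>{..<d}"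
    have "(\<Sum>jl\<in>{..<n}\<times>{..<d}. w a jl * w b jl) = (\<Sum>l<d. Q (snd a) l * w b (fst a, l))"
      using sum_del[of "fst a" "\<lambda>c jl. c * w b jl" "\<lambda>jl. Q (snd a) (snd jl)"] a by (auto simp: w_def)
    also have "\<dots> = (if a = b then 1 else 0)"
    proof (cases "fst a = fst b")
      case True
      then show ?thesis using a b Q by (cases a; cases b) (auto simp: w_def orthogonal_def)
    next
      case False
      then have "a \<noteq> b" by auto
      then show ?thesis using False by (simp add: w_def)
    qed
    finally show "(\<Sum>jl\<in>{..<n}\<times>{..<d}. w a jl * w b jl) = (if a = b then 1 else 0)" .
  qed auto
qed

lemma measurable_rot_mat: "rot_mat n d Q \<in> measurable (gram_law n d) (gram_law n d)"
  unfolding rot_mat_def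
proof (rule measurable_restrict)
  fix ik assume "ik \<in> {..<n} \<times> {..<d}"
  then have "(\<lambda>X. X (fst ik, l)) \<in> borel_measurable (gram_law n d)" if "l < d" for l
    using measurable_component_singleton[of "(fst ik, l)" "{..<n}\<times>{..<d}" "\<lambda>_. N01"] that by auto
  then show "(\<lambda>X. \<Sum>l<d. Q (snd ik) l * X (fst ik, l)) \<in> measurable (gram_law n d) N01"
    by (auto intro!: borel_measurable_sum borel_measurable_times cong: measurable_cong_sets)
qed

section \<open>The prediction as a linear form in the signal and the noise\<close>

context activation
begin

text \<open>Weight of signal coordinate l in the fitted second-layer coefficient of feature j. The
  preactivations Z are separated from the data X because a rotation by a completion of
  \<open>W\<close> acts linearly on X, while Z agrees with the first p rotated columns.\<close>

definition coef :: "nat \<Rightarrow> nat \<Rightarrow> real \<Rightarrow> (nat \<times> nat \<Rightarrow> real) \<Rightarrow> (nat \<times> nat \<Rightarrow> real) \<Rightarrow> nat \<Rightarrow> nat \<Rightarrow> real" where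
  "coef n p lam Z X j l = col_vec n (apply_entries \<phi> Z) j \<bullet> (G n {..<p} lam Z *\<^sub>v col_vec n X l) / real n"

definition noise :: "nat \<Rightarrow> nat \<Rightarrow> real \<Rightarrow> (nat \<times> nat \<Rightarrow> real) \<Rightarrow> nat \<Rightarrow> nat \<Rightarrow> real" where
  "noise n p lam Z j i = col_vec n (apply_entries \<phi> Z) j \<bullet> (G n {..<p} lam Z *\<^sub>v unit_vec n i) / real n"

lemma coef_alt:
  "coef n p lam Z X j l = (\<Sum>i<n. \<Sum>m<n. G n {..<p} lam Z $$ (i, m) * \<phi> (Z (i, j)) * X (m, l)) / real n"
  unfolding coef_def by (subst form_sum[of _ n]) (auto simp: col_vec_def apply_entries_def)

lemma noise_alt:
  assumes "i < n"
  shows "noise n p lam Z j i = (\<Sum>k<n. G n {..<p} lam Z $$ (k, i) * \<phi> (Z (k, j))) / real n"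
proof -
  have "unit_vec n i $ m = (if m = i then 1 else 0 :: real)" if "m < n" for m using that assms by simp
  then show ?thesis unfolding noise_def using assms
    by (subst form_sum[of _ n]) (auto simp: col_vec_def apply_entries_def if_distrib cong: if_cong)
qed

lemma coef_cong:
  assumes "\<And>i k. i < n \<Longrightarrow> k < p \<Longrightarrow> Z (i, k) = Z' (i, k)" "j < p" "\<And>i. i < n \<Longrightarrow> X (i, l) = X' (i, l')"
  shows "coef n p lam Z X j l = coef n p lam Z' X' j l'"
proof -
  have "G n {..<p} lam Z = G n {..<p} lam Z'"
    unfolding G_def by (rule resolvent_cong) (use assms in \<open>auto simp: apply_entries_def\<close>)
  then show ?thesis unfolding coef_alt using assms by simp
qed

lemma noise_cong:
  assumes "\<And>i k. i < n \<Longrightarrow> k < p \<Longrightarrow> Z (i, k) = Z' (i, k)" "j < p" "i < n"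
  shows "noise n p lam Z j i = noise n p lam Z' j i"
proof -
  have "G n {..<p} lam Z = G n {..<p} lam Z'"
    unfolding G_def by (rule resolvent_cong) (use assms in \<open>auto simp: apply_entries_def\<close>)
  then show ?thesis unfolding noise_alt[OF assms(3)] using assms by simp
qed

lemma coef_rot:
  assumes "k < d"
  shows "coef n p lam Z (rot_mat n d Q X) j k = (\<Sum>l<d. Q k l * coef n p lam Z X j l)"
proof -
  have "coef n p lam Z (rot_mat n d Q X) j k =
     (\<Sum>i<n. \<Sum>m<n. \<Sum>l<d. Q k l * (G n {..<p} lam Z $$ (i, m) * \<phi> (Z (i, j)) * X (m, l))) / real n"
    unfolding coef_alt using assms by (simp add: rot_mat_def sum_distrib_left mult_ac)
  also have "(\<Sum>i<n. \<Sum>m<n. \<Sum>l<d. Q k l * (G n {..<p} lam Z $$ (i, m) * \<phi> (Z (i, j)) * X (m, l))) =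
     (\<Sum>l<d. \<Sum>i<n. \<Sum>m<n. Q k l * (G n {..<p} lam Z $$ (i, m) * \<phi> (Z (i, j)) * X (m, l)))"
    by (subst (2) sum.swap, subst sum.swap, rule refl)
  finally show ?thesis unfolding coef_alt by (simp add: sum_distrib_left sum_divide_distrib)
qed

text \<open>This is \<open>resolvent_form\<close> with both vectors equal, solved for the sum of
  squares. It is the origin of the combination G - lam G^2 in the risk.\<close>

lemma coef_square_sum:
  assumes "lam > 0"
  shows "(\<Sum>j<p. (coef n p lam Z X j l)\<^sup>2) =
    (col_vec n X l \<bullet> (G n {..<p} lam Z *\<^sub>v col_vec n X l) -
      lam * ((G n {..<p} lam Z *\<^sub>v col_vec n X l) \<bullet> (G n {..<p} lam Z *\<^sub>v col_vec n X l))) / real n"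
  using resolvent_form[OF assms, of "col_vec n X l" n "col_vec n X l" "apply_entries \<phi> Z" "{..<p}"]
  unfolding coef_def G_def
  by (simp add: power2_eq_square sum_divide_distrib)

lemma noise_square_sum:
  assumes "lam > 0"
  shows "(\<Sum>i<n. \<Sum>j<p. (noise n p lam Z j i)\<^sup>2) = trn n {..<p} lam Z - lam * trn2 n {..<p} lam Z"
proof -
  have "(\<Sum>j<p. (noise n p lam Z j i)\<^sup>2) =
    (unit_vec n i \<bullet> (G n {..<p} lam Z *\<^sub>v unit_vec n i) -
      lam * ((G n {..<p} lam Z *\<^sub>v unit_vec n i) \<bullet> (G n {..<p} lam Z *\<^sub>v unit_vec n i))) / real n" for i
    using resolvent_form[OF assms, of "unit_vec n i" n "unit_vec n i" "apply_entries \<phi> Z" "{..<p}"]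
    unfolding noise_def G_def
    by (simp only: unit_vec_carrier power2_eq_square sum_divide_distrib[symmetric] times_divide_eq_left times_divide_eq_right divide_divide_eq_left simp_thms)
       (simp add: sum_divide_distrib)
  then show ?thesis
    unfolding trn_def trn2_def mat_tr_resolvent_alt[OF assms] G_def
    by (simp add: sum_subtractf sum_divide_distrib[symmetric] sum_distrib_left[symmetric] diff_divide_distrib)
qed

lemma coef_id_square_sum:
  assumes "lam > 0"
  shows "(\<Sum>j<p. (coef n p lam X X j l)\<^sup>2) = form n {..<p} lam (\<lambda>z. z) (\<lambda>z. z) l X - lam * form2 n {..<p} lam l X"
  unfolding coef_square_sum[OF assms] form_def form2_def apply_entries_id by (simp add: diff_divide_distrib)

lemma coef_diag:
  assumes "lam > 0"
  shows "coef n p lam X X k k = form n {..<p} lam (\<lambda>z. z) \<phi> k X"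
  unfolding coef_def form_def G_def apply_entries_id
  using resolvent_sym[OF assms, of "col_vec n X k" n "col_vec n (apply_entries \<phi> X) k"] by simp

definition first_layer :: "nat \<Rightarrow> (nat \<times> nat \<Rightarrow> real) \<Rightarrow> (nat \<times> nat \<Rightarrow> real) \<Rightarrow> nat \<times> nat \<Rightarrow> real" where
  "first_layer d W X = (\<lambda>(i, j). \<Sum>l<d. W (j, l) * X (i, l))"

definition layer_vec :: "nat \<Rightarrow> (nat \<times> nat \<Rightarrow> real) \<Rightarrow> (nat \<Rightarrow> real) \<Rightarrow> nat \<Rightarrow> real" where
  "layer_vec d W x j = (\<Sum>l<d. W (j, l) * x l)"

text \<open>\<open>predictor_eq\<close> is linear in the observations, so inserting X \<theta> + E
  separates the signal weights from the noise weights.\<close>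

lemma prediction_eq:
  assumes "lam > 0" "n > 0" "p > 0"
  shows "prediction \<phi> p n d lam (\<theta>, x) (W, X, E) =
    (\<Sum>j<p. \<phi> (layer_vec d W x j) *
      ((\<Sum>l<d. coef n p lam (first_layer d W X) X j l * \<theta> l) + (\<Sum>i<n. noise n p lam (first_layer d W X) j i * E i)))"
proof -
  let ?Z = "first_layer d W X"
  define Y where "Y = mat n d X *\<^sub>v vec d \<theta> + vec n E"
  have Y: "Y \<in> carrier_vec n" unfolding Y_def by (intro add_carrier_vec mult_mat_vec_carrier[of _ n d]) auto
  have Yi: "Y $ m = (\<Sum>l<d. X (m, l) * \<theta> l) + E m" if "m < n" for m
    using that by (simp add: Y_def scalar_prod_def atLeast0LessThan)
  have F: "(\<lambda>(i, j). \<phi> ((mat n d X * transpose_mat (mat p d W)) $$ (i, j))) (i, j) = apply_entries \<phi> ?Z (i, j)"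
    if "i < n" "j < p" for i j
    using that by (simp add: apply_entries_def first_layer_def scalar_prod_def atLeast0LessThan mult.commute)
  have res: "resolvent n (\<lambda>(i, j). \<phi> ((mat n d X * transpose_mat (mat p d W)) $$ (i, j))) {..<p} lam = G n {..<p} lam ?Z"
    unfolding G_def by (rule resolvent_cong) (use F in auto)
  have z: "(mat p d W *\<^sub>v vec d x) $ j = layer_vec d W x j" if "j < p" for j
    using that by (simp add: layer_vec_def scalar_prod_def atLeast0LessThan)
  have "prediction \<phi> p n d lam (\<theta>, x) (W, X, E) =
     (\<Sum>j<p. \<phi> ((mat p d W *\<^sub>v vec d x) $ j) *
       (col_vec n (\<lambda>(i, j). \<phi> ((mat n d X * transpose_mat (mat p d W)) $$ (i, j))) j \<bullet> (G n {..<p} lam ?Z *\<^sub>v Y) / real n))"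
    unfolding prediction_def split Y_def[symmetric] res[symmetric]
    by (rule predictor_eq[OF _ _ Y _ assms]) auto
  also have "\<dots> = (\<Sum>j<p. \<phi> (layer_vec d W x j) *
      ((\<Sum>l<d. coef n p lam ?Z X j l * \<theta> l) + (\<Sum>i<n. noise n p lam ?Z j i * E i)))"
  proof (intro sum.cong refl arg_cong2[where f = "(*)"])
    fix j assume "j \<in> {..<p}"
    then have j: "j < p" by simp
    then show "\<phi> ((mat p d W *\<^sub>v vec d x) $ j) = \<phi> (layer_vec d W x j)" by (simp only: z)
    have "col_vec n (\<lambda>(i, j). \<phi> ((mat n d X * transpose_mat (mat p d W)) $$ (i, j))) j \<bullet> (G n {..<p} lam ?Z *\<^sub>v Y) =
       (\<Sum>i<n. \<Sum>m<n. G n {..<p} lam ?Z $$ (i, m) * \<phi> (?Z (i, j)) * Y $ m)"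
      using j F by (subst form_sum[of _ n]) (auto simp: Y col_vec_def apply_entries_def simp del: index_mult_mat intro!: sum.cong)
    also have "\<dots> = (\<Sum>i<n. \<Sum>m<n. (\<Sum>l<d. G n {..<p} lam ?Z $$ (i, m) * \<phi> (?Z (i, j)) * X (m, l) * \<theta> l) + G n {..<p} lam ?Z $$ (i, m) * \<phi> (?Z (i, j)) * E m)"
      by (intro sum.cong refl) (simp add: Yi distrib_left sum_distrib_left mult.assoc)
    also have "\<dots> = (\<Sum>l<d. \<Sum>i<n. \<Sum>m<n. G n {..<p} lam ?Z $$ (i, m) * \<phi> (?Z (i, j)) * X (m, l) * \<theta> l) +
        (\<Sum>m<n. \<Sum>i<n. G n {..<p} lam ?Z $$ (i, m) * \<phi> (?Z (i, j)) * E m)"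
      unfolding sum.distrib
      by (subst (2) sum.swap, subst sum.swap, subst (5) sum.swap) (rule refl)
    finally have eq: "col_vec n (\<lambda>(i, j). \<phi> ((mat n d X * transpose_mat (mat p d W)) $$ (i, j))) j \<bullet> (G n {..<p} lam ?Z *\<^sub>v Y) =
      (\<Sum>l<d. \<Sum>i<n. \<Sum>m<n. G n {..<p} lam ?Z $$ (i, m) * \<phi> (?Z (i, j)) * X (m, l) * \<theta> l) +
        (\<Sum>m<n. \<Sum>i<n. G n {..<p} lam ?Z $$ (i, m) * \<phi> (?Z (i, j)) * E m)" .
    show "col_vec n (\<lambda>(i, j). \<phi> ((mat n d X * transpose_mat (mat p d W)) $$ (i, j))) j \<bullet> (G n {..<p} lam ?Z *\<^sub>v Y) / real n =
      (\<Sum>l<d. coef n p lam ?Z X j l * \<theta> l) + (\<Sum>i<n. noise n p lam ?Z j i * E i)"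
    proof -
      have c: "coef n p lam ?Z X j l * \<theta> l = (\<Sum>i<n. \<Sum>m<n. G n {..<p} lam ?Z $$ (i, m) * \<phi> (?Z (i, j)) * X (m, l) * \<theta> l) / real n" for l
        unfolding coef_alt by (simp only: times_divide_eq_left sum_distrib_right)
      have e: "(\<Sum>i<n. noise n p lam ?Z j i * E i) = (\<Sum>m<n. (\<Sum>i<n. G n {..<p} lam ?Z $$ (i, m) * \<phi> (?Z (i, j)) * E m) / real n)"
        by (intro sum.cong refl) (simp only: noise_alt lessThan_iff times_divide_eq_left sum_distrib_right)
      show ?thesis unfolding eq c e by (simp only: add_divide_distrib sum_divide_distrib)
    qed
  qed
  finally show ?thesis .
qed

lemma truth_eq: "truth d (\<theta>, x) = (\<Sum>l<d. x l * \<theta> l)"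
  by (simp add: truth_def scalar_prod_def atLeast0LessThan)

end

section \<open>Second moments of affine Gaussian forms and the risk for a given first layer\<close>

lemma prob_space_centered_normal: "prob_space (centered_normal s)"
  unfolding centered_normal_def
  by (rule prob_space.prob_space_distr[OF prob_space_N01]) simp

lemma sets_centered_normal [simp, measurable_cong]: "sets (centered_normal s) = sets borel"
  by (simp add: centered_normal_def)

lemma space_centered_normal [simp]: "space (centered_normal s) = UNIV"
  by (simp add: centered_normal_def)

lemma centered_normal_moments:
  "sq_integrable (centered_normal s) (\<lambda>z. z)" "(\<integral>z. z \<partial>centered_normal s) = 0" "(\<integral>z. z\<^sup>2 \<partial>centered_normal s) = s\<^sup>2"
proof -
  have "integrable N01 (\<lambda>z. (s * z)\<^sup>2)"
    using integrable_N01_power[of 2] by (simp add: power_mult_distrib)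
  then show "sq_integrable (centered_normal s) (\<lambda>z. z)"
    unfolding sq_integrable_def centered_normal_def by (simp add: integrable_distr_eq)
  show "(\<integral>z. z \<partial>centered_normal s) = 0"
    unfolding centered_normal_def by (simp add: integral_distr N01_mean)
  show "(\<integral>z. z\<^sup>2 \<partial>centered_normal s) = s\<^sup>2"
    unfolding centered_normal_def by (simp add: integral_distr power_mult_distrib N01_second_moment)
qed

lemma affine_form_second_moment:
  fixes c :: "'i \<Rightarrow> real"
  assumes I: "finite I"
  shows "sq_integrable (PiM I (\<lambda>_. centered_normal s)) (\<lambda>x. a + (\<Sum>i\<in>I. c i * x i))"
    "(\<integral>x. (a + (\<Sum>i\<in>I. c i * x i)) \<partial>PiM I (\<lambda>_. centered_normal s)) = a"
    "(\<integral>x. (a + (\<Sum>i\<in>I. c i * x i))\<^sup>2 \<partial>PiM I (\<lambda>_. centered_normal s)) = a\<^sup>2 + s\<^sup>2 * (\<Sum>i\<in>I. (c i)\<^sup>2)"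
proof -
  note N = prob_space_centered_normal[of s]
  note m = centered_normal_moments[of s]
  interpret P: prob_space "PiM I (\<lambda>_. centered_normal s)" by (rule prob_space_PiM) (rule N)
  have L: "sq_integrable (PiM I (\<lambda>_. centered_normal s)) (\<lambda>x. \<Sum>i\<in>I. c i * x i)"
    by (rule sq_integrable_linear_form[OF N m(1)])
  have L2: "integrable (PiM I (\<lambda>_. centered_normal s)) (\<lambda>x. (\<Sum>i\<in>I. c i * x i)\<^sup>2)"
    using L by (simp add: sq_integrable_def)
  note L1 = P.sq_integrable_integrable[OF L]
  show "sq_integrable (PiM I (\<lambda>_. centered_normal s)) (\<lambda>x. a + (\<Sum>i\<in>I. c i * x i))"
    by (intro sq_integrable_add L P.sq_integrable_const)
  have zero: "(\<integral>x. (\<Sum>i\<in>I. c i * x i) \<partial>PiM I (\<lambda>_. centered_normal s)) = 0"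
  proof -
    have i: "integrable (PiM I (\<lambda>_. centered_normal s)) (\<lambda>x. x i)" "(\<integral>x. x i \<partial>PiM I (\<lambda>_. centered_normal s)) = 0" if "i \<in> I" for i
      using integral_PiM_component[OF N that, of "\<lambda>z. z"] m prob_space.sq_integrable_integrable[OF N m(1)] by auto
    have "(\<integral>x. (\<Sum>i\<in>I. c i * x i) \<partial>PiM I (\<lambda>_. centered_normal s)) = (\<Sum>i\<in>I. \<integral>x. c i * x i \<partial>PiM I (\<lambda>_. centered_normal s))"
      by (rule Bochner_Integration.integral_sum) (use i in auto)
    then show ?thesis using i by simp
  qed
  show "(\<integral>x. (a + (\<Sum>i\<in>I. c i * x i)) \<partial>PiM I (\<lambda>_. centered_normal s)) = a"
    using L1 zero by (simp add: P.prob_space)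
  have sq: "(\<integral>x. (\<Sum>i\<in>I. c i * x i)\<^sup>2 \<partial>PiM I (\<lambda>_. centered_normal s)) = s\<^sup>2 * (\<Sum>i\<in>I. (c i)\<^sup>2)"
    using integral_linear_forms[OF N I m(1) m(1), of c c] m by (simp add: power2_eq_square)
  have "(\<integral>x. (a + (\<Sum>i\<in>I. c i * x i))\<^sup>2 \<partial>PiM I (\<lambda>_. centered_normal s)) =
      (\<integral>x. a\<^sup>2 + 2 * a * (\<Sum>i\<in>I. c i * x i) + (\<Sum>i\<in>I. c i * x i)\<^sup>2 \<partial>PiM I (\<lambda>_. centered_normal s))"
    by (simp add: power2_sum algebra_simps)
  also have "\<dots> = a\<^sup>2 + s\<^sup>2 * (\<Sum>i\<in>I. (c i)\<^sup>2)"
    using L1 L2 zero sq by (simp add: P.prob_space)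
  finally show "(\<integral>x. (a + (\<Sum>i\<in>I. c i * x i))\<^sup>2 \<partial>PiM I (\<lambda>_. centered_normal s)) = a\<^sup>2 + s\<^sup>2 * (\<Sum>i\<in>I. (c i)\<^sup>2)" .
qed

lemma nn_affine_form:
  fixes c :: "'i \<Rightarrow> real"
  assumes "finite I"
  shows "(\<integral>\<^sup>+ x. ennreal ((a + (\<Sum>i\<in>I. c i * x i))\<^sup>2) \<partial>PiM I (\<lambda>_. centered_normal s)) = ennreal (a\<^sup>2 + s\<^sup>2 * (\<Sum>i\<in>I. (c i)\<^sup>2))"
  using affine_form_second_moment[OF assms, of s a c]
  by (subst nn_integral_eq_integral) (auto simp: sq_integrable_def)

lemma PiM_centered_normal_1: "PiM I (\<lambda>_. centered_normal 1) = PiM I (\<lambda>_. N01)"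
  by (simp add: centered_normal_1)

context activation
begin

lemma measurable_coef:
  assumes "\<And>i k. i < n \<Longrightarrow> k < p \<Longrightarrow> (\<lambda>x. Z x (i, k)) \<in> borel_measurable M" "j < p"
    and "\<And>i. i < n \<Longrightarrow> (\<lambda>x. X x (i, l)) \<in> borel_measurable M"
  shows "(\<lambda>x. coef n p lam (Z x) (X x) j l) \<in> borel_measurable M"
  unfolding coef_alt G_def
  by (intro borel_measurable_divide borel_measurable_sum borel_measurable_times borel_measurable_const
        borel_measurable_resolvent measurable_compose[OF _ meas])
     (use assms in \<open>auto simp: apply_entries_def intro!: measurable_compose[OF _ meas]\<close>)

lemma measurable_noise:
  assumes "\<And>i k. i < n \<Longrightarrow> k < p \<Longrightarrow> (\<lambda>x. Z x (i, k)) \<in> borel_measurable M" "j < p" "i < n"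
  shows "(\<lambda>x. noise n p lam (Z x) j i) \<in> borel_measurable M"
  unfolding noise_alt[OF assms(3)] G_def
  by (intro borel_measurable_divide borel_measurable_sum borel_measurable_times borel_measurable_const
        borel_measurable_resolvent measurable_compose[OF _ meas])
     (use assms in \<open>auto simp: apply_entries_def intro!: measurable_compose[OF _ meas]\<close>)

lemma measurable_first_layer:
  assumes "\<And>l. l < d \<Longrightarrow> (\<lambda>x. W x (j, l)) \<in> borel_measurable M" "\<And>l. l < d \<Longrightarrow> (\<lambda>x. X x (i, l)) \<in> borel_measurable M"
  shows "(\<lambda>x. first_layer d (W x) (X x) (i, j)) \<in> borel_measurable M"
  unfolding first_layer_def split using assms by (auto intro!: borel_measurable_sum borel_measurable_times)

lemma measurable_layer_vec:
  assumes "\<And>l. l < d \<Longrightarrow> (\<lambda>x. W x (j, l)) \<in> borel_measurable M" "\<And>l. l < d \<Longrightarrow> (\<lambda>x. y x l) \<in> borel_measurable M"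
  shows "(\<lambda>x. layer_vec d (W x) (y x) j) \<in> borel_measurable M"
  unfolding layer_vec_def using assms by (auto intro!: borel_measurable_sum borel_measurable_times)

definition err_coef :: "nat \<Rightarrow> nat \<Rightarrow> nat \<Rightarrow> real \<Rightarrow> (nat \<times> nat \<Rightarrow> real) \<Rightarrow> (nat \<times> nat \<Rightarrow> real) \<Rightarrow> (nat \<Rightarrow> real) \<Rightarrow> nat \<Rightarrow> real" where
  "err_coef n d p lam W X x l = (\<Sum>j<p. \<phi> (layer_vec d W x j) * coef n p lam (first_layer d W X) X j l) - x l"

definition err_noise :: "nat \<Rightarrow> nat \<Rightarrow> nat \<Rightarrow> real \<Rightarrow> (nat \<times> nat \<Rightarrow> real) \<Rightarrow> (nat \<times> nat \<Rightarrow> real) \<Rightarrow> (nat \<Rightarrow> real) \<Rightarrow> nat \<Rightarrow> real" where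
  "err_noise n d p lam W X x i = (\<Sum>j<p. \<phi> (layer_vec d W x j) * noise n p lam (first_layer d W X) j i)"

lemma prediction_error_eq:
  assumes "lam > 0" "n > 0" "p > 0"
  shows "prediction \<phi> p n d lam (\<theta>, x) (W, X, E) - truth d (\<theta>, x) =
    (\<Sum>i<n. err_noise n d p lam W X x i * E i) + (\<Sum>l<d. err_coef n d p lam W X x l * \<theta> l)"
proof -
  have "(\<Sum>l<d. (\<Sum>j<p. \<phi> (layer_vec d W x j) * coef n p lam (first_layer d W X) X j l) * \<theta> l) =
     (\<Sum>j<p. \<phi> (layer_vec d W x j) * (\<Sum>l<d. coef n p lam (first_layer d W X) X j l * \<theta> l))"
    by (simp add: sum_distrib_left sum_distrib_right mult.assoc) (rule sum.swap)
  moreover have "(\<Sum>i<n. (\<Sum>j<p. \<phi> (layer_vec d W x j) * noise n p lam (first_layer d W X) j i) * E i) =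
     (\<Sum>j<p. \<phi> (layer_vec d W x j) * (\<Sum>i<n. noise n p lam (first_layer d W X) j i * E i))"
    by (simp add: sum_distrib_left sum_distrib_right mult.assoc) (rule sum.swap)
  ultimately show ?thesis
    unfolding prediction_eq[OF assms] truth_eq err_coef_def err_noise_def
    by (simp add: left_diff_distrib distrib_left sum.distrib sum_subtractf)
qed

lemma measurable_err_coef:
  assumes "\<And>j l. j < p \<Longrightarrow> l < d \<Longrightarrow> (\<lambda>x. W x (j, l)) \<in> borel_measurable M"
    "\<And>i l. i < n \<Longrightarrow> l < d \<Longrightarrow> (\<lambda>x. X x (i, l)) \<in> borel_measurable M"
    "\<And>l. l < d \<Longrightarrow> (\<lambda>x. y x l) \<in> borel_measurable M" "l < d"
  shows "(\<lambda>x. err_coef n d p lam (W x) (X x) (y x) l) \<in> borel_measurable M"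
  unfolding err_coef_def
  by (intro borel_measurable_diff borel_measurable_sum borel_measurable_times measurable_compose[OF _ meas]
      measurable_layer_vec measurable_coef measurable_first_layer) (use assms in auto)

lemma measurable_err_noise:
  assumes "\<And>j l. j < p \<Longrightarrow> l < d \<Longrightarrow> (\<lambda>x. W x (j, l)) \<in> borel_measurable M"
    "\<And>i l. i < n \<Longrightarrow> l < d \<Longrightarrow> (\<lambda>x. X x (i, l)) \<in> borel_measurable M"
    "\<And>l. l < d \<Longrightarrow> (\<lambda>x. y x l) \<in> borel_measurable M" "i < n"
  shows "(\<lambda>x. err_noise n d p lam (W x) (X x) (y x) i) \<in> borel_measurable M"
  unfolding err_noise_def
  by (intro borel_measurable_sum borel_measurable_times measurable_compose[OF _ meas]
      measurable_layer_vec measurable_noise measurable_first_layer) (use assms in auto)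

text \<open>Squared error after averaging over the signal, with standard deviation s, and the noise,
  for W = (I 0): the first p data columns are then the preactivations, and the first p coordinates
  of x feed the network.\<close>

definition mse_coord :: "nat \<Rightarrow> nat \<Rightarrow> nat \<Rightarrow> real \<Rightarrow> real \<Rightarrow> real \<Rightarrow> (nat \<times> nat \<Rightarrow> real) \<Rightarrow> (nat \<Rightarrow> real) \<Rightarrow> real" where
  "mse_coord n d p lam s \<sigma> X x =
     s\<^sup>2 * (\<Sum>k<d. ((\<Sum>j<p. \<phi> (x j) * coef n p lam X X j k) - x k)\<^sup>2) + \<sigma>\<^sup>2 * (\<Sum>i<n. (\<Sum>j<p. \<phi> (x j) * noise n p lam X j i)\<^sup>2)"

text \<open>\<open>mse_coord\<close> averaged over the test point, as \<open>nn_mse_coord\<close>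
  shows; the cross term keeps only k < p since \<phi>(x_j) and x_k are uncorrelated for j \<noteq>
  k.\<close>

definition mse_given :: "nat \<Rightarrow> nat \<Rightarrow> nat \<Rightarrow> real \<Rightarrow> real \<Rightarrow> real \<Rightarrow> (nat \<times> nat \<Rightarrow> real) \<Rightarrow> real" where
  "mse_given n d p lam s \<sigma> X =
     s\<^sup>2 * (v * (\<Sum>k<d. form n {..<p} lam (\<lambda>z. z) (\<lambda>z. z) k X - lam * form2 n {..<p} lam k X)
       - 2 * \<mu> * (\<Sum>k<p. form n {..<p} lam (\<lambda>z. z) \<phi> k X) + real d)
     + \<sigma>\<^sup>2 * v * (trn n {..<p} lam X - lam * trn2 n {..<p} lam X)"

lemma sq_integrable_phi: "sq_integrable N01 \<phi>"
  using prob_space.sq_integrable_of_fourth[OF prob_space_N01, of \<phi>] meas fourth by simp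

lemma sq_integrable_id: "sq_integrable N01 (\<lambda>z. z)"
  using integrable_N01_power[of 2] by (simp add: sq_integrable_def)

text \<open>Q completes \<open>W\<close>. The vector of signal coefficients of the error is rotated
  by Q, which preserves its squared norm; the noise coefficients depend only on the preactivations
  of the data and of x, which are the first p rotated coordinates.\<close>

lemma err_coef_coord:
  assumes Q: "orthogonal d Q" "\<And>j l. j < p \<Longrightarrow> l < d \<Longrightarrow> Q j l = W (j, l)" and p: "p \<le> d"
  shows "s\<^sup>2 * (\<Sum>l<d. (err_coef n d p lam W X x l)\<^sup>2) + \<sigma>\<^sup>2 * (\<Sum>i<n. (err_noise n d p lam W X x i)\<^sup>2) =
    mse_coord n d p lam s \<sigma> (rot_mat n d Q X) (rot_vec d Q x)"
proof -
  let ?X = "rot_mat n d Q X" and ?x = "rot_vec d Q x"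
  have lv: "layer_vec d W x j = ?x j" if "j < p" for j
    using that p Q(2) by (simp add: layer_vec_def rot_vec_def)
  have fl: "first_layer d W X (i, j) = ?X (i, j)" if "i < n" "j < p" for i j
    using that p Q(2) by (simp add: first_layer_def rot_mat_def)
  have c: "coef n p lam (first_layer d W X) Y j l = coef n p lam ?X Y j l" if "j < p" for Y j l
    by (rule coef_cong) (use fl that in auto)
  have e: "err_noise n d p lam W X x i = (\<Sum>j<p. \<phi> (?x j) * noise n p lam ?X j i)" if "i < n" for i
    unfolding err_noise_def
    by (intro sum.cong refl arg_cong2[where f = "(*)"] arg_cong[where f = \<phi>] lv noise_cong) (use fl that in auto)
  have "(\<Sum>j<p. \<phi> (?x j) * coef n p lam ?X ?X j k) - ?x k = (\<Sum>l<d. Q k l * err_coef n d p lam W X x l)" if k: "k < d" for k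
  proof -
    have "(\<Sum>j<p. \<phi> (?x j) * coef n p lam ?X ?X j k) = (\<Sum>j<p. \<Sum>l<d. Q k l * (\<phi> (layer_vec d W x j) * coef n p lam (first_layer d W X) X j l))"
      by (intro sum.cong refl) (simp add: coef_rot[OF k] lv c sum_distrib_left mult_ac)
    also have "\<dots> = (\<Sum>l<d. Q k l * (\<Sum>j<p. \<phi> (layer_vec d W x j) * coef n p lam (first_layer d W X) X j l))"
      by (subst sum.swap) (simp add: sum_distrib_left)
    finally show ?thesis
      using k by (simp add: err_coef_def rot_vec_def right_diff_distrib sum_subtractf)
  qed
  then have "(\<Sum>k<d. ((\<Sum>j<p. \<phi> (?x j) * coef n p lam ?X ?X j k) - ?x k)\<^sup>2) = (\<Sum>l<d. (err_coef n d p lam W X x l)\<^sup>2)"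
    using orthogonal_norm[OF Q(1)] by simp
  then show ?thesis unfolding mse_coord_def using e by simp
qed

text \<open>Under a Gaussian test point the activations are uncorrelated with variance v, and
  \<phi>(x_j) correlates with x_j alone, with covariance \<mu>. Expanding the square leaves sums of
  squared coefficients, which are resolvent forms, and the diagonal coefficients.\<close>

lemma nn_mse_coord:
  assumes lam: "lam > 0" and p: "p \<le> d"
  shows "(\<integral>\<^sup>+ x. ennreal (mse_coord n d p lam s \<sigma> X x) \<partial>PiM {..<d} (\<lambda>_. N01)) = ennreal (mse_given n d p lam s \<sigma> X)"
    "0 \<le> mse_given n d p lam s \<sigma> X"
proof -
  let ?P = "PiM {..<d} (\<lambda>_. N01)"
  interpret P: prob_space ?P by (rule prob_space_PiM) (rule prob_space_N01)
  \<comment> \<open>Padding by zeros turns sums over p activations into linear forms in all d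
    coordinates, to which \<open>integral_linear_forms\<close> applies.\<close>
  define ext where "ext = (\<lambda>(a :: nat \<Rightarrow> real) j. if j < p then a j else 0)"
  have L: "(\<Sum>j<p. \<phi> (x j) * a j) = (\<Sum>j<d. ext a j * \<phi> (x j))" for a x
    unfolding ext_def by (rule sum.mono_neutral_cong_left) (use p in auto)
  have L2: "(\<Sum>j<d. (ext a j)\<^sup>2) = (\<Sum>j<p. (a j)\<^sup>2)" for a
    unfolding ext_def by (rule sum.mono_neutral_cong_right) (use p in auto)
  have sL: "sq_integrable ?P (\<lambda>x. \<Sum>j<p. \<phi> (x j) * a j)" for a
    unfolding L by (rule sq_integrable_linear_form[OF prob_space_N01 sq_integrable_phi])
  have sX: "sq_integrable ?P (\<lambda>x. x k)" if "k < d" for k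
    using sq_integrable_component[OF prob_space_N01 _ sq_integrable_id, of k "{..<d}"] that by simp
  have i1: "(\<integral>x. (\<Sum>j<p. \<phi> (x j) * a j)\<^sup>2 \<partial>?P) = v * (\<Sum>j<p. (a j)\<^sup>2)" for a
    using integral_linear_forms[OF prob_space_N01 _ sq_integrable_phi sq_integrable_phi, of "{..<d}" "ext a" "ext a"] mean v
    unfolding L L2[symmetric] by (simp add: power2_eq_square)
  have i2: "(\<integral>x. (\<Sum>j<p. \<phi> (x j) * a j) * x k \<partial>?P) = \<mu> * ext a k" if "k < d" for a k
  proof -
    have "(\<Sum>j<d. (if j = k then 1 else 0) * x j) = x k" for x :: "nat \<Rightarrow> real"
      using that by (simp add: if_distrib[of "\<lambda>c. c * _"] cong: if_cong)
    moreover have "(\<Sum>j<d. ext a j * (if j = k then 1 else 0)) = ext a k"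
      using that by (simp add: if_distrib cong: if_cong)
    ultimately show ?thesis
      using integral_linear_forms[OF prob_space_N01 _ sq_integrable_phi sq_integrable_id, of "{..<d}" "ext a" "\<lambda>j. if j = k then 1 else 0"] mean mu
      unfolding L by (simp add: mult.commute)
  qed
  have i3: "(\<integral>x. (x k)\<^sup>2 \<partial>?P) = 1" if "k < d" for k
    using integral_PiM_component(1)[OF prob_space_N01, of k "{..<d}" "\<lambda>z. z\<^sup>2"] that N01_second_moment by simp
  have d: "sq_integrable ?P (\<lambda>x. (\<Sum>j<p. \<phi> (x j) * a j) - x k)" if "k < d" for a k
    by (intro sq_integrable_diff sL sX that)
  have i4: "(\<integral>x. ((\<Sum>j<p. \<phi> (x j) * a j) - x k)\<^sup>2 \<partial>?P) = v * (\<Sum>j<p. (a j)\<^sup>2) - 2 * (\<mu> * ext a k) + 1" if k: "k < d" for a k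
  proof -
    have "(\<integral>x. ((\<Sum>j<p. \<phi> (x j) * a j) - x k)\<^sup>2 \<partial>?P) =
       (\<integral>x. (\<Sum>j<p. \<phi> (x j) * a j)\<^sup>2 - 2 * ((\<Sum>j<p. \<phi> (x j) * a j) * x k) + (x k)\<^sup>2 \<partial>?P)"
      by (simp add: power2_diff mult.assoc add_diff_eq diff_add_eq)
    also have "\<dots> = (\<integral>x. (\<Sum>j<p. \<phi> (x j) * a j)\<^sup>2 \<partial>?P) - 2 * (\<integral>x. (\<Sum>j<p. \<phi> (x j) * a j) * x k \<partial>?P) + (\<integral>x. (x k)\<^sup>2 \<partial>?P)"
      using sL[of a] sX[OF k] sq_integrable_mult[OF sL[of a] sX[OF k]] by (simp add: sq_integrable_def)
    finally show ?thesis unfolding i1 i2[OF k] i3[OF k] .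
  qed
  have int: "integrable ?P (mse_coord n d p lam s \<sigma> X)"
    unfolding mse_coord_def[abs_def]
    using d sL by (intro Bochner_Integration.integrable_add Bochner_Integration.integrable_mult_right Bochner_Integration.integrable_sum)
      (auto simp: sq_integrable_def)
  have sum_ext: "(\<Sum>k<d. ext (\<lambda>j. coef n p lam X X j k) k) = (\<Sum>k<p. coef n p lam X X k k)"
    unfolding ext_def by (rule sum.mono_neutral_cong_right) (use p in auto)
  have "integral\<^sup>L ?P (mse_coord n d p lam s \<sigma> X) =
      s\<^sup>2 * (\<Sum>k<d. (\<integral>x. ((\<Sum>j<p. \<phi> (x j) * coef n p lam X X j k) - x k)\<^sup>2 \<partial>?P)) +
      \<sigma>\<^sup>2 * (\<Sum>i<n. (\<integral>x. (\<Sum>j<p. \<phi> (x j) * noise n p lam X j i)\<^sup>2 \<partial>?P))"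
    unfolding mse_coord_def[abs_def]
    using d sL
    by (subst Bochner_Integration.integral_add)
       (auto simp: sq_integrable_def intro!: Bochner_Integration.integrable_sum Bochner_Integration.integral_sum Bochner_Integration.integrable_mult_right)
  also have "(\<Sum>k<d. (\<integral>x. ((\<Sum>j<p. \<phi> (x j) * coef n p lam X X j k) - x k)\<^sup>2 \<partial>?P)) =
     (\<Sum>k<d. v * (\<Sum>j<p. (coef n p lam X X j k)\<^sup>2) - 2 * (\<mu> * ext (\<lambda>j. coef n p lam X X j k) k) + 1)"
    by (intro sum.cong refl i4) simp
  also have "\<dots> = v * (\<Sum>k<d. \<Sum>j<p. (coef n p lam X X j k)\<^sup>2) - 2 * \<mu> * (\<Sum>k<p. coef n p lam X X k k) + real d"
    unfolding sum_ext[symmetric] by (simp add: sum.distrib sum_subtractf sum_distrib_left mult.assoc)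
  also have "(\<Sum>i<n. (\<integral>x. (\<Sum>j<p. \<phi> (x j) * noise n p lam X j i)\<^sup>2 \<partial>?P)) = v * (\<Sum>i<n. \<Sum>j<p. (noise n p lam X j i)\<^sup>2)"
    unfolding i1 by (simp add: sum_distrib_left)
  finally have "integral\<^sup>L ?P (mse_coord n d p lam s \<sigma> X) = mse_given n d p lam s \<sigma> X"
    unfolding mse_given_def noise_square_sum[OF lam] coef_id_square_sum[OF lam] coef_diag[OF lam] by (simp add: mult.assoc)
  moreover have "mse_coord n d p lam s \<sigma> X x \<ge> 0" for x
    unfolding mse_coord_def by (intro add_nonneg_nonneg mult_nonneg_nonneg sum_nonneg) auto
  ultimately show "(\<integral>\<^sup>+ x. ennreal (mse_coord n d p lam s \<sigma> X x) \<partial>PiM {..<d} (\<lambda>_. N01)) = ennreal (mse_given n d p lam s \<sigma> X)"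
    "0 \<le> mse_given n d p lam s \<sigma> X"
    using nn_integral_eq_integral[OF int] Bochner_Integration.integral_nonneg[where M = ?P and f = "mse_coord n d p lam s \<sigma> X"] by auto
qed

end

lemma measurable_gaussian_vec_component: "l < d \<Longrightarrow> (\<lambda>x. x l) \<in> borel_measurable (gaussian_vec d s)"
  using measurable_component_singleton[of l "{..<d}" "\<lambda>_. centered_normal s"]
  by (simp add: gaussian_vec_def cong: measurable_cong_sets)

lemma gaussian_mat_eq: "gaussian_mat n d = gram_law n d"
  by (simp add: gaussian_mat_def PiM_centered_normal_1)

lemma gaussian_vec_1: "gaussian_vec d 1 = PiM {..<d} (\<lambda>_. N01)"
  by (simp add: gaussian_vec_def PiM_centered_normal_1)

lemma measurable_gram_component: "i < n \<Longrightarrow> l < d \<Longrightarrow> (\<lambda>X. X (i, l)) \<in> borel_measurable (gram_law n d)"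
  using measurable_component_singleton[of "(i, l)" "{..<n} \<times> {..<d}" "\<lambda>_. N01"]
  by (simp cong: measurable_cong_sets)

lemma prob_space_gaussian_vec: "prob_space (gaussian_vec d s)"
  unfolding gaussian_vec_def by (rule prob_space_PiM) (rule prob_space_centered_normal)

lemma measurable_stiefel_component:
  assumes "uniform_stiefel p d H" "j < p" "l < d"
  shows "(\<lambda>W. W (j, l)) \<in> borel_measurable H"
proof -
  have "sets H = sets (PiM ({..<p} \<times> {..<d}) (\<lambda>_. borel :: real measure))" using assms by (simp add: uniform_stiefel_def)
  moreover have "(\<lambda>W. W (j, l)) \<in> borel_measurable (PiM ({..<p} \<times> {..<d}) (\<lambda>_. borel :: real measure))"
    by (rule measurable_component_singleton) (use assms in auto)
  ultimately show ?thesis by (simp cong: measurable_cong_sets)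
qed

lemma stiefel_orthonormal:
  assumes "mat p d W * transpose_mat (mat p d W) = 1\<^sub>m p" "j < p" "k < p"
  shows "(\<Sum>l<d. W (j, l) * W (k, l)) = (if j = k then 1 else 0 :: real)"
proof -
  have "(mat p d W * transpose_mat (mat p d W)) $$ (j, k) = (\<Sum>l<d. W (j, l) * W (k, l))"
    using assms(2,3) by (simp add: scalar_prod_def atLeast0LessThan)
  then show ?thesis using assms by simp
qed

lemma stiefel_complete:
  assumes "mat p d W * transpose_mat (mat p d W) = (1\<^sub>m p :: real mat)" "p \<le> d"
  obtains Q where "orthogonal d Q" "\<And>j l. j < p \<Longrightarrow> l < d \<Longrightarrow> Q j l = W (j, l)"
proof -
  obtain Q where "\<forall>j<p. Q j = (\<lambda>l. W (j, l))" "orthogonal d Q"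
    using orthonormal_complete[where p = p and d = d and w = "\<lambda>j l. W (j, l)"] stiefel_orthonormal[OF assms(1)] assms(2) by blast
  then show thesis using that by simp
qed

context activation
begin

lemma integral_mse_given:
  assumes lam: "lam > 0" and n: "n > 0" and p: "p \<le> d" and d: "d > 0"
  shows "integrable (gram_law n d) (mse_given n d p lam s \<sigma>)"
    "integral\<^sup>L (gram_law n d) (mse_given n d p lam s \<sigma>) =
      s\<^sup>2 * real d * (v * (avg_form n d p lam - lam * avg_form2 n d p lam) - 2 * \<mu> * avg_cross n d p lam + 1)
      + v * \<sigma>\<^sup>2 * (\<tau> n d p lam - lam * \<tau>2 n d p lam)"
proof -
  interpret P: prob_space "gram_law n d" by (rule gram_prob)
  note i = form_id_id_limit(1)[OF lam n p] integrable_form2[OF lam n p] form_id_phi_limit(1)[OF lam n p]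
    tau_bounds(3)[OF lam n p] integrable_trn2[OF lam n p]
  define A where "A = (\<lambda>X. \<Sum>k<d. form n {..<p} lam (\<lambda>z. z) (\<lambda>z. z) k X - lam * form2 n {..<p} lam k X)"
  define B where "B = (\<lambda>X. \<Sum>k<p. form n {..<p} lam (\<lambda>z. z) \<phi> k X)"
  have A: "integrable (gram_law n d) A" "integral\<^sup>L (gram_law n d) A = real d * (avg_form n d p lam - lam * avg_form2 n d p lam)"
  proof -
    show "integrable (gram_law n d) A" unfolding A_def
      by (intro Bochner_Integration.integrable_sum Bochner_Integration.integrable_diff Bochner_Integration.integrable_mult_right i) auto
    have "integral\<^sup>L (gram_law n d) A = (\<Sum>k<d. (\<integral>X. form n {..<p} lam (\<lambda>z. z) (\<lambda>z. z) k X - lam * form2 n {..<p} lam k X \<partial>gram_law n d))"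
      unfolding A_def by (rule Bochner_Integration.integral_sum) (use i in auto)
    also have "\<dots> = (\<Sum>k<d. (\<integral>X. form n {..<p} lam (\<lambda>z. z) (\<lambda>z. z) k X \<partial>gram_law n d) - lam * (\<integral>X. form2 n {..<p} lam k X \<partial>gram_law n d))"
      by (intro sum.cong refl) (use i in auto)
    finally show "integral\<^sup>L (gram_law n d) A = real d * (avg_form n d p lam - lam * avg_form2 n d p lam)"
      unfolding avg_form_def avg_form2_def using d
      by (simp add: sum_subtractf sum_distrib_left[symmetric] right_diff_distrib)
  qed
  have B: "integrable (gram_law n d) B" "integral\<^sup>L (gram_law n d) B = real d * avg_cross n d p lam"
  proof -
    show "integrable (gram_law n d) B" unfolding B_def by (intro Bochner_Integration.integrable_sum i) auto
    have "integral\<^sup>L (gram_law n d) B = (\<Sum>k<p. (\<integral>X. form n {..<p} lam (\<lambda>z. z) \<phi> k X \<partial>gram_law n d))"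
      unfolding B_def by (rule Bochner_Integration.integral_sum) (use i in auto)
    then show "integral\<^sup>L (gram_law n d) B = real d * avg_cross n d p lam"
      unfolding avg_cross_def using d by simp
  qed
  have m: "mse_given n d p lam s \<sigma> = (\<lambda>X. s\<^sup>2 * (v * A X - 2 * \<mu> * B X + real d) + \<sigma>\<^sup>2 * v * (trn n {..<p} lam X - lam * trn2 n {..<p} lam X))"
    unfolding mse_given_def A_def B_def ..
  show "integrable (gram_law n d) (mse_given n d p lam s \<sigma>)"
    unfolding m using A(1) B(1) i(4,5) by simp
  have "integral\<^sup>L (gram_law n d) (mse_given n d p lam s \<sigma>) =
     s\<^sup>2 * (v * integral\<^sup>L (gram_law n d) A - 2 * \<mu> * integral\<^sup>L (gram_law n d) B + real d) + \<sigma>\<^sup>2 * v * (\<tau> n d p lam - lam * \<tau>2 n d p lam)"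
    unfolding m \<tau>_def \<tau>2_def using A(1) B(1) i(4,5) by (simp add: P.prob_space)
  then show "integral\<^sup>L (gram_law n d) (mse_given n d p lam s \<sigma>) =
      s\<^sup>2 * real d * (v * (avg_form n d p lam - lam * avg_form2 n d p lam) - 2 * \<mu> * avg_cross n d p lam + 1)
      + v * \<sigma>\<^sup>2 * (\<tau> n d p lam - lam * \<tau>2 n d p lam)"
    unfolding A(2) B(2) by (simp add: algebra_simps)
qed

text \<open>The laws of the data and of the test point are rotation invariant, so after rotation by
  a completion of \<open>W\<close> the expectation no longer depends on \<open>W\<close>.\<close>

lemma nn_error_given_layer:
  assumes lam: "lam > 0" and n: "n > 0" and p: "p \<le> d" and d: "d > 0"
    and W: "mat p d W * transpose_mat (mat p d W) = 1\<^sub>m p"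
  shows "(\<integral>\<^sup>+ X. \<integral>\<^sup>+ x. ennreal (s\<^sup>2 * (\<Sum>l<d. (err_coef n d p lam W X x l)\<^sup>2) + \<sigma>\<^sup>2 * (\<Sum>i<n. (err_noise n d p lam W X x i)\<^sup>2))
      \<partial>PiM {..<d} (\<lambda>_. N01) \<partial>gram_law n d) = ennreal (integral\<^sup>L (gram_law n d) (mse_given n d p lam s \<sigma>))"
proof -
  obtain Q where Q: "orthogonal d Q" "\<And>j l. j < p \<Longrightarrow> l < d \<Longrightarrow> Q j l = W (j, l)"
    using stiefel_complete[OF W p] by metis
  note i = integral_mse_given[OF lam n p d, of s \<sigma>]
  have m: "(\<lambda>x. ennreal (mse_coord n d p lam s \<sigma> Y x)) \<in> borel_measurable (PiM {..<d} (\<lambda>_. borel))" for Y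
  proof -
    have "(\<lambda>x. x l) \<in> borel_measurable (PiM {..<d} (\<lambda>_. borel))" if "l < d" for l
      by (rule measurable_component_singleton) (use that in auto)
    then show ?thesis unfolding mse_coord_def using p
      by (intro measurable_compose[OF _ measurable_ennreal] borel_measurable_add borel_measurable_times borel_measurable_const
           borel_measurable_sum borel_measurable_power borel_measurable_diff measurable_compose[OF _ meas]) auto
  qed
  have "(\<integral>\<^sup>+ X. \<integral>\<^sup>+ x. ennreal (s\<^sup>2 * (\<Sum>l<d. (err_coef n d p lam W X x l)\<^sup>2) + \<sigma>\<^sup>2 * (\<Sum>i<n. (err_noise n d p lam W X x i)\<^sup>2))
      \<partial>PiM {..<d} (\<lambda>_. N01) \<partial>gram_law n d) =
    (\<integral>\<^sup>+ X. \<integral>\<^sup>+ x. ennreal (mse_coord n d p lam s \<sigma> (rot_mat n d Q X) (rot_vec d Q x)) \<partial>PiM {..<d} (\<lambda>_. N01) \<partial>gram_law n d)"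
    using err_coef_coord[OF Q p] by (intro nn_integral_cong) simp
  also have "\<dots> = (\<integral>\<^sup>+ X. ennreal (mse_given n d p lam s \<sigma> (rot_mat n d Q X)) \<partial>gram_law n d)"
    by (intro nn_integral_cong trans[OF nn_integral_rot_vec[OF Q(1) m] nn_mse_coord(1)[OF lam p]])
  also have "\<dots> = (\<integral>\<^sup>+ X. ennreal (mse_given n d p lam s \<sigma> X) \<partial>distr (gram_law n d) (gram_law n d) (rot_mat n d Q))"
    by (rule nn_integral_distr[symmetric, OF measurable_rot_mat]) (use i in auto)
  also have "\<dots> = ennreal (integral\<^sup>L (gram_law n d) (mse_given n d p lam s \<sigma>))"
    unfolding distr_rot_mat[OF Q(1)]
    by (rule nn_integral_eq_integral[OF i(1)]) (simp add: nn_mse_coord(2)[OF lam p])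
  finally show ?thesis .
qed

lemma measurable_prediction_error:
  assumes "lam > 0" "n > 0" "p > 0"
    and "\<And>l. l < d \<Longrightarrow> (\<lambda>y. \<theta> y l) \<in> borel_measurable M" "\<And>l. l < d \<Longrightarrow> (\<lambda>y. x y l) \<in> borel_measurable M"
    "\<And>j l. j < p \<Longrightarrow> l < d \<Longrightarrow> (\<lambda>y. W y (j, l)) \<in> borel_measurable M"
    "\<And>i l. i < n \<Longrightarrow> l < d \<Longrightarrow> (\<lambda>y. X y (i, l)) \<in> borel_measurable M"
    "\<And>i. i < n \<Longrightarrow> (\<lambda>y. E y i) \<in> borel_measurable M"
  shows "(\<lambda>y. prediction \<phi> p n d lam (\<theta> y, x y) (W y, X y, E y) - truth d (\<theta> y, x y)) \<in> borel_measurable M"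
  unfolding prediction_error_eq[OF assms(1-3)]
  by (intro borel_measurable_add borel_measurable_sum borel_measurable_times measurable_err_coef measurable_err_noise)
     (use assms in auto)

lemma measurable_truth:
  assumes "\<And>l. l < d \<Longrightarrow> (\<lambda>y. \<theta> y l) \<in> borel_measurable M" "\<And>l. l < d \<Longrightarrow> (\<lambda>y. x y l) \<in> borel_measurable M"
  shows "(\<lambda>y. truth d (\<theta> y, x y)) \<in> borel_measurable M"
  unfolding truth_eq using assms by (auto intro!: borel_measurable_sum borel_measurable_times)

end

subsection \<open>The mean squared error\<close>

locale regression = activation +
  fixes n d p :: nat and lam \<alpha> \<sigma> :: real and H :: "(nat \<times> nat \<Rightarrow> real) measure"
  assumes lam: "lam > 0" and n: "n > 0" and p: "p > 0" and pd: "p \<le> d" and H: "uniform_stiefel p d H"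
begin

abbreviation "\<Theta> \<equiv> gaussian_vec d (\<alpha> / sqrt (real d))"
abbreviation "\<Xi> \<equiv> PiM {..<d} (\<lambda>_. N01)"
abbreviation "GE \<equiv> gaussian_vec n \<sigma>"
abbreviation "Tst \<equiv> test_law \<alpha> d"
abbreviation "Trn \<equiv> train_law \<sigma> n d H"

lemma d: "d > 0" using p pd by simp

lemma laws: "Tst = \<Theta> \<Otimes>\<^sub>M \<Xi>" "Trn = H \<Otimes>\<^sub>M (gram_law n d \<Otimes>\<^sub>M GE)"
  by (simp_all add: test_law_def train_law_def gaussian_vec_1 gaussian_mat_eq)

lemma prob_H: "prob_space H" and orth_H: "AE W in H. mat p d W * transpose_mat (mat p d W) = 1\<^sub>m p"
  using H by (auto simp: uniform_stiefel_def)

sublocale PH: prob_space H by (rule prob_H)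
sublocale PT: prob_space \<Theta> by (rule prob_space_gaussian_vec)
sublocale PX: prob_space \<Xi> by (rule prob_space_PiM) (rule prob_space_N01)
sublocale PG: prob_space "gram_law n d" by (rule gram_prob)
sublocale PE: prob_space GE by (rule prob_space_gaussian_vec)
sublocale PTX: pair_prob_space \<Theta> \<Xi> ..
sublocale PGE: pair_prob_space "gram_law n d" GE ..
sublocale PTst: prob_space Tst unfolding laws by (rule PTX.prob_space_axioms)
sublocale PHGE: pair_prob_space H "gram_law n d \<Otimes>\<^sub>M GE" ..
sublocale PTrn: prob_space Trn unfolding laws by (rule PHGE.prob_space_axioms)
sublocale PTT: pair_prob_space Tst Trn ..
sublocale PEX: pair_prob_space GE \<Xi> ..

lemma measurable_Xi_component: "l < d \<Longrightarrow> (\<lambda>x. x l) \<in> borel_measurable \<Xi>"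
  using measurable_gaussian_vec_component[of l d 1] unfolding gaussian_vec_1 .

lemma measurable_H_component: "j < p \<Longrightarrow> l < d \<Longrightarrow> (\<lambda>W. W (j, l)) \<in> borel_measurable H"
  by (rule measurable_stiefel_component[OF H])

lemma comps_Tst:
  "l < d \<Longrightarrow> (\<lambda>t. fst t l) \<in> borel_measurable Tst" "l < d \<Longrightarrow> (\<lambda>t. snd t l) \<in> borel_measurable Tst"
  unfolding laws
  using measurable_compose[OF measurable_fst measurable_gaussian_vec_component]
    measurable_compose[OF measurable_snd measurable_Xi_component] by auto

lemma comps_Trn:
  "j < p \<Longrightarrow> l < d \<Longrightarrow> (\<lambda>s. fst s (j, l)) \<in> borel_measurable Trn"
  "i < n \<Longrightarrow> l < d \<Longrightarrow> (\<lambda>s. fst (snd s) (i, l)) \<in> borel_measurable Trn"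
  "i < n \<Longrightarrow> (\<lambda>s. snd (snd s) i) \<in> borel_measurable Trn"
  unfolding laws
  using measurable_compose[OF measurable_fst measurable_H_component]
    measurable_compose[OF measurable_compose[OF measurable_snd measurable_fst] measurable_gram_component]
    measurable_compose[OF measurable_compose[OF measurable_snd measurable_snd] measurable_gaussian_vec_component] by auto

lemma measurable_error_joint:
  "(\<lambda>z. prediction \<phi> p n d lam (fst z) (snd z) - truth d (fst z)) \<in> borel_measurable (Tst \<Otimes>\<^sub>M Trn)"
proof -
  have "(\<lambda>z. prediction \<phi> p n d lam (fst (fst z), snd (fst z)) (fst (snd z), fst (snd (snd z)), snd (snd (snd z))) -
      truth d (fst (fst z), snd (fst z))) \<in> borel_measurable (Tst \<Otimes>\<^sub>M Trn)"
    by (rule measurable_prediction_error[OF lam n p])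
       (auto intro: measurable_compose[OF measurable_fst comps_Tst(1)] measurable_compose[OF measurable_fst comps_Tst(2)]
         measurable_compose[OF measurable_snd comps_Trn(1)] measurable_compose[OF measurable_snd comps_Trn(2)]
         measurable_compose[OF measurable_snd comps_Trn(3)])
  then show ?thesis by simp
qed

text \<open>Tonelli in the order signal, noise, test point, data, first layer. The noise is
  exchanged with the test point because the affine form in the noise has coefficients depending on
  x. All integrands are nonnegative, so the finite value also yields square integrability
  later.\<close>

lemma nn_error_total:
  "(\<integral>\<^sup>+ z. ennreal ((prediction \<phi> p n d lam (fst z) (snd z) - truth d (fst z))\<^sup>2) \<partial>(Tst \<Otimes>\<^sub>M Trn)) =
    ennreal (integral\<^sup>L (gram_law n d) (mse_given n d p lam (\<alpha> / sqrt (real d)) \<sigma>))"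
proof -
  let ?s = "\<alpha> / sqrt (real d)"
  let ?D = "\<lambda>t s. prediction \<phi> p n d lam t s - truth d t"
  let ?c = "\<lambda>W X x. \<Sum>l<d. (err_coef n d p lam W X x l)\<^sup>2"
  let ?e = "\<lambda>W X x. \<Sum>i<n. (err_noise n d p lam W X x i)\<^sup>2"
  let ?L = "\<lambda>W X E x. \<Sum>i<n. err_noise n d p lam W X x i * E i"
  note mf = measurable_compose[OF borel_measurable_power[OF measurable_error_joint] measurable_ennreal, of 2]
  have inner: "(\<integral>\<^sup>+ t. ennreal ((?D t (W, X, E))\<^sup>2) \<partial>Tst) = (\<integral>\<^sup>+ x. ennreal ((?L W X E x)\<^sup>2 + ?s\<^sup>2 * ?c W X x) \<partial>\<Xi>)" for W X E
  proof -
    have m: "(\<lambda>t. ennreal ((?D t (W, X, E))\<^sup>2)) \<in> borel_measurable (\<Theta> \<Otimes>\<^sub>M \<Xi>)"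
    proof -
      have "(\<lambda>t. prediction \<phi> p n d lam (fst t, snd t) (W, X, E) - truth d (fst t, snd t)) \<in> borel_measurable (\<Theta> \<Otimes>\<^sub>M \<Xi>)"
        by (rule measurable_prediction_error[OF lam n p]) (auto intro: comps_Tst[unfolded laws])
      then show ?thesis by simp
    qed
    have "(\<integral>\<^sup>+ t. ennreal ((?D t (W, X, E))\<^sup>2) \<partial>Tst) = (\<integral>\<^sup>+ x. \<integral>\<^sup>+ \<theta>. ennreal ((?D (\<theta>, x) (W, X, E))\<^sup>2) \<partial>\<Theta> \<partial>\<Xi>)"
      unfolding laws by (rule PTX.nn_integral_snd[OF m, symmetric])
    also have "\<dots> = (\<integral>\<^sup>+ x. ennreal ((?L W X E x)\<^sup>2 + ?s\<^sup>2 * ?c W X x) \<partial>\<Xi>)"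
      unfolding prediction_error_eq[OF lam n p] gaussian_vec_def
      by (intro nn_integral_cong nn_affine_form) simp
    finally show ?thesis .
  qed
  \<comment> \<open>\<rho> is the error after averaging the signal and the test point; its
    measurability on the training space is inherited from the joint error.\<close>
  define \<rho> where "\<rho> = (\<lambda>W X E. \<integral>\<^sup>+ x. ennreal ((?L W X E x)\<^sup>2 + ?s\<^sup>2 * ?c W X x) \<partial>\<Xi>)"
  have m\<rho>: "(\<lambda>s. \<rho> (fst s) (fst (snd s)) (snd (snd s))) \<in> borel_measurable Trn"
  proof -
    have "(\<lambda>s. \<integral>\<^sup>+ t. ennreal ((?D t s)\<^sup>2) \<partial>Tst) \<in> borel_measurable Trn"
      by (rule PTst.borel_measurable_nn_integral)
         (use measurable_compose[OF measurable_pair_swap' mf] in \<open>simp add: case_prod_beta'\<close>)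
    moreover have "(\<integral>\<^sup>+ t. ennreal ((?D t s)\<^sup>2) \<partial>Tst) = \<rho> (fst s) (fst (snd s)) (snd (snd s))" for s
      unfolding \<rho>_def using inner[of "fst s" "fst (snd s)" "snd (snd s)"] by simp
    ultimately show ?thesis by simp
  qed
  have "(\<integral>\<^sup>+ z. ennreal ((?D (fst z) (snd z))\<^sup>2) \<partial>(Tst \<Otimes>\<^sub>M Trn)) = (\<integral>\<^sup>+ s. \<integral>\<^sup>+ t. ennreal ((?D t s)\<^sup>2) \<partial>Tst \<partial>Trn)"
    using PTT.nn_integral_snd[OF mf] by simp
  also have "\<dots> = (\<integral>\<^sup>+ s. \<rho> (fst s) (fst (snd s)) (snd (snd s)) \<partial>Trn)"
    by (intro nn_integral_cong) (use inner in \<open>simp add: \<rho>_def split_paired_all\<close>)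
  also have "\<dots> = (\<integral>\<^sup>+ W. \<integral>\<^sup>+ XE. \<rho> W (fst XE) (snd XE) \<partial>(gram_law n d \<Otimes>\<^sub>M GE) \<partial>H)"
    using PGE.nn_integral_fst[OF m\<rho>[unfolded laws]] unfolding laws by simp
  also have "\<dots> = (\<integral>\<^sup>+ W. ennreal (integral\<^sup>L (gram_law n d) (mse_given n d p lam ?s \<sigma>)) \<partial>H)"
  proof (rule nn_integral_cong_AE)
    show "AE W in H. (\<integral>\<^sup>+ XE. \<rho> W (fst XE) (snd XE) \<partial>(gram_law n d \<Otimes>\<^sub>M GE)) = ennreal (integral\<^sup>L (gram_law n d) (mse_given n d p lam ?s \<sigma>))"
      using orth_H
    proof eventually_elim
      case (elim W)
      have mc: "(\<lambda>y. ennreal ((?L W (X y) (E y) (x y))\<^sup>2 + ?s\<^sup>2 * ?c W (X y) (x y))) \<in> borel_measurable M"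
        if "\<And>l. l < d \<Longrightarrow> (\<lambda>y. x y l) \<in> borel_measurable M"
          "\<And>i l. i < n \<Longrightarrow> l < d \<Longrightarrow> (\<lambda>y. X y (i, l)) \<in> borel_measurable M"
          "\<And>i. i < n \<Longrightarrow> (\<lambda>y. E y i) \<in> borel_measurable M"
        for M :: "'z measure" and X E x
        by (intro measurable_compose[OF _ measurable_ennreal] borel_measurable_add borel_measurable_times borel_measurable_const
            borel_measurable_sum borel_measurable_power measurable_err_coef measurable_err_noise) (use that in auto)
      have m1: "(\<lambda>XE. \<rho> W (fst XE) (snd XE)) \<in> borel_measurable (gram_law n d \<Otimes>\<^sub>M GE)"
        unfolding \<rho>_def
        by (rule PX.borel_measurable_nn_integral, unfold case_prod_beta', rule mc)
           (auto intro!: measurable_compose[OF measurable_snd measurable_Xi_component]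
             measurable_compose[OF measurable_compose[OF measurable_fst measurable_fst] measurable_gram_component]
             measurable_compose[OF measurable_compose[OF measurable_fst measurable_snd] measurable_gaussian_vec_component])
      have "(\<integral>\<^sup>+ XE. \<rho> W (fst XE) (snd XE) \<partial>(gram_law n d \<Otimes>\<^sub>M GE)) = (\<integral>\<^sup>+ X. \<integral>\<^sup>+ E. \<rho> W X E \<partial>GE \<partial>gram_law n d)"
        using PE.nn_integral_fst[OF m1] by simp
      also have "\<dots> = (\<integral>\<^sup>+ X. \<integral>\<^sup>+ x. ennreal (?s\<^sup>2 * ?c W X x + \<sigma>\<^sup>2 * ?e W X x) \<partial>\<Xi> \<partial>gram_law n d)"
      proof (intro nn_integral_cong)
        fix X
        have "(\<integral>\<^sup>+ E. \<rho> W X E \<partial>GE) = (\<integral>\<^sup>+ x. \<integral>\<^sup>+ E. ennreal ((?L W X E x)\<^sup>2 + ?s\<^sup>2 * ?c W X x) \<partial>GE \<partial>\<Xi>)"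
          unfolding \<rho>_def
          by (rule PEX.Fubini'[symmetric], unfold case_prod_beta', rule mc)
             (auto intro!: measurable_compose[OF measurable_snd measurable_Xi_component]
               measurable_compose[OF measurable_fst measurable_gaussian_vec_component])
        also have "\<dots> = (\<integral>\<^sup>+ x. ennreal (?s\<^sup>2 * ?c W X x + \<sigma>\<^sup>2 * ?e W X x) \<partial>\<Xi>)"
        proof (intro nn_integral_cong)
          fix x
          have c0: "0 \<le> ?s\<^sup>2 * ?c W X x" by (intro mult_nonneg_nonneg sum_nonneg) auto
          have mE: "(\<lambda>E. ennreal ((?L W X E x)\<^sup>2)) \<in> borel_measurable GE"
            by (intro measurable_compose[OF _ measurable_ennreal] borel_measurable_power borel_measurable_sum borel_measurable_times
                borel_measurable_const measurable_gaussian_vec_component) auto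
          have "(\<integral>\<^sup>+ E. ennreal ((?L W X E x)\<^sup>2 + ?s\<^sup>2 * ?c W X x) \<partial>GE) = (\<integral>\<^sup>+ E. ennreal ((?L W X E x)\<^sup>2) + ennreal (?s\<^sup>2 * ?c W X x) \<partial>GE)"
            using c0 by (intro nn_integral_cong ennreal_plus) auto
          also have "\<dots> = (\<integral>\<^sup>+ E. ennreal ((?L W X E x)\<^sup>2) \<partial>GE) + ennreal (?s\<^sup>2 * ?c W X x)"
            by (subst nn_integral_add[OF mE]) (auto simp: PE.emeasure_space_1)
          also have "(\<integral>\<^sup>+ E. ennreal ((?L W X E x)\<^sup>2) \<partial>GE) = ennreal (\<sigma>\<^sup>2 * ?e W X x)"
            using nn_affine_form[where I = "{..<n}" and a = 0 and c = "err_noise n d p lam W X x" and s = \<sigma>] by (simp add: gaussian_vec_def)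
          also have "ennreal (\<sigma>\<^sup>2 * ?e W X x) + ennreal (?s\<^sup>2 * ?c W X x) = ennreal (?s\<^sup>2 * ?c W X x + \<sigma>\<^sup>2 * ?e W X x)"
            using c0 by (subst ennreal_plus[symmetric]) (auto simp: add.commute intro!: mult_nonneg_nonneg sum_nonneg)
          finally show "(\<integral>\<^sup>+ E. ennreal ((?L W X E x)\<^sup>2 + ?s\<^sup>2 * ?c W X x) \<partial>GE) = ennreal (?s\<^sup>2 * ?c W X x + \<sigma>\<^sup>2 * ?e W X x)" .
        qed
        finally show "(\<integral>\<^sup>+ E. \<rho> W X E \<partial>GE) = (\<integral>\<^sup>+ x. ennreal (?s\<^sup>2 * ?c W X x + \<sigma>\<^sup>2 * ?e W X x) \<partial>\<Xi>)" .
      qed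
      also have "\<dots> = ennreal (integral\<^sup>L (gram_law n d) (mse_given n d p lam ?s \<sigma>))"
        by (rule nn_error_given_layer[OF lam n pd d elim])
      finally show ?case .
    qed
  qed
  also have "\<dots> = ennreal (integral\<^sup>L (gram_law n d) (mse_given n d p lam ?s \<sigma>))"
    by (simp add: PH.emeasure_space_1)
  finally show ?thesis .
qed

definition mse0 :: real where
  "mse0 = \<alpha>\<^sup>2 * (v * (avg_form n d p lam - lam * avg_form2 n d p lam) - 2 * \<mu> * avg_cross n d p lam + 1)
      + v * \<sigma>\<^sup>2 * (\<tau> n d p lam - lam * \<tau>2 n d p lam)"

lemma mse0: "mse0 = integral\<^sup>L (gram_law n d) (mse_given n d p lam (\<alpha> / sqrt (real d)) \<sigma>)" "mse0 \<ge> 0"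
proof -
  have "(\<alpha> / sqrt (real d))\<^sup>2 * real d = \<alpha>\<^sup>2" using d by (simp add: power_divide)
  then show "mse0 = integral\<^sup>L (gram_law n d) (mse_given n d p lam (\<alpha> / sqrt (real d)) \<sigma>)"
    unfolding mse0_def integral_mse_given(2)[OF lam n pd d] by simp
  then show "mse0 \<ge> 0" using nn_mse_coord(2)[OF lam pd] by simp
qed

lemma MSE_eq: "MSE \<phi> \<alpha> \<sigma> p n d H lam = mse0 + \<sigma>\<^sup>2"
proof -
  have "(\<integral>z. (prediction \<phi> p n d lam (fst z) (snd z) - truth d (fst z))\<^sup>2 \<partial>(Tst \<Otimes>\<^sub>M Trn)) =
     enn2real (\<integral>\<^sup>+ z. ennreal ((prediction \<phi> p n d lam (fst z) (snd z) - truth d (fst z))\<^sup>2) \<partial>(Tst \<Otimes>\<^sub>M Trn))"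
    by (rule integral_eq_nn_integral) (use measurable_error_joint in auto)
  also have "\<dots> = mse0" unfolding nn_error_total mse0(1)[symmetric] using mse0(2) by simp
  finally show ?thesis by (simp add: MSE_def case_prod_beta')
qed

end

subsection \<open>The mean prediction, bias and variance\<close>

text \<open>For a fixed test point the preactivations are at most |x| in absolute value for every
  \<open>W\<close> with orthonormal rows, so the growth bound makes the activations bounded in
  \<open>W\<close> and means over \<open>W\<close> can be taken coordinate by coordinate.\<close>

locale regression_growth = regression +
  fixes c\<^sub>1 c\<^sub>2 :: real
  assumes growth: "\<And>t. \<bar>\<phi> t\<bar> \<le> c\<^sub>1 * exp (c\<^sub>2 * \<bar>t\<bar>)" and c2: "c\<^sub>2 > 0"
begin

definition C :: "nat \<Rightarrow> nat \<Rightarrow> real" where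
  "C j k = (\<integral>X. coef n p lam X X j k \<partial>gram_law n d)"

text \<open>By \<open>C_trace\<close> this is \<mu> tr(C) / d, the factor by which the mean
  prediction approximately multiplies the truth.\<close>

definition \<kappa> :: real where "\<kappa> = \<mu> * avg_cross n d p lam"

definition Cnorm :: real where "Cnorm = (\<Sum>j<p. \<Sum>k<p. (C j k)\<^sup>2)"

lemma Cnorm_nonneg: "Cnorm \<ge> 0"
  by (simp add: Cnorm_def sum_nonneg)

lemma measurable_coef_gram:
  assumes "j < p" "k < d"
  shows "(\<lambda>X. coef n p lam X X j k) \<in> borel_measurable (gram_law n d)"
  by (rule measurable_coef) (use assms pd in \<open>auto intro: measurable_gram_component\<close>)

lemma coef_sq_le:
  assumes "j < p"
  shows "(coef n p lam X X j k)\<^sup>2 \<le> form n {..<p} lam (\<lambda>z. z) (\<lambda>z. z) k X"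
proof -
  have "(coef n p lam X X j k)\<^sup>2 \<le> (\<Sum>j<p. (coef n p lam X X j k)\<^sup>2)"
    by (rule member_le_sum) (use assms in auto)
  also have "\<dots> \<le> form n {..<p} lam (\<lambda>z. z) (\<lambda>z. z) k X"
    unfolding coef_id_square_sum[OF lam] using lam form2_nonneg by simp
  finally show ?thesis .
qed

lemma sq_integrable_coef:
  assumes "j < p" "k < d"
  shows "sq_integrable (gram_law n d) (\<lambda>X. coef n p lam X X j k)"
  unfolding sq_integrable_def
proof
  show "(\<lambda>X. coef n p lam X X j k) \<in> borel_measurable (gram_law n d)" by (rule measurable_coef_gram[OF assms])
  then show "integrable (gram_law n d) (\<lambda>X. (coef n p lam X X j k)\<^sup>2)"
    by (intro Bochner_Integration.integrable_bound[OF form_id_id_limit(1)[OF lam n pd assms(2)]])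
       (use coef_sq_le[OF assms(1)] form_nonneg[OF lam] in auto)
qed

text \<open>Changing the sign of data column k preserves the Gaussian law and leaves the features
  alone because k \<ge> p, but it flips the coefficient.\<close>

lemma C_zero:
  assumes j: "j < p" and k: "p \<le> k" "k < d"
  shows "C j k = 0"
proof -
  define Q where "Q = (\<lambda>a b :: nat. if a = b then (if a = k then - 1 else 1) else 0 :: real)"
  have Q: "orthogonal d Q"
    by (rule orthogonalI) (auto simp: Q_def if_distrib[of "\<lambda>c. c * _"] if_distrib[of "\<lambda>c. _ * c"] cong: if_cong)
  have r: "rot_mat n d Q X (i, a) = X (i, a)" if "i < n" "a < p" for X i a
    using that k pd by (simp add: rot_mat_def Q_def if_distrib[of "\<lambda>c. c * _"] cong: if_cong)
  have "coef n p lam (rot_mat n d Q X) (rot_mat n d Q X) j k = - coef n p lam X X j k" for X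
  proof -
    have "coef n p lam (rot_mat n d Q X) (rot_mat n d Q X) j k = coef n p lam X (rot_mat n d Q X) j k"
      by (rule coef_cong) (use r j in auto)
    also have "\<dots> = (\<Sum>l<d. Q k l * coef n p lam X X j l)" by (rule coef_rot[OF k(2)])
    also have "\<dots> = - coef n p lam X X j k"
      using k by (simp add: Q_def if_distrib[of "\<lambda>c. c * _"] cong: if_cong)
    finally show ?thesis .
  qed
  then have "(\<integral>X. - coef n p lam X X j k \<partial>gram_law n d) = (\<integral>X. coef n p lam (rot_mat n d Q X) (rot_mat n d Q X) j k \<partial>gram_law n d)" by simp
  also have "\<dots> = (\<integral>X. coef n p lam X X j k \<partial>distr (gram_law n d) (gram_law n d) (rot_mat n d Q))"
    by (rule integral_distr[symmetric, OF measurable_rot_mat measurable_coef_gram[OF j k(2)]])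
  finally show ?thesis unfolding distr_rot_mat[OF Q] C_def by simp
qed

lemma C_trace: "(\<Sum>k<p. C k k) = real d * avg_cross n d p lam"
  unfolding C_def coef_diag[OF lam] avg_cross_def using d by simp

text \<open>Jensen's inequality moves the square inside the expectation, and the squared
  coefficients of column k add up to at most its form. While \<open>avg_form\<close> stays bounded,
  C has squared Frobenius norm O(d), small against the scale d^2 of a squared trace.\<close>

lemma Cnorm_le: "Cnorm \<le> real d * avg_form n d p lam"
proof -
  have "Cnorm \<le> (\<Sum>j<p. \<Sum>k<p. \<integral>X. (coef n p lam X X j k)\<^sup>2 \<partial>gram_law n d)"
    unfolding Cnorm_def C_def using pd by (intro sum_mono PG.integral_sq_le sq_integrable_coef) auto
  also have "\<dots> = (\<Sum>k<p. \<Sum>j<p. \<integral>X. (coef n p lam X X j k)\<^sup>2 \<partial>gram_law n d)" by (rule sum.swap)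
  also have "\<dots> = (\<Sum>k<p. \<integral>X. (\<Sum>j<p. (coef n p lam X X j k)\<^sup>2) \<partial>gram_law n d)"
    using sq_integrable_coef pd
    by (intro sum.cong refl Bochner_Integration.integral_sum[symmetric]) (auto simp: sq_integrable_def)
  also have "\<dots> \<le> (\<Sum>k<p. \<integral>X. form n {..<p} lam (\<lambda>z. z) (\<lambda>z. z) k X \<partial>gram_law n d)"
  proof (intro sum_mono integral_mono')
    fix k X assume "k \<in> {..<p}"
    then have k: "k < d" using pd by simp
    show "integrable (gram_law n d) (form n {..<p} lam (\<lambda>z. z) (\<lambda>z. z) k)" by (rule form_id_id_limit(1)[OF lam n pd k])
    show "(\<Sum>j<p. (coef n p lam X X j k)\<^sup>2) \<le> form n {..<p} lam (\<lambda>z. z) (\<lambda>z. z) k X"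
      unfolding coef_id_square_sum[OF lam] using lam form2_nonneg by simp
    show "0 \<le> form n {..<p} lam (\<lambda>z. z) (\<lambda>z. z) k X" by (rule form_nonneg[OF lam])
  qed
  also have "\<dots> \<le> (\<Sum>k<d. \<integral>X. form n {..<p} lam (\<lambda>z. z) (\<lambda>z. z) k X \<partial>gram_law n d)"
    by (rule sum_mono2) (use pd form_nonneg[OF lam] in auto)
  also have "\<dots> = real d * avg_form n d p lam" unfolding avg_form_def using d by simp
  finally show ?thesis .
qed

text \<open>In matrix terms F(W, x) = W^T C^T \<phi>(W x): by \<open>mean_given_layer\<close> its
  inner product with the signal is the mean prediction given \<open>W\<close>.\<close>

definition F :: "(nat \<times> nat \<Rightarrow> real) \<Rightarrow> (nat \<Rightarrow> real) \<Rightarrow> nat \<Rightarrow> real" where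
  "F W x l = (\<Sum>j<p. \<Sum>k<p. \<phi> (layer_vec d W x j) * C j k * W (k, l))"

definition g :: "(nat \<Rightarrow> real) \<Rightarrow> nat \<Rightarrow> real" where
  "g x l = (\<integral>W. F W x l \<partial>H)"

abbreviation nsq :: "(nat \<Rightarrow> real) \<Rightarrow> real" where "nsq x \<equiv> \<Sum>l<d. (x l)\<^sup>2"

lemma measurable_F:
  assumes "\<And>j l. j < p \<Longrightarrow> l < d \<Longrightarrow> (\<lambda>y. W y (j, l)) \<in> borel_measurable M" "\<And>l. l < d \<Longrightarrow> (\<lambda>y. x y l) \<in> borel_measurable M" "l < d"
  shows "(\<lambda>y. F (W y) (x y) l) \<in> borel_measurable M"
  unfolding F_def
  by (intro borel_measurable_sum borel_measurable_times borel_measurable_const measurable_compose[OF _ meas] measurable_layer_vec)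
     (use assms in auto)

text \<open>The rows of \<open>W\<close> are unit vectors; Cauchy--Schwarz then bounds the
  preactivations by |x|.\<close>

lemma stiefel_bounds:
  assumes W: "mat p d W * transpose_mat (mat p d W) = 1\<^sub>m p" and j: "j < p"
  shows "l < d \<Longrightarrow> \<bar>W (j, l)\<bar> \<le> 1" "\<bar>layer_vec d W x j\<bar> \<le> sqrt (nsq x)"
proof -
  have 1: "(\<Sum>l<d. (W (j, l))\<^sup>2) = 1" using stiefel_orthonormal[OF W j j] by (simp add: power2_eq_square)
  show "\<bar>W (j, l)\<bar> \<le> 1" if "l < d"
  proof -
    have "(W (j, l))\<^sup>2 \<le> (\<Sum>l<d. (W (j, l))\<^sup>2)" by (rule member_le_sum) (use that in auto)
    then show ?thesis unfolding 1 using abs_le_square_iff[of "W (j, l)" 1] by simp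
  qed
  have "(layer_vec d W x j)\<^sup>2 \<le> (\<Sum>l<d. (W (j, l))\<^sup>2) * nsq x"
    unfolding layer_vec_def by (rule Cauchy_Schwarz_ineq_sum)
  then show "\<bar>layer_vec d W x j\<bar> \<le> sqrt (nsq x)" unfolding 1 by (simp add: real_le_rsqrt)
qed

definition phi_bound :: "(nat \<Rightarrow> real) \<Rightarrow> real" where
  "phi_bound x = c\<^sub>1 * exp (c\<^sub>2 * sqrt (nsq x))"

lemma phi_layer_le:
  assumes W: "mat p d W * transpose_mat (mat p d W) = 1\<^sub>m p" and j: "j < p"
  shows "\<bar>\<phi> (layer_vec d W x j)\<bar> \<le> phi_bound x"
proof -
  have "0 \<le> c\<^sub>1 * exp (c\<^sub>2 * \<bar>0\<bar>)" using growth[of 0] by (rule order_trans[OF abs_ge_zero])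
  then have "c\<^sub>1 \<ge> 0" by simp
  then have "c\<^sub>1 * exp (c\<^sub>2 * \<bar>layer_vec d W x j\<bar>) \<le> phi_bound x"
    unfolding phi_bound_def using stiefel_bounds(2)[OF W j] c2 by (intro mult_left_mono) auto
  then show ?thesis using growth[of "layer_vec d W x j"] by linarith
qed

lemma F_bounded:
  assumes W: "mat p d W * transpose_mat (mat p d W) = 1\<^sub>m p" and l: "l < d"
  shows "\<bar>F W x l\<bar> \<le> (\<Sum>j<p. \<Sum>k<p. phi_bound x * \<bar>C j k\<bar>)"
  unfolding F_def
proof (intro order_trans[OF sum_abs] sum_mono)
  fix j k assume "j \<in> {..<p}" "k \<in> {..<p}"
  then have jk: "j < p" "k < p" by auto
  have "\<bar>\<phi> (layer_vec d W x j) * C j k * W (k, l)\<bar> = (\<bar>\<phi> (layer_vec d W x j)\<bar> * \<bar>C j k\<bar>) * \<bar>W (k, l)\<bar>"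
    by (simp add: abs_mult)
  also have "\<dots> \<le> (phi_bound x * \<bar>C j k\<bar>) * 1"
    using phi_layer_le[OF W jk(1)] stiefel_bounds(1)[OF W jk(2) l] order_trans[OF abs_ge_zero phi_layer_le[OF W jk(1)]]
    by (intro mult_mono) auto
  finally show "\<bar>\<phi> (layer_vec d W x j) * C j k * W (k, l)\<bar> \<le> phi_bound x * \<bar>C j k\<bar>" by simp
qed

lemma F_measurable_H: "l < d \<Longrightarrow> (\<lambda>W. F W x l) \<in> borel_measurable H"
  by (rule measurable_F) (auto intro: measurable_H_component)

lemma integrable_F: "l < d \<Longrightarrow> integrable H (\<lambda>W. F W x l)"
  by (rule PH.integrable_const_bound[of _ "\<Sum>j<p. \<Sum>k<p. phi_bound x * \<bar>C j k\<bar>"])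
     (use orth_H F_bounded in \<open>auto elim!: eventually_mono intro: F_measurable_H\<close>)

text \<open>The noise has mean zero and the rotated data are again Gaussian, so the coefficients
  average to C. By \<open>C_zero\<close> only the columns k < p of C survive, and there the rows of
  Q are rows of \<open>W\<close>; the arbitrary remainder of the completion drops out.\<close>

lemma mean_given_layer:
  assumes W: "mat p d W * transpose_mat (mat p d W) = 1\<^sub>m p"
    and int: "integrable (gram_law n d \<Otimes>\<^sub>M GE) (\<lambda>XE. prediction \<phi> p n d lam (\<theta>, x) (W, XE))"
  shows "(\<integral>XE. prediction \<phi> p n d lam (\<theta>, x) (W, XE) \<partial>(gram_law n d \<Otimes>\<^sub>M GE)) = (\<Sum>l<d. F W x l * \<theta> l)"
proof -
  obtain Q where Q: "orthogonal d Q" "\<And>j l. j < p \<Longrightarrow> l < d \<Longrightarrow> Q j l = W (j, l)"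
    using stiefel_complete[OF W pd] by metis
  define h where "h = (\<lambda>X. \<Sum>j<p. \<phi> (layer_vec d W x j) * (\<Sum>k<d. coef n p lam X X j k * (\<Sum>l<d. Q k l * \<theta> l)))"
  have E: "(\<integral>E. prediction \<phi> p n d lam (\<theta>, x) (W, X, E) \<partial>GE) = h (rot_mat n d Q X)" for X
  proof -
    let ?Z = "first_layer d W X"
    have "prediction \<phi> p n d lam (\<theta>, x) (W, X, E) =
        (\<Sum>j<p. \<phi> (layer_vec d W x j) * (\<Sum>l<d. coef n p lam ?Z X j l * \<theta> l)) + (\<Sum>i<n. err_noise n d p lam W X x i * E i)" for E
    proof -
      have "(\<Sum>i<n. err_noise n d p lam W X x i * E i) = (\<Sum>j<p. \<phi> (layer_vec d W x j) * (\<Sum>i<n. noise n p lam ?Z j i * E i))"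
        unfolding err_noise_def by (simp add: sum_distrib_left sum_distrib_right mult.assoc) (rule sum.swap)
      then show ?thesis unfolding prediction_eq[OF lam n p] by (simp add: distrib_left sum.distrib)
    qed
    then have "(\<integral>E. prediction \<phi> p n d lam (\<theta>, x) (W, X, E) \<partial>GE) = (\<Sum>j<p. \<phi> (layer_vec d W x j) * (\<Sum>l<d. coef n p lam ?Z X j l * \<theta> l))"
      using affine_form_second_moment(2)[where I="{..<n}" and c="err_noise n d p lam W X x" and s=\<sigma>] by (simp add: gaussian_vec_def)
    also have "\<dots> = h (rot_mat n d Q X)"
      unfolding h_def
    proof (rule sum.cong[OF refl], rule arg_cong2[where f = "(*)", OF refl])
      fix j assume "j \<in> {..<p}"
      then have j: "j < p" by simp
      have fl: "?Z (i, k) = rot_mat n d Q X (i, k)" if "i < n" "k < p" for i k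
        using that pd Q(2) by (simp add: first_layer_def rot_mat_def)
      have "coef n p lam (rot_mat n d Q X) (rot_mat n d Q X) j k = (\<Sum>l<d. Q k l * coef n p lam ?Z X j l)" if "k < d" for k
      proof -
        have "coef n p lam (rot_mat n d Q X) X j l = coef n p lam ?Z X j l" for l
          by (rule coef_cong) (use fl j in auto)
        then show ?thesis using coef_rot[OF that] by simp
      qed
      then have "(\<Sum>k<d. coef n p lam (rot_mat n d Q X) (rot_mat n d Q X) j k * (\<Sum>l<d. Q k l * \<theta> l)) =
          (\<Sum>k<d. (\<Sum>l<d. Q k l * coef n p lam ?Z X j l) * (\<Sum>l<d. Q k l * \<theta> l))" by simp
      also have "\<dots> = (\<Sum>l<d. coef n p lam ?Z X j l * \<theta> l)" by (rule orthogonal_inner[OF Q(1)])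
      finally show "(\<Sum>l<d. coef n p lam ?Z X j l * \<theta> l) =
        (\<Sum>k<d. coef n p lam (rot_mat n d Q X) (rot_mat n d Q X) j k * (\<Sum>l<d. Q k l * \<theta> l))" ..
    qed
    finally show ?thesis .
  qed
  have hm: "h \<in> borel_measurable (gram_law n d)"
    unfolding h_def[abs_def]
    by (intro borel_measurable_sum borel_measurable_times borel_measurable_const measurable_coef_gram) auto
  have "(\<integral>XE. prediction \<phi> p n d lam (\<theta>, x) (W, XE) \<partial>(gram_law n d \<Otimes>\<^sub>M GE)) = (\<integral>X. \<integral>E. prediction \<phi> p n d lam (\<theta>, x) (W, X, E) \<partial>GE \<partial>gram_law n d)"
    by (rule PGE.integral_fst'[OF int, symmetric])
  also have "\<dots> = (\<integral>X. h X \<partial>distr (gram_law n d) (gram_law n d) (rot_mat n d Q))"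
    unfolding E by (rule integral_distr[symmetric, OF measurable_rot_mat hm])
  also have "\<dots> = (\<integral>X. h X \<partial>gram_law n d)" unfolding distr_rot_mat[OF Q(1)] ..
  also have "\<dots> = (\<Sum>j<p. \<phi> (layer_vec d W x j) * (\<Sum>k<d. C j k * (\<Sum>l<d. Q k l * \<theta> l)))"
  proof -
    have i: "integrable (gram_law n d) (\<lambda>X. coef n p lam X X j k)" if "j < p" "k < d" for j k
      by (rule PG.sq_integrable_integrable[OF sq_integrable_coef[OF that]])
    have "(\<integral>X. h X \<partial>gram_law n d) = (\<Sum>j<p. \<integral>X. \<phi> (layer_vec d W x j) * (\<Sum>k<d. coef n p lam X X j k * (\<Sum>l<d. Q k l * \<theta> l)) \<partial>gram_law n d)"
      unfolding h_def using i
      by (intro Bochner_Integration.integral_sum Bochner_Integration.integrable_mult_right Bochner_Integration.integrable_sum Bochner_Integration.integrable_mult_left) auto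
    also have "\<dots> = (\<Sum>j<p. \<phi> (layer_vec d W x j) * (\<Sum>k<d. C j k * (\<Sum>l<d. Q k l * \<theta> l)))"
    proof (intro sum.cong refl)
      fix j assume "j \<in> {..<p}"
      then have j: "j < p" by simp
      have "(\<integral>X. (\<Sum>k<d. coef n p lam X X j k * (\<Sum>l<d. Q k l * \<theta> l)) \<partial>gram_law n d) = (\<Sum>k<d. \<integral>X. coef n p lam X X j k * (\<Sum>l<d. Q k l * \<theta> l) \<partial>gram_law n d)"
        using i[OF j] by (intro Bochner_Integration.integral_sum Bochner_Integration.integrable_mult_left) auto
      then show "(\<integral>X. \<phi> (layer_vec d W x j) * (\<Sum>k<d. coef n p lam X X j k * (\<Sum>l<d. Q k l * \<theta> l)) \<partial>gram_law n d) =
          \<phi> (layer_vec d W x j) * (\<Sum>k<d. C j k * (\<Sum>l<d. Q k l * \<theta> l))"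
        unfolding C_def by simp
    qed
    finally show ?thesis .
  qed
  also have "\<dots> = (\<Sum>j<p. \<phi> (layer_vec d W x j) * (\<Sum>k<p. C j k * (\<Sum>l<d. W (k, l) * \<theta> l)))"
  proof (rule sum.cong[OF refl], rule arg_cong2[where f = "(*)", OF refl])
    fix j assume "j \<in> {..<p}"
    then show "(\<Sum>k<d. C j k * (\<Sum>l<d. Q k l * \<theta> l)) = (\<Sum>k<p. C j k * (\<Sum>l<d. W (k, l) * \<theta> l))"
      by (intro sum.mono_neutral_cong_right) (use pd C_zero Q(2) in auto)
  qed
  also have "\<dots> = (\<Sum>l<d. F W x l * \<theta> l)"
  proof -
    have "(\<Sum>l<d. F W x l * \<theta> l) = (\<Sum>l<d. \<Sum>j<p. \<Sum>k<p. \<phi> (layer_vec d W x j) * (C j k * (W (k, l) * \<theta> l)))"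
      by (simp add: F_def sum_distrib_right mult.assoc)
    also have "\<dots> = (\<Sum>j<p. \<Sum>l<d. \<Sum>k<p. \<phi> (layer_vec d W x j) * (C j k * (W (k, l) * \<theta> l)))" by (rule sum.swap)
    also have "\<dots> = (\<Sum>j<p. \<phi> (layer_vec d W x j) * (\<Sum>k<p. C j k * (\<Sum>l<d. W (k, l) * \<theta> l)))"
      by (rule sum.cong[OF refl], subst sum.swap, simp add: sum_distrib_left)
    finally show ?thesis ..
  qed
  finally show ?thesis .
qed

lemma nsq_moment:
  "integrable \<Xi> (\<lambda>x. (\<alpha> / sqrt (real d))\<^sup>2 * nsq x)" "(\<integral>x. (\<alpha> / sqrt (real d))\<^sup>2 * nsq x \<partial>\<Xi>) = \<alpha>\<^sup>2"
proof -
  have i: "integrable \<Xi> (\<lambda>x. (x l)\<^sup>2)" "(\<integral>x. (x l)\<^sup>2 \<partial>\<Xi>) = 1" if "l < d" for l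
    using integral_PiM_component[OF prob_space_N01, of l "{..<d}" "\<lambda>z. z\<^sup>2"] that N01_second_moment integrable_N01_power[of 2] by auto
  show "integrable \<Xi> (\<lambda>x. (\<alpha> / sqrt (real d))\<^sup>2 * nsq x)"
    using i by (intro Bochner_Integration.integrable_mult_right Bochner_Integration.integrable_sum) auto
  have "(\<integral>x. nsq x \<partial>\<Xi>) = (\<Sum>l<d. \<integral>x. (x l)\<^sup>2 \<partial>\<Xi>)" by (rule Bochner_Integration.integral_sum) (use i in auto)
  then have "(\<integral>x. nsq x \<partial>\<Xi>) = real d" using i by simp
  then show "(\<integral>x. (\<alpha> / sqrt (real d))\<^sup>2 * nsq x \<partial>\<Xi>) = \<alpha>\<^sup>2" using d by (simp add: power_divide)
qed

lemma sq_integrable_truth: "sq_integrable Tst (truth d)" "(\<integral>t. (truth d t)\<^sup>2 \<partial>Tst) = \<alpha>\<^sup>2"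
  and truth_measurable: "truth d \<in> borel_measurable Tst"
proof -
  have "(\<lambda>t. truth d (fst t, snd t)) \<in> borel_measurable Tst"
    by (rule measurable_truth) (auto intro: comps_Tst)
  then show m: "truth d \<in> borel_measurable Tst" by simp
  have m': "(\<lambda>t. ennreal ((truth d t)\<^sup>2)) \<in> borel_measurable (\<Theta> \<Otimes>\<^sub>M \<Xi>)" using m unfolding laws by simp
  have "(\<integral>\<^sup>+ t. ennreal ((truth d t)\<^sup>2) \<partial>Tst) = (\<integral>\<^sup>+ x. \<integral>\<^sup>+ \<theta>. ennreal ((0 + (\<Sum>l<d. x l * \<theta> l))\<^sup>2) \<partial>\<Theta> \<partial>\<Xi>)"
    unfolding laws by (subst PTX.nn_integral_snd[OF m', symmetric]) (simp add: truth_eq)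
  also have "\<dots> = (\<integral>\<^sup>+ x. ennreal (0\<^sup>2 + (\<alpha> / sqrt (real d))\<^sup>2 * nsq x) \<partial>\<Xi>)"
    unfolding gaussian_vec_def by (intro nn_integral_cong nn_affine_form) simp
  also have "\<dots> = ennreal (\<alpha>\<^sup>2)"
    using nn_integral_eq_integral[OF nsq_moment(1)] nsq_moment(2) by (simp add: sum_nonneg)
  finally have nn: "(\<integral>\<^sup>+ t. ennreal ((truth d t)\<^sup>2) \<partial>Tst) = ennreal (\<alpha>\<^sup>2)" .
  have "integrable Tst (\<lambda>t. (truth d t)\<^sup>2)"
    by (rule integrableI_bounded) (use m nn in auto)
  then show "sq_integrable Tst (truth d)" using m by (simp add: sq_integrable_def)
  show "(\<integral>t. (truth d t)\<^sup>2 \<partial>Tst) = \<alpha>\<^sup>2"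
    by (subst integral_eq_nn_integral) (use m nn in auto)
qed

text \<open>Finiteness of the joint error in \<open>nn_error_total\<close> gives, by Tonelli, a
  finite error for almost every test point; adding the truth, constant in the training variables,
  keeps square integrability.\<close>

lemma AE_sq_integrable_prediction: "AE t in Tst. sq_integrable Trn (prediction \<phi> p n d lam t)"
proof -
  let ?f = "\<lambda>z. ennreal ((prediction \<phi> p n d lam (fst z) (snd z) - truth d (fst z))\<^sup>2)"
  note mf = measurable_compose[OF borel_measurable_power[OF measurable_error_joint] measurable_ennreal, of 2]
  have "(\<integral>\<^sup>+ t. \<integral>\<^sup>+ s. ?f (t, s) \<partial>Trn \<partial>Tst) = integral\<^sup>N (Tst \<Otimes>\<^sub>M Trn) ?f"
    by (rule PTrn.nn_integral_fst[OF mf])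
  then have "(\<integral>\<^sup>+ t. \<integral>\<^sup>+ s. ?f (t, s) \<partial>Trn \<partial>Tst) \<noteq> \<infinity>" unfolding nn_error_total by simp
  then have "AE t in Tst. (\<integral>\<^sup>+ s. ?f (t, s) \<partial>Trn) \<noteq> \<infinity>"
    by (intro nn_integral_PInf_AE PTrn.borel_measurable_nn_integral_fst[OF mf]) auto
  moreover have "AE t in Tst. (\<lambda>s. prediction \<phi> p n d lam t s - truth d t) \<in> borel_measurable Trn"
    by (rule AE_I2) (use measurable_compose[OF measurable_Pair1' measurable_error_joint] in auto)
  ultimately show ?thesis
  proof eventually_elim
    case (elim t)
    have "integrable Trn (\<lambda>s. (prediction \<phi> p n d lam t s - truth d t)\<^sup>2)"
      by (rule integrableI_bounded) (use elim in \<open>auto simp: less_top\<close>)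
    then have "sq_integrable Trn (\<lambda>s. prediction \<phi> p n d lam t s - truth d t)"
      using elim(2) by (simp add: sq_integrable_def)
    from sq_integrable_add[OF this PTrn.sq_integrable_const[of "truth d t"]] show ?case by simp
  qed
qed

lemma mean_prediction_eq:
  "AE t in Tst. mean_prediction \<phi> \<sigma> p n d H lam t = (\<Sum>l<d. g (snd t) l * fst t l)"
  using AE_sq_integrable_prediction
proof eventually_elim
  case (elim t)
  obtain \<theta> x where t: "t = (\<theta>, x)" by (cases t)
  have int: "integrable (H \<Otimes>\<^sub>M (gram_law n d \<Otimes>\<^sub>M GE)) (prediction \<phi> p n d lam (\<theta>, x))"
    using PTrn.sq_integrable_integrable[OF elim] unfolding t laws .
  have int': "integrable (H \<Otimes>\<^sub>M (gram_law n d \<Otimes>\<^sub>M GE)) (\<lambda>z. prediction \<phi> p n d lam (\<theta>, x) (fst z, snd z))"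
    using int by simp
  have "mean_prediction \<phi> \<sigma> p n d H lam t = (\<integral>W. \<integral>XE. prediction \<phi> p n d lam (\<theta>, x) (W, XE) \<partial>(gram_law n d \<Otimes>\<^sub>M GE) \<partial>H)"
    unfolding mean_prediction_def t laws by (rule PHGE.integral_fst'[OF int, symmetric])
  also have "\<dots> = (\<integral>W. (\<Sum>l<d. F W x l * \<theta> l) \<partial>H)"
  proof (rule integral_cong_AE)
    show "(\<lambda>W. \<integral>XE. prediction \<phi> p n d lam (\<theta>, x) (W, XE) \<partial>(gram_law n d \<Otimes>\<^sub>M GE)) \<in> borel_measurable H"
      using borel_measurable_integrable[OF PHGE.integrable_fst'[OF int]] .
    show "(\<lambda>W. \<Sum>l<d. F W x l * \<theta> l) \<in> borel_measurable H"
      by (intro borel_measurable_sum borel_measurable_times borel_measurable_const F_measurable_H) auto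
    show "AE W in H. (\<integral>XE. prediction \<phi> p n d lam (\<theta>, x) (W, XE) \<partial>(gram_law n d \<Otimes>\<^sub>M GE)) = (\<Sum>l<d. F W x l * \<theta> l)"
      using orth_H PHGE.AE_integrable_fst'[OF int]
      by eventually_elim (rule mean_given_layer)
  qed
  also have "\<dots> = (\<Sum>l<d. \<integral>W. F W x l * \<theta> l \<partial>H)"
    by (intro Bochner_Integration.integral_sum Bochner_Integration.integrable_mult_left integrable_F) auto
  also have "\<dots> = (\<Sum>l<d. g x l * \<theta> l)" unfolding g_def by simp
  finally show ?case by (simp add: t)
qed

text \<open>\<open>g\<close> commutes with rotations. The reflection that fixes \<open>x\<close> and negates its orthogonal complement
  therefore forces \<open>g x\<close> to be parallel to \<open>x\<close>.\<close>

lemma g_parallel: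
  assumes l: "l < d"
  shows "g x l * nsq x = (\<Sum>m<d. g x m * x m) * x l"
proof (cases "nsq x = 0")
  case True
  then have "x l = 0" using l by (subst (asm) sum_nonneg_eq_0_iff) auto
  then show ?thesis using True by simp
next
  case False
  define N where "N = nsq x"
  have N: "N \<noteq> 0" using False by (simp add: N_def)
  define Q where "Q = (\<lambda>a b. 2 * x a * x b / N - (if a = b then 1 else 0 :: real))"
  have xx: "(\<Sum>i<d. x i * x i) = N" by (simp add: N_def power2_eq_square)
  have QQ: "(\<Sum>i<d. Q j i * Q k i) = (if j = k then 1 else 0)" if "j < d" "k < d" for j k
  proof -
    have "(\<Sum>i<d. Q j i * Q k i) = (\<Sum>i<d. 4 * x j * x k / N\<^sup>2 * (x i * x i) - (if k = i then 2 * x j * x i / N else 0)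
        - (if j = i then 2 * x k * x i / N else 0) + (if j = i then (if k = i then 1 else 0) else 0))"
      by (intro sum.cong refl) (simp add: Q_def algebra_simps power2_eq_square)
    also have "\<dots> = 4 * x j * x k / N\<^sup>2 * N - 2 * x j * x k / N - 2 * x k * x j / N + (if j = k then 1 else 0)"
      unfolding sum.distrib sum_subtractf sum_distrib_left[symmetric] xx using that by simp
    also have "\<dots> = (if j = k then 1 else 0)" using N by (simp add: power2_eq_square)
    finally show ?thesis .
  qed
  have Qx: "(\<Sum>b<d. Q a b * x b) = x a" if "a < d" for a
  proof -
    have "(\<Sum>b<d. Q a b * x b) = (\<Sum>b<d. 2 * x a / N * (x b * x b) - (if a = b then x b else 0))"
      by (intro sum.cong refl) (simp add: Q_def algebra_simps)
    also have "\<dots> = 2 * x a / N * N - x a"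
      unfolding sum_subtractf sum_distrib_left[symmetric] xx using that by simp
    finally show ?thesis using N by simp
  qed
  define Qm where "Qm = mat d d (\<lambda>(a, b). Q a b)"
  have "Qm * transpose_mat Qm = 1\<^sub>m d"
    by (rule eq_matI) (auto simp: Qm_def scalar_prod_def atLeast0LessThan QQ)
  moreover have "Qm \<in> carrier_mat d d" by (simp add: Qm_def)
  ultimately have inv: "distr H H (\<lambda>W. \<lambda>ij\<in>{..<p} \<times> {..<d}. (mat p d W * Qm) $$ ij) = H"
    using H by (simp add: uniform_stiefel_def)
  define R where "R = (\<lambda>W. \<lambda>ij\<in>{..<p} \<times> {..<d}. (mat p d W * Qm) $$ ij)"
  have R: "R W (k, l) = (\<Sum>m<d. W (k, m) * Q m l)" if "k < p" "l < d" for W k l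
    using that by (simp add: R_def Qm_def scalar_prod_def atLeast0LessThan)
  have Rm: "R \<in> measurable H H"
  proof -
    have sets: "sets H = sets (PiM ({..<p} \<times> {..<d}) (\<lambda>_. borel :: real measure))" using H by (simp add: uniform_stiefel_def)
    have "R \<in> measurable H (PiM ({..<p} \<times> {..<d}) (\<lambda>_. borel))"
      unfolding R_def
    proof (rule measurable_restrict)
      fix ij assume "ij \<in> {..<p} \<times> {..<d}"
      then obtain i j where ij: "ij = (i, j)" "i < p" "j < d" by auto
      have "(\<lambda>W. \<Sum>m<d. W (i, m) * Q m j) \<in> borel_measurable H"
        by (intro borel_measurable_sum borel_measurable_times borel_measurable_const measurable_H_component) (use ij in auto)
      then show "(\<lambda>W. (mat p d W * Qm) $$ ij) \<in> borel_measurable H"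
        using ij by (simp add: Qm_def scalar_prod_def atLeast0LessThan)
    qed
    then show ?thesis using sets by (simp cong: measurable_cong_sets)
  qed
  have FR: "F (R W) x l = (\<Sum>m<d. F W x m * Q m l)" for W
  proof -
    have lv: "layer_vec d (R W) x j = layer_vec d W x j" if "j < p" for j
    proof -
      have "layer_vec d (R W) x j = (\<Sum>b<d. \<Sum>m<d. W (j, m) * (Q m b * x b))"
        unfolding layer_vec_def using that by (simp add: R sum_distrib_right mult.assoc)
      also have "\<dots> = (\<Sum>m<d. W (j, m) * (\<Sum>b<d. Q m b * x b))"
        by (subst sum.swap) (simp add: sum_distrib_left)
      finally show ?thesis by (simp add: layer_vec_def Qx)
    qed
    have "F (R W) x l = (\<Sum>j<p. \<Sum>k<p. \<Sum>m<d. \<phi> (layer_vec d W x j) * C j k * W (k, m) * Q m l)"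
      unfolding F_def using l by (simp add: lv R sum_distrib_left mult.assoc)
    also have "\<dots> = (\<Sum>j<p. \<Sum>m<d. \<Sum>k<p. \<phi> (layer_vec d W x j) * C j k * W (k, m) * Q m l)"
      by (rule sum.cong[OF refl], rule sum.swap)
    also have "\<dots> = (\<Sum>m<d. \<Sum>j<p. \<Sum>k<p. \<phi> (layer_vec d W x j) * C j k * W (k, m) * Q m l)" by (rule sum.swap)
    finally show ?thesis by (simp add: F_def sum_distrib_right)
  qed
  have "g x l = (\<integral>W. F W x l \<partial>distr H H R)" unfolding g_def using inv by (simp add: R_def)
  also have "\<dots> = (\<integral>W. (\<Sum>m<d. F W x m * Q m l) \<partial>H)"
    unfolding FR[symmetric] by (rule integral_distr[OF Rm F_measurable_H[OF l]])
  also have "\<dots> = (\<Sum>m<d. \<integral>W. F W x m * Q m l \<partial>H)"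
    by (intro Bochner_Integration.integral_sum Bochner_Integration.integrable_mult_left integrable_F) auto
  also have "\<dots> = (\<Sum>m<d. g x m * Q m l)" unfolding g_def by simp
  also have "\<dots> = (\<Sum>m<d. 2 * x l / N * (g x m * x m) - (if l = m then g x m else 0))"
    by (intro sum.cong refl) (simp add: Q_def algebra_simps)
  also have "\<dots> = 2 * x l / N * (\<Sum>m<d. g x m * x m) - g x l"
    unfolding sum_subtractf sum_distrib_left[symmetric] using l by simp
  \<comment> \<open>Invariance says that g x equals its own reflection, which is twice its
    projection on x minus g x.\<close>
  finally have "2 * g x l = 2 * (x l / N * (\<Sum>m<d. g x m * x m))" by simp
  then have "g x l = x l / N * (\<Sum>m<d. g x m * x m)" by simp
  then show ?thesis unfolding N_def[symmetric] using N by (simp add: field_simps)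
qed


text \<open>Off the unlikely event \<open>nsq x \<le> d / 2\<close> the parallelism of \<open>g x\<close> and \<open>x\<close> bounds the deviation by a scalar.\<close>

definition \<Psi> :: "(nat \<times> nat \<Rightarrow> real) \<Rightarrow> (nat \<Rightarrow> real) \<Rightarrow> real" where
  "\<Psi> W x = (if nsq x \<le> real d / 2 then 2 * (\<Sum>l<d. (F W x l)\<^sup>2) + 2 * \<kappa>\<^sup>2 * nsq x
     else 2 / real d * ((\<Sum>l<d. F W x l * x l) - \<kappa> * nsq x)\<^sup>2)"

lemma sq_integrable_F: "l < d \<Longrightarrow> sq_integrable H (\<lambda>W. F W x l)"
  unfolding sq_integrable_def
proof
  assume l: "l < d"
  then show m: "(\<lambda>W. F W x l) \<in> borel_measurable H" by (rule F_measurable_H)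
  show "integrable H (\<lambda>W. (F W x l)\<^sup>2)"
  proof (rule PH.integrable_const_bound[of _ "(\<Sum>j<p. \<Sum>k<p. phi_bound x * \<bar>C j k\<bar>)\<^sup>2"])
    show "AE W in H. norm ((F W x l)\<^sup>2) \<le> (\<Sum>j<p. \<Sum>k<p. phi_bound x * \<bar>C j k\<bar>)\<^sup>2"
      using orth_H
    proof eventually_elim
      case (elim W)
      show ?case using power_mono[OF F_bounded[OF elim l, of x] abs_ge_zero, of 2] by simp
    qed
  qed (use m in simp)
qed

text \<open>If x is short, the triangle inequality suffices. Otherwise g - \<kappa> x is parallel to
  x, so its squared norm times |x|^2 is the square of its inner product with x, and |x|^2 > d / 2
  can be divided out. In both cases Jensen's inequality takes the mean over \<open>W\<close> out of
  the square.\<close>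

lemma deviation_le: "ennreal (\<Sum>l<d. (g x l - \<kappa> * x l)\<^sup>2) \<le> (\<integral>\<^sup>+ W. ennreal (\<Psi> W x) \<partial>H)"
proof (cases "nsq x \<le> real d / 2")
  case True
  have i: "integrable H (\<lambda>W. 2 * (\<Sum>l<d. (F W x l)\<^sup>2) + 2 * \<kappa>\<^sup>2 * nsq x)"
    using sq_integrable_F
    by (intro Bochner_Integration.integrable_add Bochner_Integration.integrable_mult_right Bochner_Integration.integrable_sum PH.integrable_const)
       (auto simp: sq_integrable_def)
  have "(\<Sum>l<d. (g x l - \<kappa> * x l)\<^sup>2) \<le> (\<Sum>l<d. 2 * (\<integral>W. (F W x l)\<^sup>2 \<partial>H) + 2 * \<kappa>\<^sup>2 * (x l)\<^sup>2)"
  proof (rule sum_mono)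
    fix l assume "l \<in> {..<d}"
    then have "(g x l)\<^sup>2 \<le> (\<integral>W. (F W x l)\<^sup>2 \<partial>H)"
      unfolding g_def by (intro PH.integral_sq_le sq_integrable_F) simp
    moreover have "(a - b)\<^sup>2 \<le> 2 * a\<^sup>2 + 2 * b\<^sup>2" for a b :: real
      using zero_le_power2[of "a + b"] by (simp add: power2_eq_square algebra_simps)
    from this[of "g x l" "\<kappa> * x l"] have "(g x l - \<kappa> * x l)\<^sup>2 \<le> 2 * (g x l)\<^sup>2 + 2 * \<kappa>\<^sup>2 * (x l)\<^sup>2" by (simp add: power_mult_distrib)
    ultimately show "(g x l - \<kappa> * x l)\<^sup>2 \<le> 2 * (\<integral>W. (F W x l)\<^sup>2 \<partial>H) + 2 * \<kappa>\<^sup>2 * (x l)\<^sup>2" by linarith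
  qed
  also have "\<dots> = 2 * (\<Sum>l<d. \<integral>W. (F W x l)\<^sup>2 \<partial>H) + 2 * \<kappa>\<^sup>2 * nsq x"
    by (simp add: sum.distrib sum_distrib_left)
  also have "(\<Sum>l<d. \<integral>W. (F W x l)\<^sup>2 \<partial>H) = (\<integral>W. (\<Sum>l<d. (F W x l)\<^sup>2) \<partial>H)"
    using sq_integrable_F by (intro Bochner_Integration.integral_sum[symmetric]) (auto simp: sq_integrable_def)
  also have "2 * (\<integral>W. (\<Sum>l<d. (F W x l)\<^sup>2) \<partial>H) + 2 * \<kappa>\<^sup>2 * nsq x = (\<integral>W. 2 * (\<Sum>l<d. (F W x l)\<^sup>2) + 2 * \<kappa>\<^sup>2 * nsq x \<partial>H)"
    using sq_integrable_F
    by (subst Bochner_Integration.integral_add) (auto simp: sq_integrable_def PH.prob_space)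
  finally have "(\<Sum>l<d. (g x l - \<kappa> * x l)\<^sup>2) \<le> (\<integral>W. 2 * (\<Sum>l<d. (F W x l)\<^sup>2) + 2 * \<kappa>\<^sup>2 * nsq x \<partial>H)" .
  also have "ennreal \<dots> = (\<integral>\<^sup>+ W. ennreal (2 * (\<Sum>l<d. (F W x l)\<^sup>2) + 2 * \<kappa>\<^sup>2 * nsq x) \<partial>H)"
    by (rule nn_integral_eq_integral[symmetric, OF i]) (simp add: sum_nonneg)
  finally show ?thesis using True by (simp add: \<Psi>_def ennreal_leI)
next
  case False
  define N where "N = (\<Sum>l<d. (g x l - \<kappa> * x l)\<^sup>2)"
  define s where "s = (\<Sum>l<d. (g x l - \<kappa> * x l) * x l)"
  define q where "q = (\<lambda>W. (\<Sum>l<d. F W x l * x l) - \<kappa> * nsq x)"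
  have s': "s = (\<Sum>l<d. g x l * x l) - \<kappa> * nsq x"
    by (simp add: s_def left_diff_distrib sum_subtractf sum_distrib_left power2_eq_square mult.assoc)
  have "N * nsq x = s\<^sup>2"
  proof -
    have "(g x l - \<kappa> * x l) * nsq x = s * x l" if "l < d" for l
      unfolding s' using g_parallel[OF that, of x] by (simp only: left_diff_distrib) (simp add: mult_ac)
    then have "(g x l - \<kappa> * x l)\<^sup>2 * nsq x = s * ((g x l - \<kappa> * x l) * x l)" if "l < d" for l
      using that by (simp add: power2_eq_square mult_ac)
    then have "N * nsq x = (\<Sum>l<d. s * ((g x l - \<kappa> * x l) * x l))" by (simp add: N_def sum_distrib_right)
    then show ?thesis by (simp add: s_def power2_eq_square sum_distrib_left)
  qed
  moreover have "N * (real d / 2) \<le> N * nsq x"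
    using False by (intro mult_left_mono) (auto simp: N_def sum_nonneg)
  ultimately have "N \<le> 2 / real d * s\<^sup>2" using d by (simp add: field_simps)
  have sq: "sq_integrable H q"
    unfolding q_def
    by (intro sq_integrable_diff PH.sq_integrable_const sq_integrable_sum)
       (use sq_integrable_cmult[OF sq_integrable_F] in \<open>auto simp: mult.commute\<close>)
  have "s = integral\<^sup>L H q"
  proof -
    have "(\<integral>W. (\<Sum>l<d. F W x l * x l) \<partial>H) = (\<Sum>l<d. \<integral>W. F W x l * x l \<partial>H)"
      by (intro Bochner_Integration.integral_sum Bochner_Integration.integrable_mult_left integrable_F) auto
    moreover have "integrable H (\<lambda>W. \<Sum>l<d. F W x l * x l)"
      by (intro Bochner_Integration.integrable_sum Bochner_Integration.integrable_mult_left integrable_F) auto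
    ultimately show ?thesis unfolding s' q_def g_def by (simp add: PH.prob_space)
  qed
  then have "s\<^sup>2 \<le> (\<integral>W. (q W)\<^sup>2 \<partial>H)" using PH.integral_sq_le[OF sq] by simp
  then have "2 / real d * s\<^sup>2 \<le> 2 / real d * (\<integral>W. (q W)\<^sup>2 \<partial>H)" by (intro mult_left_mono) auto
  with \<open>N \<le> 2 / real d * s\<^sup>2\<close> have "N \<le> (\<integral>W. 2 / real d * (q W)\<^sup>2 \<partial>H)" by simp
  also have "ennreal \<dots> = (\<integral>\<^sup>+ W. ennreal (2 / real d * (q W)\<^sup>2) \<partial>H)"
    by (rule nn_integral_eq_integral[symmetric]) (use sq in \<open>auto simp: sq_integrable_def\<close>)
  finally show ?thesis using False by (simp add: \<Psi>_def q_def N_def ennreal_leI)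
qed

text \<open>\<open>\<Psi>\<close> for W = (I 0), as a function of the rotated test point y. By
  \<open>\<Psi>_rotate\<close> and rotation invariance, \<open>\<Psi> W\<close> has the law of
  \<open>\<Psi>\<^sub>0\<close> for every \<open>W\<close> with orthonormal rows.\<close>

definition \<Psi>\<^sub>0 :: "(nat \<Rightarrow> real) \<Rightarrow> real" where
  "\<Psi>\<^sub>0 y = (if nsq y \<le> real d / 2 then 2 * (\<Sum>k<p. (\<Sum>j<p. \<phi> (y j) * C j k)\<^sup>2) + 2 * \<kappa>\<^sup>2 * nsq y
     else 2 / real d * ((\<Sum>j<p. \<Sum>k<p. \<phi> (y j) * C j k * y k) - \<kappa> * nsq y)\<^sup>2)"

lemma \<Psi>_rotate:
  assumes W: "mat p d W * transpose_mat (mat p d W) = 1\<^sub>m p"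
    and Q: "orthogonal d Q" "\<And>j l. j < p \<Longrightarrow> l < d \<Longrightarrow> Q j l = W (j, l)"
  shows "\<Psi> W x = \<Psi>\<^sub>0 (rot_vec d Q x)"
proof -
  let ?y = "rot_vec d Q x"
  have y: "layer_vec d W x j = ?y j" if "j < p" for j
    using that pd Q(2) by (simp add: layer_vec_def rot_vec_def)
  have nsq: "nsq ?y = nsq x" using orthogonal_norm[OF Q(1), of x] by (simp add: rot_vec_def)
  define u where "u = (\<lambda>k. \<Sum>j<p. \<phi> (?y j) * C j k)"
  have F: "F W x l = (\<Sum>k<p. u k * W (k, l))" for l
  proof -
    have "F W x l = (\<Sum>j<p. \<Sum>k<p. \<phi> (?y j) * C j k * W (k, l))" by (simp add: F_def y)
    also have "\<dots> = (\<Sum>k<p. u k * W (k, l))" by (subst sum.swap) (simp add: u_def sum_distrib_right)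
    finally show ?thesis .
  qed
  have "(\<Sum>l<d. (F W x l)\<^sup>2) = (\<Sum>l<d. \<Sum>k<p. \<Sum>m<p. u k * u m * (W (k, l) * W (m, l)))"
    unfolding F power2_eq_square sum_product by (simp add: mult_ac)
  also have "\<dots> = (\<Sum>k<p. \<Sum>l<d. \<Sum>m<p. u k * u m * (W (k, l) * W (m, l)))" by (rule sum.swap)
  also have "\<dots> = (\<Sum>k<p. \<Sum>m<p. u k * u m * (\<Sum>l<d. W (k, l) * W (m, l)))"
    by (rule sum.cong[OF refl], subst sum.swap, simp add: sum_distrib_left)
  also have "\<dots> = (\<Sum>k<p. \<Sum>m<p. if k = m then u k * u m else 0)"
    using stiefel_orthonormal[OF W] by (intro sum.cong refl) simp
  also have "\<dots> = (\<Sum>k<p. (u k)\<^sup>2)" by (simp add: power2_eq_square)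
  finally have 1: "(\<Sum>l<d. (F W x l)\<^sup>2) = (\<Sum>k<p. (u k)\<^sup>2)" .
  have "(\<Sum>l<d. F W x l * x l) = (\<Sum>j<p. \<Sum>k<p. \<phi> (?y j) * C j k * ?y k)"
  proof -
    have "(\<Sum>l<d. F W x l * x l) = (\<Sum>k<p. \<Sum>l<d. u k * W (k, l) * x l)"
      by (subst sum.swap) (simp add: F sum_distrib_right)
    also have "\<dots> = (\<Sum>k<p. u k * ?y k)"
      by (intro sum.cong refl) (simp add: y[symmetric] layer_vec_def sum_distrib_left mult.assoc)
    also have "\<dots> = (\<Sum>j<p. \<Sum>k<p. \<phi> (?y j) * C j k * ?y k)"
      by (subst sum.swap) (simp add: u_def sum_distrib_right)
    finally show ?thesis .
  qed
  then show ?thesis unfolding \<Psi>_def \<Psi>\<^sub>0_def 1 nsq by (simp add: u_def)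
qed

text \<open>First line: fluctuation of the forms \<phi>(y) \<cdot> C y and |y|^2 on the typical
  event. Second line: the short-vector event, whose indicator is at most 4 (|y|^2 - d)^2 / d^2.
  Third line: the fluctuation of the form in C C^T on that event. The weight d sqrt d is chosen so
  that everything is O(sqrt d) when \<open>Cnorm\<close> is O(d) and \<kappa> is bounded, which is
  small against |x|^2 of order d.\<close>

definition deviation_bound :: real where
  "deviation_bound = 4 / real d * (form_const N01 \<phi> (\<lambda>z. z) * Cnorm + \<kappa>\<^sup>2 * (form_const N01 (\<lambda>z. z) (\<lambda>z. z) * real d))
     + 4 / (real d)\<^sup>2 * (2 * v * Cnorm + \<kappa>\<^sup>2 * real d + real d * sqrt (real d)) * (form_const N01 (\<lambda>z. z) (\<lambda>z. z) * real d)
     + form_const N01 \<phi> \<phi> * Cnorm\<^sup>2 / (real d * sqrt (real d))"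

lemma nn_\<Psi>\<^sub>0: "(\<integral>\<^sup>+ y. ennreal (\<Psi>\<^sub>0 y) \<partial>\<Xi>) \<le> ennreal deviation_bound"
proof -
  let ?Ka = "form_const N01 \<phi> (\<lambda>z. z)" and ?Kb = "form_const N01 (\<lambda>z. z) (\<lambda>z. z)" and ?Kc = "form_const N01 \<phi> \<phi>"
  define D where "D = real d * sqrt (real d)" \<comment> \<open>the weight in \<open>2 c \<le> D + c\<^sup>2 / D\<close>\<close>
  have D: "D > 0" using d by (simp add: D_def)
  define A where "A = (\<lambda>j k. if j < p \<and> k < p then C j k else 0)"
  define B where "B = (\<lambda>j k :: nat. if j = k then 1 else 0 :: real)"
  \<comment> \<open>The matrix C C^T padded by zeros: the squared norm of C^T \<phi>(y) is its
    quadratic form in \<phi>(y).\<close>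
  define R where "R = (\<lambda>j k. if j < p \<and> k < p then (\<Sum>l<p. C j l * C k l) else 0)"
  have res: "(\<Sum>j<d. \<Sum>k<d. if j < p \<and> k < p then f j k else 0) = (\<Sum>j<p. \<Sum>k<p. f j k)" for f :: "nat \<Rightarrow> nat \<Rightarrow> real"
  proof -
    have "(\<Sum>k<d. if j < p \<and> k < p then f j k else 0) = (if j < p then (\<Sum>k<p. f j k) else 0)" for j
      by (cases "j < p") (use pd in \<open>auto intro!: sum.mono_neutral_cong_right split: if_splits\<close>)
    then show ?thesis by (simp, intro sum.mono_neutral_cong_right) (use pd in \<open>auto split: if_splits\<close>)
  qed
  define a where "a = (\<lambda>y. (\<Sum>j<d. \<Sum>k<d. A j k * (\<phi> (y j) * y k)) - (\<integral>z. \<phi> z * z \<partial>N01) * (\<Sum>j<d. A j j))"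
  define b where "b = (\<lambda>y. (\<Sum>j<d. \<Sum>k<d. B j k * (y j * y k)) - (\<integral>z. z * z \<partial>N01) * (\<Sum>j<d. B j j))"
  define c where "c = (\<lambda>y. (\<Sum>j<d. \<Sum>k<d. R j k * (\<phi> (y j) * \<phi> (y k))) - (\<integral>z. \<phi> z * \<phi> z \<partial>N01) * (\<Sum>j<d. R j j))"
  note q = quadratic_form_second_moment[OF prob_space_N01 finite_lessThan[of d]]
  have adm1: "\<phi> \<in> borel_measurable N01" "integrable N01 (\<lambda>z. \<phi> z ^ 4)" "integral\<^sup>L N01 \<phi> = 0"
    and adm2: "(\<lambda>z. z) \<in> borel_measurable N01" "integrable N01 (\<lambda>z. z ^ 4)" "(\<integral>z. z \<partial>N01) = 0"
    using admissible_phi admissible_id by (auto simp: admissible_def)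
  have a: "sq_integrable \<Xi> a" "(\<integral>y. (a y)\<^sup>2 \<partial>\<Xi>) \<le> ?Ka * (\<Sum>j<d. \<Sum>k<d. (A j k)\<^sup>2)"
    unfolding a_def by (rule q[of \<phi> "\<lambda>z. z" A, OF adm1(1) adm2(1) adm1(2) adm2(2) adm1(3) adm2(3)])+
  have b: "sq_integrable \<Xi> b" "(\<integral>y. (b y)\<^sup>2 \<partial>\<Xi>) \<le> ?Kb * (\<Sum>j<d. \<Sum>k<d. (B j k)\<^sup>2)"
    unfolding b_def by (rule q[of "\<lambda>z. z" "\<lambda>z. z" B, OF adm2(1) adm2(1) adm2(2) adm2(2) adm2(3) adm2(3)])+
  have c: "sq_integrable \<Xi> c" "(\<integral>y. (c y)\<^sup>2 \<partial>\<Xi>) \<le> ?Kc * (\<Sum>j<d. \<Sum>k<d. (R j k)\<^sup>2)"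
    unfolding c_def by (rule q[of \<phi> \<phi> R, OF adm1(1) adm1(1) adm1(2) adm1(2) adm1(3) adm1(3)])+
  have nA: "(\<Sum>j<d. \<Sum>k<d. (A j k)\<^sup>2) = Cnorm"
    unfolding A_def Cnorm_def res[symmetric] by (intro sum.cong refl) auto
  have nB: "(\<Sum>j<d. \<Sum>k<d. (B j k)\<^sup>2) = real d"
    by (simp add: B_def if_distrib[of "\<lambda>z. z ^ 2"] cong: if_cong)
  have nR: "(\<Sum>j<d. \<Sum>k<d. (R j k)\<^sup>2) \<le> Cnorm\<^sup>2"
  proof -
    have "(\<Sum>j<d. \<Sum>k<d. (R j k)\<^sup>2) = (\<Sum>j<p. \<Sum>k<p. (\<Sum>l<p. C j l * C k l)\<^sup>2)"
      unfolding R_def res[symmetric] by (intro sum.cong refl) auto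
    also have "\<dots> \<le> (\<Sum>j<p. \<Sum>k<p. (\<Sum>l<p. (C j l)\<^sup>2) * (\<Sum>l<p. (C k l)\<^sup>2))"
      by (intro sum_mono Cauchy_Schwarz_ineq_sum)
    also have "\<dots> = Cnorm\<^sup>2" by (simp add: Cnorm_def power2_eq_square sum_product)
    finally show ?thesis .
  qed
  have trA: "(\<integral>z. \<phi> z * z \<partial>N01) * (\<Sum>j<d. A j j) = \<kappa> * real d"
  proof -
    have "(\<Sum>j<d. A j j) = (\<Sum>k<p. C k k)"
      unfolding A_def by (intro sum.mono_neutral_cong_right) (use pd in auto)
    moreover have "(\<integral>z. \<phi> z * z \<partial>N01) = \<mu>" unfolding mu by (simp add: mult.commute)
    ultimately show ?thesis unfolding C_trace \<kappa>_def by simp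
  qed
  have trR: "(\<integral>z. \<phi> z * \<phi> z \<partial>N01) * (\<Sum>j<d. R j j) = v * Cnorm"
  proof -
    have "(\<Sum>j<d. R j j) = (\<Sum>j<p. \<Sum>l<p. C j l * C j l)"
      unfolding R_def by (intro sum.mono_neutral_cong_right) (use pd in auto)
    then show ?thesis by (simp add: v Cnorm_def power2_eq_square)
  qed
  have ay: "(\<Sum>j<p. \<Sum>k<p. \<phi> (y j) * C j k * y k) = a y + \<kappa> * real d" for y
  proof -
    have "(\<Sum>j<d. \<Sum>k<d. A j k * (\<phi> (y j) * y k)) = (\<Sum>j<p. \<Sum>k<p. \<phi> (y j) * C j k * y k)"
      unfolding A_def res[symmetric] by (intro sum.cong refl) auto
    then show ?thesis unfolding a_def trA by simp
  qed
  have by': "nsq y = b y + real d" for y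
  proof -
    have "(\<Sum>j<d. \<Sum>k<d. B j k * (y j * y k)) = nsq y"
      by (simp add: B_def power2_eq_square if_distrib[of "\<lambda>z. z * _"] cong: if_cong)
    moreover have "(\<Sum>j<d. B j j) = real d" by (simp add: B_def)
    ultimately show ?thesis unfolding b_def using N01_second_moment by (simp add: power2_eq_square)
  qed
  have cy: "(\<Sum>k<p. (\<Sum>j<p. \<phi> (y j) * C j k)\<^sup>2) = c y + v * Cnorm" for y
  proof -
    have "(\<Sum>k<p. (\<Sum>j<p. \<phi> (y j) * C j k)\<^sup>2) = (\<Sum>k<p. \<Sum>j<p. \<Sum>l<p. (C j k * C l k) * (\<phi> (y j) * \<phi> (y l)))"
      unfolding power2_eq_square sum_product by (simp add: mult_ac)
    also have "\<dots> = (\<Sum>j<p. \<Sum>k<p. \<Sum>l<p. (C j k * C l k) * (\<phi> (y j) * \<phi> (y l)))" by (rule sum.swap)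
    also have "\<dots> = (\<Sum>j<p. \<Sum>l<p. (\<Sum>k<p. C j k * C l k) * (\<phi> (y j) * \<phi> (y l)))"
      by (rule sum.cong[OF refl], subst sum.swap, simp add: sum_distrib_right)
    also have "\<dots> = (\<Sum>j<d. \<Sum>k<d. R j k * (\<phi> (y j) * \<phi> (y k)))"
      unfolding R_def res[symmetric] by (intro sum.cong refl) auto
    finally show ?thesis unfolding c_def trR by simp
  qed
  define T where "T = 2 * v * Cnorm + \<kappa>\<^sup>2 * real d + D"
  have T: "T \<ge> 0" using D vpos Cnorm_nonneg by (simp add: T_def)
  \<comment> \<open>\<open>a\<close>, \<open>b\<close> and \<open>c\<close> are the three sums minus
    their means. On the typical event the means of the two sums involved cancel by the choice of
    \<kappa>, leaving a - \<kappa> b.\<close>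
  have bound: "\<Psi>\<^sub>0 y \<le> 4 / real d * ((a y)\<^sup>2 + \<kappa>\<^sup>2 * (b y)\<^sup>2) + 4 / (real d)\<^sup>2 * T * (b y)\<^sup>2 + (c y)\<^sup>2 / D" for y
  proof (cases "nsq y \<le> real d / 2")
    case True
    then have "\<Psi>\<^sub>0 y = 2 * (c y + v * Cnorm) + 2 * \<kappa>\<^sup>2 * nsq y" by (simp add: \<Psi>\<^sub>0_def cy)
    moreover have "\<kappa>\<^sup>2 * nsq y \<le> \<kappa>\<^sup>2 * (real d / 2)" using True by (rule mult_left_mono) simp
    moreover have "2 * c y \<le> D + (c y)\<^sup>2 / D"
    proof -
      have "0 \<le> (D - c y)\<^sup>2 / D" using D by simp
      also have "\<dots> = D - 2 * c y + (c y)\<^sup>2 / D" using D by (simp add: power2_diff field_simps power2_eq_square)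
      finally show ?thesis by simp
    qed
    ultimately have 1: "\<Psi>\<^sub>0 y \<le> T + (c y)\<^sup>2 / D" by (simp add: T_def)
    \<comment> \<open>A short vector misses its mean squared norm d by at least d / 2; this inserts
      a factor 4 b^2 / d^2 \<ge> 1, as in Chebyshev's inequality.\<close>
    have "real d / 2 \<le> \<bar>b y\<bar>" using True unfolding by' by linarith
    then have "(real d / 2)\<^sup>2 \<le> (b y)\<^sup>2" using power_mono[of "real d / 2" "\<bar>b y\<bar>" 2] by simp
    then have "1 \<le> 4 / (real d)\<^sup>2 * (b y)\<^sup>2" using d by (simp add: field_simps power2_eq_square)
    then have "T * 1 \<le> T * (4 / (real d)\<^sup>2 * (b y)\<^sup>2)" using T by (rule mult_left_mono)
    then have 2: "T \<le> 4 / (real d)\<^sup>2 * T * (b y)\<^sup>2" by (simp add: mult_ac)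
    have 3: "0 \<le> 4 / real d * ((a y)\<^sup>2 + \<kappa>\<^sup>2 * (b y)\<^sup>2)" by simp
    show ?thesis by (rule order_trans[OF 1]) (use 2 3 in linarith)
  next
    case False
    have e: "(\<Sum>j<p. \<Sum>k<p. \<phi> (y j) * C j k * y k) - \<kappa> * nsq y = a y - \<kappa> * b y"
      unfolding ay by' by (simp add: algebra_simps)
    have "(s - t)\<^sup>2 \<le> 2 * (s\<^sup>2 + t\<^sup>2)" for s t :: real
      using zero_le_power2[of "s + t"] by (simp add: power2_eq_square algebra_simps)
    from this[of "a y" "\<kappa> * b y"] have "(a y - \<kappa> * b y)\<^sup>2 \<le> 2 * ((a y)\<^sup>2 + \<kappa>\<^sup>2 * (b y)\<^sup>2)" by (simp add: power_mult_distrib)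
    then have "2 / real d * (a y - \<kappa> * b y)\<^sup>2 \<le> 2 / real d * (2 * ((a y)\<^sup>2 + \<kappa>\<^sup>2 * (b y)\<^sup>2))"
      by (rule mult_left_mono) simp
    then have 1: "\<Psi>\<^sub>0 y \<le> 4 / real d * ((a y)\<^sup>2 + \<kappa>\<^sup>2 * (b y)\<^sup>2)" using False by (simp add: \<Psi>\<^sub>0_def e)
    have 2: "0 \<le> 4 / (real d)\<^sup>2 * T * (b y)\<^sup>2" "0 \<le> (c y)\<^sup>2 / D" using T D by auto
    show ?thesis by (rule order_trans[OF 1]) (use 2 in linarith)
  qed
  have i: "integrable \<Xi> (\<lambda>y. (a y)\<^sup>2)" "integrable \<Xi> (\<lambda>y. (b y)\<^sup>2)" "integrable \<Xi> (\<lambda>y. (c y)\<^sup>2)"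
    using a b c by (auto simp: sq_integrable_def)
  let ?U = "\<lambda>y. 4 / real d * ((a y)\<^sup>2 + \<kappa>\<^sup>2 * (b y)\<^sup>2) + 4 / (real d)\<^sup>2 * T * (b y)\<^sup>2 + (c y)\<^sup>2 / D"
  have iU: "integrable \<Xi> ?U" using i by simp
  have "(\<integral>\<^sup>+ y. ennreal (\<Psi>\<^sub>0 y) \<partial>\<Xi>) \<le> (\<integral>\<^sup>+ y. ennreal (?U y) \<partial>\<Xi>)"
    by (intro nn_integral_mono ennreal_leI bound)
  also have "\<dots> = ennreal (\<integral>y. ?U y \<partial>\<Xi>)"
    by (rule nn_integral_eq_integral[OF iU]) (use T D in simp)
  also have "(\<integral>y. ?U y \<partial>\<Xi>) = 4 / real d * ((\<integral>y. (a y)\<^sup>2 \<partial>\<Xi>) + \<kappa>\<^sup>2 * (\<integral>y. (b y)\<^sup>2 \<partial>\<Xi>))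
      + 4 / (real d)\<^sup>2 * T * (\<integral>y. (b y)\<^sup>2 \<partial>\<Xi>) + (\<integral>y. (c y)\<^sup>2 \<partial>\<Xi>) / D"
    using i by simp
  also have "\<dots> \<le> 4 / real d * (?Ka * Cnorm + \<kappa>\<^sup>2 * (?Kb * real d)) + 4 / (real d)\<^sup>2 * T * (?Kb * real d) + ?Kc * Cnorm\<^sup>2 / D"
  proof (intro add_mono mult_left_mono divide_right_mono)
    show "(\<integral>y. (a y)\<^sup>2 \<partial>\<Xi>) \<le> ?Ka * Cnorm" using a(2) unfolding nA .
    show "(\<integral>y. (b y)\<^sup>2 \<partial>\<Xi>) \<le> ?Kb * real d" "(\<integral>y. (b y)\<^sup>2 \<partial>\<Xi>) \<le> ?Kb * real d" using b(2) unfolding nB by auto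
    show "(\<integral>y. (c y)\<^sup>2 \<partial>\<Xi>) \<le> ?Kc * Cnorm\<^sup>2"
      by (rule order_trans[OF c(2) mult_left_mono[OF nR form_const_nonneg]])
  qed (use T D in auto)
  also have "\<dots> = deviation_bound" by (simp add: deviation_bound_def T_def D_def)
  finally show ?thesis by (simp add: ennreal_leI)
qed


sublocale PHX: pair_prob_space H \<Xi> ..

lemma measurable_F_pair:
  assumes "l < d"
  shows "(\<lambda>z. F (fst z) (snd z) l) \<in> borel_measurable (H \<Otimes>\<^sub>M \<Xi>)" "(\<lambda>z. F (snd z) (fst z) l) \<in> borel_measurable (\<Xi> \<Otimes>\<^sub>M H)"
  by (rule measurable_F;
      auto intro: assms measurable_compose[OF measurable_fst measurable_H_component] measurable_compose[OF measurable_snd measurable_H_component]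
        measurable_compose[OF measurable_fst measurable_Xi_component] measurable_compose[OF measurable_snd measurable_Xi_component])+

lemma measurable_g: "l < d \<Longrightarrow> (\<lambda>x. g x l) \<in> borel_measurable \<Xi>"
  unfolding g_def by (rule PH.borel_measurable_lebesgue_integral) (use measurable_F_pair(2) in \<open>simp add: case_prod_beta'\<close>)

lemma measurable_\<Psi>: "(\<lambda>z. \<Psi> (fst z) (snd z)) \<in> borel_measurable (H \<Otimes>\<^sub>M \<Xi>)"
proof -
  have x: "(\<lambda>z. snd z l) \<in> borel_measurable (H \<Otimes>\<^sub>M \<Xi>)" if "l < d" for l
    by (rule measurable_compose[OF measurable_snd measurable_Xi_component[OF that]])
  have nsq: "(\<lambda>z. nsq (snd z)) \<in> borel_measurable (H \<Otimes>\<^sub>M \<Xi>)"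
    by (intro borel_measurable_sum borel_measurable_power x) auto
  show ?thesis
    unfolding \<Psi>_def
    by (intro measurable_If borel_measurable_add borel_measurable_times borel_measurable_diff borel_measurable_const borel_measurable_power
        borel_measurable_sum measurable_F_pair nsq x borel_measurable_le) auto
qed

lemma measurable_\<Psi>\<^sub>0: "\<Psi>\<^sub>0 \<in> borel_measurable (PiM {..<d} (\<lambda>_. borel))"
proof -
  have x: "(\<lambda>x. x l) \<in> borel_measurable (PiM {..<d} (\<lambda>_. borel :: real measure))" if "l < d" for l
    by (rule measurable_component_singleton) (use that in auto)
  have nsq: "nsq \<in> borel_measurable (PiM {..<d} (\<lambda>_. borel :: real measure))"
    by (intro borel_measurable_sum borel_measurable_power x) auto
  show ?thesis
    unfolding \<Psi>\<^sub>0_def[abs_def]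
    by (intro measurable_If borel_measurable_add borel_measurable_times borel_measurable_diff borel_measurable_const borel_measurable_power
        borel_measurable_sum measurable_compose[OF _ meas] nsq x borel_measurable_le) (use pd in auto)
qed

lemma nn_deviation: "(\<integral>\<^sup>+ x. ennreal (\<Sum>l<d. (g x l - \<kappa> * x l)\<^sup>2) \<partial>\<Xi>) \<le> ennreal deviation_bound"
proof -
  have "(\<integral>\<^sup>+ x. ennreal (\<Sum>l<d. (g x l - \<kappa> * x l)\<^sup>2) \<partial>\<Xi>) \<le> (\<integral>\<^sup>+ x. \<integral>\<^sup>+ W. ennreal (\<Psi> W x) \<partial>H \<partial>\<Xi>)"
    by (intro nn_integral_mono deviation_le)
  also have "\<dots> = (\<integral>\<^sup>+ W. \<integral>\<^sup>+ x. ennreal (\<Psi> W x) \<partial>\<Xi> \<partial>H)"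
    by (rule PHX.Fubini') (use measurable_\<Psi> in \<open>simp add: case_prod_beta'\<close>)
  also have "\<dots> \<le> (\<integral>\<^sup>+ W. ennreal deviation_bound \<partial>H)"
  proof (rule nn_integral_mono_AE)
    show "AE W in H. (\<integral>\<^sup>+ x. ennreal (\<Psi> W x) \<partial>\<Xi>) \<le> ennreal deviation_bound"
      using orth_H
    proof eventually_elim
      case (elim W)
      obtain Q where Q: "orthogonal d Q" "\<And>j l. j < p \<Longrightarrow> l < d \<Longrightarrow> Q j l = W (j, l)"
        using stiefel_complete[OF elim pd] by metis
      have "(\<integral>\<^sup>+ x. ennreal (\<Psi> W x) \<partial>\<Xi>) = (\<integral>\<^sup>+ x. ennreal (\<Psi>\<^sub>0 (rot_vec d Q x)) \<partial>\<Xi>)"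
        using \<Psi>_rotate[OF elim Q] by simp
      also have "\<dots> = (\<integral>\<^sup>+ y. ennreal (\<Psi>\<^sub>0 y) \<partial>\<Xi>)"
        by (rule nn_integral_rot_vec[OF Q(1)]) (use measurable_\<Psi>\<^sub>0 in simp)
      finally show ?case using nn_\<Psi>\<^sub>0 by simp
    qed
  qed
  finally show ?thesis by (simp add: PH.emeasure_space_1)
qed

section \<open>From the mean prediction to bias and variance\<close>

abbreviation mp :: "(nat \<Rightarrow> real) \<times> (nat \<Rightarrow> real) \<Rightarrow> real" where
  "mp \<equiv> mean_prediction \<phi> \<sigma> p n d H lam"

lemma measurable_prediction_joint:
  "(\<lambda>z. prediction \<phi> p n d lam (fst z) (snd z)) \<in> borel_measurable (Tst \<Otimes>\<^sub>M Trn)"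
  using borel_measurable_add[OF measurable_error_joint measurable_compose[OF measurable_fst truth_measurable]] by simp

lemma measurable_mp: "mp \<in> borel_measurable Tst"
proof -
  have "(\<lambda>t. \<integral>s. prediction \<phi> p n d lam t s \<partial>Trn) \<in> borel_measurable Tst"
    by (rule PTrn.borel_measurable_lebesgue_integral) (use measurable_prediction_joint in \<open>simp add: case_prod_beta'\<close>)
  then show ?thesis by (simp add: mean_prediction_def[abs_def])
qed

definition bias_error :: real where "bias_error = \<alpha>\<^sup>2 / real d * deviation_bound"

lemma bias_error_nonneg: "bias_error \<ge> 0"
proof -
  have "deviation_bound \<ge> 0"
    unfolding deviation_bound_def
    by (intro add_nonneg_nonneg mult_nonneg_nonneg divide_nonneg_nonneg form_const_nonneg Cnorm_nonneg) (use vpos in auto)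
  then show ?thesis by (simp add: bias_error_def)
qed

text \<open>Almost surely the difference is linear in the signal with coefficients g x - \<kappa> x,
  so averaging over the signal yields \<alpha>^2 / d times the quantity bounded in
  \<open>nn_deviation\<close>.\<close>

lemma mean_prediction_close:
  "sq_integrable Tst (\<lambda>t. mp t - \<kappa> * truth d t)" "(\<integral>t. (mp t - \<kappa> * truth d t)\<^sup>2 \<partial>Tst) \<le> bias_error"
proof -
  let ?D = "\<lambda>t. mp t - \<kappa> * truth d t"
  have m: "?D \<in> borel_measurable Tst"
    by (intro borel_measurable_diff borel_measurable_times borel_measurable_const measurable_mp truth_measurable)
  have mh: "(\<lambda>t. ennreal ((\<Sum>l<d. (g (snd t) l - \<kappa> * snd t l) * fst t l)\<^sup>2)) \<in> borel_measurable (\<Theta> \<Otimes>\<^sub>M \<Xi>)"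
    by (intro measurable_compose[OF _ measurable_ennreal] borel_measurable_power borel_measurable_sum borel_measurable_times borel_measurable_diff
        borel_measurable_const measurable_compose[OF measurable_snd measurable_g] comps_Tst[unfolded laws]) auto
  have "(\<integral>\<^sup>+ t. ennreal ((?D t)\<^sup>2) \<partial>Tst) = (\<integral>\<^sup>+ t. ennreal ((\<Sum>l<d. (g (snd t) l - \<kappa> * snd t l) * fst t l)\<^sup>2) \<partial>Tst)"
  proof (rule nn_integral_cong_AE)
    show "AE t in Tst. ennreal ((?D t)\<^sup>2) = ennreal ((\<Sum>l<d. (g (snd t) l - \<kappa> * snd t l) * fst t l)\<^sup>2)"
      using mean_prediction_eq
    proof eventually_elim
      case (elim t)
      have "truth d t = (\<Sum>l<d. snd t l * fst t l)" using truth_eq[of d "fst t" "snd t"] by simp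
      then have "?D t = (\<Sum>l<d. (g (snd t) l - \<kappa> * snd t l) * fst t l)"
        by (simp add: elim left_diff_distrib sum_subtractf sum_distrib_left mult.assoc)
      then show ?case by simp
    qed
  qed
  also have "\<dots> = (\<integral>\<^sup>+ x. \<integral>\<^sup>+ \<theta>. ennreal ((0 + (\<Sum>l<d. (g x l - \<kappa> * x l) * \<theta> l))\<^sup>2) \<partial>\<Theta> \<partial>\<Xi>)"
    unfolding laws by (subst PTX.nn_integral_snd[OF mh, symmetric]) simp
  also have "\<dots> = (\<integral>\<^sup>+ x. ennreal (0\<^sup>2 + (\<alpha> / sqrt (real d))\<^sup>2 * (\<Sum>l<d. (g x l - \<kappa> * x l)\<^sup>2)) \<partial>\<Xi>)"
    unfolding gaussian_vec_def by (intro nn_integral_cong nn_affine_form) simp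
  also have "\<dots> = ennreal (\<alpha>\<^sup>2 / real d) * (\<integral>\<^sup>+ x. ennreal (\<Sum>l<d. (g x l - \<kappa> * x l)\<^sup>2) \<partial>\<Xi>)"
  proof -
    have "(\<lambda>x. ennreal (\<Sum>l<d. (g x l - \<kappa> * x l)\<^sup>2)) \<in> borel_measurable \<Xi>"
      by (intro measurable_compose[OF _ measurable_ennreal] borel_measurable_power borel_measurable_sum borel_measurable_times borel_measurable_diff
          borel_measurable_const measurable_g measurable_Xi_component) auto
    from nn_integral_cmult[OF this, of "ennreal (\<alpha>\<^sup>2 / real d)"] show ?thesis
      by (simp add: power_divide ennreal_mult' sum_nonneg flip: ennreal_mult)
  qed
  also have "\<dots> \<le> ennreal (\<alpha>\<^sup>2 / real d) * ennreal deviation_bound"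
    by (intro mult_left_mono nn_deviation) simp
  also have "\<dots> = ennreal bias_error" unfolding bias_error_def by (rule ennreal_mult'[symmetric]) simp
  finally have nn: "(\<integral>\<^sup>+ t. ennreal ((?D t)\<^sup>2) \<partial>Tst) \<le> ennreal bias_error" .
  have i: "integrable Tst (\<lambda>t. (?D t)\<^sup>2)"
  proof (rule integrableI_bounded)
    show "(\<integral>\<^sup>+ t. ennreal (norm ((?D t)\<^sup>2)) \<partial>Tst) < \<infinity>" using le_less_trans[OF nn] by simp
  qed (use m in simp)
  then show "sq_integrable Tst ?D" using m by (simp add: sq_integrable_def)
  have "ennreal (\<integral>t. (?D t)\<^sup>2 \<partial>Tst) \<le> ennreal bias_error"
    using nn nn_integral_eq_integral[OF i] by simp
  then show "(\<integral>t. (?D t)\<^sup>2 \<partial>Tst) \<le> bias_error"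
    using bias_error_nonneg by simp
qed

text \<open>The bias splits into \<open>mp\<close> - \<kappa> truth and (\<kappa> - 1) truth. The
  cross term is bounded by 2 |a b| \<le> s a^2 + b^2 / s with a free weight s, which is chosen in
  \<open>Bias2_limit\<close>.\<close>

lemma Bias2_approx:
  assumes s: "s > 0"
  shows "\<bar>Bias2 \<phi> \<alpha> \<sigma> p n d H lam - \<alpha>\<^sup>2 * (\<kappa> - 1)\<^sup>2\<bar> \<le> bias_error + \<bar>\<kappa> - 1\<bar> * (s * bias_error + \<alpha>\<^sup>2 / s)"
proof -
  let ?D = "\<lambda>t. mp t - \<kappa> * truth d t"
  note D = mean_prediction_close
  have i: "integrable Tst (\<lambda>t. (?D t)\<^sup>2)" "integrable Tst (\<lambda>t. ?D t * truth d t)" "integrable Tst (\<lambda>t. (truth d t)\<^sup>2)"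
    using D(1) sq_integrable_truth(1) sq_integrable_mult[OF D(1) sq_integrable_truth(1)] by (auto simp: sq_integrable_def)
  have "Bias2 \<phi> \<alpha> \<sigma> p n d H lam = (\<integral>t. (?D t)\<^sup>2 + 2 * (\<kappa> - 1) * (?D t * truth d t) + (\<kappa> - 1)\<^sup>2 * (truth d t)\<^sup>2 \<partial>Tst)"
    unfolding Bias2_def by (intro Bochner_Integration.integral_cong refl) (simp add: power2_eq_square algebra_simps)
  also have "\<dots> = (\<integral>t. (?D t)\<^sup>2 \<partial>Tst) + 2 * (\<kappa> - 1) * (\<integral>t. ?D t * truth d t \<partial>Tst) + (\<kappa> - 1)\<^sup>2 * (\<integral>t. (truth d t)\<^sup>2 \<partial>Tst)"
    by (subst Bochner_Integration.integral_add; (intro Bochner_Integration.integrable_add Bochner_Integration.integrable_mult_right i)?)+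
       (simp only: Bochner_Integration.integral_mult_right_zero)
  finally have eq: "Bias2 \<phi> \<alpha> \<sigma> p n d H lam - \<alpha>\<^sup>2 * (\<kappa> - 1)\<^sup>2 = (\<integral>t. (?D t)\<^sup>2 \<partial>Tst) + (\<kappa> - 1) * (2 * (\<integral>t. ?D t * truth d t \<partial>Tst))"
    unfolding sq_integrable_truth(2) by simp
  have "2 * (\<integral>t. \<bar>?D t * truth d t\<bar> \<partial>Tst) \<le> s * bias_error + \<alpha>\<^sup>2 / s"
  proof -
    have b: "2 * \<bar>a * b\<bar> \<le> s * a\<^sup>2 + b\<^sup>2 / s" for a b :: real
    proof -
      have "0 \<le> (s * \<bar>a\<bar> - \<bar>b\<bar>)\<^sup>2 / s" using s by simp
      also have "\<dots> = s * a\<^sup>2 + b\<^sup>2 / s - 2 * \<bar>a * b\<bar>"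
        using s by (simp add: power2_diff power_mult_distrib diff_divide_distrib add_divide_distrib abs_mult) (simp add: power2_eq_square)
      finally show ?thesis by simp
    qed
    have "(\<integral>t. 2 * \<bar>?D t * truth d t\<bar> \<partial>Tst) \<le> (\<integral>t. s * (?D t)\<^sup>2 + (truth d t)\<^sup>2 / s \<partial>Tst)"
      by (rule integral_mono) (use i b in auto)
    also have "\<dots> = s * (\<integral>t. (?D t)\<^sup>2 \<partial>Tst) + \<alpha>\<^sup>2 / s" using i sq_integrable_truth(2) by simp
    also have "\<dots> \<le> s * bias_error + \<alpha>\<^sup>2 / s" using mult_left_mono[OF D(2), of s] s by simp
    finally show ?thesis by simp
  qed
  moreover have "\<bar>\<integral>t. ?D t * truth d t \<partial>Tst\<bar> \<le> (\<integral>t. \<bar>?D t * truth d t\<bar> \<partial>Tst)" by (rule integral_abs_bound)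
  ultimately have "\<bar>2 * (\<integral>t. ?D t * truth d t \<partial>Tst)\<bar> \<le> s * bias_error + \<alpha>\<^sup>2 / s" by linarith
  then have "\<bar>\<kappa> - 1\<bar> * \<bar>2 * (\<integral>t. ?D t * truth d t \<partial>Tst)\<bar> \<le> \<bar>\<kappa> - 1\<bar> * (s * bias_error + \<alpha>\<^sup>2 / s)"
    by (rule mult_left_mono) simp
  then have 1: "\<bar>(\<kappa> - 1) * (2 * (\<integral>t. ?D t * truth d t \<partial>Tst))\<bar> \<le> \<bar>\<kappa> - 1\<bar> * (s * bias_error + \<alpha>\<^sup>2 / s)"
    unfolding abs_mult[of "\<kappa> - 1"] .
  have 2: "\<bar>\<integral>t. (?D t)\<^sup>2 \<partial>Tst\<bar> \<le> bias_error" using D(2) by simp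
  show ?thesis unfolding eq by (rule order_trans[OF abs_triangle_ineq add_mono[OF 2 1]])
qed

text \<open>Pythagoras in the training variables: for almost every test point the prediction is
  square integrable, and its mean squared error is variance plus squared bias. The identity is
  integrated with nonnegative integrals, so finiteness of the variance is a conclusion.\<close>

lemma Var_eq: "Var \<phi> \<alpha> \<sigma> p n d H lam = mse0 - Bias2 \<phi> \<alpha> \<sigma> p n d H lam"
proof -
  let ?P = "prediction \<phi> p n d lam"
  let ?e = "\<lambda>z. ennreal ((?P (fst z) (snd z) - truth d (fst z))\<^sup>2)"
  let ?w = "\<lambda>z. ennreal ((?P (fst z) (snd z) - mp (fst z))\<^sup>2)"
  have me: "?e \<in> borel_measurable (Tst \<Otimes>\<^sub>M Trn)"
    by (intro measurable_compose[OF _ measurable_ennreal] borel_measurable_power measurable_error_joint)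
  have mw0: "(\<lambda>z. (?P (fst z) (snd z) - mp (fst z))\<^sup>2) \<in> borel_measurable (Tst \<Otimes>\<^sub>M Trn)"
    by (intro borel_measurable_power borel_measurable_diff measurable_prediction_joint measurable_compose[OF measurable_fst measurable_mp])
  then have mw: "?w \<in> borel_measurable (Tst \<Otimes>\<^sub>M Trn)" by (rule measurable_compose[OF _ measurable_ennreal])
  have bm: "(\<lambda>t. (mp t - truth d t)\<^sup>2) \<in> borel_measurable Tst"
    by (intro borel_measurable_power borel_measurable_diff measurable_mp truth_measurable)
  have "sq_integrable Tst (\<lambda>t. (mp t - \<kappa> * truth d t) + (\<kappa> - 1) * truth d t)"
    by (intro sq_integrable_add mean_prediction_close sq_integrable_cmult sq_integrable_truth)
  then have "sq_integrable Tst (\<lambda>t. mp t - truth d t)" by (simp add: algebra_simps)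
  then have bi: "integrable Tst (\<lambda>t. (mp t - truth d t)\<^sup>2)" by (simp add: sq_integrable_def)
  have pyth: "AE t in Tst. (\<integral>\<^sup>+ s. ?e (t, s) \<partial>Trn) = (\<integral>\<^sup>+ s. ?w (t, s) \<partial>Trn) + ennreal ((mp t - truth d t)\<^sup>2)"
    using AE_sq_integrable_prediction
  proof eventually_elim
    case (elim t)
    let ?m = "mp t" and ?b = "mp t - truth d t"
    have i1: "integrable Trn (?P t)" by (rule PTrn.sq_integrable_integrable[OF elim])
    have i2: "integrable Trn (\<lambda>s. (?P t s - ?m)\<^sup>2)"
      using sq_integrable_diff[OF elim PTrn.sq_integrable_const[of ?m]] by (simp add: sq_integrable_def)
    have z: "(\<integral>s. ?P t s - ?m \<partial>Trn) = 0"
      using i1 by (simp add: PTrn.prob_space mean_prediction_def)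
    have i3: "integrable Trn (\<lambda>s. (?P t s - ?m)\<^sup>2 + 2 * ?b * (?P t s - ?m) + ?b\<^sup>2)"
      using i1 i2 by (intro Bochner_Integration.integrable_add Bochner_Integration.integrable_mult_right Bochner_Integration.integrable_diff PTrn.integrable_const) auto
    have "(\<integral>\<^sup>+ s. ?e (t, s) \<partial>Trn) = (\<integral>\<^sup>+ s. ennreal ((?P t s - ?m)\<^sup>2 + 2 * ?b * (?P t s - ?m) + ?b\<^sup>2) \<partial>Trn)"
      by (intro nn_integral_cong) (simp add: power2_eq_square algebra_simps)
    also have "\<dots> = ennreal (\<integral>s. (?P t s - ?m)\<^sup>2 + 2 * ?b * (?P t s - ?m) + ?b\<^sup>2 \<partial>Trn)"
    proof (rule nn_integral_eq_integral[OF i3], rule AE_I2)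
      fix s
      have "(?P t s - ?m)\<^sup>2 + 2 * ?b * (?P t s - ?m) + ?b\<^sup>2 = (?P t s - truth d t)\<^sup>2" by (simp add: power2_eq_square algebra_simps)
      then show "0 \<le> (?P t s - ?m)\<^sup>2 + 2 * ?b * (?P t s - ?m) + ?b\<^sup>2" by simp
    qed
    also have "(\<integral>s. (?P t s - ?m)\<^sup>2 + 2 * ?b * (?P t s - ?m) + ?b\<^sup>2 \<partial>Trn) = (\<integral>s. (?P t s - ?m)\<^sup>2 \<partial>Trn) + 2 * ?b * (\<integral>s. ?P t s - ?m \<partial>Trn) + ?b\<^sup>2"
    proof -
      have i4: "integrable Trn (\<lambda>s. 2 * ?b * (?P t s - ?m))" using i1 by (intro Bochner_Integration.integrable_mult_right Bochner_Integration.integrable_diff PTrn.integrable_const)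
      show ?thesis
        unfolding Bochner_Integration.integral_add[OF Bochner_Integration.integrable_add[OF i2 i4] PTrn.integrable_const]
          Bochner_Integration.integral_add[OF i2 i4] by (simp add: PTrn.prob_space)
    qed
    also have "ennreal \<dots> = ennreal (\<integral>s. (?P t s - ?m)\<^sup>2 \<partial>Trn) + ennreal (?b\<^sup>2)"
      unfolding z by simp
    also have "ennreal (\<integral>s. (?P t s - ?m)\<^sup>2 \<partial>Trn) = (\<integral>\<^sup>+ s. ?w (t, s) \<partial>Trn)"
      by (subst nn_integral_eq_integral) (use i2 in auto)
    finally show ?case .
  qed
  have mb: "(\<lambda>t. ennreal ((mp t - truth d t)\<^sup>2)) \<in> borel_measurable Tst" using bm by simp
  have "ennreal mse0 = (\<integral>\<^sup>+ t. \<integral>\<^sup>+ s. ?e (t, s) \<partial>Trn \<partial>Tst)"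
    unfolding PTrn.nn_integral_fst[OF me] nn_error_total mse0(1)[symmetric] ..
  also have "\<dots> = (\<integral>\<^sup>+ t. (\<integral>\<^sup>+ s. ?w (t, s) \<partial>Trn) + ennreal ((mp t - truth d t)\<^sup>2) \<partial>Tst)"
    by (rule nn_integral_cong_AE[OF pyth])
  also have "\<dots> = (\<integral>\<^sup>+ t. (\<integral>\<^sup>+ s. ?w (t, s) \<partial>Trn) \<partial>Tst) + (\<integral>\<^sup>+ t. ennreal ((mp t - truth d t)\<^sup>2) \<partial>Tst)"
    by (rule nn_integral_add[OF PTrn.borel_measurable_nn_integral_fst[OF mw] mb])
  also have "(\<integral>\<^sup>+ t. ennreal ((mp t - truth d t)\<^sup>2) \<partial>Tst) = ennreal (Bias2 \<phi> \<alpha> \<sigma> p n d H lam)"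
    unfolding Bias2_def by (rule nn_integral_eq_integral[OF bi]) simp
  also have "(\<integral>\<^sup>+ t. (\<integral>\<^sup>+ s. ?w (t, s) \<partial>Trn) \<partial>Tst) = integral\<^sup>N (Tst \<Otimes>\<^sub>M Trn) ?w"
    by (rule PTrn.nn_integral_fst[OF mw])
  finally have tot: "ennreal mse0 = integral\<^sup>N (Tst \<Otimes>\<^sub>M Trn) ?w + ennreal (Bias2 \<phi> \<alpha> \<sigma> p n d H lam)" .
  have Var: "Var \<phi> \<alpha> \<sigma> p n d H lam = enn2real (integral\<^sup>N (Tst \<Otimes>\<^sub>M Trn) ?w)"
    unfolding Var_def case_prod_beta' by (rule integral_eq_nn_integral[OF mw0]) simp
  have B: "Bias2 \<phi> \<alpha> \<sigma> p n d H lam \<ge> 0" by (simp add: Bias2_def)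
  obtain w where w: "w \<ge> 0" "integral\<^sup>N (Tst \<Otimes>\<^sub>M Trn) ?w = ennreal w"
    using tot by (cases "integral\<^sup>N (Tst \<Otimes>\<^sub>M Trn) ?w") auto
  have "ennreal mse0 = ennreal (w + Bias2 \<phi> \<alpha> \<sigma> p n d H lam)" using tot w B by simp
  then have "mse0 = w + Bias2 \<phi> \<alpha> \<sigma> p n d H lam" by (subst (asm) ennreal_inj) (use w B mse0(2) in auto)
  then show ?thesis using Var w by simp
qed

text \<open>\<open>Cnorm_le\<close> replaces the squared Frobenius norm by d S, after which each
  term carries a factor of at most sqrt d; division by d leaves the rate 1 / sqrt d.\<close>

lemma bias_error_le:
  defines "S \<equiv> avg_form n d p lam"
  shows "bias_error \<le> \<alpha>\<^sup>2 * (4 * (form_const N01 \<phi> (\<lambda>z. z) * S + \<kappa>\<^sup>2 * form_const N01 (\<lambda>z. z) (\<lambda>z. z))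
      + 4 * (2 * v * S + \<kappa>\<^sup>2 + 1) * form_const N01 (\<lambda>z. z) (\<lambda>z. z) + form_const N01 \<phi> \<phi> * S\<^sup>2) / sqrt (real d)"
proof -
  let ?Ka = "form_const N01 \<phi> (\<lambda>z. z)" and ?Kb = "form_const N01 (\<lambda>z. z) (\<lambda>z. z)" and ?Kc = "form_const N01 \<phi> \<phi>"
  define r where "r = sqrt (real d)"
  have r: "r \<ge> 1" "real d = r * r" using d by (auto simp: r_def)
  have C: "Cnorm \<le> real d * S" using Cnorm_le by (simp add: S_def)
  have S: "S \<ge> 0" using order_trans[OF Cnorm_nonneg C] d by (simp add: zero_le_mult_iff)
  have K: "?Ka \<ge> 0" "?Kb \<ge> 0" "?Kc \<ge> 0" by (auto intro: form_const_nonneg)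
  have "deviation_bound \<le> 4 / real d * (?Ka * (real d * S) + \<kappa>\<^sup>2 * (?Kb * real d))
     + 4 / (real d)\<^sup>2 * (2 * v * (real d * S) + \<kappa>\<^sup>2 * real d + real d * r) * (?Kb * real d)
     + ?Kc * (real d * S)\<^sup>2 / (real d * r)"
    unfolding deviation_bound_def r_def
    by (intro add_mono mult_left_mono mult_right_mono divide_right_mono power_mono C order_refl) (use K vpos Cnorm_nonneg in auto)
  also have "\<dots> = 4 * (?Ka * S + \<kappa>\<^sup>2 * ?Kb) + 4 * (2 * v * S + \<kappa>\<^sup>2 + r) * ?Kb + ?Kc * S\<^sup>2 * r"
  proof -
    have "4 / real d * (?Ka * (real d * S) + \<kappa>\<^sup>2 * (?Kb * real d)) = 4 * (?Ka * S + \<kappa>\<^sup>2 * ?Kb)" using d by (simp add: field_simps)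
    moreover have "4 / (real d)\<^sup>2 * (2 * v * (real d * S) + \<kappa>\<^sup>2 * real d + real d * r) * (?Kb * real d) = 4 * (2 * v * S + \<kappa>\<^sup>2 + r) * ?Kb"
      using d by (simp add: field_simps power2_eq_square)
    moreover have "?Kc * (real d * S)\<^sup>2 / (real d * r) = ?Kc * S\<^sup>2 * r"
      using d r by (simp add: power_mult_distrib power2_eq_square)
    ultimately show ?thesis by simp
  qed
  also have "\<dots> \<le> 4 * (?Ka * S + \<kappa>\<^sup>2 * ?Kb) * r + 4 * ((2 * v * S + \<kappa>\<^sup>2 + 1) * r) * ?Kb + ?Kc * S\<^sup>2 * r"
  proof (intro add_mono mult_right_mono mult_left_mono order_refl K)
    have "4 * x \<le> 4 * x * r" if "0 \<le> x" for x :: real using mult_left_mono[OF r(1) that] by simp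
    then show "4 * (?Ka * S + \<kappa>\<^sup>2 * ?Kb) \<le> 4 * (?Ka * S + \<kappa>\<^sup>2 * ?Kb) * r" using K S by simp
    have "0 \<le> 2 * v * S + \<kappa>\<^sup>2" using vpos S by simp
    from mult_left_mono[OF r(1) this] show "2 * v * S + \<kappa>\<^sup>2 + r \<le> (2 * v * S + \<kappa>\<^sup>2 + 1) * r" by (simp add: distrib_right)
  qed (use r in auto)
  also have "\<dots> = r * (4 * (?Ka * S + \<kappa>\<^sup>2 * ?Kb) + 4 * (2 * v * S + \<kappa>\<^sup>2 + 1) * ?Kb + ?Kc * S\<^sup>2)" (is "_ = r * ?J")
    by (simp add: algebra_simps)
  finally have "deviation_bound \<le> r * ?J" .
  then have "bias_error \<le> \<alpha>\<^sup>2 / real d * (r * ?J)"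
    unfolding bias_error_def by (rule mult_left_mono) simp
  also have "\<dots> = \<alpha>\<^sup>2 * ?J / r" using r by simp
  finally show ?thesis by (simp add: r_def)
qed

end

context activation
begin

text \<open>The factor of \<alpha>^2 / sqrt d in \<open>bias_error_le\<close>, with n, d and p as
  arguments so that it can be followed along the sequence of dimensions; its convergence is enough
  for the bias error to vanish.\<close>

definition bias_rate :: "nat \<Rightarrow> nat \<Rightarrow> nat \<Rightarrow> real \<Rightarrow> real" where
  "bias_rate n d p lam = 4 * (form_const N01 \<phi> (\<lambda>z. z) * avg_form n d p lam + (\<mu> * avg_cross n d p lam)\<^sup>2 * form_const N01 (\<lambda>z. z) (\<lambda>z. z))
     + 4 * (2 * v * avg_form n d p lam + (\<mu> * avg_cross n d p lam)\<^sup>2 + 1) * form_const N01 (\<lambda>z. z) (\<lambda>z. z)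
     + form_const N01 \<phi> \<phi> * (avg_form n d p lam)\<^sup>2"

end

lemma (in regression) MSE_expansion:
  "MSE \<phi> \<alpha> \<sigma> p n d H lam = \<alpha>\<^sup>2 * (v * (avg_form n d p lam - lam * avg_form2 n d p lam) - 2 * \<mu> * avg_cross n d p lam + 1)
      + v * \<sigma>\<^sup>2 * (\<tau> n d p lam - lam * \<tau>2 n d p lam) + \<sigma>\<^sup>2"
  unfolding MSE_eq mse0_def ..

lemma (in regression_growth) Var_eq_MSE_minus_Bias2: "Var \<phi> \<alpha> \<sigma> p n d H lam = MSE \<phi> \<alpha> \<sigma> p n d H lam - \<sigma>\<^sup>2 - Bias2 \<phi> \<alpha> \<sigma> p n d H lam"
  unfolding MSE_eq Var_eq by simp

lemma (in regression_growth) Bias2_rate: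
  assumes s: "s > 0"
  defines "B \<equiv> \<alpha>\<^sup>2 * bias_rate n d p lam / sqrt (real d)"
  shows "\<bar>Bias2 \<phi> \<alpha> \<sigma> p n d H lam - \<alpha>\<^sup>2 * (\<mu> * avg_cross n d p lam - 1)\<^sup>2\<bar> \<le>
    B + \<bar>\<mu> * avg_cross n d p lam - 1\<bar> * (s * B + \<alpha>\<^sup>2 / s)"
proof -
  have B: "bias_error \<le> B" unfolding B_def bias_rate_def using bias_error_le unfolding \<kappa>_def .
  have "bias_error + \<bar>\<kappa> - 1\<bar> * (s * bias_error + \<alpha>\<^sup>2 / s) \<le> B + \<bar>\<kappa> - 1\<bar> * (s * B + \<alpha>\<^sup>2 / s)"
    by (intro add_mono mult_left_mono B order_refl) (use s in auto)
  from order_trans[OF Bias2_approx[OF s] this] show ?thesis unfolding \<kappa>_def .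
qed

section \<open>Limits of risk, bias and variance, and the optimal ridge parameter\<close>

context regime
begin

definition bias_limit :: "real \<Rightarrow> real \<Rightarrow> real" where
  "bias_limit \<alpha> lam = \<alpha>\<^sup>2 * (\<pi> * (\<mu>\<^sup>2 / v) * (1 - lam / v * \<theta>1 (lam / v)) - 1)\<^sup>2"

lemma bias_rate_convergent:
  assumes lam: "lam > 0"
  shows "\<exists>L. (\<lambda>d. bias_rate (n d) d (p d) lam) \<longlonglongrightarrow> L"
  unfolding bias_rate_def
  by (rule exI, (rule tendsto_add tendsto_mult tendsto_power tendsto_const avg_form_limit[OF lam] avg_cross_limit[OF lam])+)

context
  fixes \<alpha> \<sigma> lam c\<^sub>1 c\<^sub>2 :: real and H :: "nat \<Rightarrow> (nat \<times> nat \<Rightarrow> real) measure"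
  assumes lam: "lam > 0" and H: "\<And>d. uniform_stiefel (p d) d (H d)"
    and growth: "\<And>t. \<bar>\<phi> t\<bar> \<le> c\<^sub>1 * exp (c\<^sub>2 * \<bar>t\<bar>)" and c2: "c\<^sub>2 > 0"
begin

lemma eventually_regression:
  "eventually (\<lambda>d. regression_growth \<phi> \<mu> v (n d) d (p d) lam (H d) c\<^sub>1 c\<^sub>2) sequentially"
  using eventually_pos by eventually_elim (unfold_locales; use lam H growth c2 pd in auto)

lemma MSE_limit: "(\<lambda>d. MSE \<phi> \<alpha> \<sigma> (p d) (n d) d (H d) lam) \<longlonglongrightarrow> mse_limit \<alpha> \<sigma> lam"
proof (rule Lim_transform_eventually[OF mse_limit[OF lam]])
  show "eventually (\<lambda>d. \<alpha>\<^sup>2 * (v * (avg_form (n d) d (p d) lam - lam * avg_form2 (n d) d (p d) lam) - 2 * \<mu> * avg_cross (n d) d (p d) lam + 1)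
     + v * \<sigma>\<^sup>2 * (\<tau> (n d) d (p d) lam - lam * \<tau>2 (n d) d (p d) lam) + \<sigma>\<^sup>2 = MSE \<phi> \<alpha> \<sigma> (p d) (n d) d (H d) lam) sequentially"
    using eventually_regression
  proof eventually_elim
    case (elim d)
    then interpret regression_growth \<phi> \<mu> v "n d" d "p d" lam \<alpha> \<sigma> "H d" c\<^sub>1 c\<^sub>2 .
    show ?case by (rule MSE_expansion[symmetric])
  qed
qed

lemma Bias2_limit: "(\<lambda>d. Bias2 \<phi> \<alpha> \<sigma> (p d) (n d) d (H d) lam) \<longlonglongrightarrow> bias_limit \<alpha> lam"
proof -
  obtain L where L: "(\<lambda>d. bias_rate (n d) d (p d) lam) \<longlonglongrightarrow> L" using bias_rate_convergent[OF lam] by blast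
  define q where "q = (\<lambda>d. \<mu> * avg_cross (n d) d (p d) lam)"
  define q\<^sub>0 where "q\<^sub>0 = \<mu> * (\<pi> * (\<mu> * t lam / (1 + v * t lam)))"
  have q: "q \<longlonglongrightarrow> q\<^sub>0" unfolding q_def q\<^sub>0_def by (rule tendsto_mult[OF tendsto_const avg_cross_limit[OF lam]])
  \<comment> \<open>The weight s = d^(1/4) balances s times a bound of order d^(-1/2) against
    \<alpha>^2 / s.\<close>
  define s where "s = (\<lambda>d :: nat. sqrt (sqrt (real d)))"
  define r where "r = (\<lambda>d. \<alpha>\<^sup>2 * bias_rate (n d) d (p d) lam)"
  have r: "r \<longlonglongrightarrow> \<alpha>\<^sup>2 * L" unfolding r_def by (rule tendsto_mult[OF tendsto_const L])
  have "filterlim s at_top sequentially"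
    unfolding s_def by (intro filterlim_compose[OF sqrt_at_top] filterlim_real_sequentially)
  then have is0: "(\<lambda>d. inverse (s d)) \<longlonglongrightarrow> 0" by (rule tendsto_inverse_0_at_top)
  \<comment> \<open>The bound of \<open>Bias2_rate\<close> written through 1 / s, using sqrt d =
    s^2; every term contains a factor that tends to 0.\<close>
  let ?u = "\<lambda>d. r d * (inverse (s d) * inverse (s d)) + \<bar>q d - 1\<bar> * (r d * inverse (s d) + \<alpha>\<^sup>2 * inverse (s d))"
  have u: "?u \<longlonglongrightarrow> \<alpha>\<^sup>2 * L * (0 * 0) + \<bar>q\<^sub>0 - 1\<bar> * (\<alpha>\<^sup>2 * L * 0 + \<alpha>\<^sup>2 * 0)"
    by (rule tendsto_add tendsto_mult tendsto_rabs tendsto_diff tendsto_const r q is0)+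
  have "(\<lambda>d. Bias2 \<phi> \<alpha> \<sigma> (p d) (n d) d (H d) lam - \<alpha>\<^sup>2 * (q d - 1)\<^sup>2) \<longlonglongrightarrow> 0"
  proof (rule Lim_null_comparison)
    show "eventually (\<lambda>d. norm (Bias2 \<phi> \<alpha> \<sigma> (p d) (n d) d (H d) lam - \<alpha>\<^sup>2 * (q d - 1)\<^sup>2) \<le> ?u d) sequentially"
      using eventually_regression eventually_gt_at_top[of 0]
    proof eventually_elim
      case (elim d)
      interpret regression_growth \<phi> \<mu> v "n d" d "p d" lam \<alpha> \<sigma> "H d" c\<^sub>1 c\<^sub>2 by (rule elim(1))
      have sd: "s d > 0" "sqrt (real d) = s d * s d" using elim(2) by (auto simp: s_def)
      have b: "\<bar>Bias2 \<phi> \<alpha> \<sigma> (p d) (n d) d (H d) lam - \<alpha>\<^sup>2 * (q d - 1)\<^sup>2\<bar> \<le>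
          r d / sqrt (real d) + \<bar>q d - 1\<bar> * (s d * (r d / sqrt (real d)) + \<alpha>\<^sup>2 / s d)"
        unfolding q_def r_def by (rule Bias2_rate[OF sd(1)])
      have e: "r d / sqrt (real d) = r d * (inverse (s d) * inverse (s d))"
        unfolding sd(2) by (simp add: divide_inverse)
      have e2: "s d * (r d * (inverse (s d) * inverse (s d))) = r d * inverse (s d)" using sd(1) by simp
      show ?case using b unfolding e e2 real_norm_def by (simp only: divide_inverse)
    qed
    show "?u \<longlonglongrightarrow> 0" using u by simp
  qed
  moreover have "(\<lambda>d. \<alpha>\<^sup>2 * (q d - 1)\<^sup>2) \<longlonglongrightarrow> \<alpha>\<^sup>2 * (q\<^sub>0 - 1)\<^sup>2"
    by (rule tendsto_mult tendsto_power tendsto_diff tendsto_const q)+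
  ultimately have "(\<lambda>d. (Bias2 \<phi> \<alpha> \<sigma> (p d) (n d) d (H d) lam - \<alpha>\<^sup>2 * (q d - 1)\<^sup>2) + \<alpha>\<^sup>2 * (q d - 1)\<^sup>2) \<longlonglongrightarrow> 0 + \<alpha>\<^sup>2 * (q\<^sub>0 - 1)\<^sup>2"
    by (rule tendsto_add)
  moreover have "q\<^sub>0 = \<pi> * (\<mu>\<^sup>2 / v) * (1 - lam / v * \<theta>1 (lam / v))"
  proof -
    have "q\<^sub>0 = \<pi> * (\<mu>\<^sup>2 / v) * (T (lam / v) / (1 + T (lam / v)))"
      unfolding q\<^sub>0_def t_facts(2)[OF lam, symmetric] using vpos by (simp add: power2_eq_square)
    then show ?thesis using T_facts(2)[of "lam / v"] lam vpos by simp
  qed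
  ultimately show ?thesis by (simp add: bias_limit_def)
qed

lemma Var_limit: "(\<lambda>d. Var \<phi> \<alpha> \<sigma> (p d) (n d) d (H d) lam) \<longlonglongrightarrow> mse_limit \<alpha> \<sigma> lam - \<sigma>\<^sup>2 - bias_limit \<alpha> lam"
proof (rule Lim_transform_eventually[OF tendsto_diff[OF tendsto_diff[OF MSE_limit tendsto_const] Bias2_limit]])
  show "eventually (\<lambda>d. MSE \<phi> \<alpha> \<sigma> (p d) (n d) d (H d) lam - \<sigma>\<^sup>2 - Bias2 \<phi> \<alpha> \<sigma> (p d) (n d) d (H d) lam = Var \<phi> \<alpha> \<sigma> (p d) (n d) d (H d) lam) sequentially"
    using eventually_regression
  proof eventually_elim
    case (elim d)
    then interpret regression_growth \<phi> \<mu> v "n d" d "p d" lam \<alpha> \<sigma> "H d" c\<^sub>1 c\<^sub>2 .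
    show ?case by (rule Var_eq_MSE_minus_Bias2[symmetric])
  qed
qed

end

text \<open>Expanding the square in the bias limit yields a constant \<alpha>^2, which cancels the
  term \<alpha>^2 \<pi> (1 / \<pi>) of the risk; its cross term supplies 2 \<mu>^2 / v and the
  additional multiple of \<open>\<theta>1\<close>.\<close>

lemma var_limit:
  assumes lam: "lam > 0"
  shows "mse_limit \<alpha> \<sigma> lam - \<sigma>\<^sup>2 - bias_limit \<alpha> lam = \<alpha>\<^sup>2 * \<pi> * (2 * \<mu>\<^sup>2 / v - 1
            + (- (2 * lam * \<mu>\<^sup>2 / v\<^sup>2) + \<delta> * (1 - \<pi>)) * \<theta>1 (lam / v)
            + lam / v * (lam * \<mu>\<^sup>2 / v\<^sup>2 - \<delta> * (1 - \<pi>)) * \<theta>2 (lam / v)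
            - \<pi> * \<mu> ^ 4 / v\<^sup>2 * (1 - lam / v * \<theta>1 (lam / v))\<^sup>2
            + (v - \<mu>\<^sup>2) * (\<gamma> / v * \<theta>1 (lam / v) + 1 / v - lam * \<gamma> / v\<^sup>2 * \<theta>2 (lam / v)))
        + \<sigma>\<^sup>2 * \<gamma> * (\<theta>1 (lam / v) - lam / v * \<theta>2 (lam / v))"
proof -
  define P where "P = lam / v * (lam * \<mu>\<^sup>2 / v\<^sup>2 - \<delta> * (1 - \<pi>)) * \<theta>2 (lam / v)"
  define R where "R = (v - \<mu>\<^sup>2) * (\<gamma> / v * \<theta>1 (lam / v) + 1 / v - lam * \<gamma> / v\<^sup>2 * \<theta>2 (lam / v))"
  define Z where "Z = \<sigma>\<^sup>2 * \<gamma> * (\<theta>1 (lam / v) - lam / v * \<theta>2 (lam / v))"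
  define q where "q = \<mu>\<^sup>2 / v"
  define x where "x = \<theta>1 (lam / v)"
  define l where "l = lam / v"
  have a: "2 * \<mu>\<^sup>2 / v = 2 * q" "2 * lam * \<mu>\<^sup>2 / v\<^sup>2 = 2 * l * q" "\<pi> * \<mu> ^ 4 / v\<^sup>2 = \<pi> * q\<^sup>2"
    by (simp_all add: q_def l_def power2_eq_square power4_eq_xxxx)
  have c: "\<pi> * (1 / \<pi>) = 1" using pi by simp
  have "\<alpha>\<^sup>2 * \<pi> * (w - 1 + \<delta> * (1 - \<pi>) * x + P + R) - \<alpha>\<^sup>2 * (\<pi> * q * (1 - l * x) - 1)\<^sup>2 =
     \<alpha>\<^sup>2 * (\<pi> * w) - \<alpha>\<^sup>2 + \<alpha>\<^sup>2 * \<pi> * (2 * q - 1 + (- (2 * l * q) + \<delta> * (1 - \<pi>)) * x + P - \<pi> * q\<^sup>2 * (1 - l * x)\<^sup>2 + R)" for w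
    by (simp add: algebra_simps power2_eq_square)
  from this[of "1 / \<pi>"]
  have "\<alpha>\<^sup>2 * \<pi> * (1 / \<pi> - 1 + \<delta> * (1 - \<pi>) * x + P + R) - \<alpha>\<^sup>2 * (\<pi> * q * (1 - l * x) - 1)\<^sup>2 =
     \<alpha>\<^sup>2 * \<pi> * (2 * q - 1 + (- (2 * l * q) + \<delta> * (1 - \<pi>)) * x + P - \<pi> * q\<^sup>2 * (1 - l * x)\<^sup>2 + R)"
    unfolding c by simp
  then show ?thesis
    unfolding mse_limit_def bias_limit_def P_def[symmetric] R_def[symmetric] Z_def[symmetric] a
    unfolding x_def[symmetric] unfolding l_def[symmetric] q_def[symmetric] by linarith
qed

text \<open>With l = lam / v, all factors of \<open>\<theta>1\<close> - l \<open>\<theta>2\<close>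
  add up to A c with c = lam_opt / v, and l^2 \<open>\<theta>2\<close> has the factor A > 0. The
  limit is thus an increasing affine function of the quantity in
  \<open>resolvent_moment_minimum\<close>, whose only minimiser is l = c.\<close>

lemma mse_limit_minimum:
  assumes \<alpha>: "\<alpha> > 0" and mu0: "\<mu> \<noteq> 0" and lam: "lam > 0" and opt: "lam_opt > 0" and ne: "lam \<noteq> lam_opt"
    and opt_eq: "lam_opt = v\<^sup>2 / \<mu>\<^sup>2 * (\<delta> * (1 - \<pi> + \<sigma>\<^sup>2 / \<alpha>\<^sup>2) + (v - \<mu>\<^sup>2) * \<gamma> / v)"
  shows "mse_limit \<alpha> \<sigma> lam_opt < mse_limit \<alpha> \<sigma> lam"
proof -
  define c where "c = lam_opt / v"
  define A where "A = \<alpha>\<^sup>2 * \<pi> * \<mu>\<^sup>2 / v"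
  define C0 where "C0 = \<alpha>\<^sup>2 * \<pi> * (1 / \<pi> - 1) + \<alpha>\<^sup>2 * \<pi> * ((v - \<mu>\<^sup>2) / v) + \<sigma>\<^sup>2"
  have A: "A > 0" using \<alpha> mu0 pi vpos by (simp add: A_def)
  have Ac: "A * c = \<alpha>\<^sup>2 * \<pi> * \<delta> * (1 - \<pi>) + \<alpha>\<^sup>2 * \<pi> * ((v - \<mu>\<^sup>2) * \<gamma> / v) + \<sigma>\<^sup>2 * \<gamma>"
  proof -
    have "A * c = \<alpha>\<^sup>2 * \<pi> * (\<delta> * (1 - \<pi> + \<sigma>\<^sup>2 / \<alpha>\<^sup>2) + (v - \<mu>\<^sup>2) * \<gamma> / v)"
      unfolding A_def c_def opt_eq using mu0 vpos by (simp add: power2_eq_square)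
    also have "\<dots> = \<alpha>\<^sup>2 * \<pi> * \<delta> * (1 - \<pi>) + \<alpha>\<^sup>2 * \<pi> * ((v - \<mu>\<^sup>2) * \<gamma> / v) + (\<alpha>\<^sup>2 * (\<sigma>\<^sup>2 / \<alpha>\<^sup>2)) * (\<pi> * \<delta>)"
      by (simp only: distrib_left mult_ac)
    finally show ?thesis using \<alpha> by (simp add: gam)
  qed
  have dec: "mse_limit \<alpha> \<sigma> lam = C0 + A * ((lam / v)\<^sup>2 * \<theta>2 (lam / v) + c * (\<theta>1 (lam / v) - lam / v * \<theta>2 (lam / v)))" for lam
  proof -
    define l where "l = lam / v"
    define x where "x = \<theta>1 l"
    define y where "y = \<theta>2 l"
    have l: "lam = l * v" using vpos by (simp add: l_def)
    have 1: "l * (lam * \<mu>\<^sup>2 / v\<^sup>2 - \<delta> * (1 - \<pi>)) = l\<^sup>2 * (\<mu>\<^sup>2 / v) - l * (\<delta> * (1 - \<pi>))"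
      unfolding l using vpos by (simp add: power2_eq_square right_diff_distrib)
    have 2: "(v - \<mu>\<^sup>2) * (\<gamma> / v * x + 1 / v - lam * \<gamma> / v\<^sup>2 * y) = (v - \<mu>\<^sup>2) * \<gamma> / v * (x - l * y) + (v - \<mu>\<^sup>2) / v"
      unfolding l using vpos by (simp add: power2_eq_square right_diff_distrib distrib_left mult_ac diff_divide_distrib add_divide_distrib)
    have "mse_limit \<alpha> \<sigma> lam = \<alpha>\<^sup>2 * \<pi> * (1 / \<pi> - 1 + \<delta> * (1 - \<pi>) * x + (l\<^sup>2 * (\<mu>\<^sup>2 / v) - l * (\<delta> * (1 - \<pi>))) * y
        + ((v - \<mu>\<^sup>2) * \<gamma> / v * (x - l * y) + (v - \<mu>\<^sup>2) / v)) + \<sigma>\<^sup>2 * \<gamma> * (x - l * y) + \<sigma>\<^sup>2"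
      unfolding mse_limit_def l_def[symmetric] x_def[symmetric] y_def[symmetric] 1 2 ..
    also have "\<dots> = C0 + \<alpha>\<^sup>2 * \<pi> * (\<mu>\<^sup>2 / v) * (l\<^sup>2 * y) +
        (\<alpha>\<^sup>2 * \<pi> * \<delta> * (1 - \<pi>) + \<alpha>\<^sup>2 * \<pi> * ((v - \<mu>\<^sup>2) * \<gamma> / v) + \<sigma>\<^sup>2 * \<gamma>) * (x - l * y)"
    proof -
      have "a * (w - 1 + \<delta> * (1 - \<pi>) * x + (l\<^sup>2 * e - l * (\<delta> * (1 - \<pi>))) * y + (g * (x - l * y) + m)) + s * (x - l * y) + k =
          a * (w - 1) + a * m + k + a * e * (l\<^sup>2 * y) + (a * \<delta> * (1 - \<pi>) + a * g + s) * (x - l * y)" for a w e g m s k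
        by (simp add: algebra_simps)
      then show ?thesis unfolding C0_def by blast
    qed
    also have "\<dots> = C0 + A * (l\<^sup>2 * y + c * (x - l * y))"
      unfolding Ac[symmetric] A_def by (simp add: distrib_left)
    finally show ?thesis by (simp only: l_def x_def y_def)
  qed
  have "c\<^sup>2 * \<theta>2 c + c * (\<theta>1 c - c * \<theta>2 c) < (lam / v)\<^sup>2 * \<theta>2 (lam / v) + c * (\<theta>1 (lam / v) - lam / v * \<theta>2 (lam / v))"
    by (rule resolvent_moment_minimum[OF gamma_pos refl refl]) (use lam opt ne vpos in \<open>auto simp: c_def\<close>)
  then have "A * (c\<^sup>2 * \<theta>2 c + c * (\<theta>1 c - c * \<theta>2 c)) < A * ((lam / v)\<^sup>2 * \<theta>2 (lam / v) + c * (\<theta>1 (lam / v) - lam / v * \<theta>2 (lam / v)))"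
    using A by (rule mult_strict_left_mono)
  then show ?thesis unfolding dec c_def[symmetric] by simp
qed

end

theorem theorem9:
  fixes \<alpha> \<sigma> \<pi> \<delta> \<gamma> \<mu> v :: real
    and p n :: "nat \<Rightarrow> nat"
    and H :: "nat \<Rightarrow> (nat \<times> nat \<Rightarrow> real) measure"
    and \<phi> :: "real \<Rightarrow> real"
    and \<theta>\<^sub>1 \<theta>\<^sub>2 :: "real \<Rightarrow> real"
    and lam_opt :: real
  assumes "\<alpha> > 0" and "\<sigma> \<ge> 0"
    and "\<pi> \<in> {0<..1}" and "\<delta> > 0"
    and "\<And>d. p d \<le> d"
    and "(\<lambda>d. real (p d) / real d) \<longlonglongrightarrow> \<pi>"
    and "(\<lambda>d. real d / real (n d)) \<longlonglongrightarrow> \<delta>"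
    and "\<And>d. uniform_stiefel (p d) d (H d)"
    and "locally_absolutely_continuous \<phi>"
    and "\<exists>c\<^sub>1>0. \<exists>c\<^sub>2>0. (\<forall>t. \<bar>\<phi> t\<bar> \<le> c\<^sub>1 * exp (c\<^sub>2 * \<bar>t\<bar>)) \<and>
           (AE t in lborel. \<phi> differentiable at t \<and> \<bar>deriv \<phi> t\<bar> \<le> c\<^sub>1 * exp (c\<^sub>2 * \<bar>t\<bar>))"
    and "(\<integral>z. \<phi> z \<partial>std_normal_distribution) = 0"
    and "\<mu> = (\<integral>z. z * \<phi> z \<partial>std_normal_distribution)"
    and "v = (\<integral>z. (\<phi> z)\<^sup>2 \<partial>std_normal_distribution)" and "v > 0"
    and "\<gamma> = \<pi> * \<delta>"
    and "\<theta>\<^sub>1 = (\<lambda>lam. resolvent_moment 1 \<gamma> (lam / v))"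
    and "\<theta>\<^sub>2 = (\<lambda>lam. resolvent_moment 2 \<gamma> (lam / v))"
    and "lam_opt = v\<^sup>2 / \<mu>\<^sup>2 * (\<delta> * (1 - \<pi> + \<sigma>\<^sup>2 / \<alpha>\<^sup>2) + (v - \<mu>\<^sup>2) * \<gamma> / v)"
  shows "(\<forall>lam>0.
      (\<lambda>d. MSE \<phi> \<alpha> \<sigma> (p d) (n d) d (H d) lam) \<longlonglongrightarrow>
        \<alpha>\<^sup>2 * \<pi> * (1 / \<pi> - 1 + \<delta> * (1 - \<pi>) * \<theta>\<^sub>1 lam
            + lam / v * (lam * \<mu>\<^sup>2 / v\<^sup>2 - \<delta> * (1 - \<pi>)) * \<theta>\<^sub>2 lam
            + (v - \<mu>\<^sup>2) * (\<gamma> / v * \<theta>\<^sub>1 lam + 1 / v - lam * \<gamma> / v\<^sup>2 * \<theta>\<^sub>2 lam))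
        + \<sigma>\<^sup>2 * \<gamma> * (\<theta>\<^sub>1 lam - lam / v * \<theta>\<^sub>2 lam) + \<sigma>\<^sup>2 \<and>
      (\<lambda>d. Bias2 \<phi> \<alpha> \<sigma> (p d) (n d) d (H d) lam) \<longlonglongrightarrow>
        \<alpha>\<^sup>2 * (\<pi> * (\<mu>\<^sup>2 / v) * (1 - lam / v * \<theta>\<^sub>1 lam) - 1)\<^sup>2 \<and>
      (\<lambda>d. Var \<phi> \<alpha> \<sigma> (p d) (n d) d (H d) lam) \<longlonglongrightarrow>
        \<alpha>\<^sup>2 * \<pi> * (2 * \<mu>\<^sup>2 / v - 1
            + (- (2 * lam * \<mu>\<^sup>2 / v\<^sup>2) + \<delta> * (1 - \<pi>)) * \<theta>\<^sub>1 lam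
            + lam / v * (lam * \<mu>\<^sup>2 / v\<^sup>2 - \<delta> * (1 - \<pi>)) * \<theta>\<^sub>2 lam
            - \<pi> * \<mu> ^ 4 / v\<^sup>2 * (1 - lam / v * \<theta>\<^sub>1 lam)\<^sup>2
            + (v - \<mu>\<^sup>2) * (\<gamma> / v * \<theta>\<^sub>1 lam + 1 / v - lam * \<gamma> / v\<^sup>2 * \<theta>\<^sub>2 lam))
        + \<sigma>\<^sup>2 * \<gamma> * (\<theta>\<^sub>1 lam - lam / v * \<theta>\<^sub>2 lam))
    \<and> (\<mu> \<noteq> 0 \<longrightarrow> lam_opt > 0 \<longrightarrow>
        (\<forall>lam>0. lam \<noteq> lam_opt \<longrightarrow>
          lim (\<lambda>d. MSE \<phi> \<alpha> \<sigma> (p d) (n d) d (H d) lam_opt) <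
          lim (\<lambda>d. MSE \<phi> \<alpha> \<sigma> (p d) (n d) d (H d) lam)))"
proof -
  obtain c\<^sub>1 c\<^sub>2 where c: "c\<^sub>2 > 0" and growth: "\<And>t. \<bar>\<phi> t\<bar> \<le> c\<^sub>1 * exp (c\<^sub>2 * \<bar>t\<bar>)"
    using assms(10) by blast
  have meas: "\<phi> \<in> borel_measurable borel"
    using continuous_of_locally_absolutely_continuous[OF assms(9)] by (rule borel_measurable_continuous_onI)
  interpret regime \<phi> \<mu> v \<pi> \<delta> \<gamma> p n
    by unfold_locales (use assms meas integrable_N01_exp_growth[OF meas growth] in auto)
  note lims = MSE_limit[OF _ assms(8) growth c] Bias2_limit[OF _ assms(8) growth c] Var_limit[OF _ assms(8) growth c]
  \<comment> \<open>\<open>lim\<close> is evaluated by the convergence already shown, so the unique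
    minimum becomes the strict inequality for \<open>mse_limit\<close>.\<close>
  have opt: "lim (\<lambda>d. MSE \<phi> \<alpha> \<sigma> (p d) (n d) d (H d) lam_opt) < lim (\<lambda>d. MSE \<phi> \<alpha> \<sigma> (p d) (n d) d (H d) lam)"
    if "\<mu> \<noteq> 0" "lam_opt > 0" "lam > 0" "lam \<noteq> lam_opt" for lam
    unfolding limI[OF lims(1)[OF that(2)]] limI[OF lims(1)[OF that(3)]]
    by (rule mse_limit_minimum[OF assms(1) that(1) that(3) that(2) that(4) assms(18)])
  show ?thesis
    unfolding assms(16,17)
  proof (intro conjI allI impI)
    fix lam :: real assume "0 < lam"
    note lims = lims[OF this, of \<alpha> \<sigma>, unfolded mse_limit_def[of \<alpha> \<sigma> lam] bias_limit_def]
    show "(\<lambda>d. MSE \<phi> \<alpha> \<sigma> (p d) (n d) d (H d) lam) \<longlonglongrightarrow>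
        \<alpha>\<^sup>2 * \<pi> * (1 / \<pi> - 1 + \<delta> * (1 - \<pi>) * \<theta>1 (lam / v)
            + lam / v * (lam * \<mu>\<^sup>2 / v\<^sup>2 - \<delta> * (1 - \<pi>)) * \<theta>2 (lam / v)
            + (v - \<mu>\<^sup>2) * (\<gamma> / v * \<theta>1 (lam / v) + 1 / v - lam * \<gamma> / v\<^sup>2 * \<theta>2 (lam / v)))
        + \<sigma>\<^sup>2 * \<gamma> * (\<theta>1 (lam / v) - lam / v * \<theta>2 (lam / v)) + \<sigma>\<^sup>2"
      by (rule lims(1))
    show "(\<lambda>d. Bias2 \<phi> \<alpha> \<sigma> (p d) (n d) d (H d) lam) \<longlonglongrightarrow>
        \<alpha>\<^sup>2 * (\<pi> * (\<mu>\<^sup>2 / v) * (1 - lam / v * \<theta>1 (lam / v)) - 1)\<^sup>2"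
      by (rule lims(2))
  next
    fix lam :: real assume lam: "0 < lam"
    show "(\<lambda>d. Var \<phi> \<alpha> \<sigma> (p d) (n d) d (H d) lam) \<longlonglongrightarrow>
        \<alpha>\<^sup>2 * \<pi> * (2 * \<mu>\<^sup>2 / v - 1
            + (- (2 * lam * \<mu>\<^sup>2 / v\<^sup>2) + \<delta> * (1 - \<pi>)) * \<theta>1 (lam / v)
            + lam / v * (lam * \<mu>\<^sup>2 / v\<^sup>2 - \<delta> * (1 - \<pi>)) * \<theta>2 (lam / v)
            - \<pi> * \<mu> ^ 4 / v\<^sup>2 * (1 - lam / v * \<theta>1 (lam / v))\<^sup>2
            + (v - \<mu>\<^sup>2) * (\<gamma> / v * \<theta>1 (lam / v) + 1 / v - lam * \<gamma> / v\<^sup>2 * \<theta>2 (lam / v)))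
        + \<sigma>\<^sup>2 * \<gamma> * (\<theta>1 (lam / v) - lam / v * \<theta>2 (lam / v))"
      unfolding var_limit[OF lam, symmetric] by (rule lims(3)[OF lam])
  qed (use opt in blast)
qed

end
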